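(* Let $\beta_1,\beta_2\in\mathbb{R}$ satisfy $0<\beta_1+\frac12(\beta_2-1)+1<1$ and $0<\beta_2<1$, and put $\alpha=\beta_1+\frac12(\beta_2-1)+1$. Let $$z_1^{\beta_1,\beta_2}(t)=c^{(1)}_{\beta_1,\beta_2}\int_{\mathbb{R}}\Big[\int_{\mathbb{R}}k_t^{\beta_1}(u)(u-x)_+^{\frac{\beta_2}2-1}\,\mathrm{d}u\Big]\mathrm{d}W_x,\qquad t\in[0,1],$$ which is a fractional Brownian motion with Hurst parameter $\alpha$. Then $$\|z_1^{\beta_1,\beta_2}\|_{B^\alpha_{\varPhi_2,\infty}(0,1)}\in L^{\varPhi_2}(\Omega).$$ Moreover, $$\|z_1^{\beta_1,\beta_2}(\cdot+s)-z_1^{\beta_1,\beta_2}(\cdot)\|_{L^p(0,1-s)}\in\Theta(s^\alpha)\quad\text{as } s\to0+$$ for every $p\in[1,\infty)$ almost surely, and $$\|z_1^{\beta_1,\beta_2}(\cdot+s)-z_1^{\beta_1,\beta_2}(\cdot)\|_{L^{\varPhi_2}(0,1-s)}\in\Theta(s^\alpha)\quad\text{as } s\to0+$$ almost surely.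
   Context: $\int_{\mathbb{R}}(\cdots)\,\mathrm{d}W_x$ is the Wiener-It\^o integral with respect to a two-sided Wiener process $\{W_t\}_{t\in\mathbb{R}}$ on a complete probability space $(\Omega,\mathcal{F},\mathbb{P})$ whose $\sigma$-algebra is generated by $W$, and $c^{(1)}_{\beta_1,\beta_2}$ is a suitable (non-zero) normalising constant making $z_1^{\beta_1,\beta_2}$ a (standard) fractional Brownian motion. The process is taken jointly measurable. With $(u)_+=\max\{0,u\}$ (and $(u)_+^\gamma=0$ for $u\le0$, also when $\gamma<0$), $$k_t^{\beta_1}(u)=\begin{cases}\mathbf{1}_{(0,t]}(u),&\beta_1=0,\\ \frac1{\beta_1}\big[(t-u)_+^{\beta_1}-(-u)_+^{\beta_1}\big],&\beta_1\ne0.\end{cases}$$ $f(x)\in\Theta(g(x))$ as $x\to a+$ means $0<\liminf_{x\to a+}f(x)/g(x)\le\limsup_{x\to a+}f(x)/g(x)<\infty$. Function spaces. A Young function is a non-negative, non-decreasing, continuous, convex $\mathcal{N}:[0,\infty)\to\mathbb{R}$ with $\mathcal{N}(0)=0$, $\lim_{x\to\infty}\mathcal{N}(x)=\infty$. For a $\sigma$-finite measure space $(D,\mu)$, $L^{\mathcal{N}}(D)$ is the space of measurable $f$ with finite Luxemburg norm $\|f\|_{L^{\mathcal{N}}(D)}=\inf\{\lambda>0:\int_D\mathcal{N}(|f|/\lambda)\,\mathrm{d}\mu\le1\}$. $\varPhi_2$ is a Young function with $\varPhi_2(x)=e^{x^2}-1$ for $x\ge\tau_2$, for some $\tau_2\ge0$.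 For a bounded interval $I\subseteq[0,\infty)$ let $I(h)=\{s\in I:s+h\in I\}$. For $s\in(0,1)$, the Besov-Orlicz space $B^s_{\mathcal{N},\infty}(I)$ consists of the $f\in L^{\mathcal{N}}(I)$ with $$(f)_{B^s_{\mathcal{N},\infty}(I)}=\sup_{t>0}t^{-s}\sup_{|h|\le t}\|f(\cdot+h)-f(\cdot)\|_{L^{\mathcal{N}}(I(h))}<\infty,$$ with norm $\|f\|_{L^{\mathcal{N}}(I)}+(f)_{B^s_{\mathcal{N},\infty}(I)}$. *)

theory Defs
  imports "HOL-Probability.Probability"
begin

definition young_function :: "(real \<Rightarrow> real) \<Rightarrow> bool" where
  "young_function N \<longleftrightarrow>
     (\<forall>x\<ge>0. 0 \<le> N x) \<and> mono_on {0..} N \<and> continuous_on {0..} N \<and> convex_on {0..} N \<and>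
     N 0 = 0 \<and> filterlim N at_top at_top"

text \<open>
  Norms take values in \<^typ>\<open>ennreal\<close>, so that they are infinite (infimum of the empty set)
  exactly when no admissible \<open>\<lambda>\<close> exists.
\<close>

definition luxemburg_norm :: "(real \<Rightarrow> real) \<Rightarrow> 'b measure \<Rightarrow> ('b \<Rightarrow> real) \<Rightarrow> ennreal" where
  "luxemburg_norm N D f =
     Inf {ennreal l | l. l > 0 \<and> (\<integral>\<^sup>+ x. ennreal (N (\<bar>f x\<bar> / l)) \<partial>D) \<le> 1}"

definition orlicz_space :: "(real \<Rightarrow> real) \<Rightarrow> 'b measure \<Rightarrow> ('b \<Rightarrow> real) set" where
  "orlicz_space N D = {f \<in> borel_measurable D. luxemburg_norm N D f < \<infinity>}"

definition Lp_norm :: "real \<Rightarrow> 'b measure \<Rightarrow> ('b \<Rightarrow> real) \<Rightarrow> ennreal" where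
  "Lp_norm p D f =
     (let J = \<integral>\<^sup>+ x. ennreal (\<bar>f x\<bar> powr p) \<partial>D
      in if J = \<infinity> then \<infinity> else ennreal (enn2real J powr (1 / p)))"

definition shift_domain :: "real set \<Rightarrow> real \<Rightarrow> real set" where
  "shift_domain I h = {s \<in> I. s + h \<in> I}"

definition besov_orlicz_seminorm ::
    "(real \<Rightarrow> real) \<Rightarrow> real \<Rightarrow> real set \<Rightarrow> (real \<Rightarrow> real) \<Rightarrow> ennreal" where
  "besov_orlicz_seminorm N s I f =
     (SUP t\<in>{0<..}. ennreal (t powr (- s)) *
        (SUP h\<in>{h. \<bar>h\<bar> \<le> t}.
           luxemburg_norm N (lebesgue_on (shift_domain I h)) (\<lambda>x. f (x + h) - f x)))"

definition besov_orlicz_norm ::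
    "(real \<Rightarrow> real) \<Rightarrow> real \<Rightarrow> real set \<Rightarrow> (real \<Rightarrow> real) \<Rightarrow> ennreal" where
  "besov_orlicz_norm N s I f =
     luxemburg_norm N (lebesgue_on I) f + besov_orlicz_seminorm N s I f"

definition besov_orlicz_space ::
    "(real \<Rightarrow> real) \<Rightarrow> real \<Rightarrow> real set \<Rightarrow> (real \<Rightarrow> real) set" where
  "besov_orlicz_space N s I =
     {f \<in> orlicz_space N (lebesgue_on I). besov_orlicz_seminorm N s I f < \<infinity>}"

text \<open>
  The library's Landau class \<open>bigtheta\<close> needs values in a normed field, whereas the norms
  above may be infinite.
\<close>

definition in_Theta_right :: "real \<Rightarrow> (real \<Rightarrow> ennreal) \<Rightarrow> (real \<Rightarrow> real) \<Rightarrow> bool" where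
  "in_Theta_right a f g \<longleftrightarrow>
     0 < Liminf (at_right a) (\<lambda>x. f x / ennreal (g x)) \<and>
     Liminf (at_right a) (\<lambda>x. f x / ennreal (g x))
       \<le> Limsup (at_right a) (\<lambda>x. f x / ennreal (g x)) \<and>
     Limsup (at_right a) (\<lambda>x. f x / ennreal (g x)) < \<infinity>"

definition two_sided_wiener :: "'a measure \<Rightarrow> (real \<Rightarrow> 'a \<Rightarrow> real) \<Rightarrow> bool" where
  "two_sided_wiener M W \<longleftrightarrow>
     (\<forall>t. W t \<in> borel_measurable M) \<and>
     (AE \<omega> in M. W 0 \<omega> = 0) \<and>
     (\<forall>s t. s < t \<longrightarrow>
        distributed M lborel (\<lambda>\<omega>. W t \<omega> - W s \<omega>) (normal_density 0 (sqrt (t - s)))) \<and>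
     (\<forall>n (t :: nat \<Rightarrow> real). strict_mono_on {..n} t \<longrightarrow>
        prob_space.indep_vars M (\<lambda>_. borel) (\<lambda>i \<omega>. W (t (Suc i)) \<omega> - W (t i) \<omega>) {..<n}) \<and>
     (AE \<omega> in M. continuous_on UNIV (\<lambda>t. W t \<omega>))"

text \<open>
  The \<open>\<sigma>\<close>-algebra of the complete space is the one generated by the process, augmented by the
  null sets.
\<close>

definition generated_by_process :: "'a measure \<Rightarrow> (real \<Rightarrow> 'a \<Rightarrow> real) \<Rightarrow> bool" where
  "generated_by_process M W \<longleftrightarrow>
     sets M = sigma_sets (space M)
       ({W t -` A \<inter> space M | t A. A \<in> sets borel} \<union> null_sets M)"

text \<open>
  A list of triples \<open>(a, s, t)\<close> with \<open>s \<le> t\<close> encodes the step function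
  \<open>\<Sum> a \<cdot> 1\<^bsub>(s,t]\<^esub>\<close>, whose integral is \<open>\<Sum> a \<cdot> (W\<^sub>t - W\<^sub>s)\<close>.
\<close>

definition step_fun :: "(real \<times> real \<times> real) list \<Rightarrow> real \<Rightarrow> real" where
  "step_fun S x = (\<Sum>(a, s, t)\<leftarrow>S. a * indicator {s<..t} x)"

definition step_wiener_integral ::
    "(real \<Rightarrow> 'a \<Rightarrow> real) \<Rightarrow> (real \<times> real \<times> real) list \<Rightarrow> 'a \<Rightarrow> real" where
  "step_wiener_integral W S \<omega> = (\<Sum>(a, s, t)\<leftarrow>S. a * (W t \<omega> - W s \<omega>))"

definition has_wiener_integral ::
    "'a measure \<Rightarrow> (real \<Rightarrow> 'a \<Rightarrow> real) \<Rightarrow> (real \<Rightarrow> real) \<Rightarrow> ('a \<Rightarrow> real) \<Rightarrow> bool" where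
  "has_wiener_integral M W f X \<longleftrightarrow>
     f \<in> borel_measurable lborel \<and> X \<in> borel_measurable M \<and>
     (\<exists>S. (\<forall>n. \<forall>(a, s, t)\<in>set (S n). s \<le> t) \<and>
          (\<lambda>n. \<integral>\<^sup>+ x. ennreal ((step_fun (S n) x - f x)\<^sup>2) \<partial>lborel) \<longlonglongrightarrow> 0 \<and>
          (\<lambda>n. \<integral>\<^sup>+ \<omega>. ennreal ((step_wiener_integral W (S n) \<omega> - X \<omega>)\<^sup>2) \<partial>M) \<longlonglongrightarrow> 0)"

text \<open>The integral is determined up to almost sure equality; some representative is chosen.\<close>

definition wiener_integral ::
    "'a measure \<Rightarrow> (real \<Rightarrow> 'a \<Rightarrow> real) \<Rightarrow> (real \<Rightarrow> real) \<Rightarrow> 'a \<Rightarrow> real" where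
  "wiener_integral M W f = (SOME X. has_wiener_integral M W f X)"

definition gaussian_rv :: "'a measure \<Rightarrow> ('a \<Rightarrow> real) \<Rightarrow> bool" where
  "gaussian_rv M X \<longleftrightarrow> X \<in> borel_measurable M \<and>
     ((\<exists>m. AE \<omega> in M. X \<omega> = m) \<or>
      (\<exists>m \<sigma>. \<sigma> > 0 \<and> distributed M lborel X (normal_density m \<sigma>)))"

definition gaussian_process :: "'a measure \<Rightarrow> real set \<Rightarrow> (real \<Rightarrow> 'a \<Rightarrow> real) \<Rightarrow> bool" where
  "gaussian_process M T X \<longleftrightarrow>
     (\<forall>n (t :: nat \<Rightarrow> real) (a :: nat \<Rightarrow> real). (\<forall>i<n. t i \<in> T) \<longrightarrow>
        gaussian_rv M (\<lambda>\<omega>. \<Sum>i<n. a i * X (t i) \<omega>))"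

text \<open>Here \<open>T \<subseteq> [0, \<infinity>)\<close> and \<open>0 < H < 1\<close>.\<close>

definition standard_fbm :: "'a measure \<Rightarrow> real set \<Rightarrow> real \<Rightarrow> (real \<Rightarrow> 'a \<Rightarrow> real) \<Rightarrow> bool" where
  "standard_fbm M T H X \<longleftrightarrow>
     gaussian_process M T X \<and>
     (\<forall>t\<in>T. (\<integral>\<omega>. X t \<omega> \<partial>M) = 0) \<and>
     (\<forall>s\<in>T. \<forall>t\<in>T. (\<integral>\<omega>. X s \<omega> * X t \<omega> \<partial>M) =
        (s powr (2 * H) + t powr (2 * H) - \<bar>t - s\<bar> powr (2 * H)) / 2)"

text \<open>Since \<open>0 powr \<gamma> = 0\<close> for every \<open>\<gamma>\<close>, this vanishes for \<open>u \<le> 0\<close>, also when \<open>\<gamma> \<le> 0\<close>.\<close>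

definition pos_powr :: "real \<Rightarrow> real \<Rightarrow> real" where
  "pos_powr u \<gamma> = max 0 u powr \<gamma>"

definition k_kernel :: "real \<Rightarrow> real \<Rightarrow> real \<Rightarrow> real" where
  "k_kernel \<beta> t u =
     (if \<beta> = 0 then indicator {0<..t} u
      else (pos_powr (t - u) \<beta> - pos_powr (- u) \<beta>) / \<beta>)"

definition z1_kernel :: "real \<Rightarrow> real \<Rightarrow> real \<Rightarrow> real \<Rightarrow> real" where
  "z1_kernel \<beta>1 \<beta>2 t x =
     (\<integral>u. k_kernel \<beta>1 t u * pos_powr (u - x) (\<beta>2 / 2 - 1) \<partial>lborel)"

definition z1_normalising_constant ::
    "'a measure \<Rightarrow> (real \<Rightarrow> 'a \<Rightarrow> real) \<Rightarrow> real \<Rightarrow> real \<Rightarrow> real \<Rightarrow> bool" where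
  "z1_normalising_constant M W \<beta>1 \<beta>2 c \<longleftrightarrow>
     c \<noteq> 0 \<and>
     standard_fbm M {0..1} (\<beta>1 + (\<beta>2 - 1) / 2 + 1)
       (\<lambda>t \<omega>. c * wiener_integral M W (z1_kernel \<beta>1 \<beta>2 t) \<omega>)"

text \<open>
  Each random variable of the process is defined only up to almost sure equality; the process
  itself is any jointly measurable version.
\<close>

definition is_z1 ::
    "'a measure \<Rightarrow> (real \<Rightarrow> 'a \<Rightarrow> real) \<Rightarrow> real \<Rightarrow> real \<Rightarrow> real \<Rightarrow> (real \<Rightarrow> 'a \<Rightarrow> real) \<Rightarrow> bool"
  where
  "is_z1 M W \<beta>1 \<beta>2 c z \<longleftrightarrow>
     (\<lambda>(t, \<omega>). z t \<omega>) \<in> borel_measurable (restrict_space borel {0..1} \<Otimes>\<^sub>M M) \<and>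
     (\<forall>t\<in>{0..1}. AE \<omega> in M. z t \<omega> = c * wiener_integral M W (z1_kernel \<beta>1 \<beta>2 t) \<omega>)"

end

theory Submission
  imports Defs
begin

text \<open>
  The inner integral is a Beta integral, so \<open>z\<close> has the Mandelbrot--Van Ness kernel with exponent
  \<open>\<alpha> - 1/2\<close>; shifting and scaling this kernel gives the variance \<open>\<bar>t - s\<bar> powr (2 * \<alpha>)\<close> of the
  increments, up to a constant, hence a fractional Brownian motion after normalisation.

  For the paths, let \<open>h = 1 / 2 ^ n\<close> and let \<open>Y\<close> be the increment over \<open>h\<close> divided by \<open>h powr \<alpha>\<close>, a
  stationary Gaussian process on \<open>{0<..<1 - h}\<close>. The probability that \<open>\<integral> (exp ((Y / l)\<^sup>2) - 1) > 1\<close>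
  decays like \<open>q powr l\<^sup>2\<close> with \<open>q < 1\<close> by convexity, and like a power of \<open>h\<close> by Chebyshev's
  inequality, since so does the integral of the squared correlations of \<open>Y\<close>. The geometric mean of
  the two bounds is summable over \<open>n\<close>, so the supremum over \<open>n\<close> of the normalised Luxemburg norms
  has a square-exponential moment. Binary expansion of the shift and lower semicontinuity of the norms in
  the shift extend the bound to all shifts. The lower bounds follow from the convergence of the
  quadratic variation along the dyadic shifts.
\<close>

section \<open>Centred Gaussian variables\<close>

text \<open>The two bounds for a single dyadic shift fail in opposite ways: the one from convexity
  does not improve as h decreases, so it cannot be summed over n, and the one from Chebyshev's
  inequality does not improve with l, so it gives no exponential moment. Their product has both
  decays, and its square root keeps them. The power of h is
  \<open>min (1/2) (2 - 2 * \<alpha>)\<close>: pairs of points closer than the square root of h are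
  bounded trivially, and at larger distances the correlation is, for small h, at most
  \<open>8 * h powr (1 - \<alpha>)\<close>. The process is any jointly measurable version, so its
  paths need not be continuous; dyadic shifts are therefore linked to the others through continuity
  of translation in L1 and Fatou's lemma. Mixed Gaussian moments are reduced to the one-dimensional
  laws of linear combinations. Below \<tau> the Young function is arbitrary, which costs the factor
  \<open>N \<tau> + 1\<close> when a bound for exp(x^2) - 1 is turned into one for the norm. All
  lower bounds are reduced to the L1 norm of the increments, the weakest of the norms involved,
  which is subadditive in the shift.\<close>

definition centered_gaussian :: "'a measure \<Rightarrow> real \<Rightarrow> ('a \<Rightarrow> real) \<Rightarrow> bool" where
  "centered_gaussian M v X \<longleftrightarrow> X \<in> borel_measurable M \<and>
     (v = 0 \<and> (AE \<omega> in M. X \<omega> = 0) \<or> v > 0 \<and> distributed M lborel X (normal_density 0 (sqrt v)))"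

lemma centered_gaussian_nonneg: "centered_gaussian M v X \<Longrightarrow> 0 \<le> v"
  by (auto simp: centered_gaussian_def)

lemma centered_gaussian_measurable [measurable_dest]:
  "centered_gaussian M v X \<Longrightarrow> X \<in> borel_measurable M"
  by (auto simp: centered_gaussian_def)

lemma (in prob_space) centered_gaussian_imp_gaussian_rv:
  "centered_gaussian M v X \<Longrightarrow> gaussian_rv M X"
  unfolding centered_gaussian_def gaussian_rv_def
  by (metis real_sqrt_gt_0_iff)

lemma normal_even_moments:
  fixes s :: real
  assumes s: "s > 0"
  shows "has_bochner_integral lborel (\<lambda>x. normal_density 0 s x * x\<^sup>2) (s\<^sup>2)"
    and "has_bochner_integral lborel (\<lambda>x. normal_density 0 s x * x ^ 4) (3 * s ^ 4)"
proof -
  from normal_moment_even[OF s, of 0 1]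
  show "has_bochner_integral lborel (\<lambda>x. normal_density 0 s x * x\<^sup>2) (s\<^sup>2)"
    using s by (simp add: power_divide fact_numeral)
  have "fact (2 * 2) / ((2 / s\<^sup>2) ^ 2 * fact 2) = 3 * s ^ 4"
    using s by (simp add: power_divide fact_numeral field_simps)
  with normal_moment_even[OF s, of 0 2]
  show "has_bochner_integral lborel (\<lambda>x. normal_density 0 s x * x ^ 4) (3 * s ^ 4)"
    by simp
qed

lemma (in prob_space) centered_gaussian_moments:
  assumes "centered_gaussian M v X"
  shows "integrable M X" "expectation X = 0"
    "integrable M (\<lambda>\<omega>. (X \<omega>)\<^sup>2)" "expectation (\<lambda>\<omega>. (X \<omega>)\<^sup>2) = v"
    "integrable M (\<lambda>\<omega>. (X \<omega>) ^ 4)" "expectation (\<lambda>\<omega>. (X \<omega>) ^ 4) = 3 * v\<^sup>2"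
proof -
  have [measurable]: "X \<in> borel_measurable M" using assms by (simp add: centered_gaussian_def)
  have "integrable M X \<and> expectation X = 0 \<and>
    integrable M (\<lambda>\<omega>. (X \<omega>)\<^sup>2) \<and> expectation (\<lambda>\<omega>. (X \<omega>)\<^sup>2) = v \<and>
    integrable M (\<lambda>\<omega>. (X \<omega>) ^ 4) \<and> expectation (\<lambda>\<omega>. (X \<omega>) ^ 4) = 3 * v\<^sup>2"
  \<comment> \<open>\<open>normal_density 0 0\<close> vanishes identically, so the point mass at 0
    cannot be given by its density; it does occur, for instance as the difference of two fully
    correlated variables.\<close>
  proof (cases "v = 0")
    case True
    then have 0: "AE \<omega> in M. X \<omega> = 0" using assms by (auto simp: centered_gaussian_def)
    have *: "has_bochner_integral M (\<lambda>\<omega>. (X \<omega>) ^ k) 0" if "k > 0" for k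
    proof (subst has_bochner_integral_cong_AE[where g="\<lambda>_. 0"])
      show "AE x in M. X x ^ k = 0" using 0 that by (auto simp: power_0_left)
    qed auto
    show ?thesis using *[of 1] *[of 2] *[of 4] True
      by (auto simp: has_bochner_integral_iff)
  next
    case False
    then have v: "v > 0" and D: "distributed M lborel X (normal_density 0 (sqrt v))"
      using assms by (auto simp: centered_gaussian_def)
    have s: "sqrt v > 0" using v by simp
    have "sqrt v ^ 4 = ((sqrt v)\<^sup>2)\<^sup>2" by (simp only: power_mult[symmetric]) simp
    then have s4: "sqrt v ^ 4 = v\<^sup>2" using v by simp
    have int: "integrable M (\<lambda>\<omega>. (X \<omega>) ^ k)
        \<longleftrightarrow> integrable lborel (\<lambda>x. normal_density 0 (sqrt v) x * x ^ k)" for k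
      using distributed_integrable[OF D, of "\<lambda>x. x ^ k"] by simp
    have exp: "expectation (\<lambda>\<omega>. (X \<omega>) ^ k)
        = (\<integral>x. normal_density 0 (sqrt v) x * x ^ k \<partial>lborel)" for k
      using distributed_integral[OF D, of "\<lambda>x. x ^ k"] by simp
    show ?thesis
      using int[of 1] int[of 2] int[of 4] exp[of 1] exp[of 2] exp[of 4]
        normal_even_moments[OF s] normal_moment_nz_1[OF s, of 0] v s4
      by (auto simp: has_bochner_integral_iff)
  qed
  then show "integrable M X" "expectation X = 0"
    "integrable M (\<lambda>\<omega>. (X \<omega>)\<^sup>2)" "expectation (\<lambda>\<omega>. (X \<omega>)\<^sup>2) = v"
    "integrable M (\<lambda>\<omega>. (X \<omega>) ^ 4)" "expectation (\<lambda>\<omega>. (X \<omega>) ^ 4) = 3 * v\<^sup>2" by auto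
qed

lemma (in prob_space) gaussian_rv_imp_centered_gaussian:
  assumes "gaussian_rv M X" "expectation X = 0"
  shows "centered_gaussian M (expectation (\<lambda>\<omega>. (X \<omega>)\<^sup>2)) X"
proof -
  have [measurable]: "X \<in> borel_measurable M" using assms by (simp add: gaussian_rv_def)
  consider m where "AE \<omega> in M. X \<omega> = m"
    | m s where "s > 0" "distributed M lborel X (normal_density m s)"
    using assms by (auto simp: gaussian_rv_def)
  then have "\<exists>v. centered_gaussian M v X"
  proof cases
    case (1 m)
    then have "expectation X = expectation (\<lambda>_. m)" by (intro integral_cong_AE) auto
    then have "m = 0" using assms by (simp add: prob_space)
    with 1 have "centered_gaussian M 0 X" by (auto simp: centered_gaussian_def)
    then show ?thesis ..
  next
    case (2 m s)
    then have "m = 0" using normal_distributed_expectation[OF 2(1,2)] assms by simp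
    with 2 have "centered_gaussian M (s\<^sup>2) X" by (auto simp: centered_gaussian_def)
    then show ?thesis ..
  qed
  then show ?thesis using centered_gaussian_moments by auto
qed

text \<open>Completing the square turns the integrand into a multiple of the normal density with
  variance s^2 / d, where d = 1 - 2 a s^2; the second hypothesis is exactly d > 0. One formula then
  serves for exponential moments of squares (b = 0) and for Laplace transforms (a = 0).\<close>

lemma nn_integral_normal_exp_quadratic:
  assumes "s > 0" "2 * a * s\<^sup>2 < 1"
  shows "(\<integral>\<^sup>+ x. ennreal (normal_density 0 s x) * ennreal (exp (a * x\<^sup>2 + b * x)) \<partial>lborel) =
    ennreal (1 / sqrt (1 - 2 * a * s\<^sup>2) * exp (b\<^sup>2 * s\<^sup>2 / (2 * (1 - 2 * a * s\<^sup>2))))"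
proof -
  define d where "d = 1 - 2 * a * s\<^sup>2"
  have d: "d > 0" using assms by (simp add: d_def)
  define t where "t = s / sqrt d"
  have t: "t > 0" using d assms by (simp add: t_def)
  have t2: "t\<^sup>2 = s\<^sup>2 / d" using d by (simp add: t_def power_divide)
  define m where "m = b * t\<^sup>2"
  have "normal_density 0 s x * exp (a * x\<^sup>2 + b * x) =
     (1 / sqrt d * exp (b\<^sup>2 * s\<^sup>2 / (2 * d))) * normal_density m t x" for x
  proof -
    have a: "a = (1 - d) / (2 * s\<^sup>2)" using assms by (simp add: d_def field_simps)
    have e: "- x\<^sup>2 / (2 * s\<^sup>2) + (a * x\<^sup>2 + b * x) = b\<^sup>2 * s\<^sup>2 / (2 * d) + - (x - m)\<^sup>2 / (2 * t\<^sup>2)"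
      unfolding m_def t2 a using assms(1) d
      by (simp add: field_simps power2_eq_square)
    have "sqrt (2 * pi * s\<^sup>2) = sqrt d * sqrt (2 * pi * t\<^sup>2)"
      unfolding t2 using d assms(1) by (simp flip: real_sqrt_mult)
    then show ?thesis
      unfolding normal_density_def using e by (simp add: field_simps flip: exp_add)
  qed
  then have "(\<integral>\<^sup>+ x. ennreal (normal_density 0 s x) * ennreal (exp (a * x\<^sup>2 + b * x)) \<partial>lborel) =
    (\<integral>\<^sup>+ x. ennreal (1 / sqrt d * exp (b\<^sup>2 * s\<^sup>2 / (2 * d))) * ennreal (normal_density m t x) \<partial>lborel)"
    by (intro nn_integral_cong) (simp flip: ennreal_mult' add: d less_imp_le)
  also have "\<dots> = ennreal (1 / sqrt d * exp (b\<^sup>2 * s\<^sup>2 / (2 * d)))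
      * (\<integral>\<^sup>+ x. ennreal (normal_density m t x) \<partial>lborel)"
    by (rule nn_integral_cmult) auto
  also have "(\<integral>\<^sup>+ x. ennreal (normal_density m t x) \<partial>lborel) = 1"
    by (subst nn_integral_eq_integral) (auto simp: t)
  finally show ?thesis by (simp add: d_def)
qed

lemma (in prob_space) centered_gaussian_exp_quadratic:
  assumes "centered_gaussian M v X" "2 * a * v < 1"
  shows "(\<integral>\<^sup>+ \<omega>. ennreal (exp (a * (X \<omega>)\<^sup>2 + b * X \<omega>)) \<partial>M) =
    ennreal (1 / sqrt (1 - 2 * a * v) * exp (b\<^sup>2 * v / (2 * (1 - 2 * a * v))))"
proof (cases "v = 0")
  case True
  then have "AE \<omega> in M. X \<omega> = 0" using assms by (auto simp: centered_gaussian_def)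
  then have "(\<integral>\<^sup>+ \<omega>. ennreal (exp (a * (X \<omega>)\<^sup>2 + b * X \<omega>)) \<partial>M) = (\<integral>\<^sup>+ \<omega>. 1 \<partial>M)"
    by (intro nn_integral_cong_AE) auto
  then show ?thesis using True by (simp add: emeasure_space_1)
next
  case False
  then have v: "v > 0" and D: "distributed M lborel X (normal_density 0 (sqrt v))"
    using assms by (auto simp: centered_gaussian_def)
  have "(\<integral>\<^sup>+ \<omega>. ennreal (exp (a * (X \<omega>)\<^sup>2 + b * X \<omega>)) \<partial>M)
    = (\<integral>\<^sup>+ x. ennreal (normal_density 0 (sqrt v) x) * ennreal (exp (a * x\<^sup>2 + b * x)) \<partial>lborel)"
    by (subst distributed_nn_integral[OF D, symmetric]) auto
  also have "\<dots> = ennreal (1 / sqrt (1 - 2 * a * v) * exp (b\<^sup>2 * v / (2 * (1 - 2 * a * v))))"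
    using v nn_integral_normal_exp_quadratic[of "sqrt v" a b] assms(2) by simp
  finally show ?thesis .
qed

text \<open>Polarisation: U^2 V^2 is a linear combination of the fourth powers of U, V, U + V and U
  - V, whose laws are all contained in the hypothesis. That hypothesis encodes a Gaussian pair with
  unit variances and correlation \<rho>.\<close>

lemma (in prob_space) pair_fourth_moment:
  assumes "\<And>a b. centered_gaussian M (a\<^sup>2 + 2 * \<rho> * a * b + b\<^sup>2) (\<lambda>\<omega>. a * U \<omega> + b * V \<omega>)"
  shows "integrable M (\<lambda>\<omega>. (U \<omega>)\<^sup>2 * (V \<omega>)\<^sup>2)"
    and "expectation (\<lambda>\<omega>. (U \<omega>)\<^sup>2 * (V \<omega>)\<^sup>2) = 1 + 2 * \<rho>\<^sup>2"
proof -
  have U: "centered_gaussian M 1 U" and V: "centered_gaussian M 1 V"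
    and P: "centered_gaussian M (2 + 2 * \<rho>) (\<lambda>\<omega>. U \<omega> + V \<omega>)"
    and N: "centered_gaussian M (2 - 2 * \<rho>) (\<lambda>\<omega>. U \<omega> - V \<omega>)"
    using assms[of 1 0] assms[of 0 1] assms[of 1 1] assms[of 1 "-1"] by auto
  have eq: "(U \<omega>)\<^sup>2 * (V \<omega>)\<^sup>2 =
      ((U \<omega> + V \<omega>) ^ 4 + (U \<omega> - V \<omega>) ^ 4 - 2 * (U \<omega>) ^ 4 - 2 * (V \<omega>) ^ 4) / 12" for \<omega>
    by (simp add: power2_eq_square power4_eq_xxxx algebra_simps)
  note m = centered_gaussian_moments(5,6)[OF U] centered_gaussian_moments(5,6)[OF V]
    centered_gaussian_moments(5,6)[OF P] centered_gaussian_moments(5,6)[OF N]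
  show "integrable M (\<lambda>\<omega>. (U \<omega>)\<^sup>2 * (V \<omega>)\<^sup>2)" unfolding eq using m by auto
  have "expectation (\<lambda>\<omega>. (U \<omega>)\<^sup>2 * (V \<omega>)\<^sup>2)
      = (3 * (2 + 2 * \<rho>)\<^sup>2 + 3 * (2 - 2 * \<rho>)\<^sup>2 - 6 - 6) / 12"
    unfolding eq using m by (simp add: field_simps)
  also have "\<dots> = 1 + 2 * \<rho>\<^sup>2" by (simp add: power2_eq_square algebra_simps)
  finally show "expectation (\<lambda>\<omega>. (U \<omega>)\<^sup>2 * (V \<omega>)\<^sup>2) = 1 + 2 * \<rho>\<^sup>2" .
qed

text \<open>
  The squares are linearised by \<open>exp (x\<^sup>2 / 8) = \<integral> exp (g * x / 2) d\<gamma>(g)\<close>, \<open>\<gamma>\<close> the standard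
  Gaussian measure, so that only one-dimensional exponential moments are needed.
\<close>

lemma (in prob_space) pair_exp_square:
  assumes G: "\<And>a b. centered_gaussian M (a\<^sup>2 + 2 * \<rho> * a * b + b\<^sup>2) (\<lambda>\<omega>. a * U \<omega> + b * V \<omega>)"
    and \<rho>: "\<bar>\<rho>\<bar> \<le> 1"
  shows "(\<integral>\<^sup>+ \<omega>. ennreal (exp ((U \<omega>)\<^sup>2 / 8)) * ennreal (exp ((V \<omega>)\<^sup>2 / 8)) \<partial>M)
    = ennreal (4 / sqrt (9 - \<rho>\<^sup>2))"
proof -
  let ?n = "\<lambda>g. ennreal (std_normal_density g)"
  have [measurable]: "U \<in> borel_measurable M" "V \<in> borel_measurable M"
    using G[of 1 0] G[of 0 1] by (auto simp: centered_gaussian_def)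
  have r2: "\<rho>\<^sup>2 \<le> 1" using \<rho> by (simp add: abs_square_le_1)
  have lin: "ennreal (exp (x\<^sup>2 / 8)) = (\<integral>\<^sup>+ g. ?n g * ennreal (exp (g * x / 2)) \<partial>lborel)" for x
    using nn_integral_normal_exp_quadratic[of 1 0 "x / 2"] by (simp add: power_divide mult.commute)
  have "(\<integral>\<^sup>+ \<omega>. ennreal (exp ((U \<omega>)\<^sup>2 / 8)) * ennreal (exp ((V \<omega>)\<^sup>2 / 8)) \<partial>M)
    = (\<integral>\<^sup>+ \<omega>. (\<integral>\<^sup>+ h. (\<integral>\<^sup>+ g. (?n g * ennreal (exp (g * U \<omega> / 2))) *
           (?n h * ennreal (exp (h * V \<omega> / 2))) \<partial>lborel) \<partial>lborel) \<partial>M)"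
    unfolding lin by (simp add: nn_integral_multc nn_integral_cmult)
  also have "\<dots> = (\<integral>\<^sup>+ h. (\<integral>\<^sup>+ \<omega>. (\<integral>\<^sup>+ g. (?n g * ennreal (exp (g * U \<omega> / 2))) *
           (?n h * ennreal (exp (h * V \<omega> / 2))) \<partial>lborel) \<partial>M) \<partial>lborel)"
    by (rule pair_sigma_finite.Fubini') (auto intro!: pair_sigma_finite.intro sigma_finite_measure_axioms lborel.sigma_finite_measure_axioms)
  also have "\<dots> = (\<integral>\<^sup>+ h. (\<integral>\<^sup>+ g. (\<integral>\<^sup>+ \<omega>. (?n g * ennreal (exp (g * U \<omega> / 2))) *
           (?n h * ennreal (exp (h * V \<omega> / 2))) \<partial>M) \<partial>lborel) \<partial>lborel)"
    by (intro nn_integral_cong pair_sigma_finite.Fubini') (auto intro!: pair_sigma_finite.intro sigma_finite_measure_axioms lborel.sigma_finite_measure_axioms)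
  also have "\<dots> = (\<integral>\<^sup>+ h. (\<integral>\<^sup>+ g. ?n g * ?n h * ennreal (exp ((g\<^sup>2 + 2 * \<rho> * g * h + h\<^sup>2) / 8)) \<partial>lborel) \<partial>lborel)"
  proof (intro nn_integral_cong)
    fix g h :: real
    have "(\<integral>\<^sup>+ \<omega>. (?n g * ennreal (exp (g * U \<omega> / 2))) * (?n h * ennreal (exp (h * V \<omega> / 2))) \<partial>M)
      = (\<integral>\<^sup>+ \<omega>. ?n g * ?n h * ennreal (exp (0 * (g * U \<omega> + h * V \<omega>)\<^sup>2 + (1/2) * (g * U \<omega> + h * V \<omega>))) \<partial>M)"
      by (intro nn_integral_cong) (simp add: add_divide_distrib exp_add ennreal_mult' ac_simps)
    also have "\<dots> = ?n g * ?n h * ennreal (exp ((g\<^sup>2 + 2 * \<rho> * g * h + h\<^sup>2) / 8))"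
      by (subst nn_integral_cmult, measurable, subst centered_gaussian_exp_quadratic[OF G])
         (auto simp: power_divide)
    finally show "(\<integral>\<^sup>+ \<omega>. (?n g * ennreal (exp (g * U \<omega> / 2))) * (?n h * ennreal (exp (h * V \<omega> / 2))) \<partial>M)
      = ?n g * ?n h * ennreal (exp ((g\<^sup>2 + 2 * \<rho> * g * h + h\<^sup>2) / 8))" .
  qed
  also have "\<dots> = (\<integral>\<^sup>+ h. ennreal (2 / sqrt 3) * (?n h * ennreal (exp ((1/8 + \<rho>\<^sup>2 / 24) * h\<^sup>2 + 0 * h))) \<partial>lborel)"
  proof (intro nn_integral_cong)
    fix h :: real
    have "(\<integral>\<^sup>+ g. ?n g * ?n h * ennreal (exp ((g\<^sup>2 + 2 * \<rho> * g * h + h\<^sup>2) / 8)) \<partial>lborel)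
      = (\<integral>\<^sup>+ g. (?n h * ennreal (exp (h\<^sup>2 / 8))) * (?n g * ennreal (exp (1/8 * g\<^sup>2 + (\<rho> * h / 4) * g))) \<partial>lborel)"
      by (intro nn_integral_cong) (simp add: add_divide_distrib exp_add ennreal_mult' ac_simps)
    also have "\<dots> = (?n h * ennreal (exp (h\<^sup>2 / 8))) * ennreal (1 / sqrt (3/4) * exp ((\<rho> * h / 4)\<^sup>2 / (3/2)))"
      by (subst nn_integral_cmult, measurable, subst nn_integral_normal_exp_quadratic) auto
    also have "1 / sqrt (3/4) = 2 / sqrt 3" by (simp add: real_sqrt_divide)
    also have "(?n h * ennreal (exp (h\<^sup>2 / 8))) * ennreal (2 / sqrt 3 * exp ((\<rho> * h / 4)\<^sup>2 / (3/2)))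
      = ennreal (2 / sqrt 3) * (?n h * ennreal (exp ((1/8 + \<rho>\<^sup>2 / 24) * h\<^sup>2 + 0 * h)))"
    proof -
      have "(1/8 + \<rho>\<^sup>2 / 24) * h\<^sup>2 + 0 * h = h\<^sup>2 / 8 + (\<rho> * h / 4)\<^sup>2 / (3/2)"
        by (simp add: power2_eq_square field_simps)
      moreover have "ennreal (2 / sqrt 3 * exp ((\<rho> * h / 4)\<^sup>2 / (3/2)))
          = ennreal (2 / sqrt 3) * ennreal (exp ((\<rho> * h / 4)\<^sup>2 / (3/2)))"
        by (rule ennreal_mult) auto
      ultimately show ?thesis by (simp only: exp_add ennreal_mult[OF exp_ge_zero exp_ge_zero] ac_simps)
    qed
    finally show "(\<integral>\<^sup>+ g. ?n g * ?n h * ennreal (exp ((g\<^sup>2 + 2 * \<rho> * g * h + h\<^sup>2) / 8)) \<partial>lborel)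
      = ennreal (2 / sqrt 3) * (?n h * ennreal (exp ((1/8 + \<rho>\<^sup>2 / 24) * h\<^sup>2 + 0 * h)))" .
  qed
  also have "\<dots> = ennreal (2 / sqrt 3) * ennreal (1 / sqrt (3/4 - \<rho>\<^sup>2 / 12))"
  proof (subst nn_integral_cmult, measurable, subst nn_integral_normal_exp_quadratic)
    have "1 - 2 * (1 / 8 + \<rho>\<^sup>2 / 24) * 1\<^sup>2 = 3/4 - \<rho>\<^sup>2 / 12" by simp
    then show "ennreal (2 / sqrt 3) * ennreal (1 / sqrt (1 - 2 * (1 / 8 + \<rho>\<^sup>2 / 24) * 1\<^sup>2) *
        exp (0\<^sup>2 * 1\<^sup>2 / (2 * (1 - 2 * (1 / 8 + \<rho>\<^sup>2 / 24) * 1\<^sup>2)))) =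
      ennreal (2 / sqrt 3) * ennreal (1 / sqrt (3/4 - \<rho>\<^sup>2 / 12))" by simp
  qed (use r2 in auto)
  also have "\<dots> = ennreal (2 / sqrt 3 * (1 / sqrt (3/4 - \<rho>\<^sup>2 / 12)))"
    using r2 by (intro ennreal_mult[symmetric]) auto
  also have "2 / sqrt 3 * (1 / sqrt (3/4 - \<rho>\<^sup>2 / 12)) = 4 / sqrt (9 - \<rho>\<^sup>2)"
  proof -
    have "sqrt 3 * sqrt (3/4 - \<rho>\<^sup>2 / 12) = sqrt ((9 - \<rho>\<^sup>2) / 4)"
      by (simp flip: real_sqrt_mult add: field_simps)
    also have "\<dots> = sqrt (9 - \<rho>\<^sup>2) / 2" by (simp add: real_sqrt_divide)
    finally have *: "sqrt 3 * sqrt (3/4 - \<rho>\<^sup>2 / 12) = sqrt (9 - \<rho>\<^sup>2) / 2" .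
    have "2 / sqrt 3 * (1 / sqrt (3/4 - \<rho>\<^sup>2 / 12)) = 2 / (sqrt 3 * sqrt (3/4 - \<rho>\<^sup>2 / 12))" by simp
    also have "\<dots> = 4 / sqrt (9 - \<rho>\<^sup>2)" unfolding * by simp
    finally show ?thesis .
  qed
  finally show ?thesis .
qed

section \<open>Characteristic functions, L2 limits and independent sums of Gaussian
  variables\<close>

lemma (in prob_space) centered_gaussian_iexp:
  assumes "centered_gaussian M v X"
  shows "(CLINT \<omega>|M. iexp (t * X \<omega>)) = exp (- (of_real (t\<^sup>2 * v / 2)))"
proof (cases "v = 0")
  case True
  then have "AE \<omega> in M. X \<omega> = 0" using assms by (auto simp: centered_gaussian_def)
  then have "(CLINT \<omega>|M. iexp (t * X \<omega>)) = (CLINT \<omega>|M. 1)"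
    using assms by (intro integral_cong_AE) (auto dest: centered_gaussian_measurable)
  then show ?thesis using True by (simp add: prob_space)
next
  case False
  then have v: "v > 0" and D: "distributed M lborel X (normal_density 0 (sqrt v))"
    using assms by (auto simp: centered_gaussian_def)
  have [measurable]: "X \<in> borel_measurable M" using assms by (simp add: centered_gaussian_def)
  let ?Y = "\<lambda>\<omega>. X \<omega> / sqrt v"
  have "distributed M lborel ?Y std_normal_density"
    using normal_standard_normal_convert[of "sqrt v" X 0] v D by simp
  then have "distr M borel ?Y = std_normal_distribution"
    by (simp add: distributed_def cong: distr_cong)
  then have "exp (- (of_real ((t * sqrt v)\<^sup>2) / 2)) = char (distr M borel ?Y) (t * sqrt v)"
    by (simp only: char_std_normal_distribution exp_of_real[symmetric]) simp
  also have "\<dots> = (CLINT \<omega>|M. iexp (t * X \<omega>))"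
    using v by (simp add: char_def integral_distr)
  finally show ?thesis using v by (simp add: power_mult_distrib)
qed

text \<open>By Levy's uniqueness theorem the characteristic function determines the law. Limits, and
  hence Wiener integrals, are recognised as Gaussian in this way.\<close>

lemma (in prob_space) centered_gaussian_iexpI:
  assumes [measurable]: "X \<in> borel_measurable M" and "v \<ge> 0"
    and X: "\<And>t. (CLINT \<omega>|M. iexp (t * X \<omega>)) = exp (- (of_real (t\<^sup>2 * v / 2)))"
  shows "centered_gaussian M v X"
proof -
  have rX: "real_distribution (distr M borel X)" by (rule real_distribution_distr) simp
  have cX: "char (distr M borel X) t = exp (- (of_real (t\<^sup>2 * v / 2)))" for t
    using X[of t] by (simp add: char_def integral_distr)
  show ?thesis
  proof (cases "v = 0")
    case True
    interpret R: prob_space "return borel (0::real)" by (rule prob_space_return) simp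
    have "real_distribution (return borel (0::real))"
      by (simp add: real_distribution_def real_distribution_axioms_def R.prob_space_axioms)
    moreover have "char (distr M borel X) = char (return borel 0)"
      using True cX by (auto simp: char_def integral_return)
    ultimately have eq: "distr M borel X = return borel 0" using rX by (intro Levy_uniqueness)
    have "AE x in distr M borel X. x = 0" unfolding eq by (subst AE_return) auto
    then show ?thesis using True by (subst (asm) AE_distr_iff) (auto simp: centered_gaussian_def)
  next
    case False
    with \<open>v \<ge> 0\<close> have v: "v > 0" by simp
    let ?D = "density lborel (normal_density 0 (sqrt v))"
    interpret D: prob_space ?D using v by (intro prob_space_normal_density) simp
    have "distributed ?D lborel (\<lambda>x. x) (normal_density 0 (sqrt v))"
      by (auto simp: distributed_def intro!: measure_eqI simp: emeasure_distr)
    then have "centered_gaussian ?D v (\<lambda>x. x)" using v by (auto simp: centered_gaussian_def)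
    from D.centered_gaussian_iexp[OF this] have "char ?D t = exp (- (of_real (t\<^sup>2 * v / 2)))" for t
      by (simp add: char_def)
    then have "char (distr M borel X) = char ?D" using cX by auto
    moreover have "real_distribution ?D"
      by (simp add: real_distribution_def real_distribution_axioms_def D.prob_space_axioms)
    ultimately have "distr M borel X = ?D" using rX by (intro Levy_uniqueness)
    then show ?thesis using v by (auto simp: centered_gaussian_def distributed_def cong: distr_cong)
  qed
qed


text \<open>The pointwise bound |x| \<le> \<epsilon> + x^2 / \<epsilon> stands in for the
  Cauchy-Schwarz inequality and stays meaningful when the second moment is infinite.\<close>

lemma (in prob_space) nn_integral_abs_le:
  fixes u :: "'a \<Rightarrow> real"
  assumes [measurable]: "u \<in> borel_measurable M" and \<epsilon>: "\<epsilon> > 0"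
  shows "(\<integral>\<^sup>+ \<omega>. ennreal \<bar>u \<omega>\<bar> \<partial>M) \<le> ennreal \<epsilon> + ennreal (1 / \<epsilon>) * (\<integral>\<^sup>+ \<omega>. ennreal ((u \<omega>)\<^sup>2) \<partial>M)"
proof -
  have "\<bar>x\<bar> \<le> \<epsilon> + 1 / \<epsilon> * x\<^sup>2" for x
  proof (cases "\<bar>x\<bar> \<le> \<epsilon>")
    case False
    then have "\<bar>x\<bar> * \<epsilon> \<le> \<bar>x\<bar> * \<bar>x\<bar>" using \<epsilon> by (intro mult_left_mono) auto
    then have "\<bar>x\<bar> \<le> 1 / \<epsilon> * x\<^sup>2" using \<epsilon> by (simp add: field_simps power2_eq_square)
    then show ?thesis using \<epsilon> by simp
  qed (use \<epsilon> in \<open>simp add: add_increasing2\<close>)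
  then have "(\<integral>\<^sup>+ \<omega>. ennreal \<bar>u \<omega>\<bar> \<partial>M) \<le> (\<integral>\<^sup>+ \<omega>. ennreal \<epsilon> + ennreal (1 / \<epsilon>) * ennreal ((u \<omega>)\<^sup>2) \<partial>M)"
    using \<epsilon> by (intro nn_integral_mono)
      (simp add: ennreal_leI flip: ennreal_mult' ennreal_plus)
  also have "\<dots> = ennreal \<epsilon> + ennreal (1 / \<epsilon>) * (\<integral>\<^sup>+ \<omega>. ennreal ((u \<omega>)\<^sup>2) \<partial>M)"
    by (simp add: nn_integral_add nn_integral_cmult emeasure_space_1)
  finally show ?thesis .
qed

lemma (in prob_space) L2_tendsto_imp_L1_tendsto:
  fixes u :: "nat \<Rightarrow> 'a \<Rightarrow> real"
  assumes [measurable]: "\<And>n. u n \<in> borel_measurable M"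
    and u: "(\<lambda>n. \<integral>\<^sup>+ \<omega>. ennreal ((u n \<omega>)\<^sup>2) \<partial>M) \<longlonglongrightarrow> 0"
  shows "(\<lambda>n. \<integral>\<^sup>+ \<omega>. ennreal \<bar>u n \<omega>\<bar> \<partial>M) \<longlonglongrightarrow> 0"
proof (rule order_tendstoI)
  fix a :: ennreal assume "0 < a"
  then obtain e where e: "e > 0" "ennreal e < a"
  proof -
    have "0 < min a 1" using \<open>0 < a\<close> by simp
    then obtain z where z: "0 < z" "z < min a 1" using dense by blast
    then obtain e where "z = ennreal e" "e > 0"
      by (cases z) (auto simp: ennreal_less_zero_iff)
    then show ?thesis using z by (intro that[of e]) auto
  qed
  \<comment> \<open>With this threshold the bound of \<open>nn_integral_abs_le\<close> at e / 2
    becomes e / 2 + (2 / e) (e / 2)^2 = e.\<close>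
  have "\<forall>\<^sub>F n in sequentially. (\<integral>\<^sup>+ \<omega>. ennreal ((u n \<omega>)\<^sup>2) \<partial>M) < ennreal ((e / 2)\<^sup>2)"
    using u by (rule order_tendstoD) (use e in simp)
  then show "\<forall>\<^sub>F n in sequentially. (\<integral>\<^sup>+ \<omega>. ennreal \<bar>u n \<omega>\<bar> \<partial>M) < a"
  proof eventually_elim
    case (elim n)
    have "(\<integral>\<^sup>+ \<omega>. ennreal \<bar>u n \<omega>\<bar> \<partial>M)
        \<le> ennreal (e / 2) + ennreal (1 / (e / 2)) * (\<integral>\<^sup>+ \<omega>. ennreal ((u n \<omega>)\<^sup>2) \<partial>M)"
      using e by (intro nn_integral_abs_le) auto
    also have "\<dots> \<le> ennreal (e / 2) + ennreal (1 / (e / 2)) * ennreal ((e / 2)\<^sup>2)"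
      using elim by (intro add_left_mono mult_left_mono) auto
    also have "\<dots> = ennreal e"
      using e by (simp add: power2_eq_square flip: ennreal_mult' ennreal_plus)
    finally show ?case using e by simp
  qed
qed simp

text \<open>The function exp(i t x) of x is Lipschitz with constant |t|, so L1 convergence of the
  variables forces convergence of the characteristic functions; their explicit form converges
  because v does.\<close>

lemma (in prob_space) centered_gaussian_limit:
  assumes X: "\<And>n. centered_gaussian M (v n) (X n)" and v: "v \<longlonglongrightarrow> w"
    and [measurable]: "Y \<in> borel_measurable M"
    and lim: "(\<lambda>n. \<integral>\<^sup>+ \<omega>. ennreal ((X n \<omega> - Y \<omega>)\<^sup>2) \<partial>M) \<longlonglongrightarrow> 0"
  shows "centered_gaussian M w Y"
proof (rule centered_gaussian_iexpI)
  have [measurable]: "X n \<in> borel_measurable M" for n using X by (rule centered_gaussian_measurable)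
  show "w \<ge> 0" using v X by (intro LIMSEQ_le_const[OF v]) (auto dest: centered_gaussian_nonneg)
  fix t :: real
  have L1: "(\<lambda>n. \<integral>\<^sup>+ \<omega>. ennreal \<bar>X n \<omega> - Y \<omega>\<bar> \<partial>M) \<longlonglongrightarrow> 0"
    using lim by (intro L2_tendsto_imp_L1_tendsto) auto
  have "(\<lambda>n. (CLINT \<omega>|M. iexp (t * X n \<omega>)) - (CLINT \<omega>|M. iexp (t * Y \<omega>))) \<longlonglongrightarrow> 0"
  proof (rule Lim_null_comparison)
    show "(\<lambda>n. enn2real (ennreal \<bar>t\<bar> * (\<integral>\<^sup>+ \<omega>. ennreal \<bar>X n \<omega> - Y \<omega>\<bar> \<partial>M))) \<longlonglongrightarrow> 0"
      using ennreal_tendsto_cmult[OF _ L1, of "ennreal \<bar>t\<bar>"]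
      by (intro tendsto_enn2real[of _ 0, simplified]) auto
    \<comment> \<open>\<open>enn2real\<close> sends infinity to 0, so the comparison makes sense
      only once the L1 distance is known to be finite.\<close>
    have "\<forall>\<^sub>F n in sequentially. (\<integral>\<^sup>+ \<omega>. ennreal \<bar>X n \<omega> - Y \<omega>\<bar> \<partial>M) < 1"
      using L1 by (rule order_tendstoD) simp
    then show "\<forall>\<^sub>F n in sequentially. norm ((CLINT \<omega>|M. iexp (t * X n \<omega>)) - (CLINT \<omega>|M. iexp (t * Y \<omega>)))
      \<le> enn2real (ennreal \<bar>t\<bar> * (\<integral>\<^sup>+ \<omega>. ennreal \<bar>X n \<omega> - Y \<omega>\<bar> \<partial>M))"
    proof eventually_elim
      case (elim n)
      have *: "cmod (iexp a - iexp b) \<le> \<bar>a - b\<bar>" for a b :: real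
      proof -
        have "iexp a - iexp b = iexp b * (iexp (a - b) - 1)"
          by (simp add: algebra_simps flip: exp_add)
        then have "cmod (iexp a - iexp b) = cmod (iexp (a - b) - 1)" by (simp add: norm_mult)
        also have "\<dots> \<le> \<bar>a - b\<bar>" using iexp_approx1[of "a - b" 0] by simp
        finally show ?thesis .
      qed
      have "norm ((CLINT \<omega>|M. iexp (t * X n \<omega>)) - (CLINT \<omega>|M. iexp (t * Y \<omega>)))
        = norm (CLINT \<omega>|M. iexp (t * X n \<omega>) - iexp (t * Y \<omega>))"
        by (subst Bochner_Integration.integral_diff) (auto intro!: integrable_iexp)
      also have "ennreal \<dots> \<le> (\<integral>\<^sup>+ \<omega>. ennreal (cmod (iexp (t * X n \<omega>) - iexp (t * Y \<omega>))) \<partial>M)"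
        by (rule integral_norm_bound_ennreal) (auto intro!: integrable_iexp)
      also have "\<dots> \<le> (\<integral>\<^sup>+ \<omega>. ennreal \<bar>t\<bar> * ennreal \<bar>X n \<omega> - Y \<omega>\<bar> \<partial>M)"
      proof (intro nn_integral_mono)
        fix \<omega>
        have "cmod (iexp (t * X n \<omega>) - iexp (t * Y \<omega>)) \<le> \<bar>t\<bar> * \<bar>X n \<omega> - Y \<omega>\<bar>"
          using *[of "t * X n \<omega>" "t * Y \<omega>"] by (simp add: abs_mult flip: right_diff_distrib)
        then show "ennreal (cmod (iexp (t * X n \<omega>) - iexp (t * Y \<omega>)))
            \<le> ennreal \<bar>t\<bar> * ennreal \<bar>X n \<omega> - Y \<omega>\<bar>"
          by (simp add: ennreal_leI flip: ennreal_mult')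
      qed
      also have "\<dots> = ennreal \<bar>t\<bar> * (\<integral>\<^sup>+ \<omega>. ennreal \<bar>X n \<omega> - Y \<omega>\<bar> \<partial>M)"
        by (rule nn_integral_cmult) auto
      finally have le: "ennreal (norm ((CLINT \<omega>|M. iexp (t * X n \<omega>)) - (CLINT \<omega>|M. iexp (t * Y \<omega>))))
        \<le> ennreal \<bar>t\<bar> * (\<integral>\<^sup>+ \<omega>. ennreal \<bar>X n \<omega> - Y \<omega>\<bar> \<partial>M)" .
      obtain r where r: "(\<integral>\<^sup>+ \<omega>. ennreal \<bar>X n \<omega> - Y \<omega>\<bar> \<partial>M) = ennreal r" "r \<ge> 0"
        using elim by (cases "\<integral>\<^sup>+ \<omega>. ennreal \<bar>X n \<omega> - Y \<omega>\<bar> \<partial>M") (auto simp: top_unique)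
      from le show ?case unfolding r(1) using r(2) by (simp flip: ennreal_mult')
    qed
  qed
  moreover have "(\<lambda>n. (CLINT \<omega>|M. iexp (t * X n \<omega>))) \<longlonglongrightarrow> exp (- (of_real (t\<^sup>2 * w / 2)))"
    unfolding centered_gaussian_iexp[OF X] by (auto intro!: tendsto_intros v)
  ultimately have "(\<lambda>n. (CLINT \<omega>|M. iexp (t * Y \<omega>))) \<longlonglongrightarrow> exp (- (of_real (t\<^sup>2 * w / 2)))"
    using tendsto_diff by fastforce
  then show "(CLINT \<omega>|M. iexp (t * Y \<omega>)) = exp (- (of_real (t\<^sup>2 * w / 2)))"
    by (simp add: LIMSEQ_const_iff)
qed simp

lemma (in prob_space) centered_gaussian_indep_sum:
  assumes "finite I" and D: "\<And>i. i \<in> I \<Longrightarrow> w i > 0 \<and> distributed M lborel (D i) (normal_density 0 (sqrt (w i)))"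
    and ind: "indep_vars (\<lambda>_. borel) D I"
  shows "centered_gaussian M (\<Sum>i\<in>I. (b i)\<^sup>2 * w i) (\<lambda>\<omega>. \<Sum>i\<in>I. b i * D i \<omega>)"
proof -
  \<comment> \<open>A summand with b i = 0 has no density, so \<open>sum_indep_normal\<close>
    applies only to the remaining indices; if none is left, the sum is the point mass at 0.\<close>
  define J where "J = {i\<in>I. b i \<noteq> 0}"
  have J: "finite J" "J \<subseteq> I" using assms by (auto simp: J_def)
  have eq: "(\<Sum>i\<in>I. (b i)\<^sup>2 * w i) = (\<Sum>i\<in>J. (b i)\<^sup>2 * w i)"
    "(\<Sum>i\<in>I. b i * D i \<omega>) = (\<Sum>i\<in>J. b i * D i \<omega>)" for \<omega>
    using assms(1) by (auto simp: J_def intro!: sum.mono_neutral_right)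
  show ?thesis
  proof (cases "J = {}")
    case True
    then show ?thesis unfolding eq by (auto simp: centered_gaussian_def)
  next
    case False
    have "indep_vars (\<lambda>_. borel) (\<lambda>i \<omega>. b i * D i \<omega>) J"
      by (rule indep_vars_compose2[OF indep_vars_subset[OF ind J(2)]]) auto
    moreover have "distributed M lborel (\<lambda>\<omega>. b i * D i \<omega>) (normal_density 0 (\<bar>b i\<bar> * sqrt (w i)))"
      if "i \<in> J" for i
      using that D[of i] normal_density_affine[of "D i" 0 "sqrt (w i)" "b i" 0] by (auto simp: J_def)
    ultimately have "distributed M lborel (\<lambda>\<omega>. \<Sum>i\<in>J. b i * D i \<omega>)
        (normal_density (\<Sum>i\<in>J. 0) (sqrt (\<Sum>i\<in>J. (\<bar>b i\<bar> * sqrt (w i))\<^sup>2)))"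
      using D J by (intro sum_indep_normal[OF J(1) False]) (auto simp: J_def)
    moreover have "(\<Sum>i\<in>J. (\<bar>b i\<bar> * sqrt (w i))\<^sup>2) = (\<Sum>i\<in>J. (b i)\<^sup>2 * w i)"
      using D J by (intro sum.cong) (auto simp: power_mult_distrib less_imp_le subset_iff)
    moreover have "(\<Sum>i\<in>J. (b i)\<^sup>2 * w i) > 0"
      using D J False by (intro sum_pos) (auto simp: J_def)
    ultimately show ?thesis unfolding eq
      by (auto simp: centered_gaussian_def distributed_def)
  qed
qed

section \<open>Luxemburg norms of increments\<close>

lemma young_nonneg: "young_function N \<Longrightarrow> x \<ge> 0 \<Longrightarrow> N x \<ge> 0"
  unfolding young_function_def by blast

lemma young_mono: "young_function N \<Longrightarrow> 0 \<le> x \<Longrightarrow> x \<le> y \<Longrightarrow> N x \<le> N y"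
proof -
  assume "young_function N" and xy: "0 \<le> x" "x \<le> y"
  then have "mono_on {0..} N" by (simp only: young_function_def)
  from mono_onD[OF this, of x y] xy show "N x \<le> N y" by simp
qed

lemma young_zero: "young_function N \<Longrightarrow> N 0 = 0"
  by (simp only: young_function_def)

lemma young_convex:
  assumes "young_function N" "0 \<le> x" "0 \<le> y" "0 \<le> u" "u \<le> 1"
  shows "N (u * x + (1 - u) * y) \<le> u * N x + (1 - u) * N y"
proof -
  have "convex_on {0..} N" using assms(1) unfolding young_function_def by blast
  from convex_onD[OF this, of "1 - u" x y] assms(2-) show ?thesis by simp
qed

lemma young_divide_le:
  assumes "young_function N" "0 \<le> x" "K \<ge> 1"
  shows "N (x / K) \<le> N x / K"
  using young_convex[OF assms(1), of x 0 "1 / K"] assms by (simp add: young_zero)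

text \<open>A Young function is controlled on the half-line only; composing with the absolute value
  gives a globally continuous function, from which measurability and limits follow.\<close>

lemma continuous_young_abs: "young_function N \<Longrightarrow> continuous_on UNIV (\<lambda>x. N \<bar>x\<bar>)"
proof -
  assume "young_function N"
  then have "continuous_on {0..} N" by (simp only: young_function_def)
  then show "continuous_on UNIV (\<lambda>x. N \<bar>x\<bar>)"
    by (rule continuous_on_compose2) (auto intro!: continuous_intros)
qed

lemma young_measurable:
  assumes "young_function N" and f: "f \<in> borel_measurable D" and "l > 0"
  shows "(\<lambda>x. N (\<bar>f x\<bar> / l)) \<in> borel_measurable D"
proof -
  have "(\<lambda>x. N \<bar>x\<bar>) \<in> borel_measurable borel"
    using assms(1) by (intro borel_measurable_continuous_onI continuous_young_abs)
  from measurable_compose[OF _ this, of "\<lambda>x. f x / l"] assms show ?thesis by simp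
qed

definition luxemburg_modular :: "(real \<Rightarrow> real) \<Rightarrow> 'b measure \<Rightarrow> ('b \<Rightarrow> real) \<Rightarrow> real \<Rightarrow> ennreal" where
  "luxemburg_modular N D f l = (\<integral>\<^sup>+ x. ennreal (N (\<bar>f x\<bar> / l)) \<partial>D)"

lemma luxemburg_norm_leI: "l > 0 \<Longrightarrow> luxemburg_modular N D f l \<le> 1 \<Longrightarrow> luxemburg_norm N D f \<le> ennreal l"
  unfolding luxemburg_norm_def luxemburg_modular_def by (auto intro!: Inf_lower)

lemma luxemburg_norm_compare:
  assumes "\<And>l. l > 0 \<Longrightarrow> luxemburg_modular N D g l \<le> 1 \<Longrightarrow> luxemburg_modular N' D' f l \<le> 1"
  shows "luxemburg_norm N' D' f \<le> luxemburg_norm N D g"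
  unfolding luxemburg_norm_def using assms
  by (intro Inf_superset_mono) (auto simp: luxemburg_modular_def)

lemma luxemburg_modular_antimono:
  assumes "young_function N" "0 < l" "l \<le> l'"
  shows "luxemburg_modular N D f l' \<le> luxemburg_modular N D f l"
  unfolding luxemburg_modular_def using assms
  by (intro nn_integral_mono ennreal_leI young_mono[OF assms(1)]) (auto intro!: divide_left_mono)

text \<open>Whether the infimum defining the norm is attained is left open; every number strictly
  above it is admissible, because the modular decreases in l.\<close>

lemma luxemburg_norm_lessD:
  assumes "young_function N" "luxemburg_norm N D f < ennreal l"
  shows "l > 0" "luxemburg_modular N D f l \<le> 1"
proof -
  from assms(2) obtain l' where l': "l' > 0" "luxemburg_modular N D f l' \<le> 1" "ennreal l' < ennreal l"
    unfolding luxemburg_norm_def Inf_less_iff luxemburg_modular_def by auto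
  then have "l' < l" by (metis ennreal_less_iff less_imp_le)
  then have "luxemburg_modular N D f l \<le> luxemburg_modular N D f l'"
    using l' by (intro luxemburg_modular_antimono assms(1)) auto
  also have "\<dots> \<le> 1" by (rule l')
  finally show "luxemburg_modular N D f l \<le> 1" .
  show "l > 0" using l' \<open>l' < l\<close> by simp
qed

lemma luxemburg_norm_leI':
  assumes "\<And>l. l > L \<Longrightarrow> luxemburg_modular N D f l \<le> 1" "L \<ge> 0"
  shows "luxemburg_norm N D f \<le> ennreal L"
proof (rule ennreal_le_epsilon)
  fix e :: real assume "e > 0"
  then have "luxemburg_norm N D f \<le> ennreal (L + e)" using assms by (intro luxemburg_norm_leI) auto
  then show "luxemburg_norm N D f \<le> ennreal L + ennreal e" using assms \<open>e > 0\<close> by simp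
qed

lemma luxemburg_norm_cong:
  assumes "\<And>x. x \<in> space D \<Longrightarrow> f x = g x"
  shows "luxemburg_norm N D f = luxemburg_norm N D g"
  unfolding luxemburg_norm_def using assms by (simp cong: nn_integral_cong)

lemma luxemburg_norm_triangle:
  assumes N: "young_function N" and [measurable]: "f \<in> borel_measurable D" "g \<in> borel_measurable D"
  shows "luxemburg_norm N D (\<lambda>x. f x + g x) \<le> luxemburg_norm N D f + luxemburg_norm N D g"
proof (cases "luxemburg_norm N D f = \<infinity> \<or> luxemburg_norm N D g = \<infinity>")
  case True
  then show ?thesis by auto
next
  case False
  then obtain a b where ab: "luxemburg_norm N D f = ennreal a" "a \<ge> 0"
    "luxemburg_norm N D g = ennreal b" "b \<ge> 0"
    by (metis ennreal_cases infinity_ennreal_def)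
  have "luxemburg_norm N D (\<lambda>x. f x + g x) \<le> ennreal (a + b)"
  proof (rule luxemburg_norm_leI')
    fix l assume l: "l > a + b"
    \<comment> \<open>The excess l - (a + b) is shared equally: p and q lie strictly above the two
      norms and are therefore admissible, and p / l and q / l are convex weights.\<close>
    define p where "p = a + (l - (a + b)) / 2"
    define q where "q = b + (l - (a + b)) / 2"
    have pq: "p > a" "q > b" "l = p + q" using l by (auto simp: p_def q_def field_simps)
    have p0: "p > 0" "q > 0" "l > 0" using pq ab by auto
    have m: "luxemburg_modular N D f p \<le> 1" "luxemburg_modular N D g q \<le> 1"
      using ab pq by (auto intro!: luxemburg_norm_lessD(2)[OF N] simp: ennreal_less_iff)
    note [measurable] = young_measurable[OF N, of f D p] young_measurable[OF N, of g D q]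
    have "N (\<bar>f x + g x\<bar> / l) \<le> p / l * N (\<bar>f x\<bar> / p) + q / l * N (\<bar>g x\<bar> / q)" for x
    proof -
      have u: "1 - p / l = q / l" using p0 pq by (simp add: field_simps)
      have "\<bar>f x + g x\<bar> / l \<le> p / l * (\<bar>f x\<bar> / p) + q / l * (\<bar>g x\<bar> / q)"
        using p0 abs_triangle_ineq[of "f x" "g x"] by (simp add: divide_right_mono flip: add_divide_distrib)
      then have "N (\<bar>f x + g x\<bar> / l) \<le> N (p / l * (\<bar>f x\<bar> / p) + q / l * (\<bar>g x\<bar> / q))"
        using p0 by (intro young_mono[OF N]) auto
      also have "\<dots> \<le> p / l * N (\<bar>f x\<bar> / p) + q / l * N (\<bar>g x\<bar> / q)"
        using young_convex[OF N, of "\<bar>f x\<bar> / p" "\<bar>g x\<bar> / q" "p / l"] p0 pq unfolding u by simp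
      finally show ?thesis .
    qed
    then have "luxemburg_modular N D (\<lambda>x. f x + g x) l
      \<le> (\<integral>\<^sup>+ x. ennreal (p / l) * ennreal (N (\<bar>f x\<bar> / p)) + ennreal (q / l) * ennreal (N (\<bar>g x\<bar> / q)) \<partial>D)"
      unfolding luxemburg_modular_def using p0
      by (intro nn_integral_mono) (simp add: ennreal_leI young_nonneg[OF N] flip: ennreal_mult ennreal_plus)
    also have "\<dots> = ennreal (p / l) * luxemburg_modular N D f p + ennreal (q / l) * luxemburg_modular N D g q"
      unfolding luxemburg_modular_def using p0 by (simp add: nn_integral_add nn_integral_cmult)
    also have "\<dots> \<le> ennreal (p / l) * 1 + ennreal (q / l) * 1"
      by (intro add_mono mult_left_mono m) auto
    also have "\<dots> = 1"
      using p0 pq by (simp flip: ennreal_plus add_divide_distrib)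
    finally show "luxemburg_modular N D (\<lambda>x. f x + g x) l \<le> 1" .
  qed (use ab in simp)
  then show ?thesis using ab by simp
qed

text \<open>Convexity and \<open>N 0 = 0\<close> give N (x / K) \<le> N x / K, so a modular bounded
  by K costs only the factor K in the norm.\<close>

lemma luxemburg_norm_le_scaled:
  assumes N: "young_function N" and f: "f \<in> borel_measurable D" and l: "l > 0" and K: "K \<ge> 1"
    and m: "luxemburg_modular N D f l \<le> ennreal K"
  shows "luxemburg_norm N D f \<le> ennreal (K * l)"
proof (rule luxemburg_norm_leI)
  note [measurable] = young_measurable[OF N f l]
  have "N (\<bar>f x\<bar> / (K * l)) \<le> 1 / K * N (\<bar>f x\<bar> / l)" for x
    using young_divide_le[OF N, of "\<bar>f x\<bar> / l" K] l K by (simp add: mult.commute)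
  then have "luxemburg_modular N D f (K * l) \<le> (\<integral>\<^sup>+ x. ennreal (1 / K) * ennreal (N (\<bar>f x\<bar> / l)) \<partial>D)"
    unfolding luxemburg_modular_def using K l
    by (intro nn_integral_mono) (simp add: ennreal_leI young_nonneg[OF N] flip: ennreal_mult')
  also have "\<dots> = ennreal (1 / K) * luxemburg_modular N D f l"
    unfolding luxemburg_modular_def by (simp add: nn_integral_cmult)
  also have "\<dots> \<le> ennreal (1 / K) * ennreal K" using m by (intro mult_left_mono) auto
  also have "\<dots> = 1" using K by (simp flip: ennreal_mult')
  finally show "luxemburg_modular N D f (K * l) \<le> 1" .
qed (use l K in simp)

lemma luxemburg_modular_Fatou:
  assumes N: "young_function N" and [measurable]: "\<And>k. g k \<in> borel_measurable D" "f \<in> borel_measurable D"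
    and l: "l > 0" and lim: "AE x in D. (\<lambda>k. g k x) \<longlonglongrightarrow> f x"
    and le: "\<And>k :: nat. luxemburg_modular N D (g k) l \<le> 1"
  shows "luxemburg_modular N D f l \<le> 1"
proof -
  note [measurable] = young_measurable[OF N _ l]
  have "luxemburg_modular N D f l = (\<integral>\<^sup>+ x. liminf (\<lambda>k. ennreal (N (\<bar>g k x\<bar> / l))) \<partial>D)"
    unfolding luxemburg_modular_def
  proof (rule nn_integral_cong_AE, use lim in eventually_elim)
    fix x assume "(\<lambda>k. g k x) \<longlonglongrightarrow> f x"
    then have "(\<lambda>k. g k x / l) \<longlonglongrightarrow> f x / l" using l by (intro tendsto_intros) auto
    moreover have "isCont (\<lambda>x. N \<bar>x\<bar>) (f x / l)"
      using continuous_young_abs[OF N] by (simp add: continuous_on_eq_continuous_at)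
    ultimately have "(\<lambda>k. N \<bar>g k x / l\<bar>) \<longlonglongrightarrow> N \<bar>f x / l\<bar>" by (rule isCont_tendsto_compose[rotated])
    then have "(\<lambda>k. ennreal (N (\<bar>g k x\<bar> / l))) \<longlonglongrightarrow> ennreal (N (\<bar>f x\<bar> / l))"
      using l by (intro tendsto_ennrealI) simp
    then show "ennreal (N (\<bar>f x\<bar> / l)) = liminf (\<lambda>k. ennreal (N (\<bar>g k x\<bar> / l)))"
      by (simp add: lim_imp_Liminf)
  qed
  also have "\<dots> \<le> liminf (\<lambda>k. luxemburg_modular N D (g k) l)"
    unfolding luxemburg_modular_def by (rule nn_integral_liminf) auto
  also have "\<dots> \<le> 1"
    by (rule Liminf_le) (auto simp: le)
  finally show ?thesis .
qed

section \<open>Increments over shifts in the unit interval\<close>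

definition lborel_on :: "real set \<Rightarrow> real measure" where
  "lborel_on A = restrict_space lborel A"

lemma space_lborel_on [simp]: "space (lborel_on A) = A"
  by (simp add: lborel_on_def space_restrict_space)

lemma measurable_lborel_on: "f \<in> borel_measurable borel \<Longrightarrow> f \<in> borel_measurable (lborel_on A)"
  unfolding lborel_on_def by (rule measurable_restrict_space1) simp

lemma nn_integral_lborel_on:
  "A \<in> sets borel \<Longrightarrow> nn_integral (lborel_on A) f = (\<integral>\<^sup>+ x \<in> A. f x \<partial>lborel)"
  unfolding lborel_on_def by (subst nn_integral_restrict_space) auto

text \<open>Passing to Borel measure changes no non-negative integral, and it makes joint
  measurability in time and \<omega>, and with it Fubini's theorem, available.\<close>

lemma nn_integral_lebesgue_on:
  assumes "A \<in> sets borel"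
  shows "nn_integral (lebesgue_on A) f = nn_integral (lborel_on A) f"
proof -
  have "nn_integral (lebesgue_on A) f = (\<integral>\<^sup>+ x \<in> A. f x \<partial>lebesgue)"
    using assms by (subst nn_integral_restrict_space) auto
  then show ?thesis using assms by (simp add: nn_integral_completion nn_integral_lborel_on)
qed

lemma luxemburg_norm_lebesgue_on:
  "A \<in> sets borel \<Longrightarrow> luxemburg_norm N (lebesgue_on A) f = luxemburg_norm N (lborel_on A) f"
  unfolding luxemburg_norm_def by (simp add: nn_integral_lebesgue_on)

definition increment_norm :: "(real \<Rightarrow> real) \<Rightarrow> (real \<Rightarrow> real) \<Rightarrow> real \<Rightarrow> ennreal" where
  "increment_norm N f h = luxemburg_norm N (lborel_on {0<..<1 - h}) (\<lambda>x. f (x + h) - f x)"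

lemma shift_domain_unit:
  "h \<ge> 0 \<Longrightarrow> shift_domain {0<..<1} h = {0<..<1 - h}"
  "h \<le> 0 \<Longrightarrow> shift_domain {0<..<1} h = {- h<..<1}"
  by (auto simp: shift_domain_def)

lemma nn_integral_shift:
  fixes G :: "real \<Rightarrow> ennreal"
  assumes [measurable]: "G \<in> borel_measurable borel"
  shows "(\<integral>\<^sup>+ x \<in> {a<..<b}. G (x + h) \<partial>lborel) = (\<integral>\<^sup>+ x \<in> {a + h<..<b + h}. G x \<partial>lborel)"
  by (subst nn_integral_real_affine[where c=1 and t="- h"])
     (auto intro!: nn_integral_cong simp: indicator_def)

lemma luxemburg_norm_shift:
  assumes N: "young_function N" and [measurable]: "g \<in> borel_measurable borel"
  shows "luxemburg_norm N (lborel_on {a<..<b}) (\<lambda>x. g (x + h)) = luxemburg_norm N (lborel_on {a + h<..<b + h}) g"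
proof -
  have "luxemburg_modular N (lborel_on {a<..<b}) (\<lambda>x. g (x + h)) l
      = luxemburg_modular N (lborel_on {a + h<..<b + h}) g l" if l: "l > 0" for l
  proof -
    note [measurable] = young_measurable[OF N _ l, of g borel]
    show ?thesis unfolding luxemburg_modular_def
      using nn_integral_shift[where G="\<lambda>x. ennreal (N (\<bar>g x\<bar> / l))" and a=a and b=b and h=h]
      by (simp add: nn_integral_lborel_on)
  qed
  then show ?thesis by (intro antisym luxemburg_norm_compare) auto
qed

lemma luxemburg_norm_subset:
  assumes "A \<subseteq> B" "A \<in> sets borel" "B \<in> sets borel"
  shows "luxemburg_norm N (lborel_on A) g \<le> luxemburg_norm N (lborel_on B) g"
proof (rule luxemburg_norm_compare)
  fix l :: real assume "luxemburg_modular N (lborel_on B) g l \<le> 1"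
  moreover have "luxemburg_modular N (lborel_on A) g l \<le> luxemburg_modular N (lborel_on B) g l"
    unfolding luxemburg_modular_def using assms
    by (auto simp: nn_integral_lborel_on intro!: nn_integral_mono split: split_indicator)
  ultimately show "luxemburg_modular N (lborel_on A) g l \<le> 1" by (rule order_trans[rotated])
qed

text \<open>The increment over a + b is telescoped at x + a, and the second piece is translated by
  a; both pieces then live on subsets of the domains belonging to the single shifts.\<close>

lemma increment_norm_subadditive:
  assumes N: "young_function N" and [measurable]: "f \<in> borel_measurable borel" and "a \<ge> 0" "b \<ge> 0"
  shows "increment_norm N f (a + b) \<le> increment_norm N f a + increment_norm N f b"
proof -
  let ?D = "lborel_on {0<..<1 - (a + b)}"
  have "increment_norm N f (a + b) = luxemburg_norm N ?D (\<lambda>x. (f (x + a) - f x) + (f ((x + a) + b) - f (x + a)))"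
    by (simp add: increment_norm_def add.assoc)
  also have "\<dots> \<le> luxemburg_norm N ?D (\<lambda>x. f (x + a) - f x) + luxemburg_norm N ?D (\<lambda>x. f ((x + a) + b) - f (x + a))"
    by (intro luxemburg_norm_triangle N measurable_lborel_on) auto
  also have "\<dots> \<le> increment_norm N f a + increment_norm N f b"
  proof (rule add_mono)
    show "luxemburg_norm N ?D (\<lambda>x. f (x + a) - f x) \<le> increment_norm N f a"
      unfolding increment_norm_def using assms by (intro luxemburg_norm_subset) auto
    have "luxemburg_norm N ?D (\<lambda>x. f ((x + a) + b) - f (x + a))
        = luxemburg_norm N (lborel_on {0 + a<..<1 - (a + b) + a}) (\<lambda>x. f (x + b) - f x)"
      by (rule luxemburg_norm_shift[OF N, of "\<lambda>x. f (x + b) - f x"]) simp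
    also have "\<dots> \<le> increment_norm N f b"
      unfolding increment_norm_def using assms by (intro luxemburg_norm_subset) auto
    finally show "luxemburg_norm N ?D (\<lambda>x. f ((x + a) + b) - f (x + a)) \<le> increment_norm N f b" .
  qed
  finally show ?thesis .
qed

lemma luxemburg_norm_zero:
  assumes "young_function N" "\<And>x. x \<in> space D \<Longrightarrow> f x = 0"
  shows "luxemburg_norm N D f = 0"
proof -
  have "luxemburg_norm N D f \<le> ennreal 0"
  proof (rule luxemburg_norm_leI')
    fix l :: real
    have "luxemburg_modular N D f l = (\<integral>\<^sup>+ x. 0 \<partial>D)"
      unfolding luxemburg_modular_def using assms by (intro nn_integral_cong) (simp add: young_zero)
    then show "luxemburg_modular N D f l \<le> 1" by simp
  qed simp
  then show ?thesis by simp
qed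

lemma luxemburg_norm_shift_domain:
  assumes N: "young_function N" and [measurable]: "f \<in> borel_measurable borel"
  shows "luxemburg_norm N (lebesgue_on (shift_domain {0<..<1} h)) (\<lambda>x. f (x + h) - f x)
    = increment_norm N f \<bar>h\<bar>"
proof (cases "h \<ge> 0")
  case True
  then show ?thesis by (simp add: shift_domain_unit increment_norm_def luxemburg_norm_lebesgue_on)
next
  case False
  \<comment> \<open>Up to sign, this is the increment over h at the point x - h; translating by - h
    then restores the domain (- h, 1).\<close>
  have "luxemburg_norm N (lborel_on {0<..<1 + h}) (\<lambda>x. f (x - h) - f x) =
    luxemburg_norm N (lborel_on {0<..<1 + h}) (\<lambda>x. f ((x + - h) + h) - f (x + - h))"
    by (intro antisym luxemburg_norm_compare) (auto simp: luxemburg_modular_def abs_minus_commute)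
  also have "\<dots> = luxemburg_norm N (lborel_on {0 + - h<..<1 + h + - h}) (\<lambda>x. f (x + h) - f x)"
    by (rule luxemburg_norm_shift[OF N, of "\<lambda>x. f (x + h) - f x"]) simp
  finally show ?thesis
    using False by (simp add: shift_domain_unit increment_norm_def luxemburg_norm_lebesgue_on)
qed

text \<open>As t powr (- s) decreases in t, for given h the best choice in the outer supremum is t =
  |h|. Negative shifts reduce to positive ones, and those with h = 0 or |h| \<ge> 1 contribute
  nothing.\<close>

lemma besov_orlicz_seminorm_unit:
  assumes N: "young_function N" and f: "f \<in> borel_measurable borel" and s: "s > 0"
  shows "besov_orlicz_seminorm N s {0<..<1} f
    = (SUP h\<in>{0<..<1}. ennreal (h powr (- s)) * increment_norm N f h)" (is "_ = ?R")
proof (rule antisym)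
  have z: "increment_norm N f h = 0" if "h = 0 \<or> h \<ge> 1" for h
    unfolding increment_norm_def using that by (intro luxemburg_norm_zero[OF N]) auto
  have *: "ennreal (t powr (- s)) * increment_norm N f \<bar>h\<bar> \<le> ?R" if "t > 0" "\<bar>h\<bar> \<le> t" for t h
  proof (cases "0 < \<bar>h\<bar> \<and> \<bar>h\<bar> < 1")
    case True
    have "ennreal (t powr (- s)) * increment_norm N f \<bar>h\<bar> \<le> ennreal (\<bar>h\<bar> powr (- s)) * increment_norm N f \<bar>h\<bar>"
      using that True s by (intro mult_right_mono ennreal_leI powr_mono2') auto
    also have "\<dots> \<le> ?R" using True by (intro SUP_upper) auto
    finally show ?thesis .
  next
    case False
    then show ?thesis using z[of "\<bar>h\<bar>"] by auto
  qed
  show "besov_orlicz_seminorm N s {0<..<1} f \<le> ?R"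
    unfolding besov_orlicz_seminorm_def luxemburg_norm_shift_domain[OF N f]
    by (auto intro!: SUP_least * simp: SUP_mult_left_ennreal)
  show "?R \<le> besov_orlicz_seminorm N s {0<..<1} f"
    unfolding besov_orlicz_seminorm_def luxemburg_norm_shift_domain[OF N f]
  proof (rule SUP_mono)
    fix h :: real assume h: "h \<in> {0<..<1}"
    show "\<exists>t\<in>{0<..}. ennreal (h powr (- s)) * increment_norm N f h
        \<le> ennreal (t powr (- s)) * (SUP h\<in>{h. \<bar>h\<bar> \<le> t}. increment_norm N f \<bar>h\<bar>)"
      using h by (intro bexI[of _ h] mult_left_mono) (auto intro!: SUP_upper2[of h])
  qed
qed

section \<open>Continuity of translation and lower semicontinuity in the shift\<close>

lemma bounded_borel_approx_continuous:
  fixes f :: "real \<Rightarrow> real"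
  assumes [measurable]: "f \<in> borel_measurable borel" and le: "\<And>x. \<bar>f x\<bar> \<le> c"
  obtains g where "\<And>n :: nat. continuous_on UNIV (g n)" "\<And>n x. \<bar>g n x\<bar> \<le> c"
    "AE x in lborel. (\<lambda>n. g n x) \<longlonglongrightarrow> f x"
proof -
  have "f measurable_on UNIV"
    by (rule lebesgue_measurable_imp_measurable_on_real) (auto intro: measurable_completion)
  then obtain N and g :: "nat \<Rightarrow> real \<Rightarrow> real" where N: "negligible N"
    and g: "\<And>n. continuous_on UNIV (g n)" "\<And>x. x \<notin> N \<Longrightarrow> (\<lambda>n. g n x) \<longlonglongrightarrow> f x"
    unfolding measurable_on_def by auto
  show thesis
  proof
    \<comment> \<open>Truncating enforces the bound c, and the limit is unaffected because f itself
      lies within it.\<close>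
    show "continuous_on UNIV (\<lambda>x. max (- c) (min c (g n x)))" for n
      by (intro continuous_intros g)
    show "\<bar>max (- c) (min c (g n x))\<bar> \<le> c" for n x
      using le[of 0] by auto
    have "N \<in> null_sets lebesgue" using N by (simp add: negligible_iff_null_sets)
    then have "AE x in lebesgue. x \<notin> N" by (rule AE_not_in)
    then have "AE x in lborel. x \<notin> N" by (simp add: AE_completion_iff)
    then show "AE x in lborel. (\<lambda>n. max (- c) (min c (g n x))) \<longlonglongrightarrow> f x"
    proof eventually_elim
      case (elim x)
      have "(\<lambda>n. max (- c) (min c (g n x))) \<longlonglongrightarrow> max (- c) (min c (f x))"
        by (intro tendsto_intros g elim)
      then show ?case using le[of x] by (simp add: abs_le_iff max_def min_def split: if_splits)
    qed
  qed
qed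

lemma bounded_borel_approx_continuous_L1:
  fixes f :: "real \<Rightarrow> real"
  assumes [measurable]: "f \<in> borel_measurable borel" and le: "\<And>x. \<bar>f x\<bar> \<le> c"
    and supp: "\<And>x. x \<notin> {0..1} \<Longrightarrow> f x = 0" and e: "e > 0"
  obtains g where "continuous_on UNIV g" "\<And>x. \<bar>g x\<bar> \<le> c" "\<And>x. x \<notin> {-2..2} \<Longrightarrow> g x = 0"
    "(\<integral>\<^sup>+ x. ennreal \<bar>g x - f x\<bar> \<partial>lborel) < e"
proof -
  obtain g where g: "\<And>n :: nat. continuous_on UNIV (g n)" "\<And>n x. \<bar>g n x\<bar> \<le> c"
    "AE x in lborel. (\<lambda>n. g n x) \<longlonglongrightarrow> f x"
    using bounded_borel_approx_continuous[OF assms(1) le] by blast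
  have c: "c \<ge> 0" using le[of 0] by simp
  have [measurable]: "g n \<in> borel_measurable borel" for n
    using g by (intro borel_measurable_continuous_onI)
  \<comment> \<open>The cutoff is 1 on [-1, 1], outside of which f vanishes, and 0 outside [-2, 2];
    it gives the approximants a common integrable majorant.\<close>
  define \<phi> where "\<phi> x = max 0 (min 1 (2 - \<bar>x\<bar>))" for x :: real
  have [measurable]: "\<phi> \<in> borel_measurable borel" unfolding \<phi>_def by measurable
  have \<phi>: "0 \<le> \<phi> x" "\<phi> x \<le> 1" for x by (auto simp: \<phi>_def)
  have \<phi>f: "\<phi> x * f x = f x" for x using supp[of x] by (cases "x \<in> {0..1}") (auto simp: \<phi>_def)
  have b: "\<bar>\<phi> x * g n x\<bar> \<le> c" for n x
    using mult_mono[OF \<phi>(2)[of x] g(2)[of n x]] \<phi>(1)[of x] by (simp add: abs_mult)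
  have "(\<lambda>n. \<integral>\<^sup>+ x. ennreal \<bar>\<phi> x * g n x - f x\<bar> \<partial>lborel) \<longlonglongrightarrow> (\<integral>\<^sup>+ x. 0 \<partial>(lborel :: real measure))"
  proof (rule nn_integral_dominated_convergence)
    show "AE x in lborel. ennreal \<bar>\<phi> x * g n x - f x\<bar> \<le> ennreal (2 * c) * indicator {-2..2} x" for n
    proof (rule AE_I2)
      fix x
      show "ennreal \<bar>\<phi> x * g n x - f x\<bar> \<le> ennreal (2 * c) * indicator {-2..2} x"
        using b[of x n] le[of x] supp[of x]
        by (cases "x \<in> {-2..2}") (auto simp: \<phi>_def intro!: ennreal_leI)
    qed
    show "(\<integral>\<^sup>+ x. ennreal (2 * c) * indicator {-2..2::real} x \<partial>lborel) < \<infinity>"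
      by (simp add: nn_integral_cmult_indicator ennreal_mult_less_top)
    show "AE x in lborel. (\<lambda>n. ennreal \<bar>\<phi> x * g n x - f x\<bar>) \<longlonglongrightarrow> 0"
      using g(3)
    proof eventually_elim
      case (elim x)
      then have "(\<lambda>n. \<bar>\<phi> x * g n x - f x\<bar>) \<longlonglongrightarrow> \<bar>\<phi> x * f x - f x\<bar>" by (intro tendsto_intros)
      then have "(\<lambda>n. \<bar>\<phi> x * g n x - f x\<bar>) \<longlonglongrightarrow> 0" by (simp add: \<phi>f)
      then show ?case by (simp add: ennreal_tendsto_0_iff)
    qed
  qed auto
  then have "(\<lambda>n. \<integral>\<^sup>+ x. ennreal \<bar>\<phi> x * g n x - f x\<bar> \<partial>lborel) \<longlonglongrightarrow> 0" by simp
  then have "\<forall>\<^sub>F n in sequentially. (\<integral>\<^sup>+ x. ennreal \<bar>\<phi> x * g n x - f x\<bar> \<partial>lborel) < e"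
    using e by (rule order_tendstoD)
  then obtain n where n: "(\<integral>\<^sup>+ x. ennreal \<bar>\<phi> x * g n x - f x\<bar> \<partial>lborel) < e"
    by (auto simp: eventually_sequentially)
  show thesis
  proof (rule that[OF _ _ _ n])
    show "continuous_on UNIV (\<lambda>x. \<phi> x * g n x)" unfolding \<phi>_def by (intro continuous_intros g)
  qed (use b in \<open>auto simp: \<phi>_def\<close>)
qed

lemma nn_integral_lborel_translate:
  fixes G :: "real \<Rightarrow> ennreal"
  assumes [measurable]: "G \<in> borel_measurable borel"
  shows "(\<integral>\<^sup>+ x. G (x + h) \<partial>lborel) = (\<integral>\<^sup>+ x. G x \<partial>lborel)"
  by (subst (2) nn_integral_real_affine[where c=1 and t=h]) (auto simp: add.commute)

text \<open>The classical argument: f is replaced by a compactly supported continuous g, and by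
  translation invariance the two replacement errors do not depend on the shift.\<close>

lemma L1_continuous_translation:
  fixes f :: "real \<Rightarrow> real"
  assumes [measurable]: "f \<in> borel_measurable borel" and le: "\<And>x. \<bar>f x\<bar> \<le> c"
    and supp: "\<And>x. x \<notin> {0..1} \<Longrightarrow> f x = 0" and h: "h \<longlonglongrightarrow> (h0 :: real)"
  shows "(\<lambda>k. \<integral>\<^sup>+ x. ennreal \<bar>f (x + h k) - f (x + h0)\<bar> \<partial>lborel) \<longlonglongrightarrow> 0"
proof (rule order_tendstoI)
  fix a :: ennreal assume "0 < a"
  then have "0 < a / 4" by (simp add: ennreal_zero_less_divide)
  have c: "c \<ge> 0" using le[of 0] by simp
  obtain g where g: "continuous_on UNIV g" "\<And>x. \<bar>g x\<bar> \<le> c" "\<And>x. x \<notin> {-2..2} \<Longrightarrow> g x = 0"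
    "(\<integral>\<^sup>+ x. ennreal \<bar>g x - f x\<bar> \<partial>lborel) < a / 4"
    using bounded_borel_approx_continuous_L1[OF assms(1) le supp \<open>0 < a / 4\<close>] by blast
  have [measurable]: "g \<in> borel_measurable borel" using g by (intro borel_measurable_continuous_onI)
  \<comment> \<open>A common bound for the shifts places the supports of all translates of g in one
    bounded interval, which yields the dominating function.\<close>
  have "Bseq h" using h by (intro convergent_imp_Bseq convergentI)
  then obtain B where B: "\<And>k. \<bar>h k\<bar> \<le> B" by (auto simp: Bseq_def)
  have B0: "\<bar>h0\<bar> \<le> B"
    using B by (intro LIMSEQ_le_const2[OF tendsto_rabs[OF h]]) auto
  have "(\<lambda>k. \<integral>\<^sup>+ x. ennreal \<bar>g (x + h k) - g (x + h0)\<bar> \<partial>lborel) \<longlonglongrightarrow> (\<integral>\<^sup>+ x. 0 \<partial>(lborel :: real measure))"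
  proof (rule nn_integral_dominated_convergence)
    show "AE x in lborel. ennreal \<bar>g (x + h k) - g (x + h0)\<bar>
        \<le> ennreal (2 * c) * indicator {-2-B..2+B} x" for k
    proof (rule AE_I2)
      fix x
      show "ennreal \<bar>g (x + h k) - g (x + h0)\<bar> \<le> ennreal (2 * c) * indicator {-2-B..2+B} x"
      proof (cases "x \<in> {-2-B..2+B}")
        case True
        then show ?thesis using g(2)[of "x + h k"] g(2)[of "x + h0"] by (auto intro!: ennreal_leI)
      next
        case False
        then have "x + h k \<notin> {-2..2}" "x + h0 \<notin> {-2..2}" using B[of k] B0 by auto
        then show ?thesis using g(3) by simp
      qed
    qed
    show "(\<integral>\<^sup>+ x. ennreal (2 * c) * indicator {-2-B..2+B} x \<partial>lborel) < \<infinity>"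
      using B[of 0] by (simp add: nn_integral_cmult_indicator ennreal_mult_less_top)
    show "AE x in lborel. (\<lambda>k. ennreal \<bar>g (x + h k) - g (x + h0)\<bar>) \<longlonglongrightarrow> 0"
    proof (rule AE_I2)
      fix x
      have "isCont g (x + h0)" using g(1) by (simp add: continuous_on_eq_continuous_at)
      then have "(\<lambda>k. g (x + h k)) \<longlonglongrightarrow> g (x + h0)"
        by (rule isCont_tendsto_compose) (intro tendsto_intros h)
      then have "(\<lambda>k. \<bar>g (x + h k) - g (x + h0)\<bar>) \<longlonglongrightarrow> \<bar>g (x + h0) - g (x + h0)\<bar>"
        by (intro tendsto_intros)
      then show "(\<lambda>k. ennreal \<bar>g (x + h k) - g (x + h0)\<bar>) \<longlonglongrightarrow> 0" by (simp add: ennreal_tendsto_0_iff)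
    qed
  qed auto
  then have "\<forall>\<^sub>F k in sequentially. (\<integral>\<^sup>+ x. ennreal \<bar>g (x + h k) - g (x + h0)\<bar> \<partial>lborel) < a / 4"
    using \<open>0 < a / 4\<close> by (intro order_tendstoD) auto
  then show "\<forall>\<^sub>F k in sequentially. (\<integral>\<^sup>+ x. ennreal \<bar>f (x + h k) - f (x + h0)\<bar> \<partial>lborel) < a"
  proof eventually_elim
    case (elim k)
    have "(\<integral>\<^sup>+ x. ennreal \<bar>f (x + h k) - f (x + h0)\<bar> \<partial>lborel)
      \<le> (\<integral>\<^sup>+ x. ennreal \<bar>g (x + h k) - f (x + h k)\<bar> + ennreal \<bar>g (x + h k) - g (x + h0)\<bar>
           + ennreal \<bar>g (x + h0) - f (x + h0)\<bar> \<partial>lborel)"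
      by (intro nn_integral_mono) (auto intro!: ennreal_leI simp flip: ennreal_plus)
    also have "\<dots> = (\<integral>\<^sup>+ x. ennreal \<bar>g (x + h k) - f (x + h k)\<bar> \<partial>lborel)
        + (\<integral>\<^sup>+ x. ennreal \<bar>g (x + h k) - g (x + h0)\<bar> \<partial>lborel)
        + (\<integral>\<^sup>+ x. ennreal \<bar>g (x + h0) - f (x + h0)\<bar> \<partial>lborel)"
      by (simp add: nn_integral_add)
    also have "\<dots> = (\<integral>\<^sup>+ x. ennreal \<bar>g x - f x\<bar> \<partial>lborel)
        + (\<integral>\<^sup>+ x. ennreal \<bar>g (x + h k) - g (x + h0)\<bar> \<partial>lborel)
        + (\<integral>\<^sup>+ x. ennreal \<bar>g x - f x\<bar> \<partial>lborel)"
      by (simp add: nn_integral_lborel_translate[of "\<lambda>x. ennreal \<bar>g x - f x\<bar>"])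
    also have "\<dots> < a / 4 + a / 4 + a / 4" using g(4) elim by (intro add_strict_mono)
    also have "\<dots> \<le> a"
    proof (cases a)
      case (real r)
      then have "a / 4 = ennreal (r / 4)" by (simp flip: divide_ennreal)
      then show ?thesis using real by (simp flip: ennreal_plus)
    qed auto
    finally show ?case .
  qed
qed simp

text \<open>f may fail to be integrable, so continuity of translation is applied to arctan f, which
  is bounded; tan recovers f along an almost everywhere convergent subsequence.\<close>

lemma AE_subseq_translation:
  fixes f :: "real \<Rightarrow> real"
  assumes [measurable]: "f \<in> borel_measurable borel"
    and supp: "\<And>x. x \<notin> {0..1} \<Longrightarrow> f x = 0" and h: "h \<longlonglongrightarrow> (h0 :: real)"
  obtains r where "strict_mono (r :: nat \<Rightarrow> nat)" "AE x in lborel. (\<lambda>k. f (x + h (r k))) \<longlonglongrightarrow> f (x + h0)"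
proof -
  define F where "F x = arctan (f x)" for x
  have [measurable]: "F \<in> borel_measurable borel" unfolding F_def by measurable
  have F: "\<bar>F x\<bar> \<le> 2" for x
    using arctan_lbound[of "f x"] arctan_ubound[of "f x"] pi_less_4 unfolding F_def abs_le_iff by linarith
  have F0: "x \<notin> {0..1} \<Longrightarrow> F x = 0" for x using supp by (simp add: F_def)
  have l: "(\<lambda>k. \<integral>\<^sup>+ x. ennreal \<bar>F (x + h k) - F (x + h0)\<bar> \<partial>lborel) \<longlonglongrightarrow> 0"
    by (rule L1_continuous_translation[OF _ F F0 h]) auto
  have int: "integrable lborel F"
    using F F0 by (intro integrableI_bounded_set[of "{0..1}" _ _ 2]) auto
  have inth: "integrable lborel (\<lambda>x. F (x + t))" for t
    using lborel_integrable_real_affine[OF int, of 1 t] by (simp add: add.commute)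
  have eq: "(\<integral>x. norm (F (x + h k) - F (x + h0)) \<partial>lborel) =
     enn2real (\<integral>\<^sup>+ x. ennreal \<bar>F (x + h k) - F (x + h0)\<bar> \<partial>lborel)" for k
    by (subst integral_eq_nn_integral) auto
  have "(\<lambda>k. \<integral>x. norm (F (x + h k) - F (x + h0)) \<partial>lborel) \<longlonglongrightarrow> 0"
    unfolding eq by (rule tendsto_enn2real) (use l in simp_all)
  then obtain r :: "nat \<Rightarrow> nat" where r: "strict_mono r"
    "AE x in lborel. (\<lambda>k. F (x + h (r k)) - F (x + h0)) \<longlonglongrightarrow> 0"
    using tendsto_L1_AE_subseq[of lborel "\<lambda>k x. F (x + h k) - F (x + h0)"] inth by auto
  show thesis
  proof (rule that[OF r(1)])
    show "AE x in lborel. (\<lambda>k. f (x + h (r k))) \<longlonglongrightarrow> f (x + h0)"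
      using r(2)
    proof eventually_elim
      case (elim x)
      then have "(\<lambda>k. F (x + h (r k))) \<longlonglongrightarrow> F (x + h0)" by (simp add: LIM_zero_iff)
      then have "(\<lambda>k. tan (F (x + h (r k)))) \<longlonglongrightarrow> tan (F (x + h0))"
        by (rule isCont_tendsto_compose[rotated]) (simp add: F_def cos_arctan_not_zero)
      then show ?case by (simp add: F_def tan_arctan)
    qed
  qed
qed

text \<open>Along a subsequence the translates converge almost everywhere, and Fatou's lemma carries
  the bound on the modular to the limit. The bounds may vary with k because those to be used have
  the form of a constant times h k powr s.\<close>

lemma increment_norm_lsc:
  fixes f :: "real \<Rightarrow> real"
  assumes N: "young_function N" and [measurable]: "f \<in> borel_measurable borel"
    and supp: "\<And>x. x \<notin> {0..1} \<Longrightarrow> f x = 0" and h: "h \<longlonglongrightarrow> h0"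
    and le: "\<And>k :: nat. increment_norm N f (h k) \<le> ennreal (L k)" "\<And>k. L k \<ge> 0" and L: "L \<longlonglongrightarrow> L0"
  shows "increment_norm N f h0 \<le> ennreal L0"
  unfolding increment_norm_def
proof (rule luxemburg_norm_leI')
  show "L0 \<ge> 0" using L le(2) by (intro LIMSEQ_le_const[OF L]) auto
  fix l assume l: "l > L0"
  then have l0: "l > 0" using \<open>L0 \<ge> 0\<close> by simp
  obtain r where r: "strict_mono (r :: nat \<Rightarrow> nat)" "AE x in lborel. (\<lambda>k. f (x + h (r k))) \<longlonglongrightarrow> f (x + h0)"
    using AE_subseq_translation[OF assms(2) supp h] by blast
  have "(\<lambda>k. L (r k)) \<longlonglongrightarrow> L0" "(\<lambda>k. h (r k)) \<longlonglongrightarrow> h0"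
    using LIMSEQ_subseq_LIMSEQ[OF L r(1)] LIMSEQ_subseq_LIMSEQ[OF h r(1)] by (auto simp: comp_def)
  from order_tendstoD(2)[OF this(1) l] obtain k0 where k0: "\<And>k. k \<ge> k0 \<Longrightarrow> L (r k) < l"
    by (auto simp: eventually_sequentially)
  \<comment> \<open>The domain of the limit shift may exceed that of the k-th one; the indicator
    cuts the increment down to the latter, and eventually has no effect at a given point of the
    limit domain.\<close>
  let ?g = "\<lambda>k x. (f (x + h (r (k + k0))) - f x) * indicator {0<..<1 - h (r (k + k0))} x"
  let ?D = "lborel_on {0<..<1 - h0}"
  show "luxemburg_modular N ?D (\<lambda>x. f (x + h0) - f x) l \<le> 1"
  proof (rule luxemburg_modular_Fatou[OF N _ _ l0, where g="?g"])
    show "?g k \<in> borel_measurable ?D" "(\<lambda>x. f (x + h0) - f x) \<in> borel_measurable ?D" for k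
      by (intro measurable_lborel_on; measurable)+
    have "AE x in lborel. x \<in> {0<..<1 - h0} \<longrightarrow> (\<lambda>k. ?g k x) \<longlonglongrightarrow> f (x + h0) - f x"
      using r(2)
    proof eventually_elim
      case lim: (elim x)
      show ?case
      proof (rule impI)
        assume x: "x \<in> {0<..<1 - h0}"
        have "(\<lambda>k. f (x + h (r (k + k0))) - f x) \<longlonglongrightarrow> f (x + h0) - f x"
          by (intro tendsto_intros LIMSEQ_ignore_initial_segment[OF lim])
        moreover have "\<forall>\<^sub>F k in sequentially. h (r (k + k0)) < 1 - x"
          using x by (intro order_tendstoD(2)[OF LIMSEQ_ignore_initial_segment[OF \<open>(\<lambda>k. h (r k)) \<longlonglongrightarrow> h0\<close>]]) auto
        then have "\<forall>\<^sub>F k in sequentially. f (x + h (r (k + k0))) - f x = ?g k x"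
          by eventually_elim (use x in \<open>auto simp: indicator_def\<close>)
        ultimately show "(\<lambda>k. ?g k x) \<longlonglongrightarrow> f (x + h0) - f x" by (rule Lim_transform_eventually)
      qed
    qed
    then show "AE x in ?D. (\<lambda>k. ?g k x) \<longlonglongrightarrow> f (x + h0) - f x"
      unfolding lborel_on_def by (subst AE_restrict_space_iff) auto
    fix k
    let ?E = "lborel_on {0<..<1 - h (r (k + k0))}"
    have "increment_norm N f (h (r (k + k0))) < ennreal l"
      using le(1)[of "r (k + k0)"] k0[of "k + k0"] le(2)[of "r (k + k0)"]
      by (auto intro: order.strict_trans1 simp: ennreal_less_iff)
    then have "luxemburg_modular N ?E (\<lambda>x. f (x + h (r (k + k0))) - f x) l \<le> 1"
      unfolding increment_norm_def by (intro luxemburg_norm_lessD(2)[OF N])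
    moreover have "luxemburg_modular N ?D (?g k) l \<le> luxemburg_modular N ?E (\<lambda>x. f (x + h (r (k + k0))) - f x) l"
      unfolding luxemburg_modular_def
      by (auto simp: nn_integral_lborel_on young_zero[OF N] intro!: nn_integral_mono split: split_indicator)
    ultimately show "luxemburg_modular N ?D (?g k) l \<le> 1" by (rule order_trans[rotated])
  qed
qed

section \<open>From dyadic shifts to all shifts\<close>

definition unit_dyadics :: "real set" where
  "unit_dyadics = {real k / 2 ^ m | k m. 0 < k \<and> k < 2 ^ m}"

lemma countable_dyadics: "countable unit_dyadics"
proof -
  have "unit_dyadics \<subseteq> (\<lambda>(k, m). real k / 2 ^ m) ` (UNIV :: (nat \<times> nat) set)" by (auto simp: unit_dyadics_def)
  then show ?thesis by (rule countable_subset) auto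
qed

lemma dyadics_bounds: "h \<in> unit_dyadics \<Longrightarrow> 0 < h \<and> h < 1"
proof -
  assume "h \<in> unit_dyadics"
  then obtain k m where "h = real k / 2 ^ m" "0 < k" "k < 2 ^ m" by (auto simp: unit_dyadics_def)
  moreover from this have "real k < 2 ^ m" by (metis of_nat_less_iff of_nat_numeral of_nat_power)
  ultimately show "0 < h \<and> h < 1" by simp
qed

lemma dyadics_dense:
  assumes "0 < h0" "h0 < 1"
  obtains h where "\<And>k :: nat. h k \<in> unit_dyadics" "h \<longlonglongrightarrow> h0"
proof -
  define n where "n k = nat \<lfloor>h0 * 2 ^ k\<rfloor>" for k
  define u where "u k = real (n k) / 2 ^ k" for k
  have eq: "u k = of_int \<lfloor>h0 * 2 ^ k\<rfloor> / 2 ^ k" for k using assms by (simp add: u_def n_def)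
  have u1: "u k \<le> h0" for k unfolding eq using of_int_floor_le[of "h0 * 2 ^ k"] by (simp add: divide_le_eq)
  have u2: "h0 - (1 / 2) ^ k \<le> u k" for k
  proof -
    have "(h0 * 2 ^ k - 1) / 2 ^ k \<le> of_int \<lfloor>h0 * 2 ^ k\<rfloor> / 2 ^ k"
      using real_of_int_floor_gt_diff_one[of "h0 * 2 ^ k"] by (intro divide_right_mono) auto
    then show ?thesis unfolding eq by (simp add: diff_divide_distrib power_divide)
  qed
  have "(\<lambda>k. h0 - (1 / 2) ^ k) \<longlonglongrightarrow> h0 - 0" by (intro tendsto_intros) auto
  then have lo: "(\<lambda>k. h0 - (1 / 2) ^ k) \<longlonglongrightarrow> h0" by simp
  have "u \<longlonglongrightarrow> h0"
    by (rule tendsto_sandwich[OF _ _ lo tendsto_const]) (use u1 u2 in simp_all)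
  moreover from order_tendstoD(1)[OF this assms(1)] obtain k0 where k0: "\<And>k. k \<ge> k0 \<Longrightarrow> u k > 0"
    by (auto simp: eventually_sequentially)
  have "u (k + k0) \<in> unit_dyadics" for k
  proof -
    have "u (k + k0) > 0" "u (k + k0) < 1" using k0[of "k + k0"] u1[of "k + k0"] assms by auto
    then have "0 < n (k + k0)" and lt: "real (n (k + k0)) < 2 ^ (k + k0)"
      by (auto simp: u_def zero_less_divide_iff)
    moreover have "n (k + k0) < 2 ^ (k + k0)"
      using lt by (metis of_nat_less_iff of_nat_numeral of_nat_power)
    ultimately show ?thesis unfolding unit_dyadics_def u_def by blast
  qed
  ultimately show thesis by (intro that[of "\<lambda>k. u (k + k0)"] LIMSEQ_ignore_initial_segment)
qed

lemma increment_norm_le_of_dyadics: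
  fixes f :: "real \<Rightarrow> real"
  assumes N: "young_function N" and f: "f \<in> borel_measurable borel" "\<And>x. x \<notin> {0..1} \<Longrightarrow> f x = 0"
    and le: "\<And>h. h \<in> unit_dyadics \<Longrightarrow> increment_norm N f h \<le> ennreal (L * h powr s)" and L: "L \<ge> 0"
    and h: "0 < h" "h < 1"
  shows "increment_norm N f h \<le> ennreal (L * h powr s)"
proof -
  obtain u where u: "\<And>k :: nat. u k \<in> unit_dyadics" "u \<longlonglongrightarrow> h" using dyadics_dense[OF h] by blast
  show ?thesis
  proof (rule increment_norm_lsc[OF N f u(2)])
    show "increment_norm N f (u k) \<le> ennreal (L * u k powr s)" for k using u by (intro le)
    show "(\<lambda>k. L * u k powr s) \<longlonglongrightarrow> L * h powr s" using u h by (intro tendsto_intros) auto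
  qed (use L in auto)
qed

lemma increment_norm_dyadic_bound:
  fixes f :: "real \<Rightarrow> real"
  assumes N: "young_function N" and f: "f \<in> borel_measurable borel" "\<And>x. x \<notin> {0..1} \<Longrightarrow> f x = 0"
    and s: "s > 0" and S: "S \<ge> 0"
    and le: "\<And>n. increment_norm N f (1 / 2 ^ n) \<le> ennreal (S * (1 / 2 ^ n) powr s)"
    and h: "0 < h" "h < 1"
  shows "increment_norm N f h \<le> ennreal (S / (1 - 2 powr (- s)) * h powr s)"
proof (rule increment_norm_le_of_dyadics[OF N f _ _ h])
  \<comment> \<open>With this q the bound at 1 / 2^n is S q^n, so the binary digits of a shift
    contribute terms of a geometric series.\<close>
  define q where "q = 2 powr (- s)"
  have q: "0 < q" "q < 1" using s by (auto simp: q_def powr_less_one)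
  have qn: "(1 / 2 ^ n) powr s = q ^ n" for n
  proof -
    have "(1 / 2 ^ n) powr s = (2 powr (- real n)) powr s"
      by (simp add: powr_minus powr_realpow inverse_eq_divide)
    also have "\<dots> = q powr real n" by (simp add: q_def powr_powr mult.commute)
    also have "\<dots> = q ^ n" using q by (simp add: powr_realpow)
    finally show ?thesis .
  qed
  show "S / (1 - 2 powr (- s)) \<ge> 0" using S q by (simp add: q_def)
  have zero: "increment_norm N f 0 = 0"
    unfolding increment_norm_def by (rule luxemburg_norm_zero[OF N]) auto
  \<comment> \<open>A fraction with numerator below 2^n has binary digits in the positions j + 1 to
    j + n only. The induction removes the last digit, and subadditivity adds its
    contribution.\<close>
  have claim: "k < 2 ^ n \<Longrightarrow> increment_norm N f (real k / 2 ^ (j + n)) \<le> ennreal (S * (\<Sum>i<n. q ^ (j + i + 1)))"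
    for k n j
  proof (induction n arbitrary: k)
    case 0
    then show ?case by (simp add: zero)
  next
    case (Suc n)
    have IH: "increment_norm N f (real (k div 2) / 2 ^ (j + n)) \<le> ennreal (S * (\<Sum>i<n. q ^ (j + i + 1)))"
      using Suc.prems by (intro Suc.IH) auto
    show ?case
    proof (cases "even k")
      case True
      then have "real k / 2 ^ (j + Suc n) = real (k div 2) / 2 ^ (j + n)" by (auto elim!: evenE)
      then have "increment_norm N f (real k / 2 ^ (j + Suc n)) \<le> ennreal (S * (\<Sum>i<n. q ^ (j + i + 1)))"
        using IH by simp
      also have "\<dots> \<le> ennreal (S * (\<Sum>i<Suc n. q ^ (j + i + 1)))"
        using S q by (intro ennreal_leI mult_left_mono) auto
      finally show ?thesis .
    next
      case False
      then have "real k / 2 ^ (j + Suc n) = real (k div 2) / 2 ^ (j + n) + 1 / 2 ^ (j + Suc n)"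
        by (auto elim!: oddE simp: field_simps)
      then have "increment_norm N f (real k / 2 ^ (j + Suc n))
        \<le> increment_norm N f (real (k div 2) / 2 ^ (j + n)) + increment_norm N f (1 / 2 ^ (j + Suc n))"
        using increment_norm_subadditive[OF N f(1), of "real (k div 2) / 2 ^ (j + n)" "1 / 2 ^ (j + Suc n)"]
        by simp
      also have "\<dots> \<le> ennreal (S * (\<Sum>i<n. q ^ (j + i + 1))) + ennreal (S * q ^ (j + Suc n))"
        using IH le[of "j + Suc n"] unfolding qn by (rule add_mono)
      also have "\<dots> = ennreal (S * (\<Sum>i<Suc n. q ^ (j + i + 1)))"
        using S q by (subst ennreal_plus[symmetric]) (auto simp: algebra_simps intro!: mult_nonneg_nonneg sum_nonneg)
      finally show ?thesis .
    qed
  qed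
  fix h assume "h \<in> unit_dyadics"
  then obtain k m where km: "h = real k / 2 ^ m" "0 < k" "k < 2 ^ m" by (auto simp: unit_dyadics_def)
  have h01: "0 < h" "h < 1" using \<open>h \<in> unit_dyadics\<close> dyadics_bounds by auto
  obtain n0 where "(1 / 2 :: real) ^ n0 < h" using real_arch_pow_inv[of h "1/2"] h01 by auto
  then have ex: "\<exists>n. 1 / 2 ^ n \<le> h" by (intro exI[of _ n0]) (simp add: power_divide)
  \<comment> \<open>p is the position of the leading binary digit of h, so the series starts at q^p
    = (1 / 2^p) powr s \<le> h powr s; summing it gives the factor 1 / (1 - q).\<close>
  define p where "p = (LEAST n. 1 / 2 ^ n \<le> h)"
  have p: "1 / 2 ^ p \<le> h" unfolding p_def by (rule LeastI_ex[OF ex])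
  have "p \<noteq> 0" using p h01 by (intro notI) simp
  then obtain j where j: "p = Suc j" by (cases p) auto
  have hj: "h < 1 / 2 ^ j" using not_less_Least[of j "\<lambda>n. 1 / 2 ^ n \<le> h"] j unfolding p_def by auto
  have "j \<le> m"
  proof (rule ccontr)
    assume "\<not> j \<le> m"
    then have "1 / 2 ^ j \<le> (1 / 2 ^ m :: real)" by (intro divide_left_mono power_increasing) auto
    also have "\<dots> \<le> h" using km by (simp add: divide_right_mono)
    finally show False using hj by simp
  qed
  then obtain n where n: "m = j + n" by (metis le_add_diff_inverse)
  have "real k < 2 ^ n" using hj unfolding km n by (simp add: power_add field_simps)
  then have "k < 2 ^ n" by (metis of_nat_less_iff of_nat_numeral of_nat_power)
  from claim[OF this, of j] have "increment_norm N f h \<le> ennreal (S * (\<Sum>i<n. q ^ (j + i + 1)))"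
    by (simp add: km n)
  also have "\<dots> \<le> ennreal (S / (1 - q) * h powr s)"
  proof (rule ennreal_leI)
    have "(\<Sum>i<n. q ^ (j + i + 1)) = q ^ p * (\<Sum>i<n. q ^ i)"
      by (simp add: j power_add sum_distrib_left mult_ac)
    also have "\<dots> \<le> q ^ p * (1 / (1 - q))"
      using q by (intro mult_left_mono) (auto simp: sum_gp_strict divide_right_mono)
    also have "q ^ p = (1 / 2 ^ p) powr s" by (simp add: qn)
    also have "(1 / 2 ^ p) powr s * (1 / (1 - q)) \<le> h powr s * (1 / (1 - q))"
      using p s q by (intro mult_right_mono powr_mono2) auto
    finally have "S * (\<Sum>i<n. q ^ (j + i + 1)) \<le> S * (h powr s * (1 / (1 - q)))"
      using S by (rule mult_left_mono)
    then show "S * (\<Sum>i<n. q ^ (j + i + 1)) \<le> S / (1 - q) * h powr s" by (simp add: mult_ac)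
  qed
  finally show "increment_norm N f h \<le> ennreal (S / (1 - 2 powr (- s)) * h powr s)" by (simp add: q_def)
qed

section \<open>Second-order estimates for fractional Gaussian noise\<close>

text \<open>The correlation of two increments of a fractional Brownian motion over the length h
  whose starting points differ by d.\<close>

definition fbm_corr :: "real \<Rightarrow> real \<Rightarrow> real \<Rightarrow> real" where
  "fbm_corr \<alpha> h d = (\<bar>d + h\<bar> powr (2 * \<alpha>) + \<bar>d - h\<bar> powr (2 * \<alpha>) - 2 * \<bar>d\<bar> powr (2 * \<alpha>)) / (2 * h powr (2 * \<alpha>))"

lemma fbm_corr_minus: "fbm_corr \<alpha> h (- d) = fbm_corr \<alpha> h d"
proof -
  have "\<bar>- d + h\<bar> = \<bar>d - h\<bar>" "\<bar>- d - h\<bar> = \<bar>d + h\<bar>" by auto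
  then show ?thesis by (simp add: fbm_corr_def)
qed

text \<open>The second difference is h times the difference of the first derivative at two points
  less than 2 h apart. As p \<le> 2, the modulus of the second derivative does not increase, so its
  value at d - h is a bound.\<close>

lemma powr_second_difference:
  fixes d h p :: real
  assumes "0 < h" "h < d" "p \<le> 2"
  shows "\<bar>(d + h) powr p + (d - h) powr p - 2 * d powr p\<bar> \<le> 2 * h\<^sup>2 * \<bar>p * (p - 1)\<bar> * (d - h) powr (p - 2)"
proof -
  have D: "((\<lambda>u. u powr p) has_real_derivative p * u powr (p - 1)) (at u)" if "u > 0" for u
    using that by (auto intro!: derivative_eq_intros)
  have D2: "((\<lambda>u. p * u powr (p - 1)) has_real_derivative p * (p - 1) * u powr (p - 2)) (at u)" if "u > 0" for u
    using that by (auto intro!: derivative_eq_intros simp: algebra_simps)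
  obtain \<xi> where \<xi>: "d < \<xi>" "\<xi> < d + h" "(d + h) powr p - d powr p = (d + h - d) * (p * \<xi> powr (p - 1))"
    using MVT2[of d "d + h" "\<lambda>u. u powr p" "\<lambda>u. p * u powr (p - 1)"] D assms by auto
  obtain \<eta> where \<eta>: "d - h < \<eta>" "\<eta> < d" "d powr p - (d - h) powr p = (d - (d - h)) * (p * \<eta> powr (p - 1))"
    using MVT2[of "d - h" d "\<lambda>u. u powr p" "\<lambda>u. p * u powr (p - 1)"] D assms by auto
  obtain \<zeta> where \<zeta>: "\<eta> < \<zeta>" "\<zeta> < \<xi>"
      "p * \<xi> powr (p - 1) - p * \<eta> powr (p - 1) = (\<xi> - \<eta>) * (p * (p - 1) * \<zeta> powr (p - 2))"
    using MVT2[of \<eta> \<xi> "\<lambda>u. p * u powr (p - 1)" "\<lambda>u. p * (p - 1) * u powr (p - 2)"] D2 assms \<xi> \<eta> by auto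
  have "(d + h) powr p + (d - h) powr p - 2 * d powr p = h * ((\<xi> - \<eta>) * (p * (p - 1) * \<zeta> powr (p - 2)))"
    unfolding \<zeta>(3)[symmetric] using \<xi>(3) \<eta>(3) by (simp add: algebra_simps)
  then have "\<bar>(d + h) powr p + (d - h) powr p - 2 * d powr p\<bar> = (h * (\<xi> - \<eta>)) * (\<bar>p * (p - 1)\<bar> * \<zeta> powr (p - 2))"
    using assms \<zeta> by (simp add: abs_mult)
  also have "\<dots> \<le> (h * (2 * h)) * (\<bar>p * (p - 1)\<bar> * (d - h) powr (p - 2))"
    using assms \<xi> \<eta> \<zeta> by (intro mult_mono powr_mono2') auto
  finally show ?thesis by (simp add: power2_eq_square mult_ac)
qed

text \<open>For h \<le> 1/4 and |d| \<ge> sqrt h one has 2 h \<le> |d|, so |d| - h stays above half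
  of sqrt h. The second difference is then of order h^2 h^(\<alpha> - 1), and division by h^(2
  \<alpha>) leaves h^(1 - \<alpha>).\<close>

lemma fbm_corr_bound:
  assumes \<alpha>: "0 < \<alpha>" "\<alpha> < 1" and h: "0 < h" "h \<le> 1/4" and d: "sqrt h \<le> \<bar>d\<bar>"
  shows "\<bar>fbm_corr \<alpha> h d\<bar> \<le> 8 * h powr (1 - \<alpha>)"
proof -
  have *: "\<bar>fbm_corr \<alpha> h d\<bar> \<le> 8 * h powr (1 - \<alpha>)" if d: "sqrt h \<le> d" for d
  proof -
    have "2 * h \<le> sqrt h"
    proof (rule real_le_rsqrt)
      have "4 * h * h \<le> 1 * h" using h by (intro mult_right_mono) auto
      then show "(2 * h)\<^sup>2 \<le> h" by (simp add: power2_eq_square)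
    qed
    then have hd: "2 * h \<le> d" and d0: "0 < d" using d h by (auto intro: order_trans less_le_trans[OF real_sqrt_gt_zero])
    have "\<bar>(d + h) powr (2 * \<alpha>) + (d - h) powr (2 * \<alpha>) - 2 * d powr (2 * \<alpha>)\<bar>
        \<le> 2 * h\<^sup>2 * \<bar>2 * \<alpha> * (2 * \<alpha> - 1)\<bar> * (d - h) powr (2 * \<alpha> - 2)"
      using h hd d0 \<alpha> by (intro powr_second_difference) auto
    also have "\<dots> \<le> 2 * h\<^sup>2 * 2 * (4 * h powr (\<alpha> - 1))"
    proof (intro mult_mono)
      have "\<bar>2 * \<alpha>\<bar> * \<bar>2 * \<alpha> - 1\<bar> \<le> 2 * 1" using \<alpha> by (intro mult_mono) auto
      then show "\<bar>2 * \<alpha> * (2 * \<alpha> - 1)\<bar> \<le> 2" by (simp add: abs_mult)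
      have "(d - h) powr (2 * \<alpha> - 2) \<le> (sqrt h / 2) powr (2 * \<alpha> - 2)"
        using h hd d \<alpha> by (intro powr_mono2') auto
      also have "\<dots> = h powr (\<alpha> - 1) * 2 powr (2 - 2 * \<alpha>)"
      proof -
        have "sqrt h powr (2 * \<alpha> - 2) = h powr (\<alpha> - 1)"
          using h by (simp add: powr_half_sqrt[symmetric] powr_powr algebra_simps)
        moreover have "2 powr (2 - 2 * \<alpha>) = 1 / 2 powr (2 * \<alpha> - 2)"
          by (simp add: powr_minus_divide[symmetric])
        ultimately show ?thesis using h by (simp add: powr_divide)
      qed
      also have "\<dots> \<le> h powr (\<alpha> - 1) * 2 powr 2" using \<alpha> by (intro mult_left_mono powr_mono) auto
      finally show "(d - h) powr (2 * \<alpha> - 2) \<le> 4 * h powr (\<alpha> - 1)" by simp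
    qed auto
    also have "\<dots> = 16 * (h powr 2 * h powr (\<alpha> - 1))" using h by (simp add: powr_numeral)
    also have "h powr 2 * h powr (\<alpha> - 1) = h powr (1 - \<alpha>) * h powr (2 * \<alpha>)"
      by (simp add: add.commute flip: powr_add)
    finally have "\<bar>\<bar>d + h\<bar> powr (2 * \<alpha>) + \<bar>d - h\<bar> powr (2 * \<alpha>) - 2 * \<bar>d\<bar> powr (2 * \<alpha>)\<bar>
       \<le> 16 * (h powr (1 - \<alpha>) * h powr (2 * \<alpha>))" using h hd d0 by simp
    then show ?thesis using h by (simp add: fbm_corr_def abs_divide field_simps)
  qed
  show ?thesis
  proof (cases "d \<ge> 0")
    case True then show ?thesis using *[of d] d by simp
  next
    case False then show ?thesis using *[of "- d"] d by (simp add: fbm_corr_minus)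
  qed
qed

lemma fbm_corr_measurable [measurable]: "fbm_corr \<alpha> h \<in> borel_measurable borel"
  unfolding fbm_corr_def by measurable

text \<open>The inner integral is split at |y - x| = sqrt h. The part near the diagonal contributes
  at most its length 2 sqrt h, the rest at most 64 h^(2 - 2 \<alpha>), whence 66. For h > 1/4 the
  right-hand side exceeds 1 and the trivial bound suffices.\<close>

lemma fbm_corr_integral_bound:
  assumes \<alpha>: "0 < \<alpha>" "\<alpha> < 1" and h: "0 < h" "h < 1"
    and le1: "\<And>d. \<bar>d\<bar> \<le> 1 - h \<Longrightarrow> \<bar>fbm_corr \<alpha> h d\<bar> \<le> 1"
  shows "(\<integral>\<^sup>+ x \<in> {0<..<1 - h}. (\<integral>\<^sup>+ y \<in> {0<..<1 - h}. ennreal ((fbm_corr \<alpha> h (y - x))\<^sup>2) \<partial>lborel) \<partial>lborel)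
    \<le> ennreal (66 * h powr (min (1/2) (2 - 2 * \<alpha>)))" (is "?L \<le> ennreal (66 * h powr ?\<delta>)")
proof -
  let ?I = "{0<..<1 - h}"
  have inner: "(\<integral>\<^sup>+ y \<in> ?I. ennreal ((fbm_corr \<alpha> h (y - x))\<^sup>2) \<partial>lborel) \<le> ennreal (66 * h powr ?\<delta>)"
    if x: "x \<in> ?I" for x
  proof (cases "h \<le> 1/4")
    case False
    have "(1/4) powr (1/2) \<le> h powr (1/2)" using False by (intro powr_mono2) auto
    also have "\<dots> \<le> h powr ?\<delta>" using h by (intro powr_mono' min.cobounded1) auto
    finally have "1 \<le> 66 * h powr ?\<delta>" by (simp add: powr_half_sqrt real_sqrt_divide)
    have "(\<integral>\<^sup>+ y \<in> ?I. ennreal ((fbm_corr \<alpha> h (y - x))\<^sup>2) \<partial>lborel) \<le> (\<integral>\<^sup>+ y \<in> ?I. 1 \<partial>lborel)"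
      using x h by (intro nn_integral_mono) (auto simp: abs_square_le_1 intro!: le1 split: split_indicator)
    also have "\<dots> = ennreal (1 - h)" using h by simp
    also have "\<dots> \<le> ennreal (66 * h powr ?\<delta>)" using \<open>1 \<le> 66 * h powr ?\<delta>\<close> h by (intro ennreal_leI) auto
    finally show ?thesis .
  next
    case True
    have "(\<integral>\<^sup>+ y \<in> ?I. ennreal ((fbm_corr \<alpha> h (y - x))\<^sup>2) \<partial>lborel)
      \<le> (\<integral>\<^sup>+ y. indicator {x - sqrt h<..<x + sqrt h} y + ennreal (64 * h powr (2 - 2 * \<alpha>)) * indicator ?I y \<partial>lborel)"
    proof (intro nn_integral_mono)
      fix y :: real
      show "ennreal ((fbm_corr \<alpha> h (y - x))\<^sup>2) * indicator ?I y
        \<le> indicator {x - sqrt h<..<x + sqrt h} y + ennreal (64 * h powr (2 - 2 * \<alpha>)) * indicator ?I y"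
      proof (cases "y \<in> ?I")
        case y: True
        show ?thesis
        proof (cases "\<bar>y - x\<bar> < sqrt h")
          case True
          then have "y \<in> {x - sqrt h<..<x + sqrt h}" by auto
          moreover have "ennreal ((fbm_corr \<alpha> h (y - x))\<^sup>2) \<le> 1"
            using x y h by (auto simp: abs_square_le_1 intro!: le1)
          ultimately show ?thesis using y by (simp add: add_increasing2)
        next
          case False
          then have "\<bar>fbm_corr \<alpha> h (y - x)\<bar> \<le> 8 * h powr (1 - \<alpha>)"
            using \<alpha> h \<open>h \<le> 1/4\<close> by (intro fbm_corr_bound) auto
          then have "(fbm_corr \<alpha> h (y - x))\<^sup>2 \<le> (8 * h powr (1 - \<alpha>))\<^sup>2"
            by (metis abs_ge_zero power2_abs power_mono)
          also have "\<dots> = 64 * h powr (2 - 2 * \<alpha>)"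
            using h by (simp add: power_mult_distrib powr_power algebra_simps)
          finally show ?thesis using y by (simp add: add_increasing ennreal_leI)
        qed
      qed simp
    qed
    also have "\<dots> = ennreal (2 * sqrt h) + ennreal (64 * h powr (2 - 2 * \<alpha>)) * ennreal (1 - h)"
      using h by (simp add: nn_integral_add nn_integral_cmult_indicator)
    also have "\<dots> = ennreal (2 * sqrt h + 64 * h powr (2 - 2 * \<alpha>) * (1 - h))"
      using h by (simp add: ennreal_mult ennreal_plus)
    also have "\<dots> \<le> ennreal (66 * h powr ?\<delta>)"
    proof (rule ennreal_leI)
      have "sqrt h \<le> h powr ?\<delta>" using h powr_mono'[OF min.cobounded1[of "1/2" "2 - 2 * \<alpha>"], of h] by (simp add: powr_half_sqrt)
      moreover have "h powr (2 - 2 * \<alpha>) * (1 - h) \<le> h powr ?\<delta> * 1"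
        using h by (intro mult_mono powr_mono') auto
      ultimately show "2 * sqrt h + 64 * h powr (2 - 2 * \<alpha>) * (1 - h) \<le> 66 * h powr ?\<delta>" by simp
    qed
    finally show ?thesis .
  qed
  have "?L \<le> (\<integral>\<^sup>+ x \<in> ?I. ennreal (66 * h powr ?\<delta>) \<partial>lborel)"
    using inner by (intro nn_integral_mono) (auto split: split_indicator)
  also have "\<dots> = ennreal (66 * h powr ?\<delta>) * ennreal (1 - h)"
    using h by (simp add: nn_integral_cmult_indicator)
  also have "\<dots> \<le> ennreal (66 * h powr ?\<delta>) * 1"
    using h by (intro mult_left_mono) (auto simp: ennreal_le_1)
  finally show ?thesis by simp
qed

section \<open>Tail bounds for random integrals and for suprema\<close>

lemma (in prob_space) random_integral_chebyshev:
  fixes F :: "real \<Rightarrow> 'a \<Rightarrow> ennreal" and r :: "real \<Rightarrow> real \<Rightarrow> real"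
  assumes F [measurable]: "(\<lambda>(x, \<omega>). F x \<omega>) \<in> borel_measurable (lborel \<Otimes>\<^sub>M M)"
    and A [measurable]: "A \<in> sets borel" and a: "emeasure lborel A = ennreal a" "a \<ge> 0"
    and m: "m \<ge> 0" "\<And>x. x \<in> A \<Longrightarrow> (\<integral>\<^sup>+ \<omega>. F x \<omega> \<partial>M) = ennreal m"
    and r: "\<And>x y. x \<in> A \<Longrightarrow> y \<in> A \<Longrightarrow> (\<integral>\<^sup>+ \<omega>. F x \<omega> * F y \<omega> \<partial>M) \<le> ennreal (m\<^sup>2) + ennreal (r x y)"
    and rm [measurable]: "(\<lambda>(x, y). r x y) \<in> borel_measurable (lborel \<Otimes>\<^sub>M lborel)"
    and V: "(\<integral>\<^sup>+ x \<in> A. (\<integral>\<^sup>+ y \<in> A. ennreal (r x y) \<partial>lborel) \<partial>lborel) \<le> ennreal V" "V \<ge> 0"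
    and \<epsilon>: "\<epsilon> > 0"
  shows "emeasure M {\<omega> \<in> space M. \<epsilon> \<le> \<bar>enn2real (\<integral>\<^sup>+ x \<in> A. F x \<omega> \<partial>lborel) - m * a\<bar>} \<le> ennreal (V / \<epsilon>\<^sup>2)"
    and "AE \<omega> in M. (\<integral>\<^sup>+ x \<in> A. F x \<omega> \<partial>lborel) < \<infinity>"
proof -
  interpret pair_sigma_finite lborel M ..
  define T where "T \<omega> = (\<integral>\<^sup>+ x \<in> A. F x \<omega> \<partial>lborel)" for \<omega>
  have [measurable]: "T \<in> borel_measurable M" unfolding T_def by measurable
  have ET: "(\<integral>\<^sup>+ \<omega>. T \<omega> \<partial>M) = ennreal (m * a)"
  proof -
    have "(\<integral>\<^sup>+ \<omega>. T \<omega> \<partial>M) = (\<integral>\<^sup>+ x. (\<integral>\<^sup>+ \<omega>. F x \<omega> * indicator A x \<partial>M) \<partial>lborel)"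
      unfolding T_def by (rule Fubini') measurable
    also have "\<dots> = (\<integral>\<^sup>+ x \<in> A. ennreal m \<partial>lborel)"
      using m by (intro nn_integral_cong) (auto split: split_indicator)
    also have "\<dots> = ennreal (m * a)" using a m by (simp add: nn_integral_cmult_indicator ennreal_mult)
    finally show ?thesis .
  qed
  \<comment> \<open>By Fubini's theorem the second moment is a double integral of mixed moments, and
    r bounds their excess over the squared mean; V thus bounds the variance.\<close>
  have ETT: "(\<integral>\<^sup>+ \<omega>. T \<omega> * T \<omega> \<partial>M) \<le> ennreal ((m * a)\<^sup>2 + V)"
  proof -
    have "(\<integral>\<^sup>+ \<omega>. T \<omega> * T \<omega> \<partial>M)
        = (\<integral>\<^sup>+ \<omega>. (\<integral>\<^sup>+ x. (\<integral>\<^sup>+ y. (F x \<omega> * indicator A x) * (F y \<omega> * indicator A y) \<partial>lborel) \<partial>lborel) \<partial>M)"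
    proof (intro nn_integral_cong)
      fix \<omega> assume [measurable]: "\<omega> \<in> space M"
      show "T \<omega> * T \<omega> = (\<integral>\<^sup>+ x. (\<integral>\<^sup>+ y. (F x \<omega> * indicator A x) * (F y \<omega> * indicator A y) \<partial>lborel) \<partial>lborel)"
        unfolding T_def by (simp add: nn_integral_cmult nn_integral_multc)
    qed
    also have "\<dots> = (\<integral>\<^sup>+ x. (\<integral>\<^sup>+ \<omega>. (\<integral>\<^sup>+ y. (F x \<omega> * indicator A x) * (F y \<omega> * indicator A y) \<partial>lborel) \<partial>M) \<partial>lborel)"
      by (rule Fubini') measurable
    also have "\<dots> = (\<integral>\<^sup>+ x. (\<integral>\<^sup>+ y. (\<integral>\<^sup>+ \<omega>. (F x \<omega> * indicator A x) * (F y \<omega> * indicator A y) \<partial>M) \<partial>lborel) \<partial>lborel)"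
      by (intro nn_integral_cong Fubini') measurable
    also have "\<dots> \<le> (\<integral>\<^sup>+ x. (\<integral>\<^sup>+ y. ennreal (m\<^sup>2) * (indicator A x * indicator A y) + ennreal (r x y) * indicator A y * indicator A x \<partial>lborel) \<partial>lborel)"
      using r by (intro nn_integral_mono) (auto split: split_indicator)
    also have "\<dots> = ennreal (m\<^sup>2) * (ennreal a * ennreal a) + (\<integral>\<^sup>+ x \<in> A. (\<integral>\<^sup>+ y \<in> A. ennreal (r x y) \<partial>lborel) \<partial>lborel)"
      by (simp add: nn_integral_add nn_integral_cmult nn_integral_multc a)
    also have "\<dots> \<le> ennreal (m\<^sup>2) * (ennreal a * ennreal a) + ennreal V" by (intro add_left_mono V)
    also have "\<dots> = ennreal ((m * a)\<^sup>2 + V)"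
      using a m V by (simp add: power_mult_distrib power2_eq_square flip: ennreal_mult ennreal_plus)
    finally show ?thesis .
  qed
  \<comment> \<open>The integral has finite mean, so it is finite almost surely and can be exchanged
    for the real variable R, to which Chebyshev's inequality applies.\<close>
  have fin: "AE \<omega> in M. T \<omega> < \<infinity>"
    using nn_integral_PInf_AE[of T M] ET by (auto simp: top.not_eq_extremum)
  then show "AE \<omega> in M. (\<integral>\<^sup>+ x \<in> A. F x \<omega> \<partial>lborel) < \<infinity>" by (simp add: T_def)
  define R where "R \<omega> = enn2real (T \<omega>)" for \<omega>
  have [measurable]: "R \<in> borel_measurable M" unfolding R_def by measurable
  have R1: "(\<integral>\<^sup>+ \<omega>. ennreal (R \<omega>) \<partial>M) = ennreal (m * a)"
    unfolding ET[symmetric] using fin by (intro nn_integral_cong_AE) (auto simp: R_def)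
  have R2: "(\<integral>\<^sup>+ \<omega>. ennreal ((R \<omega>)\<^sup>2) \<partial>M) \<le> ennreal ((m * a)\<^sup>2 + V)"
  proof -
    have "(\<integral>\<^sup>+ \<omega>. ennreal ((R \<omega>)\<^sup>2) \<partial>M) = (\<integral>\<^sup>+ \<omega>. T \<omega> * T \<omega> \<partial>M)"
      using fin by (intro nn_integral_cong_AE)
        (auto simp: R_def power2_eq_square ennreal_mult)
    then show ?thesis using ETT by simp
  qed
  have R_nonneg: "R \<omega> \<ge> 0" for \<omega> by (simp add: R_def)
  have intR: "integrable M R"
    using R1 R_nonneg by (intro integrableI_nonneg) auto
  have ER: "expectation R = m * a"
    using R1 R_nonneg m a by (subst integral_eq_nn_integral) auto
  have intR2: "integrable M (\<lambda>\<omega>. (R \<omega>)\<^sup>2)"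
    using R2 by (intro integrableI_nonneg) (auto intro: order.strict_trans1)
  have ER2: "expectation (\<lambda>\<omega>. (R \<omega>)\<^sup>2) \<le> (m * a)\<^sup>2 + V"
    using R2 V by (subst integral_eq_nn_integral) (auto intro!: enn2real_leI)
  have "prob {\<omega> \<in> space M. \<bar>R \<omega> - expectation R\<bar> \<ge> \<epsilon>} \<le> variance R / \<epsilon>\<^sup>2"
    using intR2 \<epsilon> by (intro Chebyshev_inequality) auto
  also have "variance R = expectation (\<lambda>\<omega>. (R \<omega>)\<^sup>2) - (m * a)\<^sup>2"
    by (subst variance_eq[OF intR intR2]) (simp only: ER)
  also have "\<dots> / \<epsilon>\<^sup>2 \<le> V / \<epsilon>\<^sup>2" using ER2 by (intro divide_right_mono) auto
  finally show "emeasure M {\<omega> \<in> space M. \<epsilon> \<le> \<bar>enn2real (\<integral>\<^sup>+ x \<in> A. F x \<omega> \<partial>lborel) - m * a\<bar>} \<le> ennreal (V / \<epsilon>\<^sup>2)"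
    unfolding ER by (simp add: emeasure_eq_measure R_def T_def ennreal_leI)
qed

text \<open>Convexity of exp between 0 and w - t L with L = ln (3/2), at weight 1 / t. The constant
  3/2 leaves only 1/2 < 1 after subtracting 1, while exp (- t L) supplies the decay (2/3)^t.\<close>

lemma exp_divide_le:
  fixes w :: real
  assumes "t \<ge> 1"
  shows "exp (w / t) \<le> 3/2 + 3/2 * (2/3) powr t / t * exp w"
proof -
  define L where "L = ln (3/2 :: real)"
  have L: "exp L = 3/2" by (simp add: L_def)
  have E: "exp (w - t * L) = exp w * (2/3) powr t"
  proof -
    have "exp (w - t * L) = exp w * exp (- (t * L))" by (simp flip: exp_add)
    also have "exp (- (t * L)) = (2/3) powr t"
      by (simp add: powr_def L_def ln_div algebra_simps)
    finally show ?thesis .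
  qed
  have "exp ((1 - 1 / t) * 0 + 1 / t * (w - t * L)) \<le> (1 - 1 / t) * exp 0 + 1 / t * exp (w - t * L)"
    using assms convex_onD[OF exp_convex, of "1 / t" 0 "w - t * L"] by simp
  also have "\<dots> \<le> 1 + 1 / t * exp (w - t * L)" using assms by simp
  finally have "exp (w / t - L) \<le> 1 + 1 / t * (exp w * (2/3) powr t)"
    using assms unfolding E by (simp add: diff_divide_distrib)
  moreover have "exp (w / t - L) = exp (w / t) / (3/2)" by (simp add: exp_diff L)
  ultimately show ?thesis by (simp add: field_simps)
qed

text \<open>On the event in question \<open>exp_divide_le\<close> forces a small multiple of U, the
  integral of exp(G^2 / 4), to be at least 1. Markov's inequality then applies, since variances of
  at most 1 keep the mean of U below 2.\<close>

lemma (in prob_space) exp_square_tail: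
  fixes G :: "real \<Rightarrow> 'a \<Rightarrow> real"
  assumes G [measurable]: "(\<lambda>(x, \<omega>). G x \<omega>) \<in> borel_measurable (lborel \<Otimes>\<^sub>M M)"
    and A [measurable]: "A \<in> sets borel" and a: "emeasure lborel A \<le> 1"
    and v: "\<And>x. x \<in> A \<Longrightarrow> \<exists>v\<le>1. centered_gaussian M v (G x)"
    and l: "l > 0" "l\<^sup>2 \<ge> 8"
  shows "emeasure M {\<omega> \<in> space M. 1 < (\<integral>\<^sup>+ x \<in> A. ennreal (exp ((G x \<omega> / l)\<^sup>2) - 1) \<partial>lborel)}
    \<le> ennreal (3 * (2/3) powr (l\<^sup>2 / 4))"
proof -
  interpret pair_sigma_finite lborel M ..
  \<comment> \<open>With this t one has (y / l)^2 = (y^2 / 4) / t, and l^2 \<ge> 8 means t \<ge>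
    2.\<close>
  define t where "t = l\<^sup>2 / 4"
  have t: "t \<ge> 2" using l by (simp add: t_def)
  define c where "c = 3/2 * (2/3) powr t / t"
  have c: "c > 0" using t by (simp add: c_def)
  define U where "U \<omega> = (\<integral>\<^sup>+ x \<in> A. ennreal (exp ((G x \<omega>)\<^sup>2 / 4)) \<partial>lborel)" for \<omega>
  have [measurable]: "U \<in> borel_measurable M" unfolding U_def by measurable
  have EU: "(\<integral>\<^sup>+ \<omega>. U \<omega> \<partial>M) \<le> ennreal 2"
  proof -
    have "(\<integral>\<^sup>+ \<omega>. U \<omega> \<partial>M) = (\<integral>\<^sup>+ x. (\<integral>\<^sup>+ \<omega>. ennreal (exp ((G x \<omega>)\<^sup>2 / 4)) * indicator A x \<partial>M) \<partial>lborel)"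
      unfolding U_def by (rule Fubini') measurable
    also have "\<dots> \<le> (\<integral>\<^sup>+ x. ennreal 2 * indicator A x \<partial>lborel)"
    proof (intro nn_integral_mono)
      fix x :: real
      show "(\<integral>\<^sup>+ \<omega>. ennreal (exp ((G x \<omega>)\<^sup>2 / 4)) * indicator A x \<partial>M) \<le> ennreal 2 * indicator A x"
      proof (cases "x \<in> A")
        case True
        then obtain v where v: "v \<le> 1" "centered_gaussian M v (G x)" using v by blast
        have "(\<integral>\<^sup>+ \<omega>. ennreal (exp ((G x \<omega>)\<^sup>2 / 4)) \<partial>M) = ennreal (1 / sqrt (1 - v / 2))"
          using centered_gaussian_exp_quadratic[OF v(2), of "1/4" 0] v by simp
        also have "\<dots> \<le> ennreal 2"
        proof (rule ennreal_leI)
          have "1 / 2 \<le> sqrt (1 - v / 2)" using v by (intro real_le_rsqrt) (simp add: power2_eq_square)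
          then show "1 / sqrt (1 - v / 2) \<le> 2"
            using le_imp_inverse_le[of "1/2" "sqrt (1 - v / 2)"] by (simp add: inverse_eq_divide)
        qed
        finally show ?thesis using True by simp
      qed simp
    qed
    also have "\<dots> = ennreal 2 * emeasure lborel A" by (simp add: nn_integral_cmult_indicator)
    also have "\<dots> \<le> ennreal 2 * 1" using a by (intro mult_left_mono) auto
    finally show ?thesis by simp
  qed
  have sub: "{\<omega> \<in> space M. 1 < (\<integral>\<^sup>+ x \<in> A. ennreal (exp ((G x \<omega> / l)\<^sup>2) - 1) \<partial>lborel)}
     \<subseteq> {\<omega> \<in> space M. 1 \<le> ennreal (2 * c) * U \<omega>}"
  proof safe
    fix \<omega> assume [measurable]: "\<omega> \<in> space M"
      and gt: "1 < (\<integral>\<^sup>+ x \<in> A. ennreal (exp ((G x \<omega> / l)\<^sup>2) - 1) \<partial>lborel)"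
    have le: "exp ((y / l)\<^sup>2) - 1 \<le> 1/2 + c * exp (y\<^sup>2 / 4)" for y
      using exp_divide_le[of t "y\<^sup>2 / 4"] t l unfolding c_def by (simp add: t_def power_divide)
    have "(\<integral>\<^sup>+ x \<in> A. ennreal (exp ((G x \<omega> / l)\<^sup>2) - 1) \<partial>lborel)
      \<le> (\<integral>\<^sup>+ x. ennreal (1/2) * indicator A x + ennreal c * (ennreal (exp ((G x \<omega>)\<^sup>2 / 4)) * indicator A x) \<partial>lborel)"
    proof (intro nn_integral_mono)
      fix x
      have "ennreal (exp ((G x \<omega> / l)\<^sup>2) - 1) \<le> ennreal (1/2 + c * exp ((G x \<omega>)\<^sup>2 / 4))"
        by (intro ennreal_leI le)
      also have "\<dots> = ennreal (1/2) + ennreal c * ennreal (exp ((G x \<omega>)\<^sup>2 / 4))"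
        using c by (subst ennreal_plus) (auto simp: ennreal_mult)
      finally show "ennreal (exp ((G x \<omega> / l)\<^sup>2) - 1) * indicator A x
        \<le> ennreal (1/2) * indicator A x + ennreal c * (ennreal (exp ((G x \<omega>)\<^sup>2 / 4)) * indicator A x)"
        by (simp split: split_indicator)
    qed
    also have "\<dots> = ennreal (1/2) * emeasure lborel A + ennreal c * U \<omega>"
      unfolding U_def by (simp add: nn_integral_add nn_integral_cmult nn_integral_cmult_indicator)
    also have "\<dots> \<le> ennreal (1/2) * 1 + ennreal c * U \<omega>"
      using a by (intro add_right_mono mult_left_mono) auto
    finally have *: "1 < ennreal (1/2) + ennreal c * U \<omega>" using gt by simp
    show "1 \<le> ennreal (2 * c) * U \<omega>"
    proof (cases "U \<omega>")
      case (real u)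
      then have "ennreal (1/2) + ennreal c * U \<omega> = ennreal (1/2 + c * u)"
        using c by (subst ennreal_plus) (auto simp: ennreal_mult)
      with * have "ennreal 1 < ennreal (1/2 + c * u)" by (simp only: ennreal_1)
      then have "1 < 1/2 + c * u" by (subst (asm) ennreal_less_iff) auto
      then have "1 \<le> 2 * c * u" by simp
      then show ?thesis using real c by (simp flip: ennreal_mult)
    next
      case top
      then show ?thesis using c by (simp add: ennreal_mult_top)
    qed
  qed
  have "emeasure M {\<omega> \<in> space M. 1 < (\<integral>\<^sup>+ x \<in> A. ennreal (exp ((G x \<omega> / l)\<^sup>2) - 1) \<partial>lborel)}
    \<le> emeasure M {\<omega> \<in> space M. 1 \<le> ennreal (2 * c) * U \<omega>}"
    using sub by (intro emeasure_mono) auto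
  also have "\<dots> \<le> ennreal (2 * c) * (\<integral>\<^sup>+ \<omega>. U \<omega> * indicator (space M) \<omega> \<partial>M)"
    by (rule nn_integral_Markov_inequality) auto
  also have "(\<integral>\<^sup>+ \<omega>. U \<omega> * indicator (space M) \<omega> \<partial>M) = (\<integral>\<^sup>+ \<omega>. U \<omega> \<partial>M)"
    by (intro nn_integral_cong) auto
  also have "ennreal (2 * c) * (\<integral>\<^sup>+ \<omega>. U \<omega> \<partial>M) \<le> ennreal (2 * c) * ennreal 2"
    by (intro mult_left_mono EU) auto
  also have "\<dots> = ennreal (4 * c)" using c by (subst ennreal_mult[symmetric]) auto
  also have "\<dots> \<le> ennreal (3 * (2/3) powr (l\<^sup>2 / 4))"
  proof (rule ennreal_leI)
    have "4 * c = 6 / t * (2/3) powr t" by (simp add: c_def)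
    also have "\<dots> \<le> 3 * (2/3) powr t" using t by (intro mult_right_mono) (auto simp: field_simps)
    finally show "4 * c \<le> 3 * (2/3) powr (l\<^sup>2 / 4)" by (simp add: t_def)
  qed
  finally show ?thesis .
qed

text \<open>The union bound sums the factor r^n; what remains is a Gaussian tail for the supremum,
  which is integrated over the layers between consecutive integer values of its square.\<close>

lemma (in prob_space) sup_square_exponential:
  fixes A :: "nat \<Rightarrow> 'a \<Rightarrow> ennreal"
  assumes [measurable]: "\<And>n. A n \<in> borel_measurable M"
    and tail: "\<And>n l. l \<ge> l0 \<Longrightarrow> emeasure M {\<omega> \<in> space M. ennreal l < A n \<omega>} \<le> ennreal (C * r ^ n * q powr (l\<^sup>2))"
    and C: "C \<ge> 0" and r: "0 \<le> r" "r < 1" and q: "0 < q" "q < 1"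
  shows "AE \<omega> in M. (SUP n. A n \<omega>) < \<infinity>"
    and "\<exists>\<epsilon>>0. (\<integral>\<^sup>+ \<omega>. ennreal (exp (\<epsilon> * (enn2real (SUP n. A n \<omega>))\<^sup>2)) \<partial>M) < \<infinity>"
proof -
  define S where "S \<omega> = (SUP n. A n \<omega>)" for \<omega>
  have [measurable]: "S \<in> borel_measurable M" unfolding S_def by measurable
  define D where "D = C / (1 - r)"
  have D: "D \<ge> 0" using C r by (simp add: D_def)
  have S_tail: "emeasure M {\<omega> \<in> space M. ennreal l < S \<omega>} \<le> ennreal (D * q powr (l\<^sup>2))" if "l \<ge> l0" for l
  proof -
    have "{\<omega> \<in> space M. ennreal l < S \<omega>} = (\<Union>n. {\<omega> \<in> space M. ennreal l < A n \<omega>})"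
      unfolding S_def less_SUP_iff by auto
    then have "emeasure M {\<omega> \<in> space M. ennreal l < S \<omega>} \<le> (\<Sum>n. emeasure M {\<omega> \<in> space M. ennreal l < A n \<omega>})"
      by (simp add: emeasure_subadditive_countably image_subset_iff)
    also have "\<dots> \<le> (\<Sum>n. ennreal (C * r ^ n * q powr (l\<^sup>2)))" using that by (intro suminf_le tail) auto
    also have "\<dots> = ennreal (D * q powr (l\<^sup>2))"
    proof (rule suminf_ennreal_eq)
      have "(\<lambda>n. C * q powr (l\<^sup>2) * r ^ n) sums (C * q powr (l\<^sup>2) * (1 / (1 - r)))"
        using r by (intro sums_mult geometric_sums) auto
      then show "(\<lambda>n. C * r ^ n * q powr (l\<^sup>2)) sums (D * q powr (l\<^sup>2))" by (simp add: D_def mult_ac)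
    qed (use C r in auto)
    finally show ?thesis .
  qed
  \<comment> \<open>The tail bound is available from l0 on only; all thresholds sqrt (K + j) lie
    beyond it, also when l0 is negative.\<close>
  define K where "K = nat \<lceil>(max 0 l0)\<^sup>2\<rceil>"
  have K: "sqrt (real (K + j)) \<ge> l0" for j
  proof -
    have "(max 0 l0)\<^sup>2 \<le> real (K + j)" unfolding K_def by linarith
    then have "max 0 l0 \<le> sqrt (real (K + j))" by (rule real_le_rsqrt)
    then show ?thesis by simp
  qed
  have Sk: "emeasure M {\<omega> \<in> space M. ennreal (sqrt (real (K + j))) < S \<omega>} \<le> ennreal (D * q ^ (K + j))" for j
    using S_tail[OF K[of j]] powr_realpow[OF q(1), of "K + j"] by simp
  have S_fin: "AE \<omega> in M. S \<omega> < \<infinity>"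
  proof -
    have "emeasure M {\<omega> \<in> space M. S \<omega> = \<infinity>} \<le> ennreal (D * q ^ (K + j))" for j
      by (rule order_trans[OF emeasure_mono Sk[of j]]) auto
    moreover have "(\<lambda>j. ennreal (D * q ^ (K + j))) \<longlonglongrightarrow> ennreal (D * 0)"
      using q by (intro tendsto_ennrealI tendsto_intros LIMSEQ_ignore_initial_segment[of _ _ K, simplified add.commute[of _ K]])
        (auto intro!: LIMSEQ_realpow_zero)
    ultimately have "emeasure M {\<omega> \<in> space M. S \<omega> = \<infinity>} \<le> ennreal (D * 0)"
      by (intro LIMSEQ_le_const[of "\<lambda>j. ennreal (D * q ^ (K + j))"]) auto
    then have "{\<omega> \<in> space M. S \<omega> = \<infinity>} \<in> null_sets M" by (auto simp: null_sets_def)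
    then show ?thesis by (rule AE_I') (auto simp flip: top.not_eq_extremum)
  qed
  then show "AE \<omega> in M. (SUP n. A n \<omega>) < \<infinity>" by (simp add: S_def)
  \<comment> \<open>Half the exponential rate of the tail, so that the layers are bounded by a
    geometric series with ratio exp \<epsilon> * q = sqrt q < 1.\<close>
  define \<epsilon> where "\<epsilon> = - ln q / 2"
  have \<epsilon>: "\<epsilon> > 0" using q by (simp add: \<epsilon>_def)
  have eq: "exp \<epsilon> * q = sqrt q"
  proof -
    have "exp \<epsilon> * q = exp (\<epsilon> + ln q)" using q by (simp add: exp_add)
    also have "\<dots> = exp (ln q / 2)" by (simp add: \<epsilon>_def)
    also have "\<dots> = sqrt q" using q by (simp add: powr_def powr_half_sqrt[symmetric])
    finally show ?thesis .
  qed
  let ?f = "\<lambda>j \<omega>. ennreal (exp (\<epsilon> * real (K + j + 1))) * indicator {\<omega> \<in> space M. ennreal (sqrt (real (K + j))) < S \<omega>} \<omega>"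
  have le_suminf: "f j \<le> (\<Sum>j. f j)" for f :: "nat \<Rightarrow> ennreal" and j
    using sum_le_suminf[of f "{j}"] by simp
  have pw: "ennreal (exp (\<epsilon> * (enn2real (S \<omega>))\<^sup>2)) \<le> ennreal (exp (\<epsilon> * real K)) + (\<Sum>j. ?f j \<omega>)"
    if "\<omega> \<in> space M" "S \<omega> < \<infinity>" for \<omega>
  proof -
    define R where "R = enn2real (S \<omega>)"
    have R: "S \<omega> = ennreal R" "R \<ge> 0" using that by (auto simp: R_def)
    show ?thesis
    proof (cases "R\<^sup>2 \<le> real K")
      case True
      then have "exp (\<epsilon> * R\<^sup>2) \<le> exp (\<epsilon> * real K)" using \<epsilon> by simp
      then show ?thesis unfolding R_def[symmetric] by (intro add_increasing2) (auto intro: ennreal_leI)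
    next
      case False
      \<comment> \<open>This is the layer k < R^2 \<le> k + 1, strict on the left because the events
        in \<open>Sk\<close> are given by strict inequalities.\<close>
      define k where "k = nat \<lceil>R\<^sup>2\<rceil> - 1"
      have "\<lceil>R\<^sup>2\<rceil> \<ge> 1 + int K" using False by linarith
      then have k: "k \<ge> K" "real k < R\<^sup>2" "R\<^sup>2 \<le> real k + 1" unfolding k_def by linarith+
      then obtain j where j: "k = K + j" by (metis le_add_diff_inverse)
      have "sqrt (real k) < R" using k(2) R by (simp add: real_sqrt_less_iff real_less_lsqrt)
      then have "ennreal (exp (\<epsilon> * (k + 1))) = ?f j \<omega>"
        using that R by (simp add: j ennreal_less_iff)
      have "exp (\<epsilon> * R\<^sup>2) \<le> exp (\<epsilon> * (k + 1))" using \<epsilon> k by simp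
      then have "ennreal (exp (\<epsilon> * R\<^sup>2)) \<le> ?f j \<omega>"
        unfolding \<open>ennreal (exp (\<epsilon> * (k + 1))) = ?f j \<omega>\<close>[symmetric] by (rule ennreal_leI)
      also have "\<dots> \<le> (\<Sum>j. ?f j \<omega>)" by (rule le_suminf)
      finally show ?thesis unfolding R_def[symmetric] by (intro add_increasing) auto
    qed
  qed
  have "(\<integral>\<^sup>+ \<omega>. ennreal (exp (\<epsilon> * (enn2real (S \<omega>))\<^sup>2)) \<partial>M)
    \<le> (\<integral>\<^sup>+ \<omega>. ennreal (exp (\<epsilon> * real K)) + (\<Sum>j. ?f j \<omega>) \<partial>M)"
  proof (rule nn_integral_mono_AE)
    show "AE \<omega> in M. ennreal (exp (\<epsilon> * (enn2real (S \<omega>))\<^sup>2)) \<le> ennreal (exp (\<epsilon> * real K)) + (\<Sum>j. ?f j \<omega>)"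
      using S_fin AE_space by eventually_elim (rule pw)
  qed
  also have "\<dots> = ennreal (exp (\<epsilon> * real K)) + (\<Sum>j. \<integral>\<^sup>+ \<omega>. ?f j \<omega> \<partial>M)"
    by (simp add: nn_integral_add nn_integral_suminf emeasure_space_1)
  also have "(\<Sum>j. \<integral>\<^sup>+ \<omega>. ?f j \<omega> \<partial>M) \<le> (\<Sum>j. ennreal (D * exp \<epsilon> * sqrt q ^ K * sqrt q ^ j))"
  proof (intro suminf_le)
    fix j
    have "(\<integral>\<^sup>+ \<omega>. ?f j \<omega> \<partial>M) = ennreal (exp (\<epsilon> * real (K + j + 1))) * emeasure M {\<omega> \<in> space M. ennreal (sqrt (real (K + j))) < S \<omega>}"
      by (rule nn_integral_cmult_indicator) measurable
    also have "\<dots> \<le> ennreal (exp (\<epsilon> * real (K + j + 1))) * ennreal (D * q ^ (K + j))"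
      by (intro mult_left_mono Sk) auto
    also have "\<dots> = ennreal (exp (\<epsilon> * real (K + j + 1)) * (D * q ^ (K + j)))"
      using D q by (simp add: ennreal_mult)
    also have "exp (\<epsilon> * real (K + j + 1)) * (D * q ^ (K + j)) = D * exp \<epsilon> * (exp \<epsilon> * q) ^ (K + j)"
      by (simp add: power_mult_distrib exp_of_nat_mult[symmetric] algebra_simps flip: exp_add)
    also have "\<dots> = D * exp \<epsilon> * sqrt q ^ K * sqrt q ^ j" unfolding eq by (simp add: power_add)
    finally show "(\<integral>\<^sup>+ \<omega>. ?f j \<omega> \<partial>M) \<le> ennreal (D * exp \<epsilon> * sqrt q ^ K * sqrt q ^ j)" .
  qed auto
  also have "\<dots> = ennreal (D * exp \<epsilon> * sqrt q ^ K * (1 / (1 - sqrt q)))"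
    using q D by (intro suminf_ennreal_eq sums_mult geometric_sums) auto
  finally have "(\<integral>\<^sup>+ \<omega>. ennreal (exp (\<epsilon> * (enn2real (S \<omega>))\<^sup>2)) \<partial>M)
      \<le> ennreal (exp (\<epsilon> * real K)) + ennreal (D * exp \<epsilon> * sqrt q ^ K * (1 / (1 - sqrt q)))"
    by (simp add: add_left_mono)
  also have "\<dots> < \<infinity>" by simp
  finally show "\<exists>\<epsilon>>0. (\<integral>\<^sup>+ \<omega>. ennreal (exp (\<epsilon> * (enn2real (SUP n. A n \<omega>))\<^sup>2)) \<partial>M) < \<infinity>"
    using \<epsilon> unfolding S_def by blast
qed

text \<open>The process lives on the whole line and vanishes off the unit interval, so that shifted
  paths are Borel functions on the line, as the translation arguments require.\<close>

locale unit_fbm = prob_space +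
  fixes Z :: "real \<Rightarrow> 'a \<Rightarrow> real" and \<alpha> :: real
  assumes Z_measurable [measurable]: "(\<lambda>(t, \<omega>). Z t \<omega>) \<in> borel_measurable (lborel \<Otimes>\<^sub>M M)"
    and Z_outside: "\<And>t \<omega>. t \<notin> {0..1} \<Longrightarrow> Z t \<omega> = 0"
    and Z_fbm: "standard_fbm M {0..1} \<alpha> Z"
    and alpha: "0 < \<alpha>" "\<alpha> < 1"
begin

lemma Z_rv [measurable]: "Z t \<in> borel_measurable M"
proof -
  have "(\<lambda>\<omega>. (\<lambda>(t, \<omega>). Z t \<omega>) (t, \<omega>)) \<in> borel_measurable M" by measurable
  then show ?thesis by simp
qed

lemma Z_path [measurable]: "\<omega> \<in> space M \<Longrightarrow> (\<lambda>t. Z t \<omega>) \<in> borel_measurable borel"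
proof -
  assume [measurable]: "\<omega> \<in> space M"
  have "(\<lambda>t. (\<lambda>(t, \<omega>). Z t \<omega>) (t, \<omega>)) \<in> borel_measurable lborel" by measurable
  then show ?thesis by simp
qed

lemma Z_gaussian: "t \<in> {0..1} \<Longrightarrow> centered_gaussian M (t powr (2 * \<alpha>)) (Z t)"
proof -
  assume t: "t \<in> {0..1}"
  have gp: "gaussian_process M {0..1} Z" using Z_fbm by (simp add: standard_fbm_def)
  have "gaussian_rv M (\<lambda>\<omega>. \<Sum>i<(1::nat). 1 * Z t \<omega>)"
    using gp[unfolded gaussian_process_def, rule_format, of 1 "\<lambda>_. t" "\<lambda>_. 1"] t by simp
  then have "gaussian_rv M (Z t)" by simp
  moreover have "expectation (Z t) = 0"
    using Z_fbm t unfolding standard_fbm_def by blast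
  moreover have "expectation (\<lambda>\<omega>. Z t \<omega> * Z t \<omega>) = (t powr (2 * \<alpha>) + t powr (2 * \<alpha>) - \<bar>t - t\<bar> powr (2 * \<alpha>)) / 2"
    using Z_fbm t unfolding standard_fbm_def by blast
  then have "expectation (\<lambda>\<omega>. (Z t \<omega>)\<^sup>2) = t powr (2 * \<alpha>)" by (simp add: power2_eq_square)
  ultimately show ?thesis using gaussian_rv_imp_centered_gaussian by metis
qed

lemma Z_product_integrable:
  assumes "s \<in> {0..1}" "t \<in> {0..1}"
  shows "integrable M (\<lambda>\<omega>. Z s \<omega> * Z t \<omega>)"
proof (rule Bochner_Integration.integrable_bound)
  show "integrable M (\<lambda>\<omega>. (Z s \<omega>)\<^sup>2 + (Z t \<omega>)\<^sup>2)"
    by (intro Bochner_Integration.integrable_add centered_gaussian_moments(3)[OF Z_gaussian] assms)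
  have "\<bar>a * b\<bar> \<le> a\<^sup>2 + b\<^sup>2" for a b :: real
  proof -
    have "2 * \<bar>a * b\<bar> \<le> a\<^sup>2 + b\<^sup>2"
      using sum_squares_bound[of "\<bar>a\<bar>" "\<bar>b\<bar>"] by (simp add: abs_mult)
    then show ?thesis using abs_ge_zero[of "a * b"] by linarith
  qed
  then show "AE \<omega> in M. norm (Z s \<omega> * Z t \<omega>) \<le> norm ((Z s \<omega>)\<^sup>2 + (Z t \<omega>)\<^sup>2)" by auto
qed measurable

definition Y :: "real \<Rightarrow> real \<Rightarrow> 'a \<Rightarrow> real" where
  "Y h x \<omega> = (Z (x + h) \<omega> - Z x \<omega>) / h powr \<alpha>"

lemma Y_measurable [measurable]: "(\<lambda>(x, \<omega>). Y h x \<omega>) \<in> borel_measurable (lborel \<Otimes>\<^sub>M M)"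
proof -
  have "(\<lambda>p. (\<lambda>(t, \<omega>). Z t \<omega>) (fst p + h, snd p)) \<in> borel_measurable (lborel \<Otimes>\<^sub>M M)"
    by measurable
  then show ?thesis unfolding Y_def by (simp add: split_beta')
qed

text \<open>Joint normality of two increments is expressed through all their linear combinations;
  the quadratic form in a and b is the one that \<open>pair_fourth_moment\<close> and
  \<open>pair_exp_square\<close> take as hypothesis.\<close>

lemma Y_pair_gaussian:
  assumes h: "0 < h" "h < 1" and x: "x \<in> {0..1 - h}" and y: "y \<in> {0..1 - h}"
  shows "centered_gaussian M (a\<^sup>2 + 2 * fbm_corr \<alpha> h (y - x) * a * b + b\<^sup>2) (\<lambda>\<omega>. a * Y h x \<omega> + b * Y h y \<omega>)"
proof -
  define c where "c = 1 / h powr \<alpha>"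
  define R where "R s t = (s powr (2 * \<alpha>) + t powr (2 * \<alpha>) - \<bar>t - s\<bar> powr (2 * \<alpha>)) / 2" for s t
  have R: "expectation (\<lambda>\<omega>. Z s \<omega> * Z t \<omega>) = R s t" if "s \<in> {0..1}" "t \<in> {0..1}" for s t
    using Z_fbm that unfolding standard_fbm_def R_def by auto
  have in01: "x \<in> {0..1}" "x + h \<in> {0..1}" "y \<in> {0..1}" "y + h \<in> {0..1}" using h x y by auto
  \<comment> \<open>The combination is a sum over four times with weights a, - a, b, - b up to the
    factor c. Repeated times are allowed, so x = y is covered.\<close>
  define tt where "tt i = (if i = 0 then x + h else if i = 1 then x else if i = 2 then y + h else y)" for i :: nat
  define aa where "aa i = (if i = 0 then a * c else if i = 1 then - a * c else if i = 2 then b * c else - b * c)" for i :: nat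
  have "gaussian_rv M (\<lambda>\<omega>. \<Sum>i<4. aa i * Z (tt i) \<omega>)"
  proof -
    have "\<forall>i<4. tt i \<in> {0..1}" using in01 by (auto simp: tt_def)
    then show ?thesis using Z_fbm unfolding standard_fbm_def gaussian_process_def by blast
  qed
  moreover have "(\<Sum>i<4. aa i * Z (tt i) \<omega>) = a * Y h x \<omega> + b * Y h y \<omega>" for \<omega>
    by (simp add: aa_def tt_def numeral_eq_Suc Y_def c_def algebra_simps diff_divide_distrib)
  ultimately have g: "gaussian_rv M (\<lambda>\<omega>. a * Y h x \<omega> + b * Y h y \<omega>)" by simp
  have int: "integrable M (Z s)" "expectation (Z s) = 0" if "s \<in> {0..1}" for s
    using centered_gaussian_moments(1,2)[OF Z_gaussian[OF that]] by auto
  have e: "expectation (\<lambda>\<omega>. a * Y h x \<omega> + b * Y h y \<omega>) = 0"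
    using in01 by (simp add: Y_def int)
  have "expectation (\<lambda>\<omega>. (a * Y h x \<omega> + b * Y h y \<omega>)\<^sup>2)
    = expectation (\<lambda>\<omega>. (a * c)\<^sup>2 * (Z (x + h) \<omega> * Z (x + h) \<omega> - 2 * (Z (x + h) \<omega> * Z x \<omega>) + Z x \<omega> * Z x \<omega>)
       + 2 * (a * c) * (b * c) * (Z (x + h) \<omega> * Z (y + h) \<omega> - Z (x + h) \<omega> * Z y \<omega> - Z x \<omega> * Z (y + h) \<omega> + Z x \<omega> * Z y \<omega>)
       + (b * c)\<^sup>2 * (Z (y + h) \<omega> * Z (y + h) \<omega> - 2 * (Z (y + h) \<omega> * Z y \<omega>) + Z y \<omega> * Z y \<omega>))"
  proof (intro Bochner_Integration.integral_cong refl)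
    fix \<omega>
    have Yc: "Y h u \<omega> = c * (Z (u + h) \<omega> - Z u \<omega>)" for u by (simp add: Y_def c_def)
    show "(a * Y h x \<omega> + b * Y h y \<omega>)\<^sup>2 = (a * c)\<^sup>2 * (Z (x + h) \<omega> * Z (x + h) \<omega> - 2 * (Z (x + h) \<omega> * Z x \<omega>) + Z x \<omega> * Z x \<omega>)
       + 2 * (a * c) * (b * c) * (Z (x + h) \<omega> * Z (y + h) \<omega> - Z (x + h) \<omega> * Z y \<omega> - Z x \<omega> * Z (y + h) \<omega> + Z x \<omega> * Z y \<omega>)
       + (b * c)\<^sup>2 * (Z (y + h) \<omega> * Z (y + h) \<omega> - 2 * (Z (y + h) \<omega> * Z y \<omega>) + Z y \<omega> * Z y \<omega>)"
      unfolding Yc by (simp add: power2_eq_square algebra_simps)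
  qed
  also have "\<dots> = (a * c)\<^sup>2 * (R (x + h) (x + h) - 2 * R (x + h) x + R x x)
       + 2 * (a * c) * (b * c) * (R (x + h) (y + h) - R (x + h) y - R x (y + h) + R x y)
       + (b * c)\<^sup>2 * (R (y + h) (y + h) - 2 * R (y + h) y + R y y)"
    using in01 by (simp add: Z_product_integrable R)
  also have "R (x + h) (x + h) - 2 * R (x + h) x + R x x = h powr (2 * \<alpha>)"
    using h x by (simp add: R_def add_divide_distrib diff_divide_distrib)
  also have "R (y + h) (y + h) - 2 * R (y + h) y + R y y = h powr (2 * \<alpha>)"
    using h y by (simp add: R_def add_divide_distrib diff_divide_distrib)
  also have "R (x + h) (y + h) - R (x + h) y - R x (y + h) + R x y = fbm_corr \<alpha> h (y - x) * h powr (2 * \<alpha>)"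
  proof -
    have "\<bar>y - x - h\<bar> = \<bar>y - (x + h)\<bar>" "\<bar>y - x + h\<bar> = \<bar>y + h - x\<bar>" "\<bar>y + h - (x + h)\<bar> = \<bar>y - x\<bar>"
      by (auto simp: algebra_simps)
    then show ?thesis using h by (simp add: fbm_corr_def R_def field_simps)
  qed
  also have "(a * c)\<^sup>2 * h powr (2 * \<alpha>) + 2 * (a * c) * (b * c) * (fbm_corr \<alpha> h (y - x) * h powr (2 * \<alpha>)) + (b * c)\<^sup>2 * h powr (2 * \<alpha>)
    = (c\<^sup>2 * h powr (2 * \<alpha>)) * (a\<^sup>2 + 2 * fbm_corr \<alpha> h (y - x) * a * b + b\<^sup>2)"
    by (simp add: power2_eq_square algebra_simps)
  also have "c\<^sup>2 * h powr (2 * \<alpha>) = 1"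
    using h by (simp add: c_def power_divide powr_power mult.commute)
  finally show ?thesis using gaussian_rv_imp_centered_gaussian[OF g e] by simp
qed

text \<open>The variances 2 + 2 \<rho> and 2 - 2 \<rho> of the sum and the difference of two
  normalised increments are non-negative. The restriction on d lets both increments fit into the
  unit interval.\<close>

lemma fbm_corr_le_1:
  assumes h: "0 < h" "h < 1" and "\<bar>d\<bar> \<le> 1 - h"
  shows "\<bar>fbm_corr \<alpha> h d\<bar> \<le> 1"
proof -
  define x where "x = max 0 (- d)"
  define y where "y = max 0 d"
  have d: "d = y - x" "x \<in> {0..1 - h}" "y \<in> {0..1 - h}" using assms by (auto simp: x_def y_def)
  show ?thesis
    using centered_gaussian_nonneg[OF Y_pair_gaussian[OF h d(2,3), of 1 1]]
      centered_gaussian_nonneg[OF Y_pair_gaussian[OF h d(2,3), of 1 "-1"]] d by auto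
qed

lemma Y_gaussian: "0 < h \<Longrightarrow> h < 1 \<Longrightarrow> x \<in> {0..1 - h} \<Longrightarrow> centered_gaussian M 1 (Y h x)"
  using Y_pair_gaussian[of h x x 1 0] by simp

end

section \<open>Exponential Young functions and measurability of the norms\<close>

lemma exp_type_upper:
  assumes N: "young_function N" and \<tau>: "\<And>x. x \<ge> \<tau> \<Longrightarrow> N x = exp (x\<^sup>2) - 1" "\<tau> \<ge> 0" and x: "x \<ge> 0"
  shows "N x \<le> N \<tau> + (exp (x\<^sup>2) - 1)"
proof (cases "x \<le> \<tau>")
  case True
  then have "N x \<le> N \<tau>" using x by (intro young_mono[OF N])
  then show ?thesis by (simp add: add_increasing2)
next
  case False
  then show ?thesis using \<tau> young_nonneg[OF N \<tau>(2)] by simp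
qed

text \<open>Below \<tau> monotonicity gives only N x \<le> N \<tau>. On a space of mass at most 1
  this adds at most N \<tau> to the modular, and \<open>luxemburg_norm_le_scaled\<close> turns the
  resulting bound N \<tau> + 1 into a factor.\<close>

lemma luxemburg_norm_le_exp:
  assumes N: "young_function N" and \<tau>: "\<And>x. x \<ge> \<tau> \<Longrightarrow> N x = exp (x\<^sup>2) - 1" "\<tau> \<ge> 0"
    and f [measurable]: "f \<in> borel_measurable D" and D: "emeasure D (space D) \<le> 1" and l: "l > 0"
    and le: "(\<integral>\<^sup>+ x. ennreal (exp ((f x / l)\<^sup>2) - 1) \<partial>D) \<le> 1"
  shows "luxemburg_norm N D f \<le> ennreal ((N \<tau> + 1) * l)"
proof (rule luxemburg_norm_le_scaled[OF N f l])
  have \<tau>0: "N \<tau> \<ge> 0" by (rule young_nonneg[OF N \<tau>(2)])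
  then show "N \<tau> + 1 \<ge> 1" by simp
  have "luxemburg_modular N D f l \<le> (\<integral>\<^sup>+ x. ennreal (N \<tau>) + ennreal (exp ((f x / l)\<^sup>2) - 1) \<partial>D)"
    unfolding luxemburg_modular_def
  proof (intro nn_integral_mono)
    fix x
    have "N (\<bar>f x\<bar> / l) \<le> N \<tau> + (exp ((\<bar>f x\<bar> / l)\<^sup>2) - 1)"
      using l by (intro exp_type_upper[OF N \<tau>]) auto
    also have "(\<bar>f x\<bar> / l)\<^sup>2 = (f x / l)\<^sup>2" by (simp add: power_divide)
    finally have "ennreal (N (\<bar>f x\<bar> / l)) \<le> ennreal (N \<tau> + (exp ((f x / l)\<^sup>2) - 1))"
      by (rule ennreal_leI)
    also have "\<dots> = ennreal (N \<tau>) + ennreal (exp ((f x / l)\<^sup>2) - 1)"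
      using \<tau>0 by (intro ennreal_plus) auto
    finally show "ennreal (N (\<bar>f x\<bar> / l)) \<le> ennreal (N \<tau>) + ennreal (exp ((f x / l)\<^sup>2) - 1)" .
  qed
  also have "\<dots> = ennreal (N \<tau>) * emeasure D (space D) + (\<integral>\<^sup>+ x. ennreal (exp ((f x / l)\<^sup>2) - 1) \<partial>D)"
    by (subst nn_integral_add) auto
  also have "\<dots> \<le> ennreal (N \<tau>) * 1 + 1"
    by (intro add_mono mult_left_mono D le) auto
  also have "\<dots> = ennreal (N \<tau> + 1)" using \<tau>0 by (simp add: ennreal_plus)
  finally show "luxemburg_modular N D f l \<le> ennreal (N \<tau> + 1)" .
qed

lemma emeasure_lborel_on_le:
  assumes "a \<ge> 0" "b \<le> 1" shows "emeasure (lborel_on {a<..<b}) (space (lborel_on {a<..<b})) \<le> 1"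
proof -
  have "emeasure (lborel_on {a<..<b}) {a<..<b} = emeasure lborel {a<..<b}"
    unfolding lborel_on_def by (rule emeasure_restrict_space) auto
  also have "\<dots> \<le> 1" using assms by (cases "a \<le> b") auto
  finally show ?thesis by simp
qed

text \<open>As the modular decreases in l, the norm is below y if and only if some rational l below
  y is admissible; this leaves a countable union of measurable events.\<close>

lemma luxemburg_norm_measurable:
  fixes F :: "real \<Rightarrow> 'a \<Rightarrow> real"
  assumes N: "young_function N" and F [measurable]: "(\<lambda>(x, \<omega>). F x \<omega>) \<in> borel_measurable (lborel \<Otimes>\<^sub>M M)"
    and A [measurable]: "A \<in> sets borel"
  shows "(\<lambda>\<omega>. luxemburg_norm N (lborel_on A) (\<lambda>x. F x \<omega>)) \<in> borel_measurable M"
proof (rule borel_measurableI_less)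
  fix y :: ennreal
  let ?L = "\<lambda>\<omega>. luxemburg_norm N (lborel_on A) (\<lambda>x. F x \<omega>)"
  let ?m = "\<lambda>l \<omega>. luxemburg_modular N (lborel_on A) (\<lambda>x. F x \<omega>) l"
  define Q where "Q = {l \<in> \<rat>. l > 0 \<and> ennreal l < y}"
  have [measurable]: "?m l \<in> borel_measurable M" if l: "l > 0" for l
  proof -
    have "(\<lambda>p. N (\<bar>(\<lambda>(x, \<omega>). F x \<omega>) (snd p, fst p)\<bar> / l)) \<in> borel_measurable (M \<Otimes>\<^sub>M lborel)"
      by (intro young_measurable[OF N _ l]) measurable
    then have [measurable]: "(\<lambda>(\<omega>, x). N (\<bar>F x \<omega>\<bar> / l)) \<in> borel_measurable (M \<Otimes>\<^sub>M lborel)"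
      by (simp add: split_beta')
    show ?thesis unfolding luxemburg_modular_def
      by (simp add: nn_integral_lborel_on)
  qed
  have "{\<omega> \<in> space M. ?L \<omega> < y} = (\<Union>l\<in>Q. {\<omega> \<in> space M. ?m l \<omega> \<le> 1})"
  proof (intro equalityI subsetI)
    fix \<omega> assume "\<omega> \<in> {\<omega> \<in> space M. ?L \<omega> < y}"
    then obtain l' where l': "l' > 0" "?m l' \<omega> \<le> 1" "ennreal l' < y" and sp: "\<omega> \<in> space M"
      unfolding luxemburg_norm_def Inf_less_iff luxemburg_modular_def by auto
    \<comment> \<open>A rational is to be found strictly above l' but still below y; the auxiliary
      real u treats finite and infinite y alike.\<close>
    obtain u where u: "l' < u" "ennreal u < y \<or> y = \<infinity>"
    proof (cases y)
      case (real c)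
      then have "l' < c" using l' by (simp add: ennreal_less_iff)
      then obtain u where "l' < u" "u < c" using dense by blast
      then show ?thesis using that[of u] real l' by (simp add: ennreal_less_iff)
    next
      case top
      then show ?thesis using that[of "l' + 1"] by simp
    qed
    obtain q where q: "q \<in> \<rat>" "l' < q" "q < u" using Rats_dense_in_real[OF u(1)] by blast
    have "ennreal q < y"
    proof (cases "y = \<infinity>")
      case False
      have "ennreal q < ennreal u" using q l' by (simp add: ennreal_less_iff)
      then show ?thesis using u False by auto
    qed simp
    moreover have "?m q \<omega> \<le> 1"
      using luxemburg_modular_antimono[OF N l'(1), of q] q l'(2) by (meson order_trans less_imp_le)
    ultimately show "\<omega> \<in> (\<Union>l\<in>Q. {\<omega> \<in> space M. ?m l \<omega> \<le> 1})"
      using q l' sp by (auto simp: Q_def)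
  next
    fix \<omega> assume "\<omega> \<in> (\<Union>l\<in>Q. {\<omega> \<in> space M. ?m l \<omega> \<le> 1})"
    then obtain l where l: "l \<in> Q" "?m l \<omega> \<le> 1" "\<omega> \<in> space M" by blast
    then have "?L \<omega> \<le> ennreal l" by (intro luxemburg_norm_leI) (auto simp: Q_def)
    then show "\<omega> \<in> {\<omega> \<in> space M. ?L \<omega> < y}" using l by (auto simp: Q_def)
  qed
  moreover have "countable Q" unfolding Q_def using countable_rat by (rule countable_subset[rotated]) auto
  moreover have "{\<omega> \<in> space M. ?m l \<omega> \<le> 1} \<in> sets M" if "l \<in> Q" for l
  proof -
    have "l > 0" using that by (simp add: Q_def)
    then show ?thesis by measurable
  qed
  ultimately show "{\<omega> \<in> space M. ?L \<omega> < y} \<in> sets M" by auto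
qed

text \<open>A countable supremum is measurable in \<omega>, which is what the seminorm is needed for
  as a random variable. Lower semicontinuity in the shift shows that the dyadic shifts already
  determine it.\<close>

lemma besov_orlicz_seminorm_dyadics:
  fixes f :: "real \<Rightarrow> real"
  assumes N: "young_function N" and f: "f \<in> borel_measurable borel" "\<And>x. x \<notin> {0..1} \<Longrightarrow> f x = 0" and s: "s > 0"
  shows "besov_orlicz_seminorm N s {0<..<1} f = (SUP h\<in>unit_dyadics. ennreal (h powr (- s)) * increment_norm N f h)"
    (is "_ = ?S")
  unfolding besov_orlicz_seminorm_unit[OF N f(1) s]
proof (rule antisym)
  show "?S \<le> (SUP h\<in>{0<..<1}. ennreal (h powr (- s)) * increment_norm N f h)"
    using dyadics_bounds by (intro SUP_subset_mono) auto
  show "(SUP h\<in>{0<..<1}. ennreal (h powr (- s)) * increment_norm N f h) \<le> ?S"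
  proof (cases ?S)
    case (real L)
    have inv: "ennreal (h powr s) * ennreal (h powr (- s)) = 1" if "h > 0" for h
    proof -
      have "h powr s * h powr (- s) = 1" using that by (simp flip: powr_add)
      then show ?thesis by (subst ennreal_mult[symmetric]) auto
    qed
    have "increment_norm N f h \<le> ennreal (L * h powr s)" if "h \<in> unit_dyadics" for h
    proof -
      have "increment_norm N f h = (ennreal (h powr s) * ennreal (h powr (- s))) * increment_norm N f h"
        using inv[of h] dyadics_bounds[OF that] by simp
      also have "\<dots> = ennreal (h powr s) * (ennreal (h powr (- s)) * increment_norm N f h)"
        by (rule mult.assoc)
      also have "\<dots> \<le> ennreal (h powr s) * ?S" using that by (intro mult_left_mono SUP_upper) auto
      also have "\<dots> = ennreal (h powr s) * ennreal L" by (simp only: real(2))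
      also have "\<dots> = ennreal (L * h powr s)"
        using real(1) by (subst ennreal_mult[symmetric]) (auto simp: mult.commute)
      finally show ?thesis .
    qed
    note dyadic_le = this
    have le: "increment_norm N f h \<le> ennreal (L * h powr s)" if "0 < h" "h < 1" for h
      by (rule increment_norm_le_of_dyadics[OF N f dyadic_le]) (use real(1) that in auto)
    show ?thesis unfolding real(2)
    proof (rule SUP_least)
      fix h :: real assume h: "h \<in> {0<..<1}"
      have "ennreal (h powr (- s)) * increment_norm N f h \<le> ennreal (h powr (- s)) * ennreal (L * h powr s)"
        using le h by (intro mult_left_mono) auto
      also have "\<dots> = ennreal L * (ennreal (h powr s) * ennreal (h powr (- s)))"
        using real(1) by (subst ennreal_mult) (auto simp: mult_ac)
      also have "\<dots> = ennreal L" using inv[of h] h by simp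
      finally show "ennreal (h powr (- s)) * increment_norm N f h \<le> ennreal L" .
    qed
  next
    case top
    show ?thesis unfolding top by (rule top_greatest)
  qed
qed

section \<open>Two tail bounds for one shift and their geometric mean\<close>

context unit_fbm
begin

lemma Y_exp_tail:
  assumes h: "0 < h" "h < 1" and l: "l > 0" "l\<^sup>2 \<ge> 8"
  shows "emeasure M {\<omega> \<in> space M. 1 < (\<integral>\<^sup>+ x \<in> {0<..<1 - h}. ennreal (exp ((Y h x \<omega> / l)\<^sup>2) - 1) \<partial>lborel)}
    \<le> ennreal (3 * (2/3) powr (l\<^sup>2 / 4))"
proof (rule exp_square_tail[OF Y_measurable _ _ _ l])
  show "\<exists>v\<le>1. centered_gaussian M v (Y h x)" if "x \<in> {0<..<1 - h}" for x
    using Y_gaussian[OF h, of x] that by (intro exI[of _ 1]) auto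
qed (use h in auto)

text \<open>On the event, the integral T of exp(Y^2 / 8) is at least 1 + (1 - h), whereas its mean
  is m (1 - h) \<le> (3/2) (1 - h). The gap is at least 1/2, and Chebyshev's inequality at 1/2
  multiplies 66 by 4.\<close>

lemma Y_exp_chebyshev:
  assumes h: "0 < h" "h < 1" and l: "l > 0" "l\<^sup>2 \<ge> 8"
  shows "emeasure M {\<omega> \<in> space M. 1 < (\<integral>\<^sup>+ x \<in> {0<..<1 - h}. ennreal (exp ((Y h x \<omega> / l)\<^sup>2) - 1) \<partial>lborel)}
    \<le> ennreal (264 * h powr (min (1/2) (2 - 2 * \<alpha>)))"
proof -
  let ?\<delta> = "min (1/2) (2 - 2 * \<alpha>)" and ?I = "{0<..<1 - h}"
  let ?F = "\<lambda>x \<omega>. ennreal (exp ((Y h x \<omega>)\<^sup>2 / 8))"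
  \<comment> \<open>The mean of exp(g^2 / 8) for a standard Gaussian g.\<close>
  define m where "m = 1 / sqrt (3/4 :: real)"
  have m0: "m > 0" by (simp add: m_def)
  have m2: "m\<^sup>2 = 4/3" by (simp add: m_def power_divide)
  have m: "m \<le> 3/2" by (rule power2_le_imp_le) (simp_all add: m2 power_divide)
  define T where "T \<omega> = (\<integral>\<^sup>+ x \<in> ?I. ?F x \<omega> \<partial>lborel)" for \<omega>
  have [measurable]: "T \<in> borel_measurable M" unfolding T_def by measurable
  have mean: "(\<integral>\<^sup>+ \<omega>. ?F x \<omega> \<partial>M) = ennreal m" if "x \<in> ?I" for x
    using centered_gaussian_exp_quadratic[OF Y_gaussian[OF h, of x], of "1/8" 0] that by (simp add: m_def)
  have cov: "(\<integral>\<^sup>+ \<omega>. ?F x \<omega> * ?F y \<omega> \<partial>M) \<le> ennreal (m\<^sup>2) + ennreal ((fbm_corr \<alpha> h (y - x))\<^sup>2)"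
    if xy: "x \<in> ?I" "y \<in> ?I" for x y
  proof -
    let ?\<rho> = "fbm_corr \<alpha> h (y - x)"
    have \<rho>: "\<bar>?\<rho>\<bar> \<le> 1" using xy by (intro fbm_corr_le_1 h) auto
    define u where "u = ?\<rho>\<^sup>2"
    have u: "0 \<le> u" "u \<le> 1" using \<rho> by (auto simp: u_def abs_square_le_1)
    have "(\<integral>\<^sup>+ \<omega>. ?F x \<omega> * ?F y \<omega> \<partial>M) = ennreal (4 / sqrt (9 - u))"
      unfolding u_def using xy by (intro pair_exp_square[OF Y_pair_gaussian[OF h] \<rho>]) auto
    also have "\<dots> \<le> ennreal (4/3 + u)"
    proof (rule ennreal_leI)
      \<comment> \<open>Nine times the difference of the two sides is
        \<open>u * (200 + 57 * u - 9 * (u * u))\<close>.\<close>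
      have "4\<^sup>2 \<le> (4/3 + u)\<^sup>2 * (9 - u)"
      proof -
        have "0 \<le> u * (200 + 57 * u - 9 * (u * u))" using u mult_left_le[of u u] by (intro mult_nonneg_nonneg) auto
        then show ?thesis by (simp add: power2_eq_square field_simps)
      qed
      also have "\<dots> = ((4/3 + u) * sqrt (9 - u))\<^sup>2" using u by (simp add: power_mult_distrib)
      finally have "4 \<le> (4/3 + u) * sqrt (9 - u)"
        using u by (intro power2_le_imp_le[of 4]) auto
      then show "4 / sqrt (9 - u) \<le> 4/3 + u" using u by (simp add: divide_le_eq)
    qed
    also have "\<dots> = ennreal (m\<^sup>2) + ennreal (?\<rho>\<^sup>2)"
      using u unfolding m2 u_def by (subst ennreal_plus) auto
    finally show ?thesis .
  qed
  have V: "(\<integral>\<^sup>+ x \<in> ?I. (\<integral>\<^sup>+ y \<in> ?I. ennreal ((fbm_corr \<alpha> h (y - x))\<^sup>2) \<partial>lborel) \<partial>lborel) \<le> ennreal (66 * h powr ?\<delta>)"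
    by (rule fbm_corr_integral_bound[OF alpha h fbm_corr_le_1[OF h]])
  have F: "(\<lambda>(x, \<omega>). ?F x \<omega>) \<in> borel_measurable (lborel \<Otimes>\<^sub>M M)" by measurable
  have r: "(\<lambda>(x, y). (fbm_corr \<alpha> h (y - x))\<^sup>2) \<in> borel_measurable (lborel \<Otimes>\<^sub>M lborel)" by measurable
  have I: "?I \<in> sets borel" "emeasure lborel ?I = ennreal (1 - h)" "0 \<le> 1 - h" using h by auto
  note chebyshev = random_integral_chebyshev[where r="\<lambda>x y. (fbm_corr \<alpha> h (y - x))\<^sup>2" and \<epsilon>="1/2",
      OF F I less_imp_le[OF m0] mean cov r V]
  have "{\<omega> \<in> space M. 1 < (\<integral>\<^sup>+ x \<in> ?I. ennreal (exp ((Y h x \<omega> / l)\<^sup>2) - 1) \<partial>lborel)}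
    \<subseteq> {\<omega> \<in> space M. 1/2 \<le> \<bar>enn2real (T \<omega>) - m * (1 - h)\<bar>} \<union> {\<omega> \<in> space M. \<not> T \<omega> < \<infinity>}"
  proof safe
    fix \<omega> assume [measurable]: "\<omega> \<in> space M" and fin: "T \<omega> < \<infinity>"
      and gt: "1 < (\<integral>\<^sup>+ x \<in> ?I. ennreal (exp ((Y h x \<omega> / l)\<^sup>2) - 1) \<partial>lborel)"
    have "(\<integral>\<^sup>+ x \<in> ?I. ennreal (exp ((Y h x \<omega> / l)\<^sup>2) - 1) \<partial>lborel) + ennreal (1 - h)
      = (\<integral>\<^sup>+ x. ennreal (exp ((Y h x \<omega> / l)\<^sup>2) - 1) * indicator ?I x + indicator ?I x \<partial>lborel)"
      using h by (subst nn_integral_add) auto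
    also have "\<dots> \<le> T \<omega>" unfolding T_def
    proof (intro nn_integral_mono)
      fix x
      have "(Y h x \<omega> / l)\<^sup>2 \<le> (Y h x \<omega>)\<^sup>2 / 8"
        unfolding power_divide using l by (intro divide_left_mono) auto
      then have "exp ((Y h x \<omega> / l)\<^sup>2) \<le> exp ((Y h x \<omega>)\<^sup>2 / 8)" by simp
      then have "ennreal (exp ((Y h x \<omega> / l)\<^sup>2) - 1) + 1 \<le> ?F x \<omega>"
        by (subst ennreal_1[symmetric], subst ennreal_plus[symmetric]) (auto intro: ennreal_leI)
      then show "ennreal (exp ((Y h x \<omega> / l)\<^sup>2) - 1) * indicator ?I x + indicator ?I x \<le> ?F x \<omega> * indicator ?I x"
        by (simp split: split_indicator)
    qed
    finally have le: "(\<integral>\<^sup>+ x \<in> ?I. ennreal (exp ((Y h x \<omega> / l)\<^sup>2) - 1) \<partial>lborel) + ennreal (1 - h) \<le> T \<omega>" .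
    have "ennreal 1 + ennreal (1 - h) \<le> T \<omega>"
      by (rule order_trans[OF _ le]) (use gt in \<open>auto intro!: add_right_mono\<close>)
    then have "ennreal (1 + (1 - h)) \<le> ennreal (enn2real (T \<omega>))"
      using h fin by (subst ennreal_plus) auto
    then have "1 + (1 - h) \<le> enn2real (T \<omega>)" by (subst (asm) ennreal_le_iff) auto
    moreover have "m * (1 - h) \<le> 3/2 * (1 - h)" using m h by (intro mult_right_mono) auto
    ultimately show "1/2 \<le> \<bar>enn2real (T \<omega>) - m * (1 - h)\<bar>" using h by (simp add: algebra_simps)
  qed
  then have "emeasure M {\<omega> \<in> space M. 1 < (\<integral>\<^sup>+ x \<in> ?I. ennreal (exp ((Y h x \<omega> / l)\<^sup>2) - 1) \<partial>lborel)}
    \<le> emeasure M ({\<omega> \<in> space M. 1/2 \<le> \<bar>enn2real (T \<omega>) - m * (1 - h)\<bar>} \<union> {\<omega> \<in> space M. \<not> T \<omega> < \<infinity>})"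
    by (rule emeasure_mono) measurable
  also have "\<dots> = emeasure M {\<omega> \<in> space M. 1/2 \<le> \<bar>enn2real (T \<omega>) - m * (1 - h)\<bar>}"
  proof (rule emeasure_Un_null_set)
    have "AE \<omega> in M. T \<omega> < \<infinity>" unfolding T_def
      by (rule chebyshev(2)) auto
    then show "{\<omega> \<in> space M. \<not> T \<omega> < \<infinity>} \<in> null_sets M" by (subst (asm) AE_iff_null) auto
  qed measurable
  also have "\<dots> \<le> ennreal (66 * h powr ?\<delta> / (1/2)\<^sup>2)" unfolding T_def
    by (rule chebyshev(1)) auto
  finally show ?thesis by (simp add: power2_eq_square)
qed

lemma Y_exp_bound:
  assumes h: "0 < h" "h < 1" and l: "l > 0" "l\<^sup>2 \<ge> 8"
  shows "emeasure M {\<omega> \<in> space M. 1 < (\<integral>\<^sup>+ x \<in> {0<..<1 - h}. ennreal (exp ((Y h x \<omega> / l)\<^sup>2) - 1) \<partial>lborel)}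
    \<le> ennreal (29 * h powr (min (1/4) (1 - \<alpha>)) * ((2/3) powr (1/8)) powr (l\<^sup>2))"
proof -
  define p where "p = measure M {\<omega> \<in> space M. 1 < (\<integral>\<^sup>+ x \<in> {0<..<1 - h}. ennreal (exp ((Y h x \<omega> / l)\<^sup>2) - 1) \<partial>lborel)}"
  have p0: "p \<ge> 0" by (simp add: p_def)
  have "p \<le> 3 * (2/3) powr (l\<^sup>2 / 4)" "p \<le> 264 * h powr (min (1/2) (2 - 2 * \<alpha>))"
    using Y_exp_tail[OF assms] Y_exp_chebyshev[OF assms] by (simp_all add: emeasure_eq_measure p_def)
  \<comment> \<open>Both bounds hold for p, so p^2 is at most their product; the square root halves
    the two exponents, and 3 * 264 = 792 \<le> 841 = 29^2.\<close>
  then have "p\<^sup>2 \<le> (3 * (2/3) powr (l\<^sup>2 / 4)) * (264 * h powr (min (1/2) (2 - 2 * \<alpha>)))"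
    unfolding power2_eq_square using p0 by (intro mult_mono) auto
  also have "\<dots> \<le> 841 * ((2/3) powr (l\<^sup>2 / 4) * h powr (min (1/2) (2 - 2 * \<alpha>)))" by simp
  also have "min (1/2) (2 - 2 * \<alpha>) = min (1/4) (1 - \<alpha>) * 2" by (simp add: min_def)
  also have "h powr (min (1/4) (1 - \<alpha>) * 2) = (h powr (min (1/4) (1 - \<alpha>)))\<^sup>2"
    using h by (simp add: powr_powr[symmetric] powr_numeral)
  also have "(2/3 :: real) powr (l\<^sup>2 / 4) = (((2/3) powr (1/8)) powr (l\<^sup>2))\<^sup>2"
    by (simp add: powr_powr powr_power)
  also have "841 * ((((2/3 :: real) powr (1/8)) powr (l\<^sup>2))\<^sup>2 * (h powr (min (1/4) (1 - \<alpha>)))\<^sup>2)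
      = (29 * h powr (min (1/4) (1 - \<alpha>)) * ((2/3) powr (1/8)) powr (l\<^sup>2))\<^sup>2"
    by (simp add: power_mult_distrib)
  finally have "p \<le> 29 * h powr (min (1/4) (1 - \<alpha>)) * ((2/3) powr (1/8)) powr (l\<^sup>2)"
    by (rule power2_le_imp_le) auto
  then show ?thesis unfolding p_def by (simp add: emeasure_eq_measure ennreal_leI)
qed

end

section \<open>Lower bounds for the increments\<close>

lemma in_Theta_rightI:
  assumes "c > 0" "s0 > 0"
    and "\<And>s. 0 < s \<Longrightarrow> s < s0 \<Longrightarrow> ennreal (c * s powr \<alpha>) \<le> F s"
    and "\<And>s. 0 < s \<Longrightarrow> s < s0 \<Longrightarrow> F s \<le> ennreal (C * s powr \<alpha>)"
  shows "in_Theta_right 0 F (\<lambda>s. s powr \<alpha>)"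
proof -
  let ?q = "\<lambda>s. F s / ennreal (s powr \<alpha>)"
  have ev: "\<forall>\<^sub>F s in at_right 0. s \<in> {0<..<s0}"
    using assms(2) by (auto simp: eventually_at_right)
  have lo: "\<forall>\<^sub>F s in at_right 0. ennreal c \<le> ?q s"
    using ev
  proof eventually_elim
    case (elim s)
    then have "ennreal (c * s powr \<alpha>) / ennreal (s powr \<alpha>) \<le> ?q s"
      using assms by (intro divide_right_mono_ennreal) auto
    then show ?case using elim assms by (simp add: divide_ennreal)
  qed
  have hi: "\<forall>\<^sub>F s in at_right 0. ?q s \<le> ennreal \<bar>C\<bar>"
    using ev
  proof eventually_elim
    case (elim s)
    have "F s \<le> ennreal (C * s powr \<alpha>)" using assms elim by auto
    also have "\<dots> \<le> ennreal (\<bar>C\<bar> * s powr \<alpha>)" by (intro ennreal_leI mult_right_mono) auto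
    finally have "?q s \<le> ennreal (\<bar>C\<bar> * s powr \<alpha>) / ennreal (s powr \<alpha>)"
      by (intro divide_right_mono_ennreal)
    then show ?case using elim by (simp add: divide_ennreal)
  qed
  have "0 < ennreal c" using assms by simp
  also have "\<dots> \<le> Liminf (at_right 0) ?q" using lo by (rule Liminf_bounded)
  finally have "0 < Liminf (at_right 0) ?q" .
  moreover have "Limsup (at_right 0) ?q \<le> ennreal \<bar>C\<bar>" using hi by (rule Limsup_bounded)
  then have "Limsup (at_right 0) ?q < \<infinity>" by (auto intro: order.strict_trans1)
  moreover have "Liminf (at_right 0) ?q \<le> Limsup (at_right (0::real)) ?q"
    by (rule Liminf_le_Limsup) (simp add: trivial_limit_at_right_real)
  ultimately show ?thesis by (simp add: in_Theta_right_def)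
qed

text \<open>These turn a bound on the Luxemburg norm into bounds on the first, the fourth and the
  p-th moment. The fourth power comes from the quadratic Taylor polynomial of exp at x^2, the p-th
  one from a single term of the exponential series, with index p rounded up.\<close>

lemma exp_type_lower:
  assumes N: "young_function N" and \<tau>: "\<And>x. x \<ge> \<tau> \<Longrightarrow> N x = exp (x\<^sup>2) - 1" "\<tau> \<ge> 0" and x: "x \<ge> 0"
  shows "x \<le> \<tau> + 1 + N x" and "x ^ 4 \<le> \<tau> ^ 4 + 2 * N x"
    and "p \<ge> 1 \<Longrightarrow> x powr p \<le> (\<tau> powr p + 1 + fact (nat \<lceil>p\<rceil>)) * (1 + N x)"
proof -
  have N0: "N x \<ge> 0" by (rule young_nonneg[OF N x])
  have 1: "x \<le> \<tau> + 1 + N x \<and> x ^ 4 \<le> \<tau> ^ 4 + 2 * N x"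
  proof (cases "x \<le> \<tau>")
    case True
    then have "x ^ 4 \<le> \<tau> ^ 4" using x by (intro power_mono)
    then show ?thesis using True N0 by simp
  next
    case False
    then have eq: "N x = exp (x\<^sup>2) - 1" using \<tau> by simp
    define a where "a = x\<^sup>2"
    have e: "1 + a + a\<^sup>2 / 2 \<le> exp a" by (rule exp_lower_Taylor_quadratic) (simp add: a_def)
    have "0 \<le> (x - 1/2)\<^sup>2" by simp
    then have "x \<le> 1 + a" by (simp add: a_def power2_eq_square algebra_simps)
    moreover have a: "0 \<le> a" "0 \<le> a\<^sup>2" by (auto simp: a_def)
    ultimately have "x \<le> \<tau> + 1 + N x" using e \<tau>(2) unfolding eq a_def[symmetric] by linarith
    moreover have "a\<^sup>2 / 2 \<le> exp a - 1" using e a by linarith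
    then have "x ^ 4 \<le> 2 * N x" unfolding eq a_def[symmetric] by (simp add: a_def field_simps flip: power_mult)
    moreover have "0 \<le> \<tau> ^ 4" using \<tau>(2) by simp
    ultimately show ?thesis by (simp add: add_increasing)
  qed
  then show "x \<le> \<tau> + 1 + N x" "x ^ 4 \<le> \<tau> ^ 4 + 2 * N x" by auto
  assume p: "p \<ge> 1"
  define k where "k = nat \<lceil>p\<rceil>"
  have k: "p \<le> real k" unfolding k_def by linarith
  show "x powr p \<le> (\<tau> powr p + 1 + fact k) * (1 + N x)"
  proof (cases "x \<le> \<tau>")
    case True
    then have "x powr p \<le> \<tau> powr p" using x p by (intro powr_mono2) auto
    also have "\<dots> \<le> (\<tau> powr p + 1 + fact k) * 1" by simp
    also have "\<dots> \<le> (\<tau> powr p + 1 + fact k) * (1 + N x)" using N0 by (intro mult_left_mono) auto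
    finally show ?thesis .
  next
    case False
    then have eq: "1 + N x = exp (x\<^sup>2)" using \<tau> by simp
    have "x powr p \<le> 1 + fact k * exp (x\<^sup>2)"
    proof (cases "x \<le> 1")
      case True
      then have "x powr p \<le> 1" using x p powr_mono2[of p x 1] by simp
      then show ?thesis by (simp add: add_increasing2)
    next
      case False
      have "x powr p \<le> x powr real k" using False k by (intro powr_mono) auto
      also have "\<dots> = x ^ k" using False by (simp add: powr_realpow)
      also have "\<dots> \<le> (x\<^sup>2) ^ k" using False by (intro power_mono) (auto simp: power2_eq_square)
      also have "\<dots> \<le> fact k * exp (x\<^sup>2)"
      proof -
        have "(x\<^sup>2) ^ k / fact k = (\<Sum>i\<in>{k}. (x\<^sup>2) ^ i / fact i)" by simp
        also have "\<dots> \<le> (\<Sum>i. (x\<^sup>2) ^ i / fact i)"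
          using summable_exp[of "x\<^sup>2"] by (intro sum_le_suminf) (auto simp: divide_inverse mult.commute)
        also have "\<dots> = exp (x\<^sup>2)" by (simp add: exp_def divide_inverse mult.commute)
        finally show ?thesis by (simp add: divide_le_eq mult.commute)
      qed
      finally show ?thesis by simp
    qed
    also have "\<dots> \<le> exp (x\<^sup>2) + fact k * exp (x\<^sup>2)" by simp
    also have "\<dots> \<le> (\<tau> powr p + 1 + fact k) * exp (x\<^sup>2)" by (simp add: algebra_simps)
    finally show ?thesis unfolding eq .
  qed
qed

text \<open>l lies above the norm and is therefore admissible: the modular contributes at most b,
  and the constant a is integrated over mass at most 1.\<close>

lemma nn_integral_le_of_luxemburg_norm:
  assumes N: "young_function N" and [measurable]: "f \<in> borel_measurable D" and D: "emeasure D (space D) \<le> 1"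
    and l: "luxemburg_norm N D f < ennreal l" and ab: "a \<ge> 0" "b \<ge> 0"
    and G: "\<And>x. x \<ge> 0 \<Longrightarrow> G x \<le> a + b * N x"
  shows "(\<integral>\<^sup>+ x. ennreal (G (\<bar>f x\<bar> / l)) \<partial>D) \<le> ennreal (a + b)"
proof -
  have l0: "l > 0" and m: "luxemburg_modular N D f l \<le> 1" using luxemburg_norm_lessD[OF N l] by auto
  note [measurable] = young_measurable[OF N assms(2) l0]
  have "(\<integral>\<^sup>+ x. ennreal (G (\<bar>f x\<bar> / l)) \<partial>D) \<le> (\<integral>\<^sup>+ x. ennreal a + ennreal b * ennreal (N (\<bar>f x\<bar> / l)) \<partial>D)"
  proof (intro nn_integral_mono)
    fix x
    have Nx: "N (\<bar>f x\<bar> / l) \<ge> 0" using l0 by (intro young_nonneg[OF N]) auto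
    have "ennreal (G (\<bar>f x\<bar> / l)) \<le> ennreal (a + b * N (\<bar>f x\<bar> / l))"
      using l0 by (intro ennreal_leI G) auto
    also have "\<dots> = ennreal a + ennreal b * ennreal (N (\<bar>f x\<bar> / l))"
      using ab Nx by (subst ennreal_plus) (auto simp: ennreal_mult)
    finally show "ennreal (G (\<bar>f x\<bar> / l)) \<le> ennreal a + ennreal b * ennreal (N (\<bar>f x\<bar> / l))" .
  qed
  also have "\<dots> = ennreal a * emeasure D (space D) + ennreal b * luxemburg_modular N D f l"
    unfolding luxemburg_modular_def by (simp add: nn_integral_add nn_integral_cmult)
  also have "\<dots> \<le> ennreal a * 1 + ennreal b * 1" by (intro add_mono mult_left_mono D m) auto
  also have "\<dots> = ennreal (a + b)" using ab by simp
  finally show ?thesis .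
qed

lemma nn_integral_abs_le_of_luxemburg_norm:
  assumes N: "young_function N" and \<tau>: "\<And>x. x \<ge> \<tau> \<Longrightarrow> N x = exp (x\<^sup>2) - 1" "\<tau> \<ge> 0"
    and f [measurable]: "f \<in> borel_measurable D" and D: "emeasure D (space D) \<le> 1"
    and l: "luxemburg_norm N D f < ennreal l"
  shows "(\<integral>\<^sup>+ x. ennreal \<bar>f x\<bar> \<partial>D) \<le> ennreal ((\<tau> + 2) * l)"
proof -
  have l0: "l > 0" using luxemburg_norm_lessD[OF N l] by auto
  have "(\<integral>\<^sup>+ x. ennreal \<bar>f x\<bar> \<partial>D) = (\<integral>\<^sup>+ x. ennreal l * ennreal (\<bar>f x\<bar> / l) \<partial>D)"
    using l0 by (intro nn_integral_cong) (simp flip: ennreal_mult')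
  also have "\<dots> = ennreal l * (\<integral>\<^sup>+ x. ennreal (\<bar>f x\<bar> / l) \<partial>D)" by (rule nn_integral_cmult) measurable
  also have "(\<integral>\<^sup>+ x. ennreal (\<bar>f x\<bar> / l) \<partial>D) \<le> ennreal ((\<tau> + 1) + 1)"
    using exp_type_lower(1)[OF N \<tau>] \<tau>(2)
    by (intro nn_integral_le_of_luxemburg_norm[where G="\<lambda>x. x", OF N f D l]) auto
  also have "ennreal l * ennreal ((\<tau> + 1) + 1) = ennreal ((\<tau> + 2) * l)"
    using l0 \<tau>(2) by (subst ennreal_mult[symmetric]) (auto simp: mult.commute add.assoc)
  finally show ?thesis by (simp add: mult_left_mono)
qed

lemma Lp_norm_le_of_luxemburg_norm:
  assumes N: "young_function N" and \<tau>: "\<And>x. x \<ge> \<tau> \<Longrightarrow> N x = exp (x\<^sup>2) - 1" "\<tau> \<ge> 0"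
    and f [measurable]: "f \<in> borel_measurable D" and D: "emeasure D (space D) \<le> 1"
    and l: "luxemburg_norm N D f < ennreal l" and p: "p \<ge> 1"
  shows "Lp_norm p D f \<le> ennreal ((2 * (\<tau> powr p + 1 + fact (nat \<lceil>p\<rceil>))) powr (1 / p) * l)"
proof -
  define C where "C = \<tau> powr p + 1 + fact (nat \<lceil>p\<rceil>)"
  have C: "C > 0" unfolding C_def by (simp add: add_nonneg_pos)
  have l0: "l > 0" using luxemburg_norm_lessD[OF N l] by auto
  have "(\<integral>\<^sup>+ x. ennreal (\<bar>f x\<bar> powr p) \<partial>D) = (\<integral>\<^sup>+ x. ennreal (l powr p) * ennreal ((\<bar>f x\<bar> / l) powr p) \<partial>D)"
    using l0 by (intro nn_integral_cong) (simp add: powr_divide flip: ennreal_mult')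
  also have "\<dots> = ennreal (l powr p) * (\<integral>\<^sup>+ x. ennreal ((\<bar>f x\<bar> / l) powr p) \<partial>D)"
    by (rule nn_integral_cmult) measurable
  also have "(\<integral>\<^sup>+ x. ennreal ((\<bar>f x\<bar> / l) powr p) \<partial>D) \<le> ennreal (C + C)"
  proof (rule nn_integral_le_of_luxemburg_norm[where G="\<lambda>x. x powr p", OF N f D l])
    show "x powr p \<le> C + C * N x" if "x \<ge> 0" for x
      using exp_type_lower(3)[OF N \<tau> that p] by (simp add: C_def algebra_simps)
  qed (use C in auto)
  then have "ennreal (l powr p) * (\<integral>\<^sup>+ x. ennreal ((\<bar>f x\<bar> / l) powr p) \<partial>D) \<le> ennreal (l powr p) * ennreal (C + C)"
    by (rule mult_left_mono) simp
  also have "\<dots> = ennreal (l powr p * (C + C))" using C by (simp add: ennreal_mult)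
  finally have J: "(\<integral>\<^sup>+ x. ennreal (\<bar>f x\<bar> powr p) \<partial>D) \<le> ennreal (l powr p * (2 * C))" by simp
  then obtain J where J': "(\<integral>\<^sup>+ x. ennreal (\<bar>f x\<bar> powr p) \<partial>D) = ennreal J" "J \<ge> 0"
    by (cases "\<integral>\<^sup>+ x. ennreal (\<bar>f x\<bar> powr p) \<partial>D") (auto simp: top_unique)
  have "J \<le> l powr p * (2 * C)" using J J' C by (simp add: ennreal_le_iff)
  then have "J powr (1 / p) \<le> (l powr p * (2 * C)) powr (1 / p)" using J' p by (intro powr_mono2) auto
  also have "\<dots> = (2 * C) powr (1 / p) * l" using l0 C p by (simp add: powr_mult powr_powr)
  finally show ?thesis unfolding Lp_norm_def J' using J' by (simp add: C_def ennreal_leI)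
qed

text \<open>A substitute for Holder's inequality, from |y| \<le> t + t^(1 - p) |y|^p, where the
  first term covers |y| \<le> t and the second the rest. The factor 2 is harmless for orders of
  magnitude.\<close>

lemma nn_integral_abs_le_of_Lp_norm:
  assumes f [measurable]: "f \<in> borel_measurable D" and D: "emeasure D (space D) \<le> 1"
    and p: "p \<ge> 1" and t: "Lp_norm p D f < ennreal t"
  shows "(\<integral>\<^sup>+ x. ennreal \<bar>f x\<bar> \<partial>D) \<le> ennreal (2 * t)"
proof -
  obtain J where J: "(\<integral>\<^sup>+ x. ennreal (\<bar>f x\<bar> powr p) \<partial>D) = ennreal J" "J \<ge> 0"
    using t by (cases "\<integral>\<^sup>+ x. ennreal (\<bar>f x\<bar> powr p) \<partial>D") (auto simp: Lp_norm_def)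
  then have lt: "J powr (1 / p) < t" using t by (auto simp: Lp_norm_def ennreal_less_iff)
  have t0: "t > 0" using lt powr_ge_zero[of J "1 / p"] by linarith
  have "J = (J powr (1 / p)) powr p" using J p by (simp add: powr_powr)
  also have "\<dots> \<le> t powr p" using lt p by (intro powr_mono2) auto
  finally have Jt: "J \<le> t powr p" .
  have pw: "\<bar>y\<bar> \<le> t + t powr (1 - p) * \<bar>y\<bar> powr p" for y
  proof (cases "\<bar>y\<bar> \<le> t")
    case False
    then have "\<bar>y\<bar> powr (1 - p) \<le> t powr (1 - p)" using t0 p by (intro powr_mono2') auto
    then have "\<bar>y\<bar> powr (1 - p) * \<bar>y\<bar> powr p \<le> t powr (1 - p) * \<bar>y\<bar> powr p" by (rule mult_right_mono) simp
    moreover have "\<bar>y\<bar> powr (1 - p) * \<bar>y\<bar> powr p = \<bar>y\<bar>" using False t0 by (simp flip: powr_add)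
    ultimately show ?thesis using t0 by simp
  qed (simp add: add_increasing2)
  have "(\<integral>\<^sup>+ x. ennreal \<bar>f x\<bar> \<partial>D) \<le> (\<integral>\<^sup>+ x. ennreal t + ennreal (t powr (1 - p)) * ennreal (\<bar>f x\<bar> powr p) \<partial>D)"
  proof (intro nn_integral_mono)
    fix x
    have "ennreal \<bar>f x\<bar> \<le> ennreal (t + t powr (1 - p) * \<bar>f x\<bar> powr p)" by (intro ennreal_leI pw)
    also have "\<dots> = ennreal t + ennreal (t powr (1 - p)) * ennreal (\<bar>f x\<bar> powr p)"
      using t0 by (subst ennreal_plus) (auto simp: ennreal_mult)
    finally show "ennreal \<bar>f x\<bar> \<le> ennreal t + ennreal (t powr (1 - p)) * ennreal (\<bar>f x\<bar> powr p)" .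
  qed
  also have "\<dots> = ennreal t * emeasure D (space D) + ennreal (t powr (1 - p)) * ennreal J"
    by (simp add: nn_integral_add nn_integral_cmult J)
  also have "\<dots> \<le> ennreal t * 1 + ennreal (t powr (1 - p)) * ennreal (t powr p)"
    using Jt by (intro add_mono mult_left_mono D ennreal_leI) auto
  also have "ennreal (t powr (1 - p)) * ennreal (t powr p) = ennreal t"
    using t0 by (subst ennreal_mult[symmetric]) (auto simp flip: powr_add)
  also have "ennreal t * 1 + ennreal t = ennreal (2 * t)" using t0 by (simp flip: ennreal_plus)
  finally show ?thesis .
qed

text \<open>Up to constants this is dominated by each of the norms in the final estimates, so one
  lower bound for it serves them all.\<close>

definition increment_L1 :: "(real \<Rightarrow> real) \<Rightarrow> real \<Rightarrow> ennreal" where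
  "increment_L1 f h = (\<integral>\<^sup>+ x \<in> {0<..<1 - h}. ennreal \<bar>f (x + h) - f x\<bar> \<partial>lborel)"

lemma increment_L1_zero [simp]: "increment_L1 f 0 = 0"
  by (simp add: increment_L1_def)

lemma increment_L1_subadditive:
  assumes [measurable]: "f \<in> borel_measurable borel" and "a \<ge> 0" "b \<ge> 0"
  shows "increment_L1 f (a + b) \<le> increment_L1 f a + increment_L1 f b"
proof -
  have "increment_L1 f (a + b) \<le> (\<integral>\<^sup>+ x. ennreal \<bar>f (x + a) - f x\<bar> * indicator {0<..<1 - a} x
      + ennreal \<bar>f ((x + a) + b) - f (x + a)\<bar> * indicator {0<..<1 - (a + b)} x \<partial>lborel)"
    unfolding increment_L1_def
  proof (intro nn_integral_mono)
    fix x
    have "ennreal \<bar>f (x + (a + b)) - f x\<bar> \<le> ennreal (\<bar>f (x + a) - f x\<bar> + \<bar>f ((x + a) + b) - f (x + a)\<bar>)"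
      by (intro ennreal_leI) (simp add: add.assoc)
    then show "ennreal \<bar>f (x + (a + b)) - f x\<bar> * indicator {0<..<1 - (a + b)} x
      \<le> ennreal \<bar>f (x + a) - f x\<bar> * indicator {0<..<1 - a} x
        + ennreal \<bar>f ((x + a) + b) - f (x + a)\<bar> * indicator {0<..<1 - (a + b)} x"
      using assms by (auto simp: indicator_def)
  qed
  also have "\<dots> = increment_L1 f a + (\<integral>\<^sup>+ x \<in> {0<..<1 - (a + b)}. ennreal \<bar>f ((x + a) + b) - f (x + a)\<bar> \<partial>lborel)"
    unfolding increment_L1_def by (rule nn_integral_add) measurable
  also have "(\<integral>\<^sup>+ x \<in> {0<..<1 - (a + b)}. ennreal \<bar>f ((x + a) + b) - f (x + a)\<bar> \<partial>lborel)
     = (\<integral>\<^sup>+ x \<in> {0 + a<..<1 - (a + b) + a}. ennreal \<bar>f (x + b) - f x\<bar> \<partial>lborel)"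
    by (rule nn_integral_shift[where G="\<lambda>x. ennreal \<bar>f (x + b) - f x\<bar>"]) measurable
  also have "\<dots> \<le> increment_L1 f b"
    unfolding increment_L1_def using assms by (intro nn_integral_mono) (auto split: split_indicator)
  finally show ?thesis by (simp add: add_left_mono)
qed

lemma increment_L1_multiple:
  assumes f: "f \<in> borel_measurable borel" and "a \<ge> 0"
  shows "increment_L1 f (real k * a) \<le> of_nat k * increment_L1 f a"
proof (induction k)
  case (Suc k)
  have "increment_L1 f (real (Suc k) * a) = increment_L1 f (real k * a + a)" by (simp add: algebra_simps)
  also have "\<dots> \<le> increment_L1 f (real k * a) + increment_L1 f a"
    using assms by (intro increment_L1_subadditive) auto
  also have "\<dots> \<le> of_nat k * increment_L1 f a + increment_L1 f a" by (intro add_right_mono Suc)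
  finally show ?case by (simp add: algebra_simps)
qed simp

text \<open>
  Divide \<open>1 / 2 ^ n\<close> by \<open>s\<close> with remainder \<open>r\<close>, where \<open>m \<le> 1 / (2 ^ n * s) \<le> 2 * m\<close>: if \<open>m\<close> is
  large, the increment over \<open>r\<close> is negligible, so the one over \<open>s\<close> cannot be small.
\<close>

lemma increment_L1_lower:
  fixes f :: "real \<Rightarrow> real"
  assumes f: "f \<in> borel_measurable borel" and \<alpha>: "\<alpha> > 0" and c: "c > 0" and C: "C \<ge> 0"
    and lo: "\<And>n. n \<ge> n0 \<Longrightarrow> ennreal (c * (1 / 2 ^ n) powr \<alpha>) \<le> increment_L1 f (1 / 2 ^ n)"
    and hi: "\<And>h. 0 < h \<Longrightarrow> h < 1 \<Longrightarrow> increment_L1 f h \<le> ennreal (C * h powr \<alpha>)"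
  shows "\<exists>c'>0. \<exists>s0>0. \<forall>s. 0 < s \<and> s < s0 \<longrightarrow> ennreal (c' * s powr \<alpha>) \<le> increment_L1 f s"
proof -
  \<comment> \<open>m is so large that the increment over a remainder r < s \<le> 1 / (2^n m) is at
    most half of the lower bound at 1 / 2^n.\<close>
  obtain m :: nat where m: "m \<ge> 1" "C * real m powr (- \<alpha>) \<le> c / 2"
  proof -
    have "((\<lambda>m. C * real m powr (- \<alpha>)) \<longlongrightarrow> C * 0) sequentially"
      using \<alpha> by (intro tendsto_intros tendsto_neg_powr filterlim_real_sequentially) auto
    then have "\<forall>\<^sub>F m in sequentially. C * real m powr (- \<alpha>) < c / 2"
      using c by (intro order_tendstoD) auto
    then have "\<forall>\<^sub>F m in sequentially. C * real m powr (- \<alpha>) < c / 2 \<and> m \<ge> 1"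
      using eventually_ge_at_top[of 1] by eventually_elim auto
    then obtain m where "C * real m powr (- \<alpha>) < c / 2 \<and> m \<ge> 1" by (auto simp: eventually_sequentially)
    then show ?thesis by (intro that[of m]) auto
  qed
  \<comment> \<open>Below s0 the least n with 1 / 2^n < 2 m s exceeds n0, so the lower bound at 1 /
    2^n is available.\<close>
  define s0 where "s0 = 1 / (2 * real m * 2 ^ n0)"
  have s0: "s0 > 0" using m by (simp add: s0_def)
  have main: "ennreal (c / (4 * real m) * s powr \<alpha>) \<le> increment_L1 f s" if s: "0 < s" "s < s0" for s
  proof -
    have ms: "2 * real m * s < 1 / 2 ^ n0" using s m by (simp add: s0_def field_simps)
    obtain n1 where "(1 / 2 :: real) ^ n1 < 2 * real m * s" using real_arch_pow_inv[of "2 * real m * s" "1/2"] s m by auto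
    then have ex: "\<exists>n. 1 / 2 ^ n < 2 * real m * s" by (intro exI[of _ n1]) (simp add: power_divide)
    define n where "n = (LEAST n. 1 / 2 ^ n < 2 * real m * s)"
    have n: "1 / 2 ^ n < 2 * real m * s" unfolding n_def by (rule LeastI_ex[OF ex])
    have nn0: "n0 < n"
    proof (rule ccontr)
      assume "\<not> n0 < n"
      then have "1 / 2 ^ n0 \<le> (1 / 2 ^ n :: real)" by (intro divide_left_mono power_increasing) auto
      then show False using n ms by simp
    qed
    then obtain j where j: "n = Suc j" by (cases n) auto
    have "\<not> 1 / 2 ^ j < 2 * real m * s" using not_less_Least[of j "\<lambda>n. 1 / 2 ^ n < 2 * real m * s"] j unfolding n_def by auto
    then have nm: "real m * s \<le> 1 / 2 ^ n" by (simp add: j)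
    have sn: "s \<le> 1 / 2 ^ n"
    proof -
      have "1 * s \<le> real m * s" using m s by (intro mult_right_mono) auto
      then show ?thesis using nm by simp
    qed
    define k where "k = nat \<lfloor>(1 / 2 ^ n) / s\<rfloor>"
    define r where "r = 1 / 2 ^ n - real k * s"
    have kr: "real k \<le> (1 / 2 ^ n) / s" "(1 / 2 ^ n) / s < real k + 1"
      unfolding k_def using s by (auto simp: of_nat_nat)
    have r: "0 \<le> r" "r < s" using kr s by (auto simp: r_def field_simps)
    have k2: "k \<le> 2 * m"
    proof -
      have "real k * s \<le> 1 / 2 ^ n" using r(1) unfolding r_def by linarith
      also have "\<dots> < 2 * real m * s" by (rule n)
      also have "\<dots> = real (2 * m) * s" by simp
      finally have "real k * s < real (2 * m) * s" .
      then have "real k < real (2 * m)" by (simp only: mult_less_cancel_right_pos[OF s(1)])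
      then show ?thesis by linarith
    qed
    have s1: "s < 1"
    proof -
      have "1 / 2 ^ n0 \<le> (1 :: real)" by simp
      moreover have "1 * s \<le> 2 * real m * s" using m s by (intro mult_right_mono) auto
      ultimately show ?thesis using ms by linarith
    qed
    have ir: "increment_L1 f r \<le> ennreal (c / 2 * (1 / 2 ^ n) powr \<alpha>)"
    proof (cases "r = 0")
      case False
      then have "increment_L1 f r \<le> ennreal (C * r powr \<alpha>)" using r s1 by (intro hi) auto
      also have "\<dots> \<le> ennreal (c / 2 * (1 / 2 ^ n) powr \<alpha>)"
      proof (rule ennreal_leI)
        have "s \<le> (1 / 2 ^ n) / real m" using nm m by (simp add: field_simps)
        then have "r \<le> (1 / 2 ^ n) / real m" using r by linarith
        then have "r powr \<alpha> \<le> ((1 / 2 ^ n) / real m) powr \<alpha>" using r \<alpha> by (intro powr_mono2) auto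
        also have "\<dots> = real m powr (- \<alpha>) * (1 / 2 ^ n) powr \<alpha>"
          by (simp add: powr_divide powr_minus powr_mult field_simps)
        finally have "C * r powr \<alpha> \<le> C * (real m powr (- \<alpha>) * (1 / 2 ^ n) powr \<alpha>)" using C by (rule mult_left_mono)
        also have "\<dots> = (C * real m powr (- \<alpha>)) * (1 / 2 ^ n) powr \<alpha>" by simp
        also have "\<dots> \<le> c / 2 * (1 / 2 ^ n) powr \<alpha>" using m by (intro mult_right_mono) auto
        finally show "C * r powr \<alpha> \<le> c / 2 * (1 / 2 ^ n) powr \<alpha>" .
      qed
      finally show ?thesis .
    qed simp
    have "ennreal (c * (1 / 2 ^ n) powr \<alpha>) \<le> increment_L1 f (real k * s + r)"
      using lo[of n] nn0 by (simp add: r_def)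
    also have "\<dots> \<le> increment_L1 f (real k * s) + increment_L1 f r"
      using r s by (intro increment_L1_subadditive f) auto
    also have "\<dots> \<le> of_nat k * increment_L1 f s + ennreal (c / 2 * (1 / 2 ^ n) powr \<alpha>)"
      using s by (intro add_mono increment_L1_multiple f ir) auto
    also have "\<dots> \<le> of_nat (2 * m) * increment_L1 f s + ennreal (c / 2 * (1 / 2 ^ n) powr \<alpha>)"
      using k2 by (intro add_right_mono mult_right_mono of_nat_mono) auto
    finally have le: "ennreal (c * (1 / 2 ^ n) powr \<alpha>)
        \<le> of_nat (2 * m) * increment_L1 f s + ennreal (c / 2 * (1 / 2 ^ n) powr \<alpha>)" .
    show ?thesis
    proof (cases "increment_L1 f s")
      case (real u)
      have "of_nat (2 * m) * increment_L1 f s + ennreal (c / 2 * (1 / 2 ^ n) powr \<alpha>)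
        = ennreal (real (2 * m) * u + c / 2 * (1 / 2 ^ n) powr \<alpha>)"
        using real c by (subst ennreal_plus) (auto simp: ennreal_mult ennreal_of_nat_eq_real_of_nat simp del: of_nat_mult)
      with le have "ennreal (c * (1 / 2 ^ n) powr \<alpha>) \<le> ennreal (real (2 * m) * u + c / 2 * (1 / 2 ^ n) powr \<alpha>)" by simp
      then have "c * (1 / 2 ^ n) powr \<alpha> \<le> real (2 * m) * u + c / 2 * (1 / 2 ^ n) powr \<alpha>"
        using real c by (subst (asm) ennreal_le_iff) auto
      then have "c / 2 * (1 / 2 ^ n) powr \<alpha> \<le> real (2 * m) * u" by simp
      moreover have "c / 2 * s powr \<alpha> \<le> c / 2 * (1 / 2 ^ n) powr \<alpha>"
        using sn s \<alpha> c by (intro mult_left_mono powr_mono2) auto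
      ultimately have "c / (4 * real m) * s powr \<alpha> \<le> u" using m by (simp add: field_simps)
      then show ?thesis unfolding real by (rule ennreal_leI)
    qed simp
  qed
  show ?thesis
  proof (intro exI conjI allI impI)
    show "0 < c / (4 * real m)" using c m by simp
    show "0 < s0" by (rule s0)
    show "ennreal (c / (4 * real m) * s powr \<alpha>) \<le> increment_L1 f s" if "0 < s \<and> s < s0" for s
      using main[of s] that by simp
  qed
qed

section \<open>Path regularity of fractional Brownian motion\<close>

text \<open>For l = c / sqrt \<epsilon> the bound on Q gives (|Q| / l)^2 \<le> \<epsilon> R^2, so
  the modular at l is finite; by convexity it is then at most 1 at a suitable multiple of l.\<close>

lemma orlicz_spaceI_exp:
  assumes N: "young_function N" and \<tau>: "\<And>x. x \<ge> \<tau> \<Longrightarrow> N x = exp (x\<^sup>2) - 1" "\<tau> \<ge> 0"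
    and Q [measurable]: "Q \<in> borel_measurable M" and R [measurable]: "R \<in> borel_measurable M"
    and M: "emeasure M (space M) = 1" and c: "c > 0" and \<epsilon>: "\<epsilon> > 0"
    and QR: "AE \<omega> in M. \<bar>Q \<omega>\<bar> \<le> c * R \<omega>"
    and fin: "(\<integral>\<^sup>+ \<omega>. ennreal (exp (\<epsilon> * (R \<omega>)\<^sup>2)) \<partial>M) < \<infinity>"
  shows "Q \<in> orlicz_space N M"
proof -
  have \<tau>0: "N \<tau> \<ge> 0" by (rule young_nonneg[OF N \<tau>(2)])
  define l where "l = c / sqrt \<epsilon>"
  have l: "l > 0" using c \<epsilon> by (simp add: l_def)
  obtain B where B: "(\<integral>\<^sup>+ \<omega>. ennreal (exp (\<epsilon> * (R \<omega>)\<^sup>2)) \<partial>M) = ennreal B" "B \<ge> 0"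
    using fin by (cases "\<integral>\<^sup>+ \<omega>. ennreal (exp (\<epsilon> * (R \<omega>)\<^sup>2)) \<partial>M") auto
  define K where "K = N \<tau> + B + 1"
  have "luxemburg_modular N M Q l \<le> (\<integral>\<^sup>+ \<omega>. ennreal (N \<tau>) + ennreal (exp (\<epsilon> * (R \<omega>)\<^sup>2)) \<partial>M)"
    unfolding luxemburg_modular_def
  proof (rule nn_integral_mono_AE)
    show "AE \<omega> in M. ennreal (N (\<bar>Q \<omega>\<bar> / l)) \<le> ennreal (N \<tau>) + ennreal (exp (\<epsilon> * (R \<omega>)\<^sup>2))"
      using QR
    proof eventually_elim
      case (elim \<omega>)
      have "\<bar>Q \<omega>\<bar> / l \<le> sqrt \<epsilon> * R \<omega>"
        using elim c \<epsilon> by (simp add: l_def field_simps)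
      then have "(\<bar>Q \<omega>\<bar> / l)\<^sup>2 \<le> (sqrt \<epsilon> * R \<omega>)\<^sup>2" using l by (intro power_mono) auto
      also have "\<dots> = \<epsilon> * (R \<omega>)\<^sup>2" using \<epsilon> by (simp add: power_mult_distrib)
      finally have "exp ((\<bar>Q \<omega>\<bar> / l)\<^sup>2) \<le> exp (\<epsilon> * (R \<omega>)\<^sup>2)" by simp
      moreover have "N (\<bar>Q \<omega>\<bar> / l) \<le> N \<tau> + (exp ((\<bar>Q \<omega>\<bar> / l)\<^sup>2) - 1)"
        using l by (intro exp_type_upper[OF N \<tau>]) auto
      ultimately have "ennreal (N (\<bar>Q \<omega>\<bar> / l)) \<le> ennreal (N \<tau> + exp (\<epsilon> * (R \<omega>)\<^sup>2))"
        by (intro ennreal_leI) linarith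
      then show ?case using \<tau>0 by (simp add: ennreal_plus)
    qed
  qed
  also have "\<dots> = ennreal (N \<tau>) + ennreal B" by (simp add: nn_integral_add M B)
  also have "\<dots> = ennreal (N \<tau> + B)" using \<tau>0 B by simp
  also have "\<dots> \<le> ennreal K" by (intro ennreal_leI) (simp add: K_def)
  finally have "luxemburg_norm N M Q \<le> ennreal (K * l)"
    using \<tau>0 B by (intro luxemburg_norm_le_scaled[OF N Q l]) (auto simp: K_def)
  then show ?thesis by (auto simp: orlicz_space_def intro: order.strict_trans1)
qed

section \<open>The supremum over dyadic shifts and the Besov-Orlicz norm\<close>

locale unit_fbm_young = unit_fbm +
  fixes N :: "real \<Rightarrow> real" and \<tau> :: real
  assumes N: "young_function N" and \<tau>: "\<And>x. x \<ge> \<tau> \<Longrightarrow> N x = exp (x\<^sup>2) - 1" "\<tau> \<ge> 0"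
begin

definition K where "K = N \<tau> + 1"

lemma K_ge_1: "K \<ge> 1"
  using young_nonneg[OF N \<tau>(2)] by (simp add: K_def)

text \<open>The increment over a shift of length 1 lives on the empty set, so index 0 is free; it
  carries the norm of the path itself, and one supremum controls the whole Besov-Orlicz
  norm.\<close>

definition dyadic_norm :: "nat \<Rightarrow> 'a \<Rightarrow> ennreal" where
  "dyadic_norm n \<omega> = (if n = 0 then luxemburg_norm N (lborel_on {0<..<1}) (\<lambda>x. Z x \<omega>)
     else ennreal ((1 / 2 ^ n) powr (- \<alpha>)) * increment_norm N (\<lambda>x. Z x \<omega>) (1 / 2 ^ n))"

lemma increment_measurable [measurable]: "(\<lambda>(x, \<omega>). Z (x + h) \<omega> - Z x \<omega>) \<in> borel_measurable (lborel \<Otimes>\<^sub>M M)"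
proof -
  have "(\<lambda>p. (\<lambda>(t, \<omega>). Z t \<omega>) (fst p + h, snd p)) \<in> borel_measurable (lborel \<Otimes>\<^sub>M M)" by measurable
  then show ?thesis by (simp add: split_beta')
qed

lemma increment_norm_measurable [measurable]: "(\<lambda>\<omega>. increment_norm N (\<lambda>x. Z x \<omega>) h) \<in> borel_measurable M"
  unfolding increment_norm_def by (rule luxemburg_norm_measurable[OF N increment_measurable]) simp

lemma path_norm_measurable [measurable]:
  "(\<lambda>\<omega>. luxemburg_norm N (lborel_on {0<..<1}) (\<lambda>x. Z x \<omega>)) \<in> borel_measurable M"
  by (rule luxemburg_norm_measurable[OF N Z_measurable]) simp

lemma dyadic_norm_measurable [measurable]: "dyadic_norm n \<in> borel_measurable M"
  unfolding dyadic_norm_def by (cases "n = 0") simp_all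

lemma dyadic_norm_tail:
  assumes l: "l \<ge> K * sqrt 8"
  shows "emeasure M {\<omega> \<in> space M. ennreal l < dyadic_norm n \<omega>}
    \<le> ennreal (29 * ((1/2) powr (min (1/4) (1 - \<alpha>))) ^ n * (((2/3) powr (1/8)) powr (1 / K\<^sup>2)) powr (l\<^sup>2))"
proof -
  have K0: "K > 0" using K_ge_1 by simp
  \<comment> \<open>K is the factor lost in \<open>luxemburg_norm_le_exp\<close>: a normalised norm
    above l = K k forces the integral of exp((Y / k)^2) - 1, or of its analogue for Z, above
    1.\<close>
  define k where "k = l / K"
  have k8: "k \<ge> sqrt 8" using l K0 by (simp add: k_def field_simps)
  then have k: "k > 0" by (rule less_le_trans[rotated]) simp
  have kk: "k\<^sup>2 \<ge> 8" using k8 real_sqrt_le_iff[of 8 "k\<^sup>2"] k by simp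
  have lk: "l = K * k" using K0 by (simp add: k_def)
  have q: "(((2/3) powr (1/8)) powr (1 / K\<^sup>2)) powr (l\<^sup>2) = ((2/3 :: real) powr (1/8)) powr (k\<^sup>2)"
    by (simp add: powr_powr k_def power_divide)
  show ?thesis
  proof (cases "n = 0")
    case True
    have "{\<omega> \<in> space M. ennreal l < dyadic_norm n \<omega>}
      \<subseteq> {\<omega> \<in> space M. 1 < (\<integral>\<^sup>+ x \<in> {0<..<1}. ennreal (exp ((Z x \<omega> / k)\<^sup>2) - 1) \<partial>lborel)}"
    proof safe
      fix \<omega> assume [measurable]: "\<omega> \<in> space M" and gt: "ennreal l < dyadic_norm n \<omega>"
      show "1 < (\<integral>\<^sup>+ x \<in> {0<..<1}. ennreal (exp ((Z x \<omega> / k)\<^sup>2) - 1) \<partial>lborel)"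
      proof (rule ccontr)
        assume "\<not> ?thesis"
        then have "luxemburg_norm N (lborel_on {0<..<1}) (\<lambda>x. Z x \<omega>) \<le> ennreal ((N \<tau> + 1) * k)"
          by (intro luxemburg_norm_le_exp[OF N \<tau> _ _ k] measurable_lborel_on emeasure_lborel_on_le)
             (auto simp: nn_integral_lborel_on not_less)
        then show False using gt True by (simp add: dyadic_norm_def lk K_def not_less[symmetric])
      qed
    qed
    then have "emeasure M {\<omega> \<in> space M. ennreal l < dyadic_norm n \<omega>}
      \<le> emeasure M {\<omega> \<in> space M. 1 < (\<integral>\<^sup>+ x \<in> {0<..<1}. ennreal (exp ((Z x \<omega> / k)\<^sup>2) - 1) \<partial>lborel)}"
      by (rule emeasure_mono) measurable
    \<comment> \<open>At index 0 no decay in h is required, so the bound from convexity suffices; on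
      the unit interval the variances t powr (2 * \<alpha>) of the path are at most 1.\<close>
    also have "\<dots> \<le> ennreal (3 * (2/3) powr (k\<^sup>2 / 4))"
    proof (rule exp_square_tail[OF Z_measurable _ _ _ k kk])
      show "\<exists>v\<le>1. centered_gaussian M v (Z x)" if "x \<in> {0<..<1}" for x
        using that alpha powr_mono2[of "2 * \<alpha>" x 1]
        by (intro exI[of _ "x powr (2 * \<alpha>)"] conjI Z_gaussian) auto
    qed auto
    also have "\<dots> \<le> ennreal (29 * ((2/3) powr (1/8)) powr (k\<^sup>2))"
    proof (intro ennreal_leI mult_mono)
      show "(2/3) powr (k\<^sup>2 / 4) \<le> ((2/3 :: real) powr (1/8)) powr (k\<^sup>2)"
        unfolding powr_powr by (intro powr_mono') auto
    qed auto
    finally show ?thesis unfolding q using True by simp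
  next
    case False
    define h :: real where "h = 1 / 2 ^ n"
    have h: "0 < h" "h < 1" using False by (auto simp: h_def)
    have "{\<omega> \<in> space M. ennreal l < dyadic_norm n \<omega>}
      \<subseteq> {\<omega> \<in> space M. 1 < (\<integral>\<^sup>+ x \<in> {0<..<1 - h}. ennreal (exp ((Y h x \<omega> / k)\<^sup>2) - 1) \<partial>lborel)}"
    proof safe
      fix \<omega> assume [measurable]: "\<omega> \<in> space M" and gt: "ennreal l < dyadic_norm n \<omega>"
      show "1 < (\<integral>\<^sup>+ x \<in> {0<..<1 - h}. ennreal (exp ((Y h x \<omega> / k)\<^sup>2) - 1) \<partial>lborel)"
      proof (rule ccontr)
        assume "\<not> ?thesis"
        then have "(\<integral>\<^sup>+ x. ennreal (exp (((Z (x + h) \<omega> - Z x \<omega>) / (k * h powr \<alpha>))\<^sup>2) - 1) \<partial>lborel_on {0<..<1 - h}) \<le> 1"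
          by (simp add: nn_integral_lborel_on not_less Y_def mult.commute)
        then have "increment_norm N (\<lambda>x. Z x \<omega>) h \<le> ennreal ((N \<tau> + 1) * (k * h powr \<alpha>))"
          unfolding increment_norm_def using h k
          by (intro luxemburg_norm_le_exp[OF N \<tau>] measurable_lborel_on emeasure_lborel_on_le) auto
        then have "dyadic_norm n \<omega> \<le> ennreal (h powr (- \<alpha>)) * ennreal (l * h powr \<alpha>)"
          using False by (auto simp: dyadic_norm_def h_def[symmetric] lk K_def mult.assoc intro!: mult_left_mono)
        also have "\<dots> = ennreal (h powr (- \<alpha>) * (l * h powr \<alpha>))"
          using k K0 by (subst ennreal_mult) (auto simp: lk)
        also have "h powr (- \<alpha>) * (l * h powr \<alpha>) = l * (h powr (- \<alpha>) * h powr \<alpha>)" by simp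
        also have "h powr (- \<alpha>) * h powr \<alpha> = 1" using h by (simp flip: powr_add)
        finally show False using gt by simp
      qed
    qed
    then have "emeasure M {\<omega> \<in> space M. ennreal l < dyadic_norm n \<omega>}
      \<le> emeasure M {\<omega> \<in> space M. 1 < (\<integral>\<^sup>+ x \<in> {0<..<1 - h}. ennreal (exp ((Y h x \<omega> / k)\<^sup>2) - 1) \<partial>lborel)}"
      by (rule emeasure_mono) measurable
    also have "\<dots> \<le> ennreal (29 * h powr (min (1/4) (1 - \<alpha>)) * ((2/3) powr (1/8)) powr (k\<^sup>2))"
      by (rule Y_exp_bound[OF h k kk])
    also have "h powr (min (1/4) (1 - \<alpha>)) = ((1/2) powr (min (1/4) (1 - \<alpha>))) ^ n"
    proof -
      have "h = (1/2) powr real n" by (simp add: h_def powr_realpow power_divide)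
      then have "h powr (min (1/4) (1 - \<alpha>)) = ((1/2) powr (min (1/4) (1 - \<alpha>))) powr real n"
        by (simp add: powr_powr mult.commute)
      then show ?thesis by (simp add: powr_realpow)
    qed
    finally show ?thesis unfolding q .
  qed
qed

definition dyadic_sup :: "'a \<Rightarrow> ennreal" where "dyadic_sup \<omega> = (SUP n. dyadic_norm n \<omega>)"

lemma dyadic_sup_measurable [measurable]: "dyadic_sup \<in> borel_measurable M"
  unfolding dyadic_sup_def by measurable

lemma dyadic_sup_finite: "AE \<omega> in M. dyadic_sup \<omega> < \<infinity>"
  and dyadic_sup_exp: "\<exists>\<epsilon>>0. (\<integral>\<^sup>+ \<omega>. ennreal (exp (\<epsilon> * (enn2real (dyadic_sup \<omega>))\<^sup>2)) \<partial>M) < \<infinity>"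
proof -
  have r: "0 \<le> (1/2 :: real) powr (min (1/4) (1 - \<alpha>))" "(1/2 :: real) powr (min (1/4) (1 - \<alpha>)) < 1"
    using alpha powr_less_mono'[of "1/2" 0 "min (1/4) (1 - \<alpha>)"] by auto
  have q1: "(2/3 :: real) powr (1/8) < 1" using powr_less_mono'[of "2/3" 0 "1/8"] by simp
  have q: "0 < ((2/3 :: real) powr (1/8)) powr (1 / K\<^sup>2)" "((2/3 :: real) powr (1/8)) powr (1 / K\<^sup>2) < 1"
    using q1 K_ge_1 powr_less_mono'[of "(2/3) powr (1/8)" 0 "1 / K\<^sup>2"] by auto
  show "AE \<omega> in M. dyadic_sup \<omega> < \<infinity>"
    and "\<exists>\<epsilon>>0. (\<integral>\<^sup>+ \<omega>. ennreal (exp (\<epsilon> * (enn2real (dyadic_sup \<omega>))\<^sup>2)) \<partial>M) < \<infinity>"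
    unfolding dyadic_sup_def
    using sup_square_exponential[OF dyadic_norm_measurable dyadic_norm_tail _ r q] by auto
qed

text \<open>The sum of the geometric series in \<open>increment_norm_dyadic_bound\<close>: the loss
  in passing from dyadic powers to all shifts.\<close>

definition \<kappa> where "\<kappa> = 1 / (1 - 2 powr (- \<alpha>))"

lemma \<kappa>_pos: "\<kappa> > 0"
  using alpha by (simp add: \<kappa>_def powr_less_one)

lemma path_norm_le: "luxemburg_norm N (lborel_on {0<..<1}) (\<lambda>x. Z x \<omega>) \<le> dyadic_sup \<omega>"
  unfolding dyadic_sup_def by (rule SUP_upper2[of 0]) (auto simp: dyadic_norm_def)

lemma increment_norm_le:
  assumes \<omega>: "\<omega> \<in> space M" "dyadic_sup \<omega> < \<infinity>" and h: "0 < h" "h < 1"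
  shows "increment_norm N (\<lambda>x. Z x \<omega>) h \<le> ennreal (enn2real (dyadic_sup \<omega>) * \<kappa> * h powr \<alpha>)"
proof -
  define R where "R = enn2real (dyadic_sup \<omega>)"
  have R: "dyadic_sup \<omega> = ennreal R" "R \<ge> 0" using \<omega> by (auto simp: R_def)
  have "increment_norm N (\<lambda>x. Z x \<omega>) (1 / 2 ^ n) \<le> ennreal (R * (1 / 2 ^ n) powr \<alpha>)" for n
  proof (cases "n = 0")
    case True
    then have "increment_norm N (\<lambda>x. Z x \<omega>) (1 / 2 ^ n) = 0"
      unfolding increment_norm_def by (intro luxemburg_norm_zero[OF N]) auto
    then show ?thesis by simp
  next
    case False
    define h :: real where "h = 1 / 2 ^ n"
    have h: "h > 0" by (simp add: h_def)
    have "dyadic_norm n \<omega> \<le> ennreal R" unfolding R(1)[symmetric] dyadic_sup_def by (rule SUP_upper) simp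
    then have le: "ennreal (h powr (- \<alpha>)) * increment_norm N (\<lambda>x. Z x \<omega>) h \<le> ennreal R"
      using False by (simp add: dyadic_norm_def h_def)
    have "h powr \<alpha> * h powr (- \<alpha>) = 1" using h by (simp flip: powr_add)
    then have "increment_norm N (\<lambda>x. Z x \<omega>) h = ennreal (h powr \<alpha> * h powr (- \<alpha>)) * increment_norm N (\<lambda>x. Z x \<omega>) h"
      by simp
    also have "\<dots> = ennreal (h powr \<alpha>) * (ennreal (h powr (- \<alpha>)) * increment_norm N (\<lambda>x. Z x \<omega>) h)"
      by (subst ennreal_mult) (auto simp: mult.assoc)
    also have "\<dots> \<le> ennreal (h powr \<alpha>) * ennreal R" by (intro mult_left_mono le) auto
    also have "\<dots> = ennreal (R * h powr \<alpha>)" using R by (subst ennreal_mult[symmetric]) (auto simp: mult.commute)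
    finally show ?thesis by (simp add: h_def)
  qed
  then have "increment_norm N (\<lambda>x. Z x \<omega>) h \<le> ennreal (R / (1 - 2 powr (- \<alpha>)) * h powr \<alpha>)"
    using \<omega> h alpha R by (intro increment_norm_dyadic_bound[OF N]) (auto intro: Z_outside)
  then show ?thesis by (simp add: R_def \<kappa>_def)
qed

lemma seminorm_le:
  assumes \<omega>: "\<omega> \<in> space M" "dyadic_sup \<omega> < \<infinity>"
  shows "besov_orlicz_seminorm N \<alpha> {0<..<1} (\<lambda>x. Z x \<omega>) \<le> ennreal (enn2real (dyadic_sup \<omega>) * \<kappa>)"
proof -
  note [measurable] = \<omega>(1)
  have f: "(\<lambda>x. Z x \<omega>) \<in> borel_measurable borel" by measurable
  show ?thesis
    unfolding besov_orlicz_seminorm_unit[OF N f alpha(1)]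
  proof (rule SUP_least)
    fix h :: real assume h: "h \<in> {0<..<1}"
    have "ennreal (h powr (- \<alpha>)) * increment_norm N (\<lambda>x. Z x \<omega>) h
      \<le> ennreal (h powr (- \<alpha>)) * ennreal (enn2real (dyadic_sup \<omega>) * \<kappa> * h powr \<alpha>)"
      using h by (intro mult_left_mono increment_norm_le \<omega>) auto
    also have "\<dots> = ennreal (h powr (- \<alpha>) * (enn2real (dyadic_sup \<omega>) * \<kappa> * h powr \<alpha>))"
      using \<kappa>_pos by (subst ennreal_mult) auto
    also have "h powr (- \<alpha>) * (enn2real (dyadic_sup \<omega>) * \<kappa> * h powr \<alpha>) = enn2real (dyadic_sup \<omega>) * \<kappa> * (h powr (- \<alpha>) * h powr \<alpha>)" by simp
    also have "h powr (- \<alpha>) * h powr \<alpha> = 1" using h by (simp flip: powr_add)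
    finally show "ennreal (h powr (- \<alpha>)) * increment_norm N (\<lambda>x. Z x \<omega>) h \<le> ennreal (enn2real (dyadic_sup \<omega>) * \<kappa>)" by simp
  qed
qed

lemma besov_norm_le:
  assumes \<omega>: "\<omega> \<in> space M" "dyadic_sup \<omega> < \<infinity>"
  shows "besov_orlicz_norm N \<alpha> {0<..<1} (\<lambda>x. Z x \<omega>) \<le> ennreal ((1 + \<kappa>) * enn2real (dyadic_sup \<omega>))"
proof -
  define R where "R = enn2real (dyadic_sup \<omega>)"
  have R: "dyadic_sup \<omega> = ennreal R" "R \<ge> 0" using \<omega> by (auto simp: R_def)
  have "besov_orlicz_norm N \<alpha> {0<..<1} (\<lambda>x. Z x \<omega>) \<le> ennreal R + ennreal (R * \<kappa>)"
    unfolding besov_orlicz_norm_def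
  proof (rule add_mono)
    show "luxemburg_norm N (lebesgue_on {0<..<1}) (\<lambda>x. Z x \<omega>) \<le> ennreal R"
      using path_norm_le[of \<omega>] by (simp add: luxemburg_norm_lebesgue_on R(1))
    show "besov_orlicz_seminorm N \<alpha> {0<..<1} (\<lambda>x. Z x \<omega>) \<le> ennreal (R * \<kappa>)"
      using seminorm_le[OF \<omega>] by (simp add: R_def)
  qed
  also have "ennreal R + ennreal (R * \<kappa>) = ennreal ((1 + \<kappa>) * R)"
    using \<kappa>_pos R(2) by (subst ennreal_plus[symmetric]) (auto simp: algebra_simps)
  finally show ?thesis by (simp add: R_def)
qed

lemma besov_norm_measurable: "(\<lambda>\<omega>. besov_orlicz_norm N \<alpha> {0<..<1} (\<lambda>x. Z x \<omega>)) \<in> borel_measurable M"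
proof -
  have "besov_orlicz_norm N \<alpha> {0<..<1} (\<lambda>x. Z x \<omega>) = luxemburg_norm N (lborel_on {0<..<1}) (\<lambda>x. Z x \<omega>)
      + (SUP h\<in>unit_dyadics. ennreal (h powr (- \<alpha>)) * increment_norm N (\<lambda>x. Z x \<omega>) h)"
    if [measurable]: "\<omega> \<in> space M" for \<omega>
    unfolding besov_orlicz_norm_def
    by (subst besov_orlicz_seminorm_dyadics[OF N _ _ alpha(1)])
       (auto simp: luxemburg_norm_lebesgue_on intro: Z_outside)
  moreover have "(\<lambda>\<omega>. luxemburg_norm N (lborel_on {0<..<1}) (\<lambda>x. Z x \<omega>)
      + (SUP h\<in>unit_dyadics. ennreal (h powr (- \<alpha>)) * increment_norm N (\<lambda>x. Z x \<omega>) h)) \<in> borel_measurable M"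
    using countable_dyadics by measurable
  ultimately show ?thesis by (simp cong: measurable_cong)
qed

lemma besov_norm_orlicz:
  "(\<lambda>\<omega>. enn2real (besov_orlicz_norm N \<alpha> {0<..<1} (\<lambda>x. Z x \<omega>))) \<in> orlicz_space N M"
proof -
  note [measurable] = besov_norm_measurable
  obtain \<epsilon> where \<epsilon>: "\<epsilon> > 0" "(\<integral>\<^sup>+ \<omega>. ennreal (exp (\<epsilon> * (enn2real (dyadic_sup \<omega>))\<^sup>2)) \<partial>M) < \<infinity>" using dyadic_sup_exp by blast
  show ?thesis
  proof (rule orlicz_spaceI_exp[OF N \<tau> _ _ emeasure_space_1 _ \<epsilon>(1) _ \<epsilon>(2)])
    show "AE \<omega> in M. \<bar>enn2real (besov_orlicz_norm N \<alpha> {0<..<1} (\<lambda>x. Z x \<omega>))\<bar> \<le> (1 + \<kappa>) * enn2real (dyadic_sup \<omega>)"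
      using dyadic_sup_finite AE_space
    proof eventually_elim
      case (elim \<omega>)
      then show ?case using besov_norm_le[of \<omega>] \<kappa>_pos by (auto intro!: enn2real_leI)
    qed
    show "0 < 1 + \<kappa>" using \<kappa>_pos by simp
  qed measurable
qed

section \<open>Quadratic variation along dyadic shifts\<close>

lemma AE_quadratic_variation:
  "AE \<omega> in M. \<forall>\<^sub>F n in sequentially. ennreal (1/4) \<le> (\<integral>\<^sup>+ x \<in> {0<..<1 - 1 / 2 ^ n}. ennreal ((Y (1 / 2 ^ n) x \<omega>)\<^sup>2) \<partial>lborel)"
proof -
  let ?\<delta> = "min (1/2) (2 - 2 * \<alpha>)"
  \<comment> \<open>Starting at index 1 keeps h \<le> 1/2, so the mean 1 - h is at least 1/2, and a
    deviation below 1/4 leaves at least 1/4.\<close>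
  let ?h = "\<lambda>n :: nat. 1 / 2 ^ Suc n :: real"
  let ?I = "\<lambda>n. {0<..<1 - ?h n}"
  let ?T = "\<lambda>n \<omega>. \<integral>\<^sup>+ x \<in> ?I n. ennreal ((Y (?h n) x \<omega>)\<^sup>2) \<partial>lborel"
  define E where "E n = {\<omega> \<in> space M. 1/4 \<le> \<bar>enn2real (?T n \<omega>) - 1 * (1 - ?h n)\<bar>}" for n
  have h: "0 < ?h n" "?h n < 1" for n by (auto simp: field_simps intro: less_le_trans[of _ 2])
  have E [measurable]: "E n \<in> sets M" for n unfolding E_def by measurable
  have bound: "emeasure M (E n) \<le> ennreal (132 * ?h n powr ?\<delta> / (1/4)\<^sup>2)" for n
    unfolding E_def
  proof (rule random_integral_chebyshev(1)[where r="\<lambda>x y. 2 * (fbm_corr \<alpha> (?h n) (y - x))\<^sup>2"])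
    show "(\<integral>\<^sup>+ \<omega>. ennreal ((Y (?h n) x \<omega>)\<^sup>2) \<partial>M) = ennreal 1" if "x \<in> ?I n" for x
      using that centered_gaussian_moments(3,4)[OF Y_gaussian[OF h, of x n]]
      by (subst nn_integral_eq_integral) auto
    show "(\<integral>\<^sup>+ \<omega>. ennreal ((Y (?h n) x \<omega>)\<^sup>2) * ennreal ((Y (?h n) y \<omega>)\<^sup>2) \<partial>M)
      \<le> ennreal (1\<^sup>2) + ennreal (2 * (fbm_corr \<alpha> (?h n) (y - x))\<^sup>2)" if "x \<in> ?I n" "y \<in> ?I n" for x y
    proof -
      \<comment> \<open>The fourth moment formula makes the covariance of the two squares equal to 2
        \<rho>^2, which doubles the constant 66 of \<open>fbm_corr_integral_bound\<close>.\<close>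
      note m = pair_fourth_moment[OF Y_pair_gaussian[OF h, of x n y]]
      have "(\<integral>\<^sup>+ \<omega>. ennreal ((Y (?h n) x \<omega>)\<^sup>2) * ennreal ((Y (?h n) y \<omega>)\<^sup>2) \<partial>M)
        = (\<integral>\<^sup>+ \<omega>. ennreal ((Y (?h n) x \<omega>)\<^sup>2 * (Y (?h n) y \<omega>)\<^sup>2) \<partial>M)"
        by (simp add: ennreal_mult)
      also have "\<dots> = ennreal (1 + 2 * (fbm_corr \<alpha> (?h n) (y - x))\<^sup>2)"
        using that m by (subst nn_integral_eq_integral) auto
      also have "\<dots> = ennreal (1\<^sup>2) + ennreal (2 * (fbm_corr \<alpha> (?h n) (y - x))\<^sup>2)"
        by (subst ennreal_plus) auto
      finally show ?thesis by simp
    qed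
    have "(\<integral>\<^sup>+ x \<in> ?I n. (\<integral>\<^sup>+ y \<in> ?I n. ennreal (2 * (fbm_corr \<alpha> (?h n) (y - x))\<^sup>2) \<partial>lborel) \<partial>lborel)
      = ennreal 2 * (\<integral>\<^sup>+ x \<in> ?I n. (\<integral>\<^sup>+ y \<in> ?I n. ennreal ((fbm_corr \<alpha> (?h n) (y - x))\<^sup>2) \<partial>lborel) \<partial>lborel)"
    proof -
      have "(\<integral>\<^sup>+ y \<in> ?I n. ennreal (2 * (fbm_corr \<alpha> (?h n) (y - x))\<^sup>2) \<partial>lborel)
        = ennreal 2 * (\<integral>\<^sup>+ y \<in> ?I n. ennreal ((fbm_corr \<alpha> (?h n) (y - x))\<^sup>2) \<partial>lborel)" for x
        by (subst nn_integral_cmult[symmetric], measurable) (simp add: ennreal_mult mult.assoc)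
      then show ?thesis by (subst nn_integral_cmult[symmetric], measurable) (simp add: mult.assoc)
    qed
    also have "\<dots> \<le> ennreal 2 * ennreal (66 * ?h n powr ?\<delta>)"
      using fbm_corr_le_1[OF h] by (intro mult_left_mono fbm_corr_integral_bound alpha h) auto
    also have "\<dots> = ennreal (132 * ?h n powr ?\<delta>)" by (subst ennreal_mult[symmetric]) auto
    finally show "(\<integral>\<^sup>+ x \<in> ?I n. (\<integral>\<^sup>+ y \<in> ?I n. ennreal (2 * (fbm_corr \<alpha> (?h n) (y - x))\<^sup>2) \<partial>lborel) \<partial>lborel)
      \<le> ennreal (132 * ?h n powr ?\<delta>)" .
    show "emeasure lborel (?I n) = ennreal (1 - ?h n)" using h[of n] by simp
  qed (use h in \<open>auto simp: less_imp_le\<close>)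
  \<comment> \<open>Along dyadic shifts the Chebyshev bounds form a geometric series, so the
    Borel-Cantelli lemma applies; 2112 = 132 * 16.\<close>
  have "AE \<omega> in M. \<forall>\<^sub>F n in sequentially. \<omega> \<in> space M - E n"
  proof (rule borel_cantelli_AE1)
    have hd: "?h n powr ?\<delta> = (1/2) powr ?\<delta> * ((1/2) powr ?\<delta>) ^ n" for n
    proof -
      have "?h n = (1/2) powr real (Suc n)" by (simp only: powr_realpow) (simp add: power_divide)
      then have "?h n powr ?\<delta> = ((1/2) powr ?\<delta>) powr real (Suc n)"
        by (simp add: powr_powr mult.commute)
      also have "\<dots> = ((1/2) powr ?\<delta>) ^ Suc n" by (rule powr_realpow) simp
      finally show ?thesis by simp
    qed
    have "(1/2 :: real) powr ?\<delta> < 1" using alpha powr_less_mono'[of "1/2" 0 ?\<delta>] by auto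
    then have sm: "summable (\<lambda>n. 2112 * ((1/2) powr ?\<delta> * ((1/2 :: real) powr ?\<delta>) ^ n))"
      by (intro summable_mult summable_geometric) simp
    have le: "measure M (E n) \<le> 2112 * ((1/2) powr ?\<delta> * ((1/2 :: real) powr ?\<delta>) ^ n)" for n
      using bound[of n] unfolding hd by (simp add: emeasure_eq_measure power_divide)
    show "summable (\<lambda>n. measure M (E n))"
      by (rule summable_comparison_test'[OF sm, of 0]) (use le in simp)
  qed (auto simp: emeasure_eq_measure)
  then show ?thesis
  proof eventually_elim
    case (elim \<omega>)
    then have "\<forall>\<^sub>F n in sequentially. ennreal (1/4) \<le> ?T n \<omega>"
    proof eventually_elim
      case (elim n)
      then have "\<bar>enn2real (?T n \<omega>) - (1 - ?h n)\<bar> < 1/4" by (auto simp: E_def)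
      moreover have "?h n \<le> 1/2" by (auto simp: field_simps)
      ultimately have "1/4 \<le> enn2real (?T n \<omega>)" by linarith
      then have "ennreal (1/4) \<le> ennreal (enn2real (?T n \<omega>))" by (rule ennreal_leI)
      also have "\<dots> \<le> ?T n \<omega>" by (cases "?T n \<omega>") auto
      finally show ?case .
    qed
    then show ?case by (subst (asm) eventually_sequentially_Suc)
  qed
qed

end

context unit_fbm_young
begin

lemma increment_L1_le:
  assumes \<omega>: "\<omega> \<in> space M" "dyadic_sup \<omega> < \<infinity>" and h: "0 < h" "h < 1"
  shows "increment_L1 (\<lambda>x. Z x \<omega>) h \<le> ennreal ((\<tau> + 2) * (enn2real (dyadic_sup \<omega>) * \<kappa> + 1) * h powr \<alpha>)"
proof -
  note [measurable] = \<omega>(1)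
  \<comment> \<open>The added 1 makes the bound on the norm strict, as
    \<open>luxemburg_norm_lessD\<close> requires.\<close>
  let ?l = "(enn2real (dyadic_sup \<omega>) * \<kappa> + 1) * h powr \<alpha>"
  have lt: "increment_norm N (\<lambda>x. Z x \<omega>) h < ennreal ?l"
  proof (rule order.strict_trans1[OF increment_norm_le[OF \<omega> h]])
    show "ennreal (enn2real (dyadic_sup \<omega>) * \<kappa> * h powr \<alpha>) < ennreal ?l"
      using h \<kappa>_pos by (subst ennreal_less_iff) (auto simp: algebra_simps)
  qed
  have "(\<integral>\<^sup>+ x. ennreal \<bar>Z (x + h) \<omega> - Z x \<omega>\<bar> \<partial>lborel_on {0<..<1 - h}) \<le> ennreal ((\<tau> + 2) * ?l)"
    using lt h unfolding increment_norm_def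
    by (intro nn_integral_abs_le_of_luxemburg_norm[OF N \<tau>] measurable_lborel_on emeasure_lborel_on_le) auto
  then show ?thesis by (simp add: increment_L1_def nn_integral_lborel_on mult.assoc)
qed

text \<open>
  The square function is bounded by \<open>c * \<bar>y\<bar> + y ^ 4 / c\<^sup>2\<close>, so a lower bound for the second moment
  of the increments and an upper bound for the fourth one bound the first moment from below.
\<close>

lemma AE_increment_L1_dyadic_lower:
  "AE \<omega> in M. \<exists>c>0. \<exists>n0. \<forall>n\<ge>n0. ennreal (c * (1 / 2 ^ n) powr \<alpha>) \<le> increment_L1 (\<lambda>x. Z x \<omega>) (1 / 2 ^ n)"
  using AE_quadratic_variation dyadic_sup_finite AE_space
proof eventually_elim
  case \<omega>: (elim \<omega>)
  note [measurable] = \<omega>(3)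
  define l where "l = enn2real (dyadic_sup \<omega>) * \<kappa> + 1"
  have l: "l > 0" using \<kappa>_pos by (simp add: l_def add_nonneg_pos)
  define B where "B = l ^ 4 * (\<tau> ^ 4 + 2)"
  have B: "B \<ge> 0" using \<tau>(2) by (simp add: B_def)
  \<comment> \<open>With this c the fourth moment contributes at most B / c^2 \<le> 1/8, half of the
    lower bound 1/4 for the second moment.\<close>
  define c where "c = sqrt (8 * B + 1)"
  have c: "c > 0" "c\<^sup>2 = 8 * B + 1" using B by (auto simp: c_def)
  from \<omega>(1) obtain n1 where n1: "\<And>n. n \<ge> n1 \<Longrightarrow>
      ennreal (1/4) \<le> (\<integral>\<^sup>+ x \<in> {0<..<1 - 1 / 2 ^ n}. ennreal ((Y (1 / 2 ^ n) x \<omega>)\<^sup>2) \<partial>lborel)"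
    by (auto simp: eventually_sequentially)
  have "ennreal (1 / (8 * c) * (1 / 2 ^ n) powr \<alpha>) \<le> increment_L1 (\<lambda>x. Z x \<omega>) (1 / 2 ^ n)"
    if n: "n \<ge> max 1 n1" for n
  proof -
    define h :: real where "h = 1 / 2 ^ n"
    have "1 < (2 :: real) ^ n" using n by (intro one_less_power) auto
    then have h: "0 < h" "h < 1" by (auto simp: h_def)
    let ?D = "lborel_on {0<..<1 - h}"
    have [measurable]: "(\<lambda>x. Y h x \<omega>) \<in> borel_measurable ?D"
      unfolding Y_def by (intro measurable_lborel_on) measurable
    have lt: "increment_norm N (\<lambda>x. Z x \<omega>) h < ennreal (l * h powr \<alpha>)"
    proof (rule order.strict_trans1[OF increment_norm_le[OF \<omega>(3,2) h]])
      show "ennreal (enn2real (dyadic_sup \<omega>) * \<kappa> * h powr \<alpha>) < ennreal (l * h powr \<alpha>)"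
        using h \<kappa>_pos by (subst ennreal_less_iff) (auto simp: l_def algebra_simps)
    qed
    have "(\<integral>\<^sup>+ x. ennreal ((\<bar>Z (x + h) \<omega> - Z x \<omega>\<bar> / (l * h powr \<alpha>)) ^ 4) \<partial>?D) \<le> ennreal (\<tau> ^ 4 + 2)"
      using lt h exp_type_lower(2)[OF N \<tau>] unfolding increment_norm_def
      by (intro nn_integral_le_of_luxemburg_norm[where G="\<lambda>x. x ^ 4", OF N] measurable_lborel_on emeasure_lborel_on_le) auto
    moreover have "(\<bar>Z (x + h) \<omega> - Z x \<omega>\<bar> / (l * h powr \<alpha>)) ^ 4 = (Y h x \<omega>) ^ 4 / l ^ 4" for x
      by (simp add: Y_def power_divide power_mult_distrib)
    ultimately have "(\<integral>\<^sup>+ x. ennreal ((Y h x \<omega>) ^ 4 / l ^ 4) \<partial>?D) \<le> ennreal (\<tau> ^ 4 + 2)" by simp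
    then have "ennreal (l ^ 4) * (\<integral>\<^sup>+ x. ennreal ((Y h x \<omega>) ^ 4 / l ^ 4) \<partial>?D) \<le> ennreal (l ^ 4) * ennreal (\<tau> ^ 4 + 2)"
      by (rule mult_left_mono) simp
    also have "\<dots> = ennreal B" using l \<tau>(2) by (subst ennreal_mult[symmetric]) (auto simp: B_def)
    also have "ennreal (l ^ 4) * (\<integral>\<^sup>+ x. ennreal ((Y h x \<omega>) ^ 4 / l ^ 4) \<partial>?D) = (\<integral>\<^sup>+ x. ennreal (l ^ 4) * ennreal ((Y h x \<omega>) ^ 4 / l ^ 4) \<partial>?D)"
      by (rule nn_integral_cmult[symmetric]) measurable
    also have "\<dots> = (\<integral>\<^sup>+ x. ennreal ((Y h x \<omega>) ^ 4) \<partial>?D)"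
      using l by (intro nn_integral_cong) (simp flip: ennreal_mult')
    finally have fourth: "(\<integral>\<^sup>+ x. ennreal ((Y h x \<omega>) ^ 4) \<partial>?D) \<le> ennreal B" .
    have pw: "y\<^sup>2 \<le> c * \<bar>y\<bar> + 1 / c\<^sup>2 * y ^ 4" for y
    proof (cases "\<bar>y\<bar> \<le> c")
      case True
      then have "\<bar>y\<bar> * \<bar>y\<bar> \<le> c * \<bar>y\<bar>" by (intro mult_right_mono) auto
      then have "y\<^sup>2 \<le> c * \<bar>y\<bar>" by (simp add: power2_eq_square)
      moreover have "0 \<le> 1 / c\<^sup>2 * y ^ 4" by (intro mult_nonneg_nonneg) auto
      ultimately show ?thesis by (intro add_increasing2)
    next
      case False
      then have "c\<^sup>2 \<le> \<bar>y\<bar>\<^sup>2" using c by (intro power_mono) auto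
      then have "c\<^sup>2 * y\<^sup>2 \<le> y\<^sup>2 * y\<^sup>2" by (intro mult_right_mono) auto
      then have "y\<^sup>2 \<le> 1 / c\<^sup>2 * y ^ 4" using c(1) by (simp add: field_simps power2_eq_square power4_eq_xxxx)
      then show ?thesis using c by (simp add: add_increasing)
    qed
    have "ennreal (1/4) \<le> (\<integral>\<^sup>+ x. ennreal ((Y h x \<omega>)\<^sup>2) \<partial>?D)"
      using n1[of n] n by (simp add: nn_integral_lborel_on h_def)
    also have "\<dots> \<le> (\<integral>\<^sup>+ x. ennreal c * ennreal \<bar>Y h x \<omega>\<bar> + ennreal (1 / c\<^sup>2) * ennreal ((Y h x \<omega>) ^ 4) \<partial>?D)"
    proof (intro nn_integral_mono)
      fix x
      have "ennreal ((Y h x \<omega>)\<^sup>2) \<le> ennreal (c * \<bar>Y h x \<omega>\<bar> + 1 / c\<^sup>2 * (Y h x \<omega>) ^ 4)"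
        by (intro ennreal_leI pw)
      also have "\<dots> = ennreal c * ennreal \<bar>Y h x \<omega>\<bar> + ennreal (1 / c\<^sup>2) * ennreal ((Y h x \<omega>) ^ 4)"
      proof -
        have "ennreal (c * \<bar>Y h x \<omega>\<bar>) = ennreal c * ennreal \<bar>Y h x \<omega>\<bar>"
          "ennreal (1 / c\<^sup>2 * (Y h x \<omega>) ^ 4) = ennreal (1 / c\<^sup>2) * ennreal ((Y h x \<omega>) ^ 4)"
          using c(1) by (auto intro!: ennreal_mult simp del: times_divide_eq_left)
        moreover have "ennreal (c * \<bar>Y h x \<omega>\<bar> + 1 / c\<^sup>2 * (Y h x \<omega>) ^ 4)
            = ennreal (c * \<bar>Y h x \<omega>\<bar>) + ennreal (1 / c\<^sup>2 * (Y h x \<omega>) ^ 4)"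
          using c(1) by (intro ennreal_plus) auto
        ultimately show ?thesis by simp
      qed
      finally show "ennreal ((Y h x \<omega>)\<^sup>2) \<le> ennreal c * ennreal \<bar>Y h x \<omega>\<bar> + ennreal (1 / c\<^sup>2) * ennreal ((Y h x \<omega>) ^ 4)" .
    qed
    also have "\<dots> = ennreal c * (\<integral>\<^sup>+ x. ennreal \<bar>Y h x \<omega>\<bar> \<partial>?D) + ennreal (1 / c\<^sup>2) * (\<integral>\<^sup>+ x. ennreal ((Y h x \<omega>) ^ 4) \<partial>?D)"
      by (simp add: nn_integral_add nn_integral_cmult)
    also have "\<dots> \<le> ennreal c * (\<integral>\<^sup>+ x. ennreal \<bar>Y h x \<omega>\<bar> \<partial>?D) + ennreal (1 / c\<^sup>2) * ennreal B"
      by (intro add_left_mono mult_left_mono fourth) auto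
    also have "ennreal (1 / c\<^sup>2) * ennreal B \<le> ennreal (1/8)"
      using B by (subst ennreal_mult[symmetric]) (auto simp: c(2) field_simps intro!: ennreal_leI)
    finally have le: "ennreal (1/4) \<le> ennreal c * (\<integral>\<^sup>+ x. ennreal \<bar>Y h x \<omega>\<bar> \<partial>?D) + ennreal (1/8)"
      by (simp add: add_left_mono)
    have J: "increment_L1 (\<lambda>x. Z x \<omega>) h = ennreal (h powr \<alpha>) * (\<integral>\<^sup>+ x. ennreal \<bar>Y h x \<omega>\<bar> \<partial>?D)"
    proof -
      have "increment_L1 (\<lambda>x. Z x \<omega>) h = (\<integral>\<^sup>+ x. ennreal \<bar>Z (x + h) \<omega> - Z x \<omega>\<bar> \<partial>?D)"
        by (simp add: increment_L1_def nn_integral_lborel_on)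
      also have "\<dots> = (\<integral>\<^sup>+ x. ennreal (h powr \<alpha>) * ennreal \<bar>Y h x \<omega>\<bar> \<partial>?D)"
        using h by (intro nn_integral_cong) (simp add: Y_def abs_divide flip: ennreal_mult')
      also have "\<dots> = ennreal (h powr \<alpha>) * (\<integral>\<^sup>+ x. ennreal \<bar>Y h x \<omega>\<bar> \<partial>?D)"
        by (rule nn_integral_cmult) measurable
      finally show ?thesis .
    qed
    have "ennreal (1 / (8 * c)) \<le> (\<integral>\<^sup>+ x. ennreal \<bar>Y h x \<omega>\<bar> \<partial>?D)"
    proof (cases "\<integral>\<^sup>+ x. ennreal \<bar>Y h x \<omega>\<bar> \<partial>?D")
      case (real u)
      have "ennreal c * ennreal u + ennreal (1/8) = ennreal (c * u + 1/8)"
        using real(1) c(1) by (subst ennreal_plus) (auto simp: ennreal_mult)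
      then have "ennreal (1/4) \<le> ennreal (c * u + 1/8)" using le unfolding real(2) by simp
      then have "1/4 \<le> c * u + 1/8" using real(1) c(1) by (subst (asm) ennreal_le_iff) auto
      then have "1 / (8 * c) \<le> u" using c(1) by (simp add: field_simps)
      then show ?thesis unfolding real(2) by (rule ennreal_leI)
    qed simp
    then have "ennreal (h powr \<alpha>) * ennreal (1 / (8 * c)) \<le> increment_L1 (\<lambda>x. Z x \<omega>) h"
      unfolding J by (rule mult_left_mono) simp
    then show ?thesis using c(1) by (subst (asm) ennreal_mult[symmetric]) (auto simp: h_def mult.commute)
  qed
  then show ?case using c(1) by (intro exI[of _ "1 / (8 * c)"] conjI exI[of _ "max 1 n1"] allI impI) auto
qed

lemma AE_increment_L1_lower:
  "AE \<omega> in M. \<exists>c>0. \<exists>s0>0. \<forall>s. 0 < s \<and> s < s0 \<longrightarrow> ennreal (c * s powr \<alpha>) \<le> increment_L1 (\<lambda>x. Z x \<omega>) s"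
  using AE_increment_L1_dyadic_lower dyadic_sup_finite AE_space
proof eventually_elim
  case \<omega>: (elim \<omega>)
  note [measurable] = \<omega>(3)
  from \<omega>(1) obtain c n0 where c: "c > 0"
    "\<And>n. n \<ge> n0 \<Longrightarrow> ennreal (c * (1 / 2 ^ n) powr \<alpha>) \<le> increment_L1 (\<lambda>x. Z x \<omega>) (1 / 2 ^ n)" by auto
  show ?case
  proof (rule increment_L1_lower[OF _ alpha(1) c(1) _ c(2) increment_L1_le[OF \<omega>(3,2)]])
    show "0 \<le> (\<tau> + 2) * (enn2real (dyadic_sup \<omega>) * \<kappa> + 1)" using \<tau>(2) \<kappa>_pos by (intro mult_nonneg_nonneg) auto
  qed auto
qed

text \<open>c, s0 and the dyadic supremum are fixed for the path before p is chosen, so a single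
  null set serves all p.\<close>

lemma AE_increment_Theta:
  "AE \<omega> in M. (\<forall>p\<ge>1. in_Theta_right 0 (\<lambda>s. Lp_norm p (lebesgue_on {0<..<1 - s}) (\<lambda>x. Z (x + s) \<omega> - Z x \<omega>)) (\<lambda>s. s powr \<alpha>))
    \<and> in_Theta_right 0 (\<lambda>s. luxemburg_norm N (lebesgue_on {0<..<1 - s}) (\<lambda>x. Z (x + s) \<omega> - Z x \<omega>)) (\<lambda>s. s powr \<alpha>)"
  using AE_increment_L1_lower dyadic_sup_finite AE_space
proof eventually_elim
  case \<omega>: (elim \<omega>)
  note [measurable] = \<omega>(3)
  from \<omega>(1) obtain c s0 where c: "c > 0" "s0 > 0"
    "\<And>s. 0 < s \<Longrightarrow> s < s0 \<Longrightarrow> ennreal (c * s powr \<alpha>) \<le> increment_L1 (\<lambda>x. Z x \<omega>) s" by auto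
  define l where "l = enn2real (dyadic_sup \<omega>) * \<kappa> + 1"
  have l: "l > 0" using \<kappa>_pos by (simp add: l_def add_nonneg_pos)
  let ?D = "\<lambda>s. lborel_on {0<..<1 - s}" and ?f = "\<lambda>s x. Z (x + s) \<omega> - Z x \<omega>"
  have f [measurable]: "?f s \<in> borel_measurable (?D s)" for s by (intro measurable_lborel_on) measurable
  have D: "emeasure (?D s) (space (?D s)) \<le> 1" if "s > 0" for s using that by (intro emeasure_lborel_on_le) auto
  have L1: "increment_L1 (\<lambda>x. Z x \<omega>) s = (\<integral>\<^sup>+ x. ennreal \<bar>?f s x\<bar> \<partial>?D s)" for s
    by (simp add: increment_L1_def nn_integral_lborel_on)
  have "increment_norm N (\<lambda>x. Z x \<omega>) s < ennreal (l * s powr \<alpha>)" if "0 < s" "s < min 1 s0" for s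
  proof (rule order.strict_trans1[OF increment_norm_le[OF \<omega>(3,2)]])
    show "ennreal (enn2real (dyadic_sup \<omega>) * \<kappa> * s powr \<alpha>) < ennreal (l * s powr \<alpha>)"
      using that \<kappa>_pos by (subst ennreal_less_iff) (auto simp: l_def algebra_simps)
  qed (use that in auto)
  then have lt: "luxemburg_norm N (?D s) (?f s) < ennreal (l * s powr \<alpha>)" if "0 < s" "s < min 1 s0" for s
    using that by (simp add: increment_norm_def)
  have "in_Theta_right 0 (\<lambda>s. Lp_norm p (lebesgue_on {0<..<1 - s}) (?f s)) (\<lambda>s. s powr \<alpha>)" if p: "p \<ge> 1" for p
  proof (rule in_Theta_rightI)
    have leb: "Lp_norm p (lebesgue_on {0<..<1 - s}) g = Lp_norm p (?D s) g" for s g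
      unfolding Lp_norm_def by (simp add: nn_integral_lebesgue_on)
    fix s assume s: "0 < s" "s < min 1 s0"
    show "Lp_norm p (lebesgue_on {0<..<1 - s}) (?f s)
      \<le> ennreal (((2 * (\<tau> powr p + 1 + fact (nat \<lceil>p\<rceil>))) powr (1 / p) * l) * s powr \<alpha>)"
      unfolding leb using Lp_norm_le_of_luxemburg_norm[OF N \<tau> f D lt[OF s] p] s by (simp add: mult.assoc)
    \<comment> \<open>\<open>nn_integral_abs_le_of_Lp_norm\<close> costs a factor 2, and 2 * (c / 3)
      < c contradicts the lower bound for the L1 norm.\<close>
    show "ennreal (c / 3 * s powr \<alpha>) \<le> Lp_norm p (lebesgue_on {0<..<1 - s}) (?f s)"
    proof (rule ccontr)
      assume "\<not> ?thesis"
      then have "Lp_norm p (?D s) (?f s) < ennreal (c / 3 * s powr \<alpha>)" unfolding leb by simp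
      then have "increment_L1 (\<lambda>x. Z x \<omega>) s \<le> ennreal (2 * (c / 3 * s powr \<alpha>))"
        unfolding L1 using s by (intro nn_integral_abs_le_of_Lp_norm[OF f D p]) auto
      also have "\<dots> < ennreal (c * s powr \<alpha>)" using s c(1) by (subst ennreal_less_iff) auto
      finally show False using c(3)[of s] s by auto
    qed
  qed (use c in auto)
  moreover have "in_Theta_right 0 (\<lambda>s. luxemburg_norm N (lebesgue_on {0<..<1 - s}) (?f s)) (\<lambda>s. s powr \<alpha>)"
  proof (rule in_Theta_rightI)
    fix s assume s: "0 < s" "s < min 1 s0"
    show "luxemburg_norm N (lebesgue_on {0<..<1 - s}) (?f s) \<le> ennreal (l * s powr \<alpha>)"
      using lt[OF s] by (simp add: luxemburg_norm_lebesgue_on)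
    \<comment> \<open>Here the loss is the factor \<tau> + 2 of
      \<open>nn_integral_abs_le_of_luxemburg_norm\<close>, and (\<tau> + 2) / (\<tau> + 3) <
      1.\<close>
    show "ennreal (c / (\<tau> + 3) * s powr \<alpha>) \<le> luxemburg_norm N (lebesgue_on {0<..<1 - s}) (?f s)"
    proof (rule ccontr)
      assume "\<not> ?thesis"
      then have "luxemburg_norm N (?D s) (?f s) < ennreal (c / (\<tau> + 3) * s powr \<alpha>)"
        by (simp add: luxemburg_norm_lebesgue_on)
      then have "increment_L1 (\<lambda>x. Z x \<omega>) s \<le> ennreal ((\<tau> + 2) * (c / (\<tau> + 3) * s powr \<alpha>))"
        unfolding L1 using s by (intro nn_integral_abs_le_of_luxemburg_norm[OF N \<tau> f D]) auto
      also have "\<dots> < ennreal (c * s powr \<alpha>)"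
        using s c(1) \<tau>(2) by (subst ennreal_less_iff) (auto simp: field_simps)
      finally show False using c(3)[of s] s by auto
    qed
  qed (use c \<tau>(2) in auto)
  ultimately show ?case by blast
qed

lemma AE_besov_space: "AE \<omega> in M. (\<lambda>t. Z t \<omega>) \<in> besov_orlicz_space N \<alpha> {0<..<1}"
  using dyadic_sup_finite AE_space
proof eventually_elim
  case \<omega>: (elim \<omega>)
  note [measurable] = \<omega>(2)
  have "(\<lambda>t. Z t \<omega>) \<in> borel_measurable borel" by measurable
  then have "(\<lambda>t. Z t \<omega>) \<in> borel_measurable lebesgue" by (intro measurable_completion) simp
  then have "(\<lambda>t. Z t \<omega>) \<in> borel_measurable (lebesgue_on {0<..<1})" by (rule measurable_restrict_space1)
  moreover have "luxemburg_norm N (lebesgue_on {0<..<1}) (\<lambda>x. Z x \<omega>) < \<infinity>"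
    using path_norm_le[of \<omega>] \<omega>(1) by (simp add: luxemburg_norm_lebesgue_on order.strict_trans1)
  moreover have "besov_orlicz_seminorm N \<alpha> {0<..<1} (\<lambda>x. Z x \<omega>) < \<infinity>"
    using seminorm_le[OF \<omega>(2,1)] by (auto intro: order.strict_trans1)
  ultimately show ?case by (simp add: besov_orlicz_space_def orlicz_space_def)
qed

end

text \<open>
  A process given on \<open>{0..1}\<close> only is extended by composing with the retraction onto \<open>{0..1}\<close>
  (for joint measurability) and multiplying with the indicator function.
\<close>

definition zero_extension :: "(real \<Rightarrow> 'a \<Rightarrow> real) \<Rightarrow> real \<Rightarrow> 'a \<Rightarrow> real" where
  "zero_extension z t \<omega> = indicator {0..1} t * z (max 0 (min 1 t)) \<omega>"

lemma zero_extension_inside: "t \<in> {0..1} \<Longrightarrow> zero_extension z t = z t"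
  by (auto simp: zero_extension_def fun_eq_iff)

lemma zero_extension_measurable:
  assumes [measurable]: "(\<lambda>(t, \<omega>). z t \<omega>) \<in> borel_measurable (restrict_space borel {0..1} \<Otimes>\<^sub>M M)"
  shows "(\<lambda>(t, \<omega>). zero_extension z t \<omega>) \<in> borel_measurable (lborel \<Otimes>\<^sub>M M)"
proof -
  have [measurable]: "(\<lambda>t. max 0 (min 1 t)) \<in> measurable lborel (restrict_space borel {0..1::real})"
    by (intro measurable_restrict_space2) auto
  have "(\<lambda>p. (\<lambda>(t, \<omega>). z t \<omega>) (max 0 (min 1 (fst p)), snd p)) \<in> borel_measurable (lborel \<Otimes>\<^sub>M M)"
    by measurable
  then have "(\<lambda>p. indicator {0..1} (fst p) * (\<lambda>(t, \<omega>). z t \<omega>) (max 0 (min 1 (fst p)), snd p)) \<in> borel_measurable (lborel \<Otimes>\<^sub>M M)"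
    by (intro borel_measurable_times) measurable
  then show ?thesis by (simp add: zero_extension_def split_beta')
qed

text \<open>Each condition involves finitely many times only, so exceptional null sets that depend
  on t are harmless.\<close>

lemma standard_fbm_cong_AE:
  assumes X: "standard_fbm M T H X" and Y: "\<And>t. t \<in> T \<Longrightarrow> Y t \<in> borel_measurable M"
    and XY: "\<And>t. t \<in> T \<Longrightarrow> AE \<omega> in M. Y t \<omega> = X t \<omega>"
  shows "standard_fbm M T H Y"
proof -
  have gX: "gaussian_rv M (\<lambda>\<omega>. \<Sum>i<n. a i * X (t i) \<omega>)" if "\<forall>i<n. t i \<in> T" for n :: nat and t a
    using X that by (auto simp: standard_fbm_def gaussian_process_def)
  have Xm: "X t \<in> borel_measurable M" if "t \<in> T" for t
    using gX[of 1 "\<lambda>_. t" "\<lambda>_. 1"] that by (simp add: gaussian_rv_def)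
  have cong: "gaussian_rv M g" if f: "gaussian_rv M f" and g: "g \<in> borel_measurable M" and fg: "AE \<omega> in M. g \<omega> = f \<omega>" for f g
  proof -
    have fm: "f \<in> borel_measurable M" using f by (simp add: gaussian_rv_def)
    have "distr M lborel g = distr M lborel f"
      by (rule distr_cong_AE) (use fm g fg in auto)
    then have "distributed M lborel g d" if "distributed M lborel f d" for d
      using that g by (auto simp: distributed_def)
    moreover have "AE \<omega> in M. g \<omega> = m" if "AE \<omega> in M. f \<omega> = m" for m
      using that fg by eventually_elim simp
    ultimately show ?thesis using f g unfolding gaussian_rv_def by blast
  qed
  have "gaussian_rv M (\<lambda>\<omega>. \<Sum>i<n. a i * Y (t i) \<omega>)" if t: "\<forall>i<n. t i \<in> T" for n :: nat and t a
  proof (rule cong[OF gX[OF t]])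
    show "(\<lambda>\<omega>. \<Sum>i<n. a i * Y (t i) \<omega>) \<in> borel_measurable M"
      using Y t by (intro borel_measurable_sum borel_measurable_times) auto
    have "AE \<omega> in M. \<forall>i\<in>{..<n}. Y (t i) \<omega> = X (t i) \<omega>"
      using t XY by (subst AE_finite_all) auto
    then show "AE \<omega> in M. (\<Sum>i<n. a i * Y (t i) \<omega>) = (\<Sum>i<n. a i * X (t i) \<omega>)"
      by eventually_elim simp
  qed
  then have "gaussian_process M T Y" by (simp add: gaussian_process_def)
  moreover have "(\<integral>\<omega>. Y t \<omega> \<partial>M) = (\<integral>\<omega>. X t \<omega> \<partial>M)" if "t \<in> T" for t
    using that Xm Y XY by (intro integral_cong_AE) auto
  moreover have "(\<integral>\<omega>. Y s \<omega> * Y t \<omega> \<partial>M) = (\<integral>\<omega>. X s \<omega> * X t \<omega> \<partial>M)" if st: "s \<in> T" "t \<in> T" for s t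
  proof (rule integral_cong_AE)
    show "AE \<omega> in M. Y s \<omega> * Y t \<omega> = X s \<omega> * X t \<omega>"
      using XY[OF st(1)] XY[OF st(2)] by eventually_elim simp
  qed (use st Xm Y in auto)
  ultimately show ?thesis using X by (simp add: standard_fbm_def)
qed

lemma standard_fbm_path_regularity:
  fixes M :: "'a measure" and z :: "real \<Rightarrow> 'a \<Rightarrow> real"
  assumes M: "prob_space M" and \<alpha>: "0 < \<alpha>" "\<alpha> < 1" and \<Phi>: "young_function \<Phi>" "\<tau> \<ge> 0"
    "\<And>x. x \<ge> \<tau> \<Longrightarrow> \<Phi> x = exp (x\<^sup>2) - 1"
    and z: "(\<lambda>(t, \<omega>). z t \<omega>) \<in> borel_measurable (restrict_space borel {0..1} \<Otimes>\<^sub>M M)"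
    and fbm: "standard_fbm M {0..1} \<alpha> z"
  shows "AE \<omega> in M. (\<lambda>t. z t \<omega>) \<in> besov_orlicz_space \<Phi> \<alpha> {0<..<1}"
    and "(\<lambda>\<omega>. enn2real (besov_orlicz_norm \<Phi> \<alpha> {0<..<1} (\<lambda>t. z t \<omega>))) \<in> orlicz_space \<Phi> M"
    and "AE \<omega> in M. \<forall>p\<ge>1. in_Theta_right 0
           (\<lambda>s. Lp_norm p (lebesgue_on {0<..<1 - s}) (\<lambda>x. z (x + s) \<omega> - z x \<omega>)) (\<lambda>s. s powr \<alpha>)"
    and "AE \<omega> in M. in_Theta_right 0
           (\<lambda>s. luxemburg_norm \<Phi> (lebesgue_on {0<..<1 - s}) (\<lambda>x. z (x + s) \<omega> - z x \<omega>)) (\<lambda>s. s powr \<alpha>)"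
proof -
  define Z where "Z = zero_extension z"
  have Zz: "Z t = z t" if "t \<in> {0..1}" for t using that by (simp add: Z_def zero_extension_inside)
  have Zm [measurable]: "(\<lambda>(t, \<omega>). Z t \<omega>) \<in> borel_measurable (lborel \<Otimes>\<^sub>M M)"
    unfolding Z_def by (rule zero_extension_measurable[OF z])
  have Z0: "Z t \<omega> = 0" if "t \<notin> {0..1}" for t \<omega> using that by (simp add: Z_def zero_extension_def)
  have fbmZ: "standard_fbm M {0..1} \<alpha> Z"
  proof (rule standard_fbm_cong_AE[OF fbm])
    fix t :: real assume t: "t \<in> {0..1}"
    have "(\<lambda>\<omega>. (\<lambda>(t, \<omega>). Z t \<omega>) (t, \<omega>)) \<in> borel_measurable M" by measurable
    then show "Z t \<in> borel_measurable M" by simp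
    show "AE \<omega> in M. Z t \<omega> = z t \<omega>" using t by (simp add: Zz)
  qed
  interpret unit_fbm_young M Z \<alpha> \<Phi> \<tau>
    by (intro unit_fbm_young.intro unit_fbm.intro M unit_fbm_axioms.intro unit_fbm_young_axioms.intro)
       (use \<alpha> \<Phi> fbmZ Zm Z0 in auto)
  have lux: "luxemburg_norm \<Phi> (lebesgue_on {0<..<1}) (\<lambda>t. z t \<omega>) = luxemburg_norm \<Phi> (lebesgue_on {0<..<1}) (\<lambda>t. Z t \<omega>)" for \<omega>
    by (rule luxemburg_norm_cong) (auto simp: Zz)
  have semi: "besov_orlicz_seminorm \<Phi> \<alpha> {0<..<1} (\<lambda>t. z t \<omega>) = besov_orlicz_seminorm \<Phi> \<alpha> {0<..<1} (\<lambda>t. Z t \<omega>)" for \<omega>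
  proof -
    have "luxemburg_norm \<Phi> (lebesgue_on (shift_domain {0<..<1} h)) (\<lambda>x. z (x + h) \<omega> - z x \<omega>)
      = luxemburg_norm \<Phi> (lebesgue_on (shift_domain {0<..<1} h)) (\<lambda>x. Z (x + h) \<omega> - Z x \<omega>)" for h
      by (rule luxemburg_norm_cong) (auto simp: Zz shift_domain_def)
    then show ?thesis by (simp add: besov_orlicz_seminorm_def)
  qed
  have meas: "(\<lambda>t. z t \<omega>) \<in> borel_measurable (lebesgue_on {0<..<1}) \<longleftrightarrow> (\<lambda>t. Z t \<omega>) \<in> borel_measurable (lebesgue_on {0<..<1})" for \<omega>
    by (rule measurable_cong) (auto simp: Zz)
  show "AE \<omega> in M. (\<lambda>t. z t \<omega>) \<in> besov_orlicz_space \<Phi> \<alpha> {0<..<1}"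
    using AE_besov_space by (simp add: besov_orlicz_space_def orlicz_space_def lux semi meas)
  show "(\<lambda>\<omega>. enn2real (besov_orlicz_norm \<Phi> \<alpha> {0<..<1} (\<lambda>t. z t \<omega>))) \<in> orlicz_space \<Phi> M"
    using besov_norm_orlicz by (simp add: besov_orlicz_norm_def lux semi)
  \<comment> \<open>Limits from the right at 0 see positive shifts only; then x and x + s both lie
    in the unit interval, where the extension agrees with z.\<close>
  have lux_s: "luxemburg_norm \<Phi> (lebesgue_on {0<..<1 - s}) (\<lambda>x. z (x + s) \<omega> - z x \<omega>)
      = luxemburg_norm \<Phi> (lebesgue_on {0<..<1 - s}) (\<lambda>x. Z (x + s) \<omega> - Z x \<omega>)" if "s > 0" for s \<omega>
    using that by (intro luxemburg_norm_cong) (auto simp: Zz)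
  have Lp_s: "Lp_norm p (lebesgue_on {0<..<1 - s}) (\<lambda>x. z (x + s) \<omega> - z x \<omega>)
      = Lp_norm p (lebesgue_on {0<..<1 - s}) (\<lambda>x. Z (x + s) \<omega> - Z x \<omega>)" if "s > 0" for s p \<omega>
  proof -
    have "(\<integral>\<^sup>+ x. ennreal (\<bar>z (x + s) \<omega> - z x \<omega>\<bar> powr p) \<partial>lebesgue_on {0<..<1 - s})
      = (\<integral>\<^sup>+ x. ennreal (\<bar>Z (x + s) \<omega> - Z x \<omega>\<bar> powr p) \<partial>lebesgue_on {0<..<1 - s})"
      using that by (intro nn_integral_cong) (auto simp: Zz)
    then show ?thesis by (simp add: Lp_norm_def)
  qed
  have Theta: "in_Theta_right 0 F g \<longleftrightarrow> in_Theta_right 0 G g" if "\<And>s. s > 0 \<Longrightarrow> F s = G s" for F G g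
  proof -
    have "\<forall>\<^sub>F s in at_right 0. F s / ennreal (g s) = G s / ennreal (g s)"
      using eventually_at_right_less[of "0 :: real"] by eventually_elim (simp add: that)
    from Liminf_eq[OF this] Limsup_eq[OF this] show ?thesis by (simp add: in_Theta_right_def)
  qed
  show "AE \<omega> in M. \<forall>p\<ge>1. in_Theta_right 0
           (\<lambda>s. Lp_norm p (lebesgue_on {0<..<1 - s}) (\<lambda>x. z (x + s) \<omega> - z x \<omega>)) (\<lambda>s. s powr \<alpha>)"
    using AE_increment_Theta by eventually_elim (subst Theta[OF Lp_s], auto)
  show "AE \<omega> in M. in_Theta_right 0
           (\<lambda>s. luxemburg_norm \<Phi> (lebesgue_on {0<..<1 - s}) (\<lambda>x. z (x + s) \<omega> - z x \<omega>)) (\<lambda>s. s powr \<alpha>)"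
    using AE_increment_Theta by eventually_elim (subst Theta[OF lux_s], auto)
qed

section \<open>The Wiener integral\<close>

definition valid_steps :: "(real \<times> real \<times> real) list \<Rightarrow> bool" where
  "valid_steps S \<longleftrightarrow> (\<forall>(a, s, t)\<in>set S. s \<le> t)"

text \<open>Together with concatenation of lists this realises linear combinations of step functions
  and of their integrals.\<close>

definition scale_steps :: "real \<Rightarrow> (real \<times> real \<times> real) list \<Rightarrow> (real \<times> real \<times> real) list" where
  "scale_steps c S = map (\<lambda>(a, s, t). (c * a, s, t)) S"

lemma valid_steps_append: "valid_steps S \<Longrightarrow> valid_steps T \<Longrightarrow> valid_steps (S @ T)"
  by (auto simp: valid_steps_def)

lemma valid_steps_scale: "valid_steps S \<Longrightarrow> valid_steps (scale_steps c S)"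
  by (auto simp: valid_steps_def scale_steps_def)

lemma step_fun_append: "step_fun (S @ T) x = step_fun S x + step_fun T x"
  by (simp add: step_fun_def)

lemma step_fun_scale: "step_fun (scale_steps c S) x = c * step_fun S x"
  by (induction S) (auto simp: step_fun_def scale_steps_def algebra_simps)

lemma step_wiener_integral_append:
  "step_wiener_integral W (S @ T) \<omega> = step_wiener_integral W S \<omega> + step_wiener_integral W T \<omega>"
  by (simp add: step_wiener_integral_def)

lemma step_wiener_integral_scale:
  "step_wiener_integral W (scale_steps c S) \<omega> = c * step_wiener_integral W S \<omega>"
  by (induction S) (auto simp: step_wiener_integral_def scale_steps_def algebra_simps)

lemma step_fun_measurable [measurable]: "step_fun S \<in> borel_measurable borel"
proof (induction S)
  case (Cons p S)
  obtain a s t where p: "p = (a, s, t)" by (cases p)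
  have "step_fun (p # S) = (\<lambda>x. a * indicator {s<..t} x + step_fun S x)"
    by (auto simp: step_fun_def p)
  then show ?case using Cons by simp
qed (simp add: step_fun_def[abs_def])

text \<open>A cell of the partition lies in (t j, t k] exactly when its right endpoint does; this is
  why the indicator is evaluated at \<open>t (Suc i)\<close>, in accordance with the half-open
  intervals of \<open>step_fun\<close>.\<close>

lemma telescope_indicator:
  fixes X :: "real \<Rightarrow> real"
  assumes t: "strict_mono_on {..n} t" and jk: "j \<le> k" "k \<le> n"
  shows "X (t k) - X (t j) = (\<Sum>i<n. indicator {t j<..t k} (t (Suc i)) * (X (t (Suc i)) - X (t i)))"
proof -
  have less: "t a < t b \<longleftrightarrow> a < b" if "a \<le> n" "b \<le> n" for a b
    using t that by (simp add: strict_mono_on_less)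
  have ind: "indicator {t j<..t k} (t (Suc i)) = (if j \<le> i \<and> i < k then 1 else 0 :: real)" if "i < n" for i
    using that jk less[of j "Suc i"] less[of k "Suc i"] by (auto simp: indicator_def not_less)
  have "(\<Sum>i<n. indicator {t j<..t k} (t (Suc i)) * (X (t (Suc i)) - X (t i)))
    = (\<Sum>i<n. if j \<le> i \<and> i < k then X (t (Suc i)) - X (t i) else 0)"
    by (intro sum.cong) (auto simp: ind)
  also have "\<dots> = (\<Sum>i\<in>{j..<k}. X (t (Suc i)) - X (t i))"
    using jk by (intro sum.mono_neutral_cong_right) auto
  also have "\<dots> = X (t k) - X (t j)" using jk by (intro sum_Suc_diff') auto
  finally show ?thesis by simp
qed

text \<open>The partition does not depend on X: a path of W gives the step integral, and the
  indicator of {x..} gives the value of the step function at x, both as sums over the same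
  cells.\<close>

lemma step_refinement:
  assumes S: "valid_steps S"
  obtains n and t :: "nat \<Rightarrow> real" where "strict_mono_on {..n} t"
    "\<And>X :: real \<Rightarrow> real. (\<Sum>(a, s, t)\<leftarrow>S. a * (X t - X s)) = (\<Sum>i<n. step_fun S (t (Suc i)) * (X (t (Suc i)) - X (t i)))"
proof -
  \<comment> \<open>The point 0 keeps the partition non-empty when the list is empty.\<close>
  define P where "P = insert 0 ((\<lambda>(a, s, t). s) ` set S \<union> (\<lambda>(a, s, t). t) ` set S)"
  have P: "finite P" "P \<noteq> {}" by (auto simp: P_def)
  define L where "L = sorted_list_of_set P"
  define n where "n = length L - 1"
  define t where "t i = L ! i" for i
  have L: "set L = P" "sorted_wrt (<) L" "L \<noteq> []"
    using P by (auto simp: L_def strict_sorted_list_of_set)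
  have t: "strict_mono_on {..n} t"
  proof (rule strict_mono_onI)
    fix r s assume "r \<in> {..n}" "s \<in> {..n}" "r < s"
    moreover have "0 < length L" using L(3) by simp
    then have "s < length L" using \<open>s \<in> {..n}\<close> unfolding n_def atMost_iff by linarith
    ultimately show "t r < t s"
      unfolding t_def by (intro sorted_wrt_nth_less[OF L(2)])
  qed
  have mem: "\<exists>j\<le>n. p = t j" if "p \<in> P" for p
  proof -
    have "p \<in> set L" using that L(1) by simp
    then obtain j where "j < length L" "L ! j = p" unfolding in_set_conv_nth by blast
    then show ?thesis by (intro exI[of _ j]) (simp add: t_def n_def)
  qed
  have main: "(\<Sum>(a, s, t)\<leftarrow>T. a * (X t - X s)) = (\<Sum>i<n. step_fun T (t (Suc i)) * (X (t (Suc i)) - X (t i)))"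
    if "set T \<subseteq> set S" for T and X :: "real \<Rightarrow> real"
    using that
  proof (induction T)
    case Nil
    then show ?case by (simp add: step_fun_def)
  next
    case (Cons p T)
    obtain a s u where p: "p = (a, s, u)" by (cases p)
    have "p \<in> set S" using Cons.prems by simp
    have su: "s \<le> u" using bspec[OF S[unfolded valid_steps_def] \<open>p \<in> set S\<close>] by (simp add: p)
    have "s \<in> P" "u \<in> P"
      unfolding P_def using imageI[OF \<open>p \<in> set S\<close>, of "\<lambda>(a, s, t). s"] imageI[OF \<open>p \<in> set S\<close>, of "\<lambda>(a, s, t). t"]
      by (simp_all add: p)
    then obtain j k where jk: "j \<le> n" "s = t j" "k \<le> n" "u = t k" using mem[of s] mem[of u] by blast
    have "j \<le> k" using su jk t by (simp add: strict_mono_on_less_eq)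
    have "step_fun (p # T) x = a * indicator {s<..u} x + step_fun T x" for x by (simp add: step_fun_def p)
    then have "(\<Sum>i<n. step_fun (p # T) (t (Suc i)) * (X (t (Suc i)) - X (t i)))
      = a * (\<Sum>i<n. indicator {t j<..t k} (t (Suc i)) * (X (t (Suc i)) - X (t i)))
        + (\<Sum>i<n. step_fun T (t (Suc i)) * (X (t (Suc i)) - X (t i)))"
      unfolding sum_distrib_left sum.distrib[symmetric] jk(4)[symmetric] jk(2)[symmetric]
      by (intro sum.cong refl) (simp add: algebra_simps)
    also have "\<dots> = a * (X u - X s) + (\<Sum>(a, s, t)\<leftarrow>T. a * (X t - X s))"
      using telescope_indicator[OF t \<open>j \<le> k\<close> jk(3), of X] Cons by (simp add: jk)
    finally show ?case by (simp add: p)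
  qed
  show thesis by (rule that[OF t main]) simp
qed

text \<open>The Ito isometry for step functions: over a common partition the increments of W are
  independent and the cells disjoint, so the variance of the integral and the squared L2 norm of the
  step function are the same sum.\<close>

lemma (in prob_space) step_wiener_integral_gaussian:
  assumes W: "two_sided_wiener M W" and S: "valid_steps S"
  shows "\<exists>v. centered_gaussian M v (step_wiener_integral W S) \<and> (\<integral>\<^sup>+ x. ennreal ((step_fun S x)\<^sup>2) \<partial>lborel) = ennreal v"
proof -
  obtain n t where t: "strict_mono_on {..n} t"
    and eq: "\<And>X :: real \<Rightarrow> real. (\<Sum>(a, s, t)\<leftarrow>S. a * (X t - X s)) = (\<Sum>i<n. step_fun S (t (Suc i)) * (X (t (Suc i)) - X (t i)))"
    using step_refinement[OF S] by blast
  define b where "b i = step_fun S (t (Suc i))" for i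
  have less: "t i < t (Suc i)" if "i < n" for i
    using t that by (simp add: strict_mono_on_less)
  let ?v = "\<Sum>i<n. (b i)\<^sup>2 * (t (Suc i) - t i)"
  have "centered_gaussian M ?v (\<lambda>\<omega>. \<Sum>i<n. b i * (W (t (Suc i)) \<omega> - W (t i) \<omega>))"
  proof (rule centered_gaussian_indep_sum)
    show "0 < t (Suc i) - t i \<and> distributed M lborel (\<lambda>\<omega>. W (t (Suc i)) \<omega> - W (t i) \<omega>)
        (\<lambda>x. ennreal (normal_density 0 (sqrt (t (Suc i) - t i)) x))" if "i \<in> {..<n}" for i
      using that less[of i] W unfolding two_sided_wiener_def by auto
    show "indep_vars (\<lambda>_. borel) (\<lambda>i \<omega>. W (t (Suc i)) \<omega> - W (t i) \<omega>) {..<n}"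
      using W t unfolding two_sided_wiener_def by blast
  qed simp
  moreover have "step_wiener_integral W S = (\<lambda>\<omega>. \<Sum>i<n. b i * (W (t (Suc i)) \<omega> - W (t i) \<omega>))"
    unfolding step_wiener_integral_def b_def by (rule ext) (rule eq)
  moreover have "(\<integral>\<^sup>+ x. ennreal ((step_fun S x)\<^sup>2) \<partial>lborel) = ennreal ?v"
  proof -
    \<comment> \<open>The indicator of (s, u] at x becomes an increment of a function of the
      endpoints, to which the refinement applies.\<close>
    have ind: "indicator {s<..u} x = indicator {x..} u - (indicator {x..} s :: real)" if "s \<le> u" for s u x :: real
      using that by (auto simp: indicator_def)
    have f: "step_fun S x = (\<Sum>i<n. b i * indicator {t i<..t (Suc i)} x)" for x
    proof -
      have "step_fun S x = (\<Sum>(a, s, t)\<leftarrow>S. a * (indicator {x..} t - indicator {x..} s))"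
        unfolding step_fun_def using S ind by (intro arg_cong[where f=sum_list] map_cong) (auto simp: valid_steps_def)
      also have "\<dots> = (\<Sum>i<n. b i * (indicator {x..} (t (Suc i)) - indicator {x..} (t i)))"
        unfolding b_def by (rule eq)
      also have "\<dots> = (\<Sum>i<n. b i * indicator {t i<..t (Suc i)} x)"
        using less by (intro sum.cong) (auto simp: ind less_imp_le)
      finally show ?thesis .
    qed
    have disj: "indicator {t i<..t (Suc i)} x * indicator {t j<..t (Suc j)} x
        = (if i = j then indicator {t i<..t (Suc i)} x else 0 :: real)" if ij: "i < n" "j < n" for i j x
    proof -
      have le: "t (Suc p) \<le> t q" if "p < q" "q < n" for p q
        using that t by (simp add: strict_mono_on_less_eq)
      show ?thesis using le[of i j] le[of j i] ij by (cases i j rule: linorder_cases) (auto simp: indicator_def)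
    qed
    have sq: "(step_fun S x)\<^sup>2 = (\<Sum>i<n. (b i)\<^sup>2 * indicator {t i<..t (Suc i)} x)" for x
    proof -
      have "(step_fun S x)\<^sup>2 = (\<Sum>i<n. \<Sum>j<n. (b i * b j) * (indicator {t i<..t (Suc i)} x * indicator {t j<..t (Suc j)} x))"
        unfolding f power2_eq_square sum_product by (intro sum.cong refl) (simp add: mult_ac)
      also have "\<dots> = (\<Sum>i<n. \<Sum>j<n. if j = i then (b i)\<^sup>2 * indicator {t i<..t (Suc i)} x else 0)"
        by (intro sum.cong refl) (auto simp: disj power2_eq_square)
      also have "\<dots> = (\<Sum>i<n. (b i)\<^sup>2 * indicator {t i<..t (Suc i)} x)" by (intro sum.cong refl) simp
      finally show ?thesis .
    qed
    have "(\<integral>\<^sup>+ x. ennreal ((step_fun S x)\<^sup>2) \<partial>lborel)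
      = (\<integral>\<^sup>+ x. (\<Sum>i<n. ennreal ((b i)\<^sup>2) * indicator {t i<..t (Suc i)} x) \<partial>lborel)"
    proof (intro nn_integral_cong)
      fix x
      have *: "ennreal ((b i)\<^sup>2 * indicator {t i<..t (Suc i)} x) = ennreal ((b i)\<^sup>2) * indicator {t i<..t (Suc i)} x" for i
        by (simp split: split_indicator)
      show "ennreal ((step_fun S x)\<^sup>2) = (\<Sum>i<n. ennreal ((b i)\<^sup>2) * indicator {t i<..t (Suc i)} x)"
        unfolding sq *[symmetric] by (rule sum_ennreal[symmetric]) auto
    qed
    also have "\<dots> = (\<Sum>i<n. ennreal ((b i)\<^sup>2) * ennreal (t (Suc i) - t i))"
      using less by (subst nn_integral_sum) (auto simp: nn_integral_cmult_indicator less_imp_le intro!: sum.cong)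
    also have "\<dots> = ennreal ?v"
      using less by (subst sum_ennreal[symmetric]) (auto intro!: sum.cong mult_nonneg_nonneg simp: ennreal_mult less_imp_le)
    finally show ?thesis .
  qed
  ultimately show ?thesis by auto
qed

lemma nn_integral_square_triangle:
  fixes f g h :: "'b \<Rightarrow> real"
  assumes [measurable]: "f \<in> borel_measurable D" "g \<in> borel_measurable D" "h \<in> borel_measurable D"
  shows "(\<integral>\<^sup>+ x. ennreal ((f x - h x)\<^sup>2) \<partial>D)
    \<le> 2 * (\<integral>\<^sup>+ x. ennreal ((f x - g x)\<^sup>2) \<partial>D) + 2 * (\<integral>\<^sup>+ x. ennreal ((g x - h x)\<^sup>2) \<partial>D)"
proof -
  have pw: "(a - c)\<^sup>2 \<le> 2 * (a - b)\<^sup>2 + 2 * (b - c)\<^sup>2" for a b c :: real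
    using zero_le_power2[of "(a - b) - (b - c)"] by (simp add: power2_eq_square algebra_simps)
  have "(\<integral>\<^sup>+ x. ennreal ((f x - h x)\<^sup>2) \<partial>D)
    \<le> (\<integral>\<^sup>+ x. 2 * ennreal ((f x - g x)\<^sup>2) + 2 * ennreal ((g x - h x)\<^sup>2) \<partial>D)"
  proof (intro nn_integral_mono)
    fix x
    have "ennreal ((f x - h x)\<^sup>2) \<le> ennreal (2 * (f x - g x)\<^sup>2 + 2 * (g x - h x)\<^sup>2)"
      by (intro ennreal_leI pw)
    then show "ennreal ((f x - h x)\<^sup>2) \<le> 2 * ennreal ((f x - g x)\<^sup>2) + 2 * ennreal ((g x - h x)\<^sup>2)"
      by (simp add: ennreal_plus ennreal_mult)
  qed
  then show ?thesis by (simp add: nn_integral_add nn_integral_cmult)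
qed

section \<open>Density of step functions in L2\<close>

definition step_approximable :: "(real \<Rightarrow> real) \<Rightarrow> bool" where
  "step_approximable f \<longleftrightarrow> f \<in> borel_measurable borel \<and>
     (\<forall>e>0. \<exists>S. valid_steps S \<and> (\<integral>\<^sup>+ x. ennreal ((step_fun S x - f x)\<^sup>2) \<partial>lborel) < e)"

lemma step_approximable_limit:
  assumes g: "\<And>n. step_approximable (g n)" and f [measurable]: "f \<in> borel_measurable borel"
    and lim: "(\<lambda>n :: nat. \<integral>\<^sup>+ x. ennreal ((g n x - f x)\<^sup>2) \<partial>lborel) \<longlonglongrightarrow> 0"
  shows "step_approximable f"
  unfolding step_approximable_def
proof (intro conjI allI impI)
  fix e :: ennreal assume "e > 0"
  \<comment> \<open>Two errors below e / 4, each doubled by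
    \<open>nn_integral_square_triangle\<close>, add up to at most e.\<close>
  then have e4: "e / 4 > 0" by (simp add: ennreal_zero_less_divide)
  from order_tendstoD(2)[OF lim e4] obtain n where n: "(\<integral>\<^sup>+ x. ennreal ((g n x - f x)\<^sup>2) \<partial>lborel) < e / 4"
    by (auto simp: eventually_sequentially)
  have [measurable]: "g n \<in> borel_measurable borel" using g by (simp add: step_approximable_def)
  obtain S where S: "valid_steps S" "(\<integral>\<^sup>+ x. ennreal ((step_fun S x - g n x)\<^sup>2) \<partial>lborel) < e / 4"
    using g[of n] e4 unfolding step_approximable_def by blast
  let ?a = "\<integral>\<^sup>+ x. ennreal ((step_fun S x - g n x)\<^sup>2) \<partial>lborel" and ?b = "\<integral>\<^sup>+ x. ennreal ((g n x - f x)\<^sup>2) \<partial>lborel"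
  have "(\<integral>\<^sup>+ x. ennreal ((step_fun S x - f x)\<^sup>2) \<partial>lborel) \<le> 2 * ?a + 2 * ?b"
    by (rule nn_integral_square_triangle) measurable
  also have "\<dots> = (?a + ?b) + (?a + ?b)" by (simp add: mult_2)
  also have "\<dots> < (e / 4 + e / 4) + (e / 4 + e / 4)" by (intro add_strict_mono S n)
  also have "\<dots> \<le> e"
  proof (cases e)
    case (real r)
    then have "e / 4 = ennreal (r / 4)" by (simp flip: divide_ennreal)
    then show ?thesis using real by (simp flip: ennreal_plus)
  qed auto
  finally show "\<exists>S. valid_steps S \<and> (\<integral>\<^sup>+ x. ennreal ((step_fun S x - f x)\<^sup>2) \<partial>lborel) < e"
    using S(1) by blast
qed simp

lemma step_approximable_continuous:
  fixes g :: "real \<Rightarrow> real"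
  assumes g: "continuous_on UNIV g" and m: "m \<ge> 0"
  shows "step_approximable (\<lambda>x. g x * indicator {-m<..m} x)"
  unfolding step_approximable_def
proof (intro conjI allI impI)
  have [measurable]: "g \<in> borel_measurable borel" using g by (intro borel_measurable_continuous_onI)
  show "(\<lambda>x. g x * indicator {-m<..m} x) \<in> borel_measurable borel" by measurable
  fix e :: ennreal assume "e > 0"
  \<comment> \<open>\<eta> will be the uniform error on an interval of length 2 m, so \<eta>^2 (2 m)
    bounds the squared L2 error.\<close>
  obtain \<eta> :: real where \<eta>: "\<eta> > 0" "ennreal (\<eta>\<^sup>2 * (2 * m)) < e"
  proof -
    have "((\<lambda>\<eta>. ennreal (\<eta>\<^sup>2 * (2 * m))) \<longlongrightarrow> ennreal (0\<^sup>2 * (2 * m))) (at_right 0)"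
      by (intro tendsto_ennrealI tendsto_intros)
    then have "\<forall>\<^sub>F \<eta> in at_right 0. ennreal (\<eta>\<^sup>2 * (2 * m)) < e"
      using \<open>e > 0\<close> by (intro order_tendstoD) auto
    then have "\<forall>\<^sub>F \<eta> in at_right 0. ennreal (\<eta>\<^sup>2 * (2 * m)) < e \<and> \<eta> > (0::real)"
      using eventually_at_right_less[of "0::real"] by eventually_elim auto
    then show ?thesis using that eventually_happens'[OF trivial_limit_at_right_real] by blast
  qed
  have "uniformly_continuous_on {-m..m} g"
    using g by (intro compact_uniformly_continuous continuous_on_subset[OF g]) auto
  then obtain d where d: "d > 0" "\<And>x y. x \<in> {-m..m} \<Longrightarrow> y \<in> {-m..m} \<Longrightarrow> \<bar>x - y\<bar> < d \<Longrightarrow> \<bar>g x - g y\<bar> < \<eta>"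
    using \<eta>(1) unfolding uniformly_continuous_on_def dist_real_def by metis
  obtain n :: nat where n: "2 * m / d < real n" using reals_Archimedean2 by blast
  have "0 \<le> 2 * m / d" using m d by simp
  then have n0: "n > 0" using n by (cases n) auto
  define w where "w = 2 * m / real n"
  define t where "t i = - m + real i * w" for i
  have tSuc: "t i \<le> t (Suc i)" "t (Suc i) - t i < d" for i
  proof -
    have "t (Suc i) - t i = w" by (simp add: t_def algebra_simps)
    moreover have "0 \<le> w" using m by (simp add: w_def)
    moreover have "w < d" using n n0 d by (simp add: w_def field_simps)
    ultimately show "t i \<le> t (Suc i)" "t (Suc i) - t i < d" by linarith+
  qed
  have t_ends: "t 0 = - m" "t n = m" using n0 by (auto simp: t_def w_def)
  have t_mono: "mono t" using tSuc(1) by (rule incseq_SucI)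
  have t_range: "t i \<in> {-m..m}" if "i \<le> n" for i
    using monoD[OF t_mono, of 0 i] monoD[OF t_mono, of i n] that t_ends by auto
  define S where "S = map (\<lambda>i. (g (t i), t i, t (Suc i))) [0..<n]"
  have S: "valid_steps S" using tSuc by (auto simp: S_def valid_steps_def)
  have fS: "step_fun S x = (\<Sum>i<n. g (t i) * indicator {t i<..t (Suc i)} x)" for x
    by (simp add: step_fun_def S_def comp_def interv_sum_list_conv_sum_set_nat atLeast0LessThan)
  have one: "indicator {-m<..m} x = (\<Sum>i<n. indicator {t i<..t (Suc i)} x :: real)" for x
  proof -
    have "(\<Sum>i<n. indicator {t i<..t (Suc i)} x :: real) = (\<Sum>i<n. indicator {x..} (t (Suc i)) - indicator {x..} (t i))"
    proof (rule sum.cong)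
      fix i show "(indicator {t i<..t (Suc i)} x :: real) = indicator {x..} (t (Suc i)) - indicator {x..} (t i)"
        using tSuc(1)[of i] by (auto simp: indicator_def)
    qed simp
    also have "\<dots> = indicator {x..} (t n) - indicator {x..} (t 0)" by (rule sum_lessThan_telescope)
    also have "\<dots> = indicator {-m<..m} x" unfolding t_ends using m by (auto simp: indicator_def)
    finally show ?thesis by simp
  qed
  have close: "\<bar>step_fun S x - g x * indicator {-m<..m} x\<bar> \<le> \<eta> * indicator {-m<..m} x" for x
  proof -
    have "step_fun S x - g x * indicator {-m<..m} x = (\<Sum>i<n. (g (t i) - g x) * indicator {t i<..t (Suc i)} x)"
      unfolding fS one by (simp add: sum_distrib_left sum_subtractf algebra_simps)
    also have "\<bar>\<dots>\<bar> \<le> (\<Sum>i<n. \<bar>(g (t i) - g x) * indicator {t i<..t (Suc i)} x\<bar>)" by (rule sum_abs)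
    also have "\<dots> \<le> (\<Sum>i<n. \<eta> * indicator {t i<..t (Suc i)} x)"
    proof (rule sum_mono)
      fix i assume i: "i \<in> {..<n}"
      show "\<bar>(g (t i) - g x) * indicator {t i<..t (Suc i)} x\<bar> \<le> \<eta> * indicator {t i<..t (Suc i)} x"
      proof (cases "x \<in> {t i<..t (Suc i)}")
        case True
        have "\<bar>g (t i) - g x\<bar> < \<eta>"
        proof (rule d(2))
          show "t i \<in> {-m..m}" using i by (intro t_range) auto
          show "x \<in> {-m..m}" using True t_range[of i] t_range[of "Suc i"] i by auto
          show "\<bar>t i - x\<bar> < d" using True tSuc(2)[of i] by auto
        qed
        then show ?thesis using True by simp
      qed simp
    qed
    also have "\<dots> = \<eta> * indicator {-m<..m} x" unfolding one by (simp add: sum_distrib_left)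
    finally show ?thesis .
  qed
  have "(\<integral>\<^sup>+ x. ennreal ((step_fun S x - g x * indicator {-m<..m} x)\<^sup>2) \<partial>lborel)
    \<le> (\<integral>\<^sup>+ x. ennreal (\<eta>\<^sup>2) * indicator {-m<..m} x \<partial>lborel)"
  proof (intro nn_integral_mono)
    fix x
    have "\<bar>step_fun S x - g x * indicator {-m<..m} x\<bar>\<^sup>2 \<le> (\<eta> * indicator {-m<..m} x)\<^sup>2"
      by (intro power_mono close) auto
    then show "ennreal ((step_fun S x - g x * indicator {-m<..m} x)\<^sup>2) \<le> ennreal (\<eta>\<^sup>2) * indicator {-m<..m} x"
      by (cases "x \<in> {-m<..m}") (auto intro!: ennreal_leI)
  qed
  also have "\<dots> = ennreal (\<eta>\<^sup>2) * ennreal (2 * m)" using m by (simp add: nn_integral_cmult_indicator)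
  also have "\<dots> = ennreal (\<eta>\<^sup>2 * (2 * m))" using m by (subst ennreal_mult) auto
  finally show "\<exists>S. valid_steps S \<and> (\<integral>\<^sup>+ x. ennreal ((step_fun S x - g x * indicator {-m<..m} x)\<^sup>2) \<partial>lborel) < e"
    using S \<eta>(2) by (intro exI[of _ S]) (auto intro: order.strict_trans1)
qed

lemma step_approximable_bounded:
  fixes f :: "real \<Rightarrow> real"
  assumes f [measurable]: "f \<in> borel_measurable borel" and le: "\<And>x. \<bar>f x\<bar> \<le> c" and m: "m \<ge> 0"
  shows "step_approximable (\<lambda>x. f x * indicator {-m<..m} x)"
proof -
  obtain g where g: "\<And>n :: nat. continuous_on UNIV (g n)" "\<And>n x. \<bar>g n x\<bar> \<le> c"
    "AE x in lborel. (\<lambda>n. g n x) \<longlonglongrightarrow> f x"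
    using bounded_borel_approx_continuous[OF f le] by blast
  have [measurable]: "g n \<in> borel_measurable borel" for n
    using g by (intro borel_measurable_continuous_onI)
  show ?thesis
  proof (rule step_approximable_limit)
    show "step_approximable (\<lambda>x. g n x * indicator {-m<..m} x)" for n
      by (rule step_approximable_continuous[OF g(1) m])
    have "(\<lambda>n. \<integral>\<^sup>+ x. ennreal ((g n x * indicator {-m<..m} x - f x * indicator {-m<..m} x)\<^sup>2) \<partial>lborel)
      \<longlonglongrightarrow> (\<integral>\<^sup>+ x. 0 \<partial>(lborel :: real measure))"
    proof (rule nn_integral_dominated_convergence)
      show "AE x in lborel. ennreal ((g n x * indicator {-m<..m} x - f x * indicator {-m<..m} x)\<^sup>2)
          \<le> ennreal ((2 * c)\<^sup>2) * indicator {-m<..m} x" for n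
      proof (rule AE_I2)
        fix x
        have "\<bar>g n x - f x\<bar> \<le> 2 * c" using g(2)[of n x] le[of x] by linarith
        then have "\<bar>g n x - f x\<bar>\<^sup>2 \<le> (2 * c)\<^sup>2" by (intro power_mono) auto
        then show "ennreal ((g n x * indicator {-m<..m} x - f x * indicator {-m<..m} x)\<^sup>2)
          \<le> ennreal ((2 * c)\<^sup>2) * indicator {-m<..m} x"
          by (cases "x \<in> {-m<..m}") (auto intro!: ennreal_leI)
      qed
      show "(\<integral>\<^sup>+ x. ennreal ((2 * c)\<^sup>2) * indicator {-m<..m} x \<partial>lborel) < \<infinity>"
        using m by (simp add: nn_integral_cmult_indicator ennreal_mult_less_top del: power_mult_distrib)
      show "AE x in lborel. (\<lambda>n. ennreal ((g n x * indicator {-m<..m} x - f x * indicator {-m<..m} x)\<^sup>2)) \<longlonglongrightarrow> 0"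
        using g(3)
      proof eventually_elim
        case (elim x)
        then have "(\<lambda>n. (g n x * indicator {-m<..m} x - f x * indicator {-m<..m} x)\<^sup>2)
          \<longlonglongrightarrow> (f x * indicator {-m<..m} x - f x * indicator {-m<..m} x)\<^sup>2" by (intro tendsto_intros)
        then show ?case by (simp add: ennreal_tendsto_0_iff)
      qed
    qed auto
    then show "(\<lambda>n. \<integral>\<^sup>+ x. ennreal ((g n x * indicator {-m<..m} x - f x * indicator {-m<..m} x)\<^sup>2) \<partial>lborel) \<longlonglongrightarrow> 0"
      by simp
  qed measurable
qed

lemma step_approximable_L2:
  fixes f :: "real \<Rightarrow> real"
  assumes f [measurable]: "f \<in> borel_measurable borel" and fin: "(\<integral>\<^sup>+ x. ennreal ((f x)\<^sup>2) \<partial>lborel) < \<infinity>"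
  shows "step_approximable f"
proof -
  \<comment> \<open>Values and range are truncated at once; the error never exceeds |f|, which is
    the majorant for dominated convergence.\<close>
  define g where "g m x = max (- real m) (min (real m) (f x)) * indicator {- real m<..real m} x" for m :: nat and x
  have [measurable]: "g m \<in> borel_measurable borel" for m unfolding g_def by measurable
  show ?thesis
  proof (rule step_approximable_limit[OF _ f])
    show "step_approximable (g m)" for m
      unfolding g_def by (rule step_approximable_bounded[of _ "real m"]) auto
    have "(\<lambda>m. \<integral>\<^sup>+ x. ennreal ((g m x - f x)\<^sup>2) \<partial>lborel) \<longlonglongrightarrow> (\<integral>\<^sup>+ x. 0 \<partial>(lborel :: real measure))"
    proof (rule nn_integral_dominated_convergence[where w="\<lambda>x. ennreal ((f x)\<^sup>2)"])
      show "AE x in lborel. ennreal ((g m x - f x)\<^sup>2) \<le> ennreal ((f x)\<^sup>2)" for m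
      proof (rule AE_I2)
        fix x
        have "\<bar>g m x - f x\<bar> \<le> \<bar>f x\<bar>" by (cases "x \<in> {- real m<..real m}") (auto simp: g_def)
        then have "\<bar>g m x - f x\<bar>\<^sup>2 \<le> \<bar>f x\<bar>\<^sup>2" by (intro power_mono) auto
        then show "ennreal ((g m x - f x)\<^sup>2) \<le> ennreal ((f x)\<^sup>2)" by (intro ennreal_leI) simp
      qed
      show "AE x in lborel. (\<lambda>m. ennreal ((g m x - f x)\<^sup>2)) \<longlonglongrightarrow> 0"
      proof (rule AE_I2)
        fix x
        obtain m0 :: nat where m0: "\<bar>x\<bar> + \<bar>f x\<bar> < real m0" using reals_Archimedean2 by blast
        have "g m x = f x" if "m \<ge> m0" for m
        proof -
          have "\<bar>x\<bar> + \<bar>f x\<bar> < real m" using m0 that by linarith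
          then have "- real m < x" "x \<le> real m" "- real m \<le> f x" "f x \<le> real m" by linarith+
          then show ?thesis by (simp add: g_def)
        qed
        then have "\<forall>\<^sub>F m in sequentially. ennreal ((g m x - f x)\<^sup>2) = 0"
          by (auto simp: eventually_sequentially)
        then show "(\<lambda>m. ennreal ((g m x - f x)\<^sup>2)) \<longlonglongrightarrow> 0" by (rule tendsto_eventually)
      qed
    qed (use fin in auto)
    then show "(\<lambda>m. \<integral>\<^sup>+ x. ennreal ((g m x - f x)\<^sup>2) \<partial>lborel) \<longlonglongrightarrow> 0" by simp
  qed
qed

section \<open>Gaussian law, linearity and existence of the Wiener integral\<close>

lemma square_integral_limit:
  fixes f :: "nat \<Rightarrow> 'b \<Rightarrow> real" and g :: "'b \<Rightarrow> real"
  assumes [measurable]: "\<And>n. f n \<in> borel_measurable D" "g \<in> borel_measurable D"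
    and lim: "(\<lambda>n. \<integral>\<^sup>+ x. ennreal ((f n x - g x)\<^sup>2) \<partial>D) \<longlonglongrightarrow> 0"
    and fv: "\<And>n. (\<integral>\<^sup>+ x. ennreal ((f n x)\<^sup>2) \<partial>D) = ennreal (v n)" "\<And>n. v n \<ge> 0"
    and gw: "(\<integral>\<^sup>+ x. ennreal ((g x)\<^sup>2) \<partial>D) = ennreal w" "w \<ge> 0"
  shows "v \<longlonglongrightarrow> w"
proof (rule LIMSEQ_I)
  fix e :: real assume e: "e > 0"
  \<comment> \<open>\<eta> makes \<eta> w at most e / 2, and \<theta> below makes (1 + 1 / \<eta>)
    \<theta> equal to e / 4; the denominator w + 1 covers w = 0.\<close>
  define \<eta> where "\<eta> = e / (2 * (w + 1))"
  have \<eta>: "\<eta> > 0" using e gw by (simp add: \<eta>_def)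
  have \<eta>w: "\<eta> * w \<le> e / 2" using e gw(2) by (simp add: \<eta>_def field_simps)
  define d where "d n = enn2real (\<integral>\<^sup>+ x. ennreal ((f n x - g x)\<^sup>2) \<partial>D)" for n
  define \<theta> where "\<theta> = e / (4 * (1 + 1 / \<eta>))"
  have \<theta>: "\<theta> > 0" using e \<eta> by (simp add: \<theta>_def add_pos_pos)
  have "\<forall>\<^sub>F n in sequentially. (\<integral>\<^sup>+ x. ennreal ((f n x - g x)\<^sup>2) \<partial>D) < ennreal \<theta>"
    using lim \<theta> by (intro order_tendstoD) auto
  then obtain n0 where n0: "\<And>n. n \<ge> n0 \<Longrightarrow> (\<integral>\<^sup>+ x. ennreal ((f n x - g x)\<^sup>2) \<partial>D) < ennreal \<theta>"
    by (auto simp: eventually_sequentially)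
  \<comment> \<open>The mixed term 2 b u, with u = a - b, is absorbed into \<eta> b^2 + u^2 /
    \<eta>. In both inequalities the \<eta>-term carries b, to be taken as the limit g, whose second
    moment is fixed.\<close>
  have pw: "a\<^sup>2 \<le> b\<^sup>2 + \<eta> * b\<^sup>2 + (1 + 1 / \<eta>) * (a - b)\<^sup>2 \<and> b\<^sup>2 \<le> a\<^sup>2 + \<eta> * b\<^sup>2 + (1 + 1 / \<eta>) * (a - b)\<^sup>2"
    for a b :: real
  proof -
    define u where "u = a - b"
    have "0 \<le> (\<eta> * b - u)\<^sup>2 / \<eta>" "0 \<le> (\<eta> * b + u)\<^sup>2 / \<eta>" using \<eta> by auto
    then have "2 * b * u \<le> \<eta> * b\<^sup>2 + 1 / \<eta> * u\<^sup>2" "- (2 * b * u) \<le> \<eta> * b\<^sup>2 + 1 / \<eta> * u\<^sup>2"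
      using \<eta> by (auto simp: power2_eq_square field_simps)
    moreover have "a\<^sup>2 = b\<^sup>2 + 2 * b * u + u\<^sup>2" by (simp add: u_def power2_eq_square algebra_simps)
    moreover have "0 \<le> u\<^sup>2" by simp
    ultimately show ?thesis unfolding u_def[symmetric] by (simp add: distrib_right)
  qed
  have int: "(\<integral>\<^sup>+ x. ennreal ((p x)\<^sup>2) \<partial>D) \<le> (\<integral>\<^sup>+ x. ennreal ((q x)\<^sup>2) \<partial>D)
      + ennreal \<eta> * ennreal w + ennreal (1 + 1 / \<eta>) * (\<integral>\<^sup>+ x. ennreal ((f n x - g x)\<^sup>2) \<partial>D)"
    if le: "\<And>x. (p x)\<^sup>2 \<le> (q x)\<^sup>2 + \<eta> * (g x)\<^sup>2 + (1 + 1 / \<eta>) * (f n x - g x)\<^sup>2"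
      and [measurable]: "q \<in> borel_measurable D" for p q n
  proof -
    have "(\<integral>\<^sup>+ x. ennreal ((p x)\<^sup>2) \<partial>D) \<le> (\<integral>\<^sup>+ x. ennreal ((q x)\<^sup>2) + ennreal \<eta> * ennreal ((g x)\<^sup>2)
      + ennreal (1 + 1 / \<eta>) * ennreal ((f n x - g x)\<^sup>2) \<partial>D)"
    proof (intro nn_integral_mono)
      fix x
      have "ennreal ((p x)\<^sup>2) \<le> ennreal ((q x)\<^sup>2 + \<eta> * (g x)\<^sup>2 + (1 + 1 / \<eta>) * (f n x - g x)\<^sup>2)"
        by (intro ennreal_leI le)
      also have "\<dots> = ennreal ((q x)\<^sup>2) + ennreal (\<eta> * (g x)\<^sup>2) + ennreal ((1 + 1 / \<eta>) * (f n x - g x)\<^sup>2)"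
        using \<eta> by (subst ennreal_plus, simp, simp)+ simp
      also have "ennreal (\<eta> * (g x)\<^sup>2) = ennreal \<eta> * ennreal ((g x)\<^sup>2)" using \<eta> by (intro ennreal_mult) auto
      also have "ennreal ((1 + 1 / \<eta>) * (f n x - g x)\<^sup>2) = ennreal (1 + 1 / \<eta>) * ennreal ((f n x - g x)\<^sup>2)"
        using \<eta> by (intro ennreal_mult) auto
      finally show "ennreal ((p x)\<^sup>2) \<le> ennreal ((q x)\<^sup>2) + ennreal \<eta> * ennreal ((g x)\<^sup>2)
        + ennreal (1 + 1 / \<eta>) * ennreal ((f n x - g x)\<^sup>2)" .
    qed
    also have "\<dots> = (\<integral>\<^sup>+ x. ennreal ((q x)\<^sup>2) \<partial>D) + ennreal \<eta> * ennreal w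
      + ennreal (1 + 1 / \<eta>) * (\<integral>\<^sup>+ x. ennreal ((f n x - g x)\<^sup>2) \<partial>D)"
      by (simp add: nn_integral_add nn_integral_cmult gw)
    finally show ?thesis .
  qed
  have real: "a \<le> b + e / 2 + e / 4"
    if "ennreal a \<le> ennreal b + ennreal \<eta> * ennreal w + ennreal (1 + 1 / \<eta>) * I" "I < ennreal \<theta>" "0 \<le> b" for a b I
  proof -
    have "ennreal a \<le> ennreal b + ennreal \<eta> * ennreal w + ennreal (1 + 1 / \<eta>) * ennreal \<theta>"
      using that by (elim order_trans) (auto intro!: add_left_mono mult_left_mono)
    also have "\<dots> = ennreal (b + \<eta> * w + (1 + 1 / \<eta>) * \<theta>)"
    proof -
      have "ennreal (b + \<eta> * w + (1 + 1 / \<eta>) * \<theta>) = ennreal (b + \<eta> * w) + ennreal ((1 + 1 / \<eta>) * \<theta>)"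
        using that \<eta> \<theta> gw by (intro ennreal_plus) auto
      also have "ennreal (b + \<eta> * w) = ennreal b + ennreal (\<eta> * w)" using that \<eta> gw by (intro ennreal_plus) auto
      also have "ennreal (\<eta> * w) = ennreal \<eta> * ennreal w" using \<eta> gw by (intro ennreal_mult) auto
      also have "ennreal ((1 + 1 / \<eta>) * \<theta>) = ennreal (1 + 1 / \<eta>) * ennreal \<theta>" using \<eta> \<theta> by (intro ennreal_mult) auto
      finally show ?thesis by simp
    qed
    finally have "a \<le> b + \<eta> * w + (1 + 1 / \<eta>) * \<theta>"
      using that \<eta> \<theta> gw by (subst (asm) ennreal_le_iff) auto
    moreover have "P * (e / (4 * P)) = e / 4" if "P > 0" for P using that by simp
    from this[of "1 + 1 / \<eta>"] have "(1 + 1 / \<eta>) * \<theta> = e / 4" using \<eta> by (simp only: \<theta>_def) (simp add: add_pos_pos)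
    ultimately show ?thesis using \<eta>w by linarith
  qed
  have "norm (v n - w) < e" if "n \<ge> n0" for n
  proof -
    have "v n \<le> w + e / 2 + e / 4"
      using int[of "f n" g n] pw fv(1)[of n] n0[OF that] gw by (intro real) auto
    moreover have "w \<le> v n + e / 2 + e / 4"
      using int[of g "f n" n] pw fv[of n] n0[OF that] gw by (intro real) auto
    ultimately show ?thesis using e by (simp add: abs_less_iff)
  qed
  then show "\<exists>n0. \<forall>n\<ge>n0. norm (v n - w) < e" by blast
qed

text \<open>The approximating step integrals are centred Gaussian with the squared norms of the step
  functions as variances. These norms converge to that of f, and the Gaussian laws are closed under
  L2 limits.\<close>

lemma (in prob_space) has_wiener_integral_gaussian:
  assumes W: "two_sided_wiener M W" and X: "has_wiener_integral M W f X"
  shows "(\<integral>\<^sup>+ x. ennreal ((f x)\<^sup>2) \<partial>lborel) < \<infinity>"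
    and "centered_gaussian M (enn2real (\<integral>\<^sup>+ x. ennreal ((f x)\<^sup>2) \<partial>lborel)) X"
proof -
  have [measurable]: "f \<in> borel_measurable borel" "X \<in> borel_measurable M"
    using X by (auto simp: has_wiener_integral_def)
  obtain S where S: "\<And>n. valid_steps (S n)"
    and f: "(\<lambda>n. \<integral>\<^sup>+ x. ennreal ((step_fun (S n) x - f x)\<^sup>2) \<partial>lborel) \<longlonglongrightarrow> 0"
    and I: "(\<lambda>n. \<integral>\<^sup>+ \<omega>. ennreal ((step_wiener_integral W (S n) \<omega> - X \<omega>)\<^sup>2) \<partial>M) \<longlonglongrightarrow> 0"
    using X unfolding has_wiener_integral_def valid_steps_def by blast
  have "\<exists>v. \<forall>n. centered_gaussian M (v n) (step_wiener_integral W (S n)) \<and>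
      (\<integral>\<^sup>+ x. ennreal ((step_fun (S n) x)\<^sup>2) \<partial>lborel) = ennreal (v n)"
    using step_wiener_integral_gaussian[OF W S] by metis
  then obtain v where v: "\<And>n. centered_gaussian M (v n) (step_wiener_integral W (S n))"
    "\<And>n. (\<integral>\<^sup>+ x. ennreal ((step_fun (S n) x)\<^sup>2) \<partial>lborel) = ennreal (v n)" by blast
  have v0: "v n \<ge> 0" for n using v(1) by (rule centered_gaussian_nonneg)
  have "\<forall>\<^sub>F n in sequentially. (\<integral>\<^sup>+ x. ennreal ((step_fun (S n) x - f x)\<^sup>2) \<partial>lborel) < 1"
    using f by (rule order_tendstoD) simp
  then obtain n where n: "(\<integral>\<^sup>+ x. ennreal ((step_fun (S n) x - f x)\<^sup>2) \<partial>lborel) < 1"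
    by (auto simp: eventually_sequentially)
  have "(\<integral>\<^sup>+ x. ennreal ((f x - 0)\<^sup>2) \<partial>lborel) \<le> 2 * (\<integral>\<^sup>+ x. ennreal ((f x - step_fun (S n) x)\<^sup>2) \<partial>lborel)
      + 2 * (\<integral>\<^sup>+ x. ennreal ((step_fun (S n) x - 0)\<^sup>2) \<partial>lborel)"
    by (rule nn_integral_square_triangle) measurable
  also have "\<dots> < \<infinity>"
    using n v(2)[of n] by (simp add: power2_commute[of "f _"] ennreal_mult_less_top order.strict_trans[OF n])
  finally show fin: "(\<integral>\<^sup>+ x. ennreal ((f x)\<^sup>2) \<partial>lborel) < \<infinity>" by simp
  have "v \<longlonglongrightarrow> enn2real (\<integral>\<^sup>+ x. ennreal ((f x)\<^sup>2) \<partial>lborel)"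
    by (rule square_integral_limit[OF _ _ f v(2) v0]) (use fin in auto)
  then show "centered_gaussian M (enn2real (\<integral>\<^sup>+ x. ennreal ((f x)\<^sup>2) \<partial>lborel)) X"
    by (rule centered_gaussian_limit[OF v(1)]) (use I in auto)
qed

lemma step_wiener_integral_measurable:
  assumes W: "\<And>t. W t \<in> borel_measurable M"
  shows "step_wiener_integral W S \<in> borel_measurable M"
proof (induction S)
  case (Cons p S)
  obtain a s t where p: "p = (a, s, t)" by (cases p)
  have "step_wiener_integral W (p # S) = (\<lambda>\<omega>. a * (W t \<omega> - W s \<omega>) + step_wiener_integral W S \<omega>)"
    by (auto simp: step_wiener_integral_def p)
  then show ?case using Cons W by simp
qed (simp add: step_wiener_integral_def[abs_def])

lemma has_wiener_integral_add:
  assumes W: "\<And>t. W t \<in> borel_measurable M"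
    and X: "has_wiener_integral M W f X" and Y: "has_wiener_integral M W g Y"
  shows "has_wiener_integral M W (\<lambda>x. f x + g x) (\<lambda>\<omega>. X \<omega> + Y \<omega>)"
proof -
  note [measurable] = step_wiener_integral_measurable[OF W]
  have [measurable]: "f \<in> borel_measurable borel" "X \<in> borel_measurable M" "g \<in> borel_measurable borel" "Y \<in> borel_measurable M"
    using X Y by (auto simp: has_wiener_integral_def)
  obtain S where S: "\<And>n. valid_steps (S n)"
    and f: "(\<lambda>n. \<integral>\<^sup>+ x. ennreal ((step_fun (S n) x - f x)\<^sup>2) \<partial>lborel) \<longlonglongrightarrow> 0"
    and I: "(\<lambda>n. \<integral>\<^sup>+ \<omega>. ennreal ((step_wiener_integral W (S n) \<omega> - X \<omega>)\<^sup>2) \<partial>M) \<longlonglongrightarrow> 0"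
    using X unfolding has_wiener_integral_def valid_steps_def by blast
  obtain T where T: "\<And>n. valid_steps (T n)"
    and g: "(\<lambda>n. \<integral>\<^sup>+ x. ennreal ((step_fun (T n) x - g x)\<^sup>2) \<partial>lborel) \<longlonglongrightarrow> 0"
    and J: "(\<lambda>n. \<integral>\<^sup>+ \<omega>. ennreal ((step_wiener_integral W (T n) \<omega> - Y \<omega>)\<^sup>2) \<partial>M) \<longlonglongrightarrow> 0"
    using Y unfolding has_wiener_integral_def valid_steps_def by blast
  have lim: "(\<lambda>n. \<integral>\<^sup>+ x. ennreal ((p n x + q n x - (r x + s x))\<^sup>2) \<partial>D) \<longlonglongrightarrow> 0"
    if p: "(\<lambda>n. \<integral>\<^sup>+ x. ennreal ((p n x - r x)\<^sup>2) \<partial>D) \<longlonglongrightarrow> 0" and q: "(\<lambda>n. \<integral>\<^sup>+ x. ennreal ((q n x - s x)\<^sup>2) \<partial>D) \<longlonglongrightarrow> 0"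
      and [measurable]: "\<And>n. p n \<in> borel_measurable D" "\<And>n. q n \<in> borel_measurable D" "r \<in> borel_measurable D" "s \<in> borel_measurable D"
    for p q :: "nat \<Rightarrow> 'b \<Rightarrow> real" and r s :: "'b \<Rightarrow> real" and D :: "'b measure"
  proof (rule tendsto_sandwich[OF _ _ tendsto_const])
    show "\<forall>\<^sub>F n in sequentially. (\<integral>\<^sup>+ x. ennreal ((p n x + q n x - (r x + s x))\<^sup>2) \<partial>D)
      \<le> 2 * (\<integral>\<^sup>+ x. ennreal ((p n x - r x)\<^sup>2) \<partial>D) + 2 * (\<integral>\<^sup>+ x. ennreal ((q n x - s x)\<^sup>2) \<partial>D)"
    proof (rule always_eventually, rule allI)
      fix n
      \<comment> \<open>The triangle inequality for p - r and s - q through 0.\<close>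
      show "(\<integral>\<^sup>+ x. ennreal ((p n x + q n x - (r x + s x))\<^sup>2) \<partial>D)
        \<le> 2 * (\<integral>\<^sup>+ x. ennreal ((p n x - r x)\<^sup>2) \<partial>D) + 2 * (\<integral>\<^sup>+ x. ennreal ((q n x - s x)\<^sup>2) \<partial>D)"
        using nn_integral_square_triangle[of "\<lambda>x. p n x - r x" D "\<lambda>_. 0" "\<lambda>x. s x - q n x"]
        by (simp add: algebra_simps power2_commute[of "s _"])
    qed
    have "(\<lambda>n. 2 * (\<integral>\<^sup>+ x. ennreal ((p n x - r x)\<^sup>2) \<partial>D) + 2 * (\<integral>\<^sup>+ x. ennreal ((q n x - s x)\<^sup>2) \<partial>D)) \<longlonglongrightarrow> 2 * 0 + 2 * 0"
      by (intro tendsto_add ennreal_tendsto_cmult p q) auto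
    then show "(\<lambda>n. 2 * (\<integral>\<^sup>+ x. ennreal ((p n x - r x)\<^sup>2) \<partial>D) + 2 * (\<integral>\<^sup>+ x. ennreal ((q n x - s x)\<^sup>2) \<partial>D)) \<longlonglongrightarrow> 0" by simp
  qed auto
  show ?thesis
    unfolding has_wiener_integral_def
  proof (intro conjI exI[of _ "\<lambda>n. S n @ T n"])
    show "\<forall>n. \<forall>(a, s, t)\<in>set (S n @ T n). s \<le> t"
      using valid_steps_append[OF S T] by (auto simp: valid_steps_def)
    show "(\<lambda>n. \<integral>\<^sup>+ x. ennreal ((step_fun (S n @ T n) x - (f x + g x))\<^sup>2) \<partial>lborel) \<longlonglongrightarrow> 0"
      unfolding step_fun_append by (rule lim[OF f g]) auto
    show "(\<lambda>n. \<integral>\<^sup>+ \<omega>. ennreal ((step_wiener_integral W (S n @ T n) \<omega> - (X \<omega> + Y \<omega>))\<^sup>2) \<partial>M) \<longlonglongrightarrow> 0"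
      unfolding step_wiener_integral_append by (rule lim[OF I J]) auto
  qed auto
qed

lemma has_wiener_integral_scale:
  assumes W: "\<And>t. W t \<in> borel_measurable M" and X: "has_wiener_integral M W f X"
  shows "has_wiener_integral M W (\<lambda>x. c * f x) (\<lambda>\<omega>. c * X \<omega>)"
proof -
  note [measurable] = step_wiener_integral_measurable[OF W]
  have [measurable]: "f \<in> borel_measurable borel" "X \<in> borel_measurable M"
    using X by (auto simp: has_wiener_integral_def)
  obtain S where S: "\<And>n. valid_steps (S n)"
    and f: "(\<lambda>n. \<integral>\<^sup>+ x. ennreal ((step_fun (S n) x - f x)\<^sup>2) \<partial>lborel) \<longlonglongrightarrow> 0"
    and I: "(\<lambda>n. \<integral>\<^sup>+ \<omega>. ennreal ((step_wiener_integral W (S n) \<omega> - X \<omega>)\<^sup>2) \<partial>M) \<longlonglongrightarrow> 0"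
    using X unfolding has_wiener_integral_def valid_steps_def by blast
  have scale: "(\<integral>\<^sup>+ x. ennreal ((c * p x - c * r x)\<^sup>2) \<partial>D) = ennreal (c\<^sup>2) * (\<integral>\<^sup>+ x. ennreal ((p x - r x)\<^sup>2) \<partial>D)"
    if [measurable]: "p \<in> borel_measurable D" "r \<in> borel_measurable D" for p r :: "'b \<Rightarrow> real" and D :: "'b measure"
  proof -
    have "(\<integral>\<^sup>+ x. ennreal ((c * p x - c * r x)\<^sup>2) \<partial>D) = (\<integral>\<^sup>+ x. ennreal (c\<^sup>2) * ennreal ((p x - r x)\<^sup>2) \<partial>D)"
      by (intro nn_integral_cong) (simp add: power_mult_distrib flip: right_diff_distrib ennreal_mult)
    then show ?thesis by (simp add: nn_integral_cmult)
  qed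
  show ?thesis
    unfolding has_wiener_integral_def
  proof (intro conjI exI[of _ "\<lambda>n. scale_steps c (S n)"])
    show "\<forall>n. \<forall>(a, s, t)\<in>set (scale_steps c (S n)). s \<le> t"
      using valid_steps_scale[OF S] by (auto simp: valid_steps_def)
    show "(\<lambda>n. \<integral>\<^sup>+ x. ennreal ((step_fun (scale_steps c (S n)) x - c * f x)\<^sup>2) \<partial>lborel) \<longlonglongrightarrow> 0"
      unfolding step_fun_scale using ennreal_tendsto_cmult[OF _ f, of "ennreal (c\<^sup>2)"] by (simp add: scale)
    show "(\<lambda>n. \<integral>\<^sup>+ \<omega>. ennreal ((step_wiener_integral W (scale_steps c (S n)) \<omega> - c * X \<omega>)\<^sup>2) \<partial>M) \<longlonglongrightarrow> 0"
      unfolding step_wiener_integral_scale using ennreal_tendsto_cmult[OF _ I, of "ennreal (c\<^sup>2)"] by (simp add: scale)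
  qed auto
qed

lemma has_wiener_integral_sum:
  fixes n :: nat
  assumes W: "\<And>t. W t \<in> borel_measurable M" and X: "\<And>i. i < n \<Longrightarrow> has_wiener_integral M W (f i) (X i)"
  shows "has_wiener_integral M W (\<lambda>x. \<Sum>i<n. a i * f i x) (\<lambda>\<omega>. \<Sum>i<n. a i * X i \<omega>)"
  using X
proof (induction n)
  case 0
  have "step_fun [] = (\<lambda>x. 0)" "step_wiener_integral W [] = (\<lambda>\<omega>. 0)"
    by (auto simp: step_fun_def step_wiener_integral_def)
  then show ?case unfolding has_wiener_integral_def by (auto intro!: exI[of _ "\<lambda>_. []"])
next
  case (Suc n)
  then show ?case
    using has_wiener_integral_add[OF W Suc.IH has_wiener_integral_scale[OF W Suc.prems[of n], of "a n"]] by simp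
qed

text \<open>By the isometry the integrals of approximating step functions are Cauchy in L2, hence in
  L1, hence almost surely along a subsequence. Fatou's lemma then identifies the almost sure limit
  as the L2 limit of the whole sequence.\<close>

lemma (in prob_space) has_wiener_integral_exists:
  assumes W: "two_sided_wiener M W" and f [measurable]: "f \<in> borel_measurable borel"
    and fin: "(\<integral>\<^sup>+ x. ennreal ((f x)\<^sup>2) \<partial>lborel) < \<infinity>"
  shows "\<exists>X. has_wiener_integral M W f X"
proof -
  have Wm: "W t \<in> borel_measurable M" for t using W by (simp add: two_sided_wiener_def)
  note [measurable] = step_wiener_integral_measurable[OF Wm]
  have "step_approximable f" by (rule step_approximable_L2[OF f fin])
  then have "\<exists>S. \<forall>n. valid_steps (S n) \<and> (\<integral>\<^sup>+ x. ennreal ((step_fun (S n) x - f x)\<^sup>2) \<partial>lborel) < ennreal (1 / real (Suc n))"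
    unfolding step_approximable_def by (intro choice allI) simp
  then obtain S where S: "\<And>n. valid_steps (S n)"
    and d: "\<And>n. (\<integral>\<^sup>+ x. ennreal ((step_fun (S n) x - f x)\<^sup>2) \<partial>lborel) < ennreal (1 / real (Suc n))" by blast
  define X where "X n = step_wiener_integral W (S n)" for n
  have [measurable]: "X n \<in> borel_measurable M" for n by (simp add: X_def)
  have isometry: "(\<integral>\<^sup>+ \<omega>. ennreal ((X m \<omega> - X n \<omega>)\<^sup>2) \<partial>M) \<le> ennreal (2 / real (Suc m) + 2 / real (Suc n))" for m n
  proof -
    \<comment> \<open>The difference of two step integrals is itself a step integral, of the first
      list followed by the negated second one, so the isometry for step functions applies.\<close>
    let ?T = "S m @ scale_steps (- 1) (S n)"
    have "valid_steps ?T" by (intro valid_steps_append valid_steps_scale S)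
    then obtain v where v: "centered_gaussian M v (step_wiener_integral W ?T)"
      "(\<integral>\<^sup>+ x. ennreal ((step_fun ?T x)\<^sup>2) \<partial>lborel) = ennreal v"
      using step_wiener_integral_gaussian[OF W] by blast
    have "(\<integral>\<^sup>+ \<omega>. ennreal ((X m \<omega> - X n \<omega>)\<^sup>2) \<partial>M) = (\<integral>\<^sup>+ \<omega>. ennreal ((step_wiener_integral W ?T \<omega>)\<^sup>2) \<partial>M)"
      by (simp add: X_def step_wiener_integral_append step_wiener_integral_scale)
    also have "\<dots> = ennreal v"
      using centered_gaussian_moments(3,4)[OF v(1)] by (subst nn_integral_eq_integral) auto
    also have "\<dots> = (\<integral>\<^sup>+ x. ennreal ((step_fun (S m) x - step_fun (S n) x)\<^sup>2) \<partial>lborel)"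
      unfolding v(2)[symmetric] by (simp add: step_fun_append step_fun_scale)
    also have "\<dots> \<le> 2 * (\<integral>\<^sup>+ x. ennreal ((step_fun (S m) x - f x)\<^sup>2) \<partial>lborel)
        + 2 * (\<integral>\<^sup>+ x. ennreal ((f x - step_fun (S n) x)\<^sup>2) \<partial>lborel)"
      by (rule nn_integral_square_triangle) measurable
    also have "\<dots> \<le> 2 * ennreal (1 / real (Suc m)) + 2 * ennreal (1 / real (Suc n))"
      using d[of m] d[of n] by (intro add_mono mult_left_mono) (auto simp: power2_commute[of "f _"])
    also have "\<dots> = ennreal (2 / real (Suc m)) + ennreal (2 / real (Suc n))"
    proof -
      have "2 * ennreal (1 / real (Suc k)) = ennreal (2 / real (Suc k))" for k
        using ennreal_mult[of 2 "1 / real (Suc k)"] by (simp del: of_nat_Suc)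
      then show ?thesis by simp
    qed
    also have "\<dots> = ennreal (2 / real (Suc m) + 2 / real (Suc n))" by (rule ennreal_plus[symmetric]) auto
    finally show ?thesis .
  qed
  have intX: "integrable M (X n)" for n
    using step_wiener_integral_gaussian[OF W S[of n]] centered_gaussian_moments(1) by (auto simp: X_def)
  have "\<exists>r :: nat \<Rightarrow> nat. strict_mono r \<and> (AE \<omega> in M. Cauchy (\<lambda>i. X (r i) \<omega>))"
  proof -
    have "\<exists>N. \<forall>i\<ge>N. \<forall>j\<ge>N. (LINT \<omega>|M. norm (X i \<omega> - X j \<omega>)) < e" if e: "e > 0" for e
    proof -
      \<comment> \<open>Beyond N each 2 / (k + 1) is below e^2 / 8, so the second moment stays below
        e^2 / 4 and \<open>nn_integral_abs_le\<close> at e / 2 gives less than e.\<close>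
      obtain N :: nat where N: "16 / e\<^sup>2 < real N" using reals_Archimedean2 by blast
      have "(LINT \<omega>|M. norm (X i \<omega> - X j \<omega>)) < e" if ij: "i \<ge> N" "j \<ge> N" for i j
      proof -
        have small: "2 / real (Suc k) < e\<^sup>2 / 8" if "k \<ge> N" for k
        proof -
          have "16 / e\<^sup>2 < real (Suc k)" using N that by linarith
          then show ?thesis using e by (simp add: field_simps del: of_nat_Suc)
        qed
        have "ennreal (LINT \<omega>|M. norm (X i \<omega> - X j \<omega>)) = (\<integral>\<^sup>+ \<omega>. ennreal \<bar>X i \<omega> - X j \<omega>\<bar> \<partial>M)"
          using intX by (subst nn_integral_eq_integral) auto
        also have "\<dots> \<le> ennreal (e / 2) + ennreal (1 / (e / 2)) * (\<integral>\<^sup>+ \<omega>. ennreal ((X i \<omega> - X j \<omega>)\<^sup>2) \<partial>M)"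
          using e by (intro nn_integral_abs_le) auto
        also have "\<dots> \<le> ennreal (e / 2) + ennreal (1 / (e / 2)) * ennreal (2 / real (Suc i) + 2 / real (Suc j))"
          by (intro add_left_mono mult_left_mono isometry) auto
        also have "\<dots> = ennreal (e / 2 + 1 / (e / 2) * (2 / real (Suc i) + 2 / real (Suc j)))"
          using e by (subst ennreal_mult[symmetric], simp, simp, subst ennreal_plus[symmetric]) auto
        also have "\<dots> < ennreal e"
        proof (subst ennreal_less_iff)
          have "1 / (e / 2) * (2 / real (Suc i) + 2 / real (Suc j)) < 1 / (e / 2) * (e\<^sup>2 / 4)"
            using small[OF ij(1)] small[OF ij(2)] e by (intro mult_strict_left_mono) auto
          also have "\<dots> = e / 2" using e by (simp add: power2_eq_square)
          finally show "e / 2 + 1 / (e / 2) * (2 / real (Suc i) + 2 / real (Suc j)) < e" by linarith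
        qed (use e in auto)
        finally show ?thesis using e by (simp add: ennreal_less_iff)
      qed
      then show ?thesis by blast
    qed
    then show ?thesis using cauchy_L1_AE_cauchy_subseq[of M X] intX by blast
  qed
  then obtain r :: "nat \<Rightarrow> nat" where r: "strict_mono r" "AE \<omega> in M. Cauchy (\<lambda>i. X (r i) \<omega>)" by blast
  define Y where "Y \<omega> = lim (\<lambda>i. X (r i) \<omega>)" for \<omega>
  have [measurable]: "Y \<in> borel_measurable M" unfolding Y_def by measurable
  have Y: "AE \<omega> in M. (\<lambda>i. X (r i) \<omega>) \<longlonglongrightarrow> Y \<omega>"
    using r(2) by eventually_elim (simp add: Y_def Cauchy_convergent_iff convergent_LIMSEQ_iff)
  have le: "(\<integral>\<^sup>+ \<omega>. ennreal ((X n \<omega> - Y \<omega>)\<^sup>2) \<partial>M) \<le> ennreal (2 / real (Suc n))" for n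
  proof -
    have lim: "(\<lambda>i. ennreal (2 / real (Suc n) + 2 / real (Suc (r i)))) \<longlonglongrightarrow> ennreal (2 / real (Suc n) + 0)"
    proof (intro tendsto_ennrealI tendsto_add tendsto_const)
      have "(\<lambda>k. 2 / real (Suc k)) \<longlonglongrightarrow> 0" by (rule LIMSEQ_Suc[OF lim_const_over_n])
      from LIMSEQ_subseq_LIMSEQ[OF this r(1)] show "(\<lambda>i. 2 / real (Suc (r i))) \<longlonglongrightarrow> 0" by (simp add: comp_def)
    qed
    have "(\<integral>\<^sup>+ \<omega>. ennreal ((X n \<omega> - Y \<omega>)\<^sup>2) \<partial>M) = (\<integral>\<^sup>+ \<omega>. liminf (\<lambda>i. ennreal ((X n \<omega> - X (r i) \<omega>)\<^sup>2)) \<partial>M)"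
    proof (rule nn_integral_cong_AE, use Y in eventually_elim)
      case (elim \<omega>)
      then have "(\<lambda>i. ennreal ((X n \<omega> - X (r i) \<omega>)\<^sup>2)) \<longlonglongrightarrow> ennreal ((X n \<omega> - Y \<omega>)\<^sup>2)"
        by (intro tendsto_ennrealI tendsto_intros)
      from lim_imp_Liminf[OF trivial_limit_sequentially this] show ?case by (rule sym)
    qed
    also have "\<dots> \<le> liminf (\<lambda>i. \<integral>\<^sup>+ \<omega>. ennreal ((X n \<omega> - X (r i) \<omega>)\<^sup>2) \<partial>M)"
      by (rule nn_integral_liminf) auto
    also have "\<dots> \<le> liminf (\<lambda>i. ennreal (2 / real (Suc n) + 2 / real (Suc (r i))))"
      by (intro Liminf_mono always_eventually allI isometry)
    also have "\<dots> = ennreal (2 / real (Suc n) + 0)" using lim by (intro lim_imp_Liminf) auto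
    finally show ?thesis by simp
  qed
  have "has_wiener_integral M W f Y"
    unfolding has_wiener_integral_def
  proof (intro conjI exI[of _ S])
    show "\<forall>n. \<forall>(a, s, t)\<in>set (S n). s \<le> t" using S by (simp add: valid_steps_def)
    have z: "(\<lambda>n. ennreal (c / real (Suc n))) \<longlonglongrightarrow> 0" for c
    proof -
      have "(\<lambda>n. c / real (Suc n)) \<longlonglongrightarrow> 0" by (rule LIMSEQ_Suc[OF lim_const_over_n])
      from tendsto_ennrealI[OF this] show ?thesis by simp
    qed
    show "(\<lambda>n. \<integral>\<^sup>+ x. ennreal ((step_fun (S n) x - f x)\<^sup>2) \<partial>lborel) \<longlonglongrightarrow> 0"
      by (rule tendsto_sandwich[OF _ _ tendsto_const z[of 1]]) (use d in \<open>auto simp: less_imp_le\<close>)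
    show "(\<lambda>n. \<integral>\<^sup>+ \<omega>. ennreal ((step_wiener_integral W (S n) \<omega> - Y \<omega>)\<^sup>2) \<partial>M) \<longlonglongrightarrow> 0"
      by (rule tendsto_sandwich[OF _ _ tendsto_const z[of 2]]) (use le in \<open>auto simp: X_def\<close>)
  qed auto
  then show ?thesis by blast
qed

section \<open>The Mandelbrot--Van Ness kernel\<close>

lemma pos_powr_measurable [measurable]: "(\<lambda>x. pos_powr (f x) \<gamma>) \<in> borel_measurable D" if "f \<in> borel_measurable D" for f
  using that unfolding pos_powr_def by measurable

lemma pos_powr_scale: "c > 0 \<Longrightarrow> pos_powr (c * u) \<gamma> = c powr \<gamma> * pos_powr u \<gamma>"
  by (cases "u \<ge> 0") (auto simp: pos_powr_def powr_mult max_def zero_le_mult_iff)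

lemma nn_integral_real_affine_0:
  fixes G :: "real \<Rightarrow> ennreal"
  assumes [measurable]: "G \<in> borel_measurable borel" and "c > 0"
  shows "(\<integral>\<^sup>+ x. G x \<partial>lborel) = ennreal c * (\<integral>\<^sup>+ x. G (t + c * x) \<partial>lborel)"
  using nn_integral_real_affine[of G c t] assms by simp

lemma nn_integral_powr_from_0:
  assumes "a > -1" "c \<ge> 0"
  shows "(\<integral>\<^sup>+ x \<in> {0..c}. ennreal (x powr a) \<partial>lborel) < \<infinity>"
proof -
  have "((\<lambda>x. x powr a) has_integral (c powr (a + 1) / (a + 1))) {0..c}"
    by (rule has_integral_powr_from_0[OF assms])
  then have "(\<integral>\<^sup>+ x. ennreal (x powr a) * indicator {0..c} x \<partial>lborel) = ennreal (c powr (a + 1) / (a + 1))"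
    by (intro nn_integral_has_integral_lebesgue') auto
  then show ?thesis by simp
qed

lemma nn_integral_powr_to_inf:
  fixes a :: real
  assumes "e < -1" "a > 0"
  shows "(\<integral>\<^sup>+ x \<in> {a..}. ennreal (x powr e) \<partial>lborel) < \<infinity>"
proof -
  have "((\<lambda>x. x powr e) has_integral -(a powr (e + 1)) / (e + 1)) {a..}"
    by (rule has_integral_powr_to_inf[OF assms])
  then have "(\<integral>\<^sup>+ x. ennreal (x powr e) * indicator {a..} x \<partial>lborel) = ennreal (-(a powr (e + 1)) / (e + 1))"
    by (intro nn_integral_has_integral_lebesgue') auto
  then show ?thesis by simp
qed

definition mvn :: "real \<Rightarrow> real \<Rightarrow> real \<Rightarrow> real" where
  "mvn \<gamma> t x = pos_powr (t - x) \<gamma> - pos_powr (- x) \<gamma>"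

lemma mvn_measurable [measurable]: "mvn \<gamma> t \<in> borel_measurable borel"
  unfolding mvn_def[abs_def] by measurable

text \<open>In the far past the mean value theorem gives the bound \<gamma>^2 y^(2 \<gamma> - 2)
  with y = - x, integrable at infinity as \<gamma> < 1/2. On the remaining bounded range the squares
  are powers with exponent 2 \<gamma>, integrable as \<gamma> > -1/2.\<close>

lemma mvn_one_finite:
  assumes \<gamma>: "-1/2 < \<gamma>" "\<gamma> < 1/2"
  shows "(\<integral>\<^sup>+ x. ennreal ((mvn \<gamma> 1 x)\<^sup>2) \<partial>lborel) < \<infinity>"
proof -
  have tail: "(mvn \<gamma> 1 (- y))\<^sup>2 \<le> \<gamma>\<^sup>2 * y powr (2 * \<gamma> - 2)" if y: "y \<ge> 1" for y
  proof -
    have D: "((\<lambda>u. u powr \<gamma>) has_real_derivative \<gamma> * u powr (\<gamma> - 1)) (at u)" if "u > 0" for u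
      using that by (auto intro!: derivative_eq_intros)
    obtain \<xi> where \<xi>: "y < \<xi>" "(y + 1) powr \<gamma> - y powr \<gamma> = (y + 1 - y) * (\<gamma> * \<xi> powr (\<gamma> - 1))"
      using MVT2[of y "y + 1" "\<lambda>u. u powr \<gamma>" "\<lambda>u. \<gamma> * u powr (\<gamma> - 1)"] y D by auto
    have "\<xi> powr (\<gamma> - 1) \<le> y powr (\<gamma> - 1)" using \<xi> y \<gamma> by (intro powr_mono2') auto
    then have "(\<xi> powr (\<gamma> - 1))\<^sup>2 \<le> (y powr (\<gamma> - 1))\<^sup>2" by (intro power_mono) auto
    also have "\<dots> = y powr (2 * \<gamma> - 2)" using y by (simp add: powr_power algebra_simps)
    finally have "\<gamma>\<^sup>2 * (\<xi> powr (\<gamma> - 1))\<^sup>2 \<le> \<gamma>\<^sup>2 * y powr (2 * \<gamma> - 2)" by (rule mult_left_mono) simp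
    moreover have "mvn \<gamma> 1 (- y) = \<gamma> * \<xi> powr (\<gamma> - 1)"
      using \<xi>(2) y by (simp add: mvn_def pos_powr_def max_def add.commute)
    ultimately show ?thesis by (simp add: power_mult_distrib)
  qed
  have p: "(pos_powr u \<gamma>)\<^sup>2 = u powr (2 * \<gamma>)" if "u \<ge> 0" for u
    using that by (cases "u = 0") (auto simp: pos_powr_def powr_power max_def mult.commute)
  have pw: "ennreal ((mvn \<gamma> 1 (- y))\<^sup>2) \<le> ennreal (\<gamma>\<^sup>2) * (ennreal (y powr (2 * \<gamma> - 2)) * indicator {1..} y)
      + 2 * (ennreal ((1 + y) powr (2 * \<gamma>)) * indicator {0..2} (1 + y)) + 2 * (ennreal (y powr (2 * \<gamma>)) * indicator {0..2} y)" for y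
  proof -
    consider "y \<ge> 1" | "0 \<le> y" "y < 1" | "-1 \<le> y" "y < 0" | "y < -1" by linarith
    then show ?thesis
    proof cases
      case 1
      have "ennreal ((mvn \<gamma> 1 (- y))\<^sup>2) \<le> ennreal (\<gamma>\<^sup>2) * ennreal (y powr (2 * \<gamma> - 2))"
        using tail[OF 1] by (subst ennreal_mult[symmetric]) (auto intro: ennreal_leI)
      also have "\<dots> = ennreal (\<gamma>\<^sup>2) * (ennreal (y powr (2 * \<gamma> - 2)) * indicator {1..} y)" using 1 by simp
      finally show ?thesis unfolding add.assoc by (rule add_increasing2[rotated]) simp
    next
      case 2
      have "(a - b)\<^sup>2 \<le> 2 * a\<^sup>2 + 2 * b\<^sup>2" for a b :: real
        using zero_le_power2[of "a + b"] by (simp add: power2_eq_square algebra_simps)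
      then have "(mvn \<gamma> 1 (- y))\<^sup>2 \<le> 2 * (pos_powr (1 + y) \<gamma>)\<^sup>2 + 2 * (pos_powr y \<gamma>)\<^sup>2" by (simp add: mvn_def)
      then have "(mvn \<gamma> 1 (- y))\<^sup>2 \<le> 2 * (1 + y) powr (2 * \<gamma>) + 2 * y powr (2 * \<gamma>)" using 2 by (simp add: p)
      then have "ennreal ((mvn \<gamma> 1 (- y))\<^sup>2) \<le> ennreal (2 * (1 + y) powr (2 * \<gamma>) + 2 * y powr (2 * \<gamma>))" by (rule ennreal_leI)
      also have "\<dots> = 2 * ennreal ((1 + y) powr (2 * \<gamma>)) + 2 * ennreal (y powr (2 * \<gamma>))"
        by (simp add: ennreal_plus ennreal_mult)
      finally show ?thesis using 2 by simp
    next
      case 3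
      have "(mvn \<gamma> 1 (- y))\<^sup>2 = (pos_powr (1 + y) \<gamma>)\<^sup>2" using 3 by (simp add: mvn_def pos_powr_def)
      also have "\<dots> = (1 + y) powr (2 * \<gamma>)" using 3 by (intro p) auto
      finally have "ennreal ((mvn \<gamma> 1 (- y))\<^sup>2) = ennreal ((1 + y) powr (2 * \<gamma>))" by simp
      also have "\<dots> \<le> 2 * ennreal ((1 + y) powr (2 * \<gamma>))" using mult_right_mono[of 1 2 "ennreal ((1 + y) powr (2 * \<gamma>))"] by simp
      finally show ?thesis using 3 by simp
    next
      case 4
      then show ?thesis by (simp add: mvn_def pos_powr_def)
    qed
  qed
  have "(\<integral>\<^sup>+ x. ennreal ((mvn \<gamma> 1 x)\<^sup>2) \<partial>lborel) = (\<integral>\<^sup>+ y. ennreal ((mvn \<gamma> 1 (- y))\<^sup>2) \<partial>lborel)"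
    using nn_integral_real_affine[of "\<lambda>x. ennreal ((mvn \<gamma> 1 x)\<^sup>2)" "-1" 0] by simp
  also have "\<dots> \<le> (\<integral>\<^sup>+ y. ennreal (\<gamma>\<^sup>2) * (ennreal (y powr (2 * \<gamma> - 2)) * indicator {1..} y)
      + 2 * (ennreal ((1 + y) powr (2 * \<gamma>)) * indicator {0..2} (1 + y)) + 2 * (ennreal (y powr (2 * \<gamma>)) * indicator {0..2} y) \<partial>lborel)"
    by (intro nn_integral_mono pw)
  also have "\<dots> = ennreal (\<gamma>\<^sup>2) * (\<integral>\<^sup>+ y \<in> {1..}. ennreal (y powr (2 * \<gamma> - 2)) \<partial>lborel)
      + 2 * (\<integral>\<^sup>+ y. ennreal ((1 + y) powr (2 * \<gamma>)) * indicator {0..2} (1 + y) \<partial>lborel)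
      + 2 * (\<integral>\<^sup>+ y \<in> {0..2}. ennreal (y powr (2 * \<gamma>)) \<partial>lborel)"
    by (simp add: nn_integral_add nn_integral_cmult)
  also have "(\<integral>\<^sup>+ y. ennreal ((1 + y) powr (2 * \<gamma>)) * indicator {0..2} (1 + y) \<partial>lborel)
      = (\<integral>\<^sup>+ y \<in> {0..2}. ennreal (y powr (2 * \<gamma>)) \<partial>lborel)"
    using nn_integral_lborel_translate[of "\<lambda>y. ennreal (y powr (2 * \<gamma>)) * indicator {0..2} y" 1]
    by (simp add: add.commute)
  also have "ennreal (\<gamma>\<^sup>2) * (\<integral>\<^sup>+ y \<in> {1..}. ennreal (y powr (2 * \<gamma> - 2)) \<partial>lborel)
      + 2 * (\<integral>\<^sup>+ y \<in> {0..2}. ennreal (y powr (2 * \<gamma>)) \<partial>lborel)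
      + 2 * (\<integral>\<^sup>+ y \<in> {0..2}. ennreal (y powr (2 * \<gamma>)) \<partial>lborel) < \<infinity>"
    using nn_integral_powr_to_inf[of "2 * \<gamma> - 2" 1] nn_integral_powr_from_0[of "2 * \<gamma>" 2] \<gamma>
    by (simp add: ennreal_mult_less_top)
  finally show ?thesis .
qed

text \<open>On (0, 1) the kernel is (1 - x)^\<gamma>, which does not vanish.\<close>

lemma mvn_one_positive: "0 < (\<integral>\<^sup>+ x. ennreal ((mvn \<gamma> 1 x)\<^sup>2) \<partial>lborel)"
proof -
  have "(\<integral>\<^sup>+ x. ennreal ((mvn \<gamma> 1 x)\<^sup>2) \<partial>lborel) \<noteq> 0"
  proof
    assume "(\<integral>\<^sup>+ x. ennreal ((mvn \<gamma> 1 x)\<^sup>2) \<partial>lborel) = 0"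
    then have "AE x in lborel. ennreal ((mvn \<gamma> 1 x)\<^sup>2) = 0"
      by (subst (asm) nn_integral_0_iff_AE) auto
    then have "AE x in lborel. x \<notin> {0<..<1::real}"
    proof eventually_elim
      case (elim x)
      then show ?case by (auto simp: mvn_def pos_powr_def max_def)
    qed
    then have "emeasure lborel {0<..<1::real} = 0"
      by (subst (asm) AE_iff_measurable[of "{0<..<1}"]) auto
    then show False by simp
  qed
  then show ?thesis by (simp add: zero_less_iff_neq_zero)
qed

text \<open>Substituting s + c x with c = t - s and using homogeneity of degree \<gamma> yields c^(2
  \<gamma>) from the square and one further factor c from the measure. This gives the process
  stationary and self-similar increments.\<close>

lemma mvn_increment:
  assumes "s < t"
  shows "(\<integral>\<^sup>+ x. ennreal ((mvn \<gamma> t x - mvn \<gamma> s x)\<^sup>2) \<partial>lborel)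
    = ennreal ((t - s) powr (2 * \<gamma> + 1)) * (\<integral>\<^sup>+ x. ennreal ((mvn \<gamma> 1 x)\<^sup>2) \<partial>lborel)"
proof -
  define c where "c = t - s"
  have c: "c > 0" using assms by (simp add: c_def)
  have eq: "mvn \<gamma> t (s + c * x) - mvn \<gamma> s (s + c * x) = c powr \<gamma> * mvn \<gamma> 1 x" for x
  proof -
    have "t - (s + c * x) = c * (1 - x)" "s - (s + c * x) = c * (- x)" by (simp_all add: c_def algebra_simps)
    then show ?thesis using pos_powr_scale[OF c, of "1 - x" \<gamma>] pos_powr_scale[OF c, of "- x" \<gamma>]
      by (simp add: mvn_def algebra_simps)
  qed
  have "(\<integral>\<^sup>+ x. ennreal ((mvn \<gamma> t x - mvn \<gamma> s x)\<^sup>2) \<partial>lborel)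
    = ennreal c * (\<integral>\<^sup>+ x. ennreal ((mvn \<gamma> t (s + c * x) - mvn \<gamma> s (s + c * x))\<^sup>2) \<partial>lborel)"
    by (rule nn_integral_real_affine_0[OF _ c]) measurable
  also have "\<dots> = ennreal c * (\<integral>\<^sup>+ x. ennreal ((c powr \<gamma>)\<^sup>2) * ennreal ((mvn \<gamma> 1 x)\<^sup>2) \<partial>lborel)"
    unfolding eq by (simp add: power_mult_distrib ennreal_mult)
  also have "\<dots> = ennreal c * ennreal ((c powr \<gamma>)\<^sup>2) * (\<integral>\<^sup>+ x. ennreal ((mvn \<gamma> 1 x)\<^sup>2) \<partial>lborel)"
    by (simp add: nn_integral_cmult mult.assoc)
  also have "ennreal c * ennreal ((c powr \<gamma>)\<^sup>2) = ennreal (c powr (2 * \<gamma> + 1))"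
  proof -
    have "c * (c powr \<gamma>)\<^sup>2 = c powr (2 * \<gamma> + 1)"
      using c by (simp add: powr_power powr_add mult.commute)
    then show ?thesis using c by (subst ennreal_mult[symmetric]) auto
  qed
  finally show ?thesis by (simp add: c_def)
qed

section \<open>The kernel of \<open>z1\<close> as a Mandelbrot-Van Ness kernel\<close>

lemma pos_powr_convolution:
  assumes ab: "a > -1" "b > -1"
  shows "has_bochner_integral lborel (\<lambda>u. pos_powr (t - u) a * pos_powr (u - x) b) (Beta (b + 1) (a + 1) * pos_powr (t - x) (a + b + 1))"
proof (cases "x < t")
  case False
  \<comment> \<open>For t \<le> x the two factors have disjoint supports.\<close>
  have eq: "(\<lambda>u. pos_powr (t - u) a * pos_powr (u - x) b) = (\<lambda>u. 0)"
  proof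
    fix u show "pos_powr (t - u) a * pos_powr (u - x) b = 0"
      using False by (cases "u \<le> x") (auto simp: pos_powr_def max_def)
  qed
  moreover have "pos_powr (t - x) (a + b + 1) = 0" using False by (auto simp: pos_powr_def max_def)
  ultimately show ?thesis by (simp only: eq mult_zero_right has_bochner_integral_zero)
next
  case True
  \<comment> \<open>The substitution u = x + c v turns the integral into c^(a + b + 1) times the
    Beta integral over [0, 1].\<close>
  define c where "c = t - x"
  have c: "c > 0" using True by (simp add: c_def)
  let ?g = "\<lambda>v. pos_powr (1 - v) a * pos_powr v b"
  have "has_bochner_integral lborel ?g (Beta (b + 1) (a + 1))"
  proof -
    have hi: "((\<lambda>v. v powr b * (1 - v) powr a) has_integral Beta (b + 1) (a + 1)) {0..1}"
      using has_integral_Beta_real[of "b + 1" "a + 1"] ab by simp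
    have B0: "Beta (b + 1) (a + 1) \<ge> 0" by (rule has_integral_nonneg[OF hi]) auto
    have "(\<integral>\<^sup>+ v. ennreal (v powr b * (1 - v) powr a) * indicator {0..1} v \<partial>lborel) = ennreal (Beta (b + 1) (a + 1))"
      by (rule nn_integral_has_integral_lebesgue'[OF _ hi]) auto
    also have "(\<integral>\<^sup>+ v. ennreal (v powr b * (1 - v) powr a) * indicator {0..1} v \<partial>lborel) = (\<integral>\<^sup>+ v. ennreal (?g v) \<partial>lborel)"
      by (intro nn_integral_cong) (auto simp: pos_powr_def max_def indicator_def mult.commute)
    finally have nn: "(\<integral>\<^sup>+ v. ennreal (?g v) \<partial>lborel) = ennreal (Beta (b + 1) (a + 1))" .
    show ?thesis
      by (rule has_bochner_integral_nn_integral[OF _ _ B0 nn]) (auto simp: pos_powr_def)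
  qed
  then have "has_bochner_integral lborel (\<lambda>v. c powr (a + b) * ?g v) (c powr (a + b) * Beta (b + 1) (a + 1))"
    by (rule has_bochner_integral_mult_right)
  moreover have "c powr (a + b) * ?g v = pos_powr (t - (x + c * v)) a * pos_powr ((x + c * v) - x) b" for v
  proof -
    have "t - (x + c * v) = c * (1 - v)" "(x + c * v) - x = c * v" by (simp_all add: c_def algebra_simps)
    then show ?thesis using c by (simp add: pos_powr_scale powr_add mult_ac)
  qed
  ultimately have "has_bochner_integral lborel (\<lambda>v. pos_powr (t - (x + c * v)) a * pos_powr ((x + c * v) - x) b) (c powr (a + b) * Beta (b + 1) (a + 1))"
    by simp
  moreover have "(\<bar>c\<bar> *\<^sub>R k) /\<^sub>R \<bar>c\<bar> = k" for k :: real using c by simp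
  ultimately have "has_bochner_integral lborel (\<lambda>u. pos_powr (t - u) a * pos_powr (u - x) b) (\<bar>c\<bar> *\<^sub>R (c powr (a + b) * Beta (b + 1) (a + 1)))"
    using lborel_has_bochner_integral_real_affine_iff[where c=c and t=x
        and f="\<lambda>u. pos_powr (t - u) a * pos_powr (u - x) b"
        and x="\<bar>c\<bar> *\<^sub>R (c powr (a + b) * Beta (b + 1) (a + 1))"] c by (simp only:)
  moreover have "\<bar>c\<bar> *\<^sub>R (c powr (a + b) * Beta (b + 1) (a + 1)) = Beta (b + 1) (a + 1) * pos_powr (t - x) (a + b + 1)"
    using c by (simp add: c_def[symmetric] pos_powr_def powr_add max_def)
  ultimately show ?thesis by (simp only:)
qed

text \<open>As \<open>pos_powr u 0\<close> is the indicator of u > 0, the formula with denominator 1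
  gives the indicator of [0, t) for \<beta> = 0. It differs from that of (0, t] at the endpoints
  only, hence the almost everywhere statement, which merges the two cases of the kernel.\<close>

lemma k_kernel_pos_powr:
  assumes "t \<ge> 0"
  shows "AE u in lborel. k_kernel \<beta> t u = (pos_powr (t - u) \<beta> - pos_powr (- u) \<beta>) / (if \<beta> = 0 then 1 else \<beta>)"
proof -
  have "AE u in lborel. u \<noteq> t \<and> u \<noteq> 0"
    using AE_lborel_singleton[of t] AE_lborel_singleton[of "0::real"] by eventually_elim auto
  then show ?thesis
  proof eventually_elim
    case (elim u)
    then show ?case using assms by (auto simp: k_kernel_def pos_powr_def max_def indicator_def)
  qed
qed

text \<open>Up to a factor, \<open>k_kernel\<close> is the difference of one truncated power based
  at t and at 0, so \<open>pos_powr_convolution\<close> applies twice. The exponent \<beta>1 +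
  \<beta>2 / 2 is \<alpha> - 1/2.\<close>

lemma z1_kernel_eq_mvn:
  assumes \<beta>1: "\<beta>1 > -1" and \<beta>2: "\<beta>2 > 0" and t: "t \<ge> 0"
  shows "z1_kernel \<beta>1 \<beta>2 t x = Beta (\<beta>2 / 2) (\<beta>1 + 1) / (if \<beta>1 = 0 then 1 else \<beta>1) * mvn (\<beta>1 + \<beta>2 / 2) t x"
proof -
  define b where "b = (if \<beta>1 = 0 then 1 else \<beta>1)"
  have I: "has_bochner_integral lborel (\<lambda>u. pos_powr (s - u) \<beta>1 * pos_powr (u - x) (\<beta>2 / 2 - 1))
      (Beta (\<beta>2 / 2) (\<beta>1 + 1) * pos_powr (s - x) (\<beta>1 + \<beta>2 / 2))" for s
    using pos_powr_convolution[of \<beta>1 "\<beta>2 / 2 - 1" s x] \<beta>1 \<beta>2 by simp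
  have "has_bochner_integral lborel (\<lambda>u. (pos_powr (t - u) \<beta>1 * pos_powr (u - x) (\<beta>2 / 2 - 1)
      - pos_powr (0 - u) \<beta>1 * pos_powr (u - x) (\<beta>2 / 2 - 1)) / b)
      ((Beta (\<beta>2 / 2) (\<beta>1 + 1) * pos_powr (t - x) (\<beta>1 + \<beta>2 / 2) - Beta (\<beta>2 / 2) (\<beta>1 + 1) * pos_powr (0 - x) (\<beta>1 + \<beta>2 / 2)) / b)"
    by (intro has_bochner_integral_divide has_bochner_integral_diff I)
  then have eq: "(\<integral>u. (pos_powr (t - u) \<beta>1 * pos_powr (u - x) (\<beta>2 / 2 - 1)
      - pos_powr (0 - u) \<beta>1 * pos_powr (u - x) (\<beta>2 / 2 - 1)) / b \<partial>lborel)
      = (Beta (\<beta>2 / 2) (\<beta>1 + 1) * pos_powr (t - x) (\<beta>1 + \<beta>2 / 2) - Beta (\<beta>2 / 2) (\<beta>1 + 1) * pos_powr (0 - x) (\<beta>1 + \<beta>2 / 2)) / b"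
    by (rule has_bochner_integral_integral_eq)
  have [measurable]: "k_kernel \<beta>1 t \<in> borel_measurable borel"
    unfolding k_kernel_def[abs_def] by measurable
  have "z1_kernel \<beta>1 \<beta>2 t x = (\<integral>u. (pos_powr (t - u) \<beta>1 * pos_powr (u - x) (\<beta>2 / 2 - 1)
      - pos_powr (0 - u) \<beta>1 * pos_powr (u - x) (\<beta>2 / 2 - 1)) / b \<partial>lborel)"
    unfolding z1_kernel_def
  proof (rule integral_cong_AE)
    show "AE u in lborel. k_kernel \<beta>1 t u * pos_powr (u - x) (\<beta>2 / 2 - 1) =
      (pos_powr (t - u) \<beta>1 * pos_powr (u - x) (\<beta>2 / 2 - 1) - pos_powr (0 - u) \<beta>1 * pos_powr (u - x) (\<beta>2 / 2 - 1)) / b"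
      using k_kernel_pos_powr[OF t, of \<beta>1]
      by eventually_elim (simp add: b_def[symmetric] diff_divide_distrib left_diff_distrib)
  qed measurable
  also have "\<dots> = Beta (\<beta>2 / 2) (\<beta>1 + 1) / b * mvn (\<beta>1 + \<beta>2 / 2) t x"
    unfolding eq by (simp add: mvn_def diff_divide_distrib right_diff_distrib)
  finally show ?thesis by (simp add: b_def)
qed

lemma Beta_real_pos: "a > 0 \<Longrightarrow> b > 0 \<Longrightarrow> Beta a b > (0 :: real)"
  by (simp add: Beta_def Gamma_real_pos)

text \<open>Linearity and the isometry reduce the variances of increments to L2 norms of kernel
  differences, which \<open>mvn_increment\<close> makes proportional to |t - s|^(2 \<alpha>).
  Polarisation recovers the covariances, and c normalises the variance at time 1.\<close>

lemma (in prob_space) z1_normalising_constant_exists: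
  assumes W: "two_sided_wiener M W" and \<alpha>: "\<alpha> = \<beta>1 + (\<beta>2 - 1) / 2 + 1" "0 < \<alpha>" "\<alpha> < 1" and \<beta>2: "0 < \<beta>2" "\<beta>2 < 1"
  shows "\<exists>c. z1_normalising_constant M W \<beta>1 \<beta>2 c"
proof -
  define \<gamma> where "\<gamma> = \<beta>1 + \<beta>2 / 2"
  have \<gamma>: "-1/2 < \<gamma>" "\<gamma> < 1/2" "2 * \<gamma> + 1 = 2 * \<alpha>" using \<alpha> by (auto simp: \<gamma>_def field_simps)
  \<comment> \<open>\<beta>1 = \<alpha> - (\<beta>2 + 1) / 2 with \<alpha> > 0 and \<beta>2 < 1;
    this is the integrability condition of the Beta integral.\<close>
  have \<beta>1: "\<beta>1 > -1" using \<alpha> \<beta>2 by (simp add: field_simps)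
  have Wm: "W t \<in> borel_measurable M" for t using W by (simp add: two_sided_wiener_def)
  define B where "B = Beta (\<beta>2 / 2) (\<beta>1 + 1) / (if \<beta>1 = 0 then 1 else \<beta>1)"
  have B: "B \<noteq> 0" using Beta_real_pos[of "\<beta>2 / 2" "\<beta>1 + 1"] \<beta>1 \<beta>2 by (auto simp: B_def)
  define f where "f t = z1_kernel \<beta>1 \<beta>2 t" for t
  have f: "f t x = B * mvn \<gamma> t x" if "t \<ge> 0" for t x
    unfolding f_def B_def \<gamma>_def using z1_kernel_eq_mvn[OF \<beta>1 \<beta>2(1) that] by simp
  define \<kappa> where "\<kappa> = enn2real (\<integral>\<^sup>+ x. ennreal ((mvn \<gamma> 1 x)\<^sup>2) \<partial>lborel)"
  have \<kappa>: "(\<integral>\<^sup>+ x. ennreal ((mvn \<gamma> 1 x)\<^sup>2) \<partial>lborel) = ennreal \<kappa>" "\<kappa> > 0"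
    using mvn_one_finite[OF \<gamma>(1,2)] mvn_one_positive[of \<gamma>] by (auto simp: \<kappa>_def enn2real_positive_iff)
  have d: "(\<integral>\<^sup>+ x. ennreal ((f t x - f s x)\<^sup>2) \<partial>lborel) = ennreal (B\<^sup>2 * \<kappa> * \<bar>t - s\<bar> powr (2 * \<alpha>))"
    if "0 \<le> s" "0 \<le> t" for s t
  proof -
    have *: "(\<integral>\<^sup>+ x. ennreal ((f t x - f s x)\<^sup>2) \<partial>lborel) = ennreal (B\<^sup>2 * \<kappa> * \<bar>t - s\<bar> powr (2 * \<alpha>))"
      if "0 \<le> s" "s \<le> t" for s t
    proof (cases "s = t")
      case False
      then have st: "s < t" using that by simp
      have "(\<integral>\<^sup>+ x. ennreal ((f t x - f s x)\<^sup>2) \<partial>lborel) = (\<integral>\<^sup>+ x. ennreal (B\<^sup>2) * ennreal ((mvn \<gamma> t x - mvn \<gamma> s x)\<^sup>2) \<partial>lborel)"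
        using that by (intro nn_integral_cong) (simp add: f power_mult_distrib flip: right_diff_distrib ennreal_mult)
      also have "\<dots> = ennreal (B\<^sup>2) * (ennreal ((t - s) powr (2 * \<alpha>)) * ennreal \<kappa>)"
        by (simp add: nn_integral_cmult mvn_increment[OF st] \<gamma>(3) \<kappa>(1))
      also have "\<dots> = ennreal (B\<^sup>2 * \<kappa> * \<bar>t - s\<bar> powr (2 * \<alpha>))"
        using \<kappa>(2) st by (simp add: mult_ac flip: ennreal_mult)
      finally show ?thesis .
    qed simp
    show ?thesis
      using *[of s t] *[of t s] that by (cases "s \<le> t") (auto simp: power2_commute[of "f t _"] abs_minus_commute)
  qed
  have f0: "f 0 x = 0" for x by (simp add: f mvn_def)
  have fm [measurable]: "f t \<in> borel_measurable borel" if "t \<ge> 0" for t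
  proof -
    have "f t = (\<lambda>x. B * mvn \<gamma> t x)" using f[OF that] by auto
    then show ?thesis by simp
  qed
  define X where "X t = wiener_integral M W (f t)" for t
  \<comment> \<open>The kernel is square integrable, so an integral exists and the representative
    picked in \<open>wiener_integral\<close> is one.\<close>
  have X: "has_wiener_integral M W (f t) (X t)" if "t \<ge> 0" for t
  proof -
    have "\<exists>X. has_wiener_integral M W (f t) X"
      using d[of 0 t] that by (intro has_wiener_integral_exists[OF W fm]) (auto simp: f0)
    then show ?thesis unfolding X_def wiener_integral_def by (rule someI_ex)
  qed
  have diff: "expectation (\<lambda>\<omega>. (X t \<omega> - X s \<omega>)\<^sup>2) = B\<^sup>2 * \<kappa> * \<bar>t - s\<bar> powr (2 * \<alpha>)"
    and int: "integrable M (\<lambda>\<omega>. (X t \<omega> - X s \<omega>)\<^sup>2)" if "0 \<le> s" "0 \<le> t" for s t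
  proof -
    have "has_wiener_integral M W (\<lambda>x. f t x - f s x) (\<lambda>\<omega>. X t \<omega> - X s \<omega>)"
      using has_wiener_integral_add[OF Wm X[OF that(2)] has_wiener_integral_scale[OF Wm X[OF that(1)], of "-1"]] by simp
    from has_wiener_integral_gaussian(2)[OF W this]
    have g: "centered_gaussian M (B\<^sup>2 * \<kappa> * \<bar>t - s\<bar> powr (2 * \<alpha>)) (\<lambda>\<omega>. X t \<omega> - X s \<omega>)"
      unfolding d[OF that] using \<kappa>(2) by simp
    show "expectation (\<lambda>\<omega>. (X t \<omega> - X s \<omega>)\<^sup>2) = B\<^sup>2 * \<kappa> * \<bar>t - s\<bar> powr (2 * \<alpha>)"
      and "integrable M (\<lambda>\<omega>. (X t \<omega> - X s \<omega>)\<^sup>2)"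
      using centered_gaussian_moments(3,4)[OF g] by auto
  qed
  have g1: "centered_gaussian M (B\<^sup>2 * \<kappa> * t powr (2 * \<alpha>)) (X t)" if "0 \<le> t" for t
    using has_wiener_integral_gaussian(2)[OF W X[OF that]] d[of 0 t] that \<kappa>(2) by (simp add: f0)
  have cov: "expectation (\<lambda>\<omega>. X s \<omega> * X t \<omega>) = B\<^sup>2 * \<kappa> * ((s powr (2 * \<alpha>) + t powr (2 * \<alpha>) - \<bar>t - s\<bar> powr (2 * \<alpha>)) / 2)"
    if "0 \<le> s" "0 \<le> t" for s t
  proof -
    note ms = centered_gaussian_moments(3,4)[OF g1[OF that(1)]] and mt = centered_gaussian_moments(3,4)[OF g1[OF that(2)]]
    have "expectation (\<lambda>\<omega>. X s \<omega> * X t \<omega>) = expectation (\<lambda>\<omega>. ((X s \<omega>)\<^sup>2 + (X t \<omega>)\<^sup>2 - (X t \<omega> - X s \<omega>)\<^sup>2) / 2)"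
      by (intro Bochner_Integration.integral_cong) (auto simp: power2_eq_square algebra_simps)
    also have "\<dots> = (B\<^sup>2 * \<kappa> * s powr (2 * \<alpha>) + B\<^sup>2 * \<kappa> * t powr (2 * \<alpha>) - B\<^sup>2 * \<kappa> * \<bar>t - s\<bar> powr (2 * \<alpha>)) / 2"
      using ms mt int[OF that] diff[OF that] by simp
    finally show ?thesis by (simp add: algebra_simps diff_divide_distrib add_divide_distrib)
  qed
  define c where "c = 1 / sqrt (B\<^sup>2 * \<kappa>)"
  have c: "c \<noteq> 0" "c * c * (B\<^sup>2 * \<kappa>) = 1" using B \<kappa>(2) by (auto simp: c_def)
  have "gaussian_process M {0..1} (\<lambda>t \<omega>. c * X t \<omega>)"
    unfolding gaussian_process_def
  proof (intro allI impI)
    fix n :: nat and t a :: "nat \<Rightarrow> real" assume t: "\<forall>i<n. t i \<in> {0..1}"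
    have "has_wiener_integral M W (\<lambda>x. \<Sum>i<n. (a i * c) * f (t i) x) (\<lambda>\<omega>. \<Sum>i<n. (a i * c) * X (t i) \<omega>)"
      using t by (intro has_wiener_integral_sum[OF Wm] X) auto
    from centered_gaussian_imp_gaussian_rv[OF has_wiener_integral_gaussian(2)[OF W this]]
    show "gaussian_rv M (\<lambda>\<omega>. \<Sum>i<n. a i * (c * X (t i) \<omega>))" by (simp add: mult.assoc)
  qed
  moreover have "expectation (\<lambda>\<omega>. c * X t \<omega>) = 0" if "t \<in> {0..1}" for t
    using centered_gaussian_moments(2)[OF g1[of t]] that by simp
  moreover have "expectation (\<lambda>\<omega>. (c * X s \<omega>) * (c * X t \<omega>)) = (s powr (2 * \<alpha>) + t powr (2 * \<alpha>) - \<bar>t - s\<bar> powr (2 * \<alpha>)) / 2"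
    if "s \<in> {0..1}" "t \<in> {0..1}" for s t
  proof -
    have "expectation (\<lambda>\<omega>. (c * X s \<omega>) * (c * X t \<omega>)) = expectation (\<lambda>\<omega>. (c * c) * (X s \<omega> * X t \<omega>))"
      by (simp add: mult_ac)
    also have "\<dots> = (c * c) * expectation (\<lambda>\<omega>. X s \<omega> * X t \<omega>)" by (rule integral_mult_right_zero)
    also have "\<dots> = (c * c * (B\<^sup>2 * \<kappa>)) * ((s powr (2 * \<alpha>) + t powr (2 * \<alpha>) - \<bar>t - s\<bar> powr (2 * \<alpha>)) / 2)"
      using cov[of s t] that by (simp only: mult.assoc) simp
    finally show ?thesis unfolding c(2) by simp
  qed
  ultimately have "standard_fbm M {0..1} \<alpha> (\<lambda>t \<omega>. c * X t \<omega>)" by (simp add: standard_fbm_def)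
  then have "z1_normalising_constant M W \<beta>1 \<beta>2 c"
    using c(1) unfolding z1_normalising_constant_def X_def f_def \<alpha>(1)[symmetric] by simp
  then show ?thesis ..
qed

theorem corollary4p2:
  fixes M :: "'a measure"
    and W :: "real \<Rightarrow> 'a \<Rightarrow> real"
    and \<beta>1 \<beta>2 \<alpha> \<tau>2 :: real
    and \<Phi>2 :: "real \<Rightarrow> real"
  assumes "prob_space M"
    and "complete_measure M"
    and "two_sided_wiener M W"
    and "generated_by_process M W"
    and "\<alpha> = \<beta>1 + (\<beta>2 - 1) / 2 + 1"
    and "0 < \<alpha>" and "\<alpha> < 1"
    and "0 < \<beta>2" and "\<beta>2 < 1"
    and "young_function \<Phi>2"
    and "\<tau>2 \<ge> 0"
    and "\<And>x. x \<ge> \<tau>2 \<Longrightarrow> \<Phi>2 x = exp (x\<^sup>2) - 1"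
  shows "(\<exists>c. z1_normalising_constant M W \<beta>1 \<beta>2 c) \<and>
    (\<forall>c z. z1_normalising_constant M W \<beta>1 \<beta>2 c \<and> is_z1 M W \<beta>1 \<beta>2 c z \<longrightarrow>
      standard_fbm M {0..1} \<alpha> z \<and>
      (AE \<omega> in M. (\<lambda>t. z t \<omega>) \<in> besov_orlicz_space \<Phi>2 \<alpha> {0<..<1}) \<and>
      (\<lambda>\<omega>. enn2real (besov_orlicz_norm \<Phi>2 \<alpha> {0<..<1} (\<lambda>t. z t \<omega>))) \<in> orlicz_space \<Phi>2 M \<and>
      (AE \<omega> in M. \<forall>p\<ge>1.
         in_Theta_right 0
           (\<lambda>s. Lp_norm p (lebesgue_on {0<..<1 - s}) (\<lambda>x. z (x + s) \<omega> - z x \<omega>))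
           (\<lambda>s. s powr \<alpha>)) \<and>
      (AE \<omega> in M.
         in_Theta_right 0
           (\<lambda>s. luxemburg_norm \<Phi>2 (lebesgue_on {0<..<1 - s}) (\<lambda>x. z (x + s) \<omega> - z x \<omega>))
           (\<lambda>s. s powr \<alpha>)))"
proof -
  interpret prob_space M by fact
  \<comment> \<open>This guarantees that the quantification over c in the second conjunct is not
    vacuous.\<close>
  have exists: "\<exists>c. z1_normalising_constant M W \<beta>1 \<beta>2 c"
    by (rule z1_normalising_constant_exists) fact+
  have fbm: "standard_fbm M {0..1} \<alpha> z"
    and z: "(\<lambda>(t, \<omega>). z t \<omega>) \<in> borel_measurable (restrict_space borel {0..1} \<Otimes>\<^sub>M M)"
    if c: "z1_normalising_constant M W \<beta>1 \<beta>2 c" and z: "is_z1 M W \<beta>1 \<beta>2 c z" for c z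
  proof -
    show zm: "(\<lambda>(t, \<omega>). z t \<omega>) \<in> borel_measurable (restrict_space borel {0..1} \<Otimes>\<^sub>M M)"
      using z by (simp add: is_z1_def)
    \<comment> \<open>At each time z differs from the normalised integral on a null set only, which
      \<open>standard_fbm_cong_AE\<close> permits.\<close>
    show "standard_fbm M {0..1} \<alpha> z"
    proof (rule standard_fbm_cong_AE)
      show "standard_fbm M {0..1} \<alpha> (\<lambda>t \<omega>. c * wiener_integral M W (z1_kernel \<beta>1 \<beta>2 t) \<omega>)"
        using c assms(5) by (simp add: z1_normalising_constant_def)
      fix t :: real assume t: "t \<in> {0..1}"
      then have "(\<lambda>\<omega>. (\<lambda>(t, \<omega>). z t \<omega>) (t, \<omega>)) \<in> borel_measurable M"
        using zm by (intro measurable_compose[OF measurable_Pair1']) (auto simp: space_restrict_space)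
      then show "z t \<in> borel_measurable M" by simp
      show "AE \<omega> in M. z t \<omega> = c * wiener_integral M W (z1_kernel \<beta>1 \<beta>2 t) \<omega>"
        using z t by (simp add: is_z1_def)
    qed
  qed
  note regularity = standard_fbm_path_regularity[OF assms(1,6,7,10,11,12) z fbm]
  show ?thesis using exists fbm regularity by blast
qed

end
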